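(* Let $\mathcal{R}$ be a II$_1$ equivalence relation on a standard probability space $(X,\mu)$. (1) If the full group $[\mathcal{R}]$ contains a property (T) group $\Gamma$ acting ergodically on $(X,\mu)$, then $\mathcal{F}(\mathcal{R})$ is countable. More generally, if $[\mathcal{R}]$ contains a countable group $\Gamma$ having a subgroup $H\subset\Gamma$ such that the pair $H\subset\Gamma$ has the relative property (T) and $H$ acts ergodically on $(X,\mu)$, then $\mathcal{F}(\mathcal{R})$ is countable. (2) Let $\mathcal{T}$ be the set of property (T) subgroups $\Gamma\subset[[\mathcal{R}]]$ acting ergodically on their support $s(\Gamma)$. Then $\mathcal{T}$ is countable modulo conjugacy by elements of $[[\mathcal{R}]]$.
   Context: A II$_1$ equivalence relation is an ergodic p.m.p. measurable equivalence relation with countable classes; $\mathcal{F}(\mathcal{R})=\{\mu(Y)/\mu(Z):\mathcal{R}|_Y\cong\mathcal{R}|_Z\}$. The full group $[\mathcal{R}]$ consists of non-singular automorphisms $\phi$ of $X$ with $(x,\phi(x))\in\mathcal{R}$ a.e.; the full pseudogroup $[[\mathcal{R}]]$ consists of non-singular partial automorphisms $\phi:D(\phi)\to R(\phi)$ between measurable subsets with $(x,\phi(x))\in\mathcal{R}$ for a.e. $x\in D(\phi)$. For a subgroup $\Gamma\subset[[\mathcal{R}]]$ (under composition), its support $s(\Gamma)$ is the set $Y$ with $D(g)=R(g)=Y$ for all $g\in\Gamma$. Two such subgroups $\Gamma,\Lambda$ are conjugate by an element of $[[\mathcal{R}]]$ if there is $\phi\in[[\mathcal{R}]]$ with $D(\phi)=s(\Gamma)$,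 $R(\phi)=s(\Lambda)$ and $\phi\Gamma=\Lambda\phi$. *)

theory Defs
  imports "HOL-Probability.Probability" "HOL-Algebra.Group"
begin

definition standard_borel :: "'a measure \<Rightarrow> bool" where
  "standard_borel M \<longleftrightarrow> (\<exists>(f::'a \<Rightarrow> real) B. B \<in> sets borel \<and> bij_betw f (space M) B \<and>
      f \<in> M \<rightarrow>\<^sub>M borel \<and> (\<forall>A\<in>sets M. f ` A \<in> sets borel))"

definition standard_prob_space :: "'a measure \<Rightarrow> bool" where
  "standard_prob_space M \<longleftrightarrow> prob_space M \<and> standard_borel M"

definition pmp_rel :: "'a measure \<Rightarrow> ('a \<times> 'a) set \<Rightarrow> bool" where
  "pmp_rel M R \<longleftrightarrow> (\<forall>A f. A \<in> sets M \<longrightarrow> f \<in> M \<rightarrow>\<^sub>M M \<longrightarrow> inj_on f A \<longrightarrow>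
      (\<forall>x\<in>A. (x, f x) \<in> R) \<longrightarrow> f ` A \<in> sets M \<longrightarrow> emeasure M (f ` A) = emeasure M A)"

definition ergodic_rel :: "'a measure \<Rightarrow> ('a \<times> 'a) set \<Rightarrow> bool" where
  "ergodic_rel M R \<longleftrightarrow> (\<forall>A\<in>sets M. R `` A \<subseteq> A \<longrightarrow> emeasure M A = 0 \<or> emeasure M (space M - A) = 0)"

definition II1_rel :: "'a measure \<Rightarrow> ('a \<times> 'a) set \<Rightarrow> bool" where
  "II1_rel M R \<longleftrightarrow> equiv (space M) R \<and> R \<in> sets (M \<Otimes>\<^sub>M M) \<and>
     (\<forall>x\<in>space M. countable (R `` {x})) \<and> pmp_rel M R \<and> ergodic_rel M R"

definition restr_iso :: "'a measure \<Rightarrow> ('a \<times> 'a) set \<Rightarrow> 'a set \<Rightarrow> 'a set \<Rightarrow> bool" where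
  "restr_iso M R Y Z \<longleftrightarrow> (\<exists>\<theta> Y0 Z0. Y0 \<in> sets M \<and> Z0 \<in> sets M \<and> Y0 \<subseteq> Y \<and> Z0 \<subseteq> Z \<and>
      emeasure M (Y - Y0) = 0 \<and> emeasure M (Z - Z0) = 0 \<and> bij_betw \<theta> Y0 Z0 \<and>
      \<theta> \<in> restrict_space M Y0 \<rightarrow>\<^sub>M M \<and>
      (\<forall>A\<in>sets M. A \<subseteq> Y0 \<longrightarrow> \<theta> ` A \<in> sets M \<and>
          measure M (\<theta> ` A) / measure M Z = measure M A / measure M Y) \<and>
      (\<forall>x\<in>Y0. \<forall>y\<in>Y0. (x, y) \<in> R \<longleftrightarrow> (\<theta> x, \<theta> y) \<in> R))"

definition fundamental_group :: "'a measure \<Rightarrow> ('a \<times> 'a) set \<Rightarrow> real set" where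
  "fundamental_group M R = {measure M Y / measure M Z | Y Z. Y \<in> sets M \<and> Z \<in> sets M \<and>
      measure M Y > 0 \<and> measure M Z > 0 \<and> restr_iso M R Y Z}"

text \<open>f represents an element of [[R]] with domain D and range E (both up to null sets):
  a non-singular Borel bijection between conull parts of D and E, with graph a.e. in R.\<close>
definition in_pseudogroup :: "'a measure \<Rightarrow> ('a \<times> 'a) set \<Rightarrow> 'a set \<Rightarrow> 'a set \<Rightarrow> ('a \<Rightarrow> 'a) \<Rightarrow> bool" where
  "in_pseudogroup M R D E f \<longleftrightarrow> D \<in> sets M \<and> E \<in> sets M \<and>
     (\<exists>D0 E0. D0 \<in> sets M \<and> E0 \<in> sets M \<and> D0 \<subseteq> D \<and> E0 \<subseteq> E \<and>
        emeasure M (D - D0) = 0 \<and> emeasure M (E - E0) = 0 \<and> bij_betw f D0 E0 \<and>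
        f \<in> restrict_space M D0 \<rightarrow>\<^sub>M M \<and>
        (\<forall>A\<in>sets M. A \<subseteq> D0 \<longrightarrow> f ` A \<in> sets M \<and> (emeasure M (f ` A) = 0 \<longleftrightarrow> emeasure M A = 0))) \<and>
     (AE x in M. x \<in> D \<longrightarrow> (x, f x) \<in> R)"

definition ae_class :: "'a measure \<Rightarrow> 'a set \<Rightarrow> ('a \<Rightarrow> 'a) \<Rightarrow> ('a \<Rightarrow> 'a) set" where
  "ae_class M Y f = {g. AE x in M. x \<in> Y \<longrightarrow> g x = f x}"

text \<open>S is a set of representatives of a subgroup of [[R]] with support Y.\<close>
definition pseudo_subgroup :: "'a measure \<Rightarrow> ('a \<times> 'a) set \<Rightarrow> 'a set \<Rightarrow> ('a \<Rightarrow> 'a) set \<Rightarrow> bool" where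
  "pseudo_subgroup M R Y S \<longleftrightarrow> Y \<in> sets M \<and> S \<noteq> {} \<and> (\<forall>f\<in>S. in_pseudogroup M R Y Y f) \<and>
     (\<forall>f\<in>S. \<forall>g\<in>S. \<exists>h\<in>S. AE x in M. x \<in> Y \<longrightarrow> h x = f (g x)) \<and>
     (\<forall>f\<in>S. \<exists>g\<in>S. AE x in M. x \<in> Y \<longrightarrow> g (f x) = x)"

definition class_group :: "'a measure \<Rightarrow> 'a set \<Rightarrow> ('a \<Rightarrow> 'a) set \<Rightarrow> ('a \<Rightarrow> 'a) set monoid" where
  "class_group M Y S = \<lparr>carrier = ae_class M Y ` S,
      mult = (\<lambda>A B. ae_class M Y ((SOME f. f \<in> A) \<circ> (SOME g. g \<in> B))),
      one = ae_class M Y id\<rparr>"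

definition ergodic_on :: "'a measure \<Rightarrow> 'a set \<Rightarrow> ('a \<Rightarrow> 'a) set \<Rightarrow> bool" where
  "ergodic_on M Y F \<longleftrightarrow> (\<forall>A\<in>sets M. A \<subseteq> Y \<longrightarrow>
      (\<forall>f\<in>F. AE x in M. x \<in> Y \<longrightarrow> (f x \<in> A \<longleftrightarrow> x \<in> A)) \<longrightarrow>
      emeasure M A = 0 \<or> emeasure M (Y - A) = 0)"

text \<open>Complex Hilbert space l2(I) with I = 'g \<times> nat (dimension at least the cardinality of any
  group with elements of type 'g, which suffices for testing property (T)).\<close>
definition l2space :: "('i \<Rightarrow> complex) set" where
  "l2space = {x. (\<lambda>i. (cmod (x i))\<^sup>2) summable_on UNIV}"

definition l2norm :: "('i \<Rightarrow> complex) \<Rightarrow> real" where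
  "l2norm x = sqrt (\<Sum>\<^sub>\<infinity>i. (cmod (x i))\<^sup>2)"

definition unitary_rep :: "('g, 'b) monoid_scheme \<Rightarrow> ('g \<Rightarrow> ('g \<times> nat \<Rightarrow> complex) \<Rightarrow> ('g \<times> nat \<Rightarrow> complex)) \<Rightarrow> bool" where
  "unitary_rep G \<rho> \<longleftrightarrow>
     (\<forall>g\<in>carrier G. bij_betw (\<rho> g) l2space l2space \<and>
        (\<forall>x\<in>l2space. \<forall>y\<in>l2space. \<rho> g (\<lambda>i. x i + y i) = (\<lambda>i. \<rho> g x i + \<rho> g y i)) \<and>
        (\<forall>x\<in>l2space. \<forall>c. \<rho> g (\<lambda>i. c * x i) = (\<lambda>i. c * \<rho> g x i)) \<and>
        (\<forall>x\<in>l2space. l2norm (\<rho> g x) = l2norm x)) \<and>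
     (\<forall>g\<in>carrier G. \<forall>h\<in>carrier G. \<forall>x\<in>l2space. \<rho> (g \<otimes>\<^bsub>G\<^esub> h) x = \<rho> g (\<rho> h x)) \<and>
     (\<forall>x\<in>l2space. \<rho> \<one>\<^bsub>G\<^esub> x = x)"

definition almost_invariant_vectors :: "('g, 'b) monoid_scheme \<Rightarrow> ('g \<Rightarrow> ('g \<times> nat \<Rightarrow> complex) \<Rightarrow> ('g \<times> nat \<Rightarrow> complex)) \<Rightarrow> bool" where
  "almost_invariant_vectors G \<rho> \<longleftrightarrow> (\<forall>F \<epsilon>. finite F \<longrightarrow> F \<subseteq> carrier G \<longrightarrow> \<epsilon> > 0 \<longrightarrow>
      (\<exists>\<xi>\<in>l2space. l2norm \<xi> = 1 \<and> (\<forall>g\<in>F. l2norm (\<lambda>i. \<rho> g \<xi> i - \<xi> i) < \<epsilon>)))"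

definition relative_T :: "('g, 'b) monoid_scheme \<Rightarrow> 'g set \<Rightarrow> bool" where
  "relative_T G H \<longleftrightarrow> group G \<and> subgroup H G \<and>
     (\<forall>\<rho>. unitary_rep G \<rho> \<longrightarrow> almost_invariant_vectors G \<rho> \<longrightarrow>
        (\<exists>\<xi>\<in>l2space. \<xi> \<noteq> (\<lambda>i. 0) \<and> (\<forall>h\<in>H. \<rho> h \<xi> = \<xi>)))"

definition property_T :: "('g, 'b) monoid_scheme \<Rightarrow> bool" where
  "property_T G \<longleftrightarrow> relative_T G (carrier G)"

definition T_subgroups :: "'a measure \<Rightarrow> ('a \<times> 'a) set \<Rightarrow> ('a set \<times> ('a \<Rightarrow> 'a) set) set" where
  "T_subgroups M R = {(Y, S). pseudo_subgroup M R Y S \<and> property_T (class_group M Y S) \<and> ergodic_on M Y S}"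

definition pseudo_conjugate :: "'a measure \<Rightarrow> ('a \<times> 'a) set \<Rightarrow> 'a set \<times> ('a \<Rightarrow> 'a) set \<Rightarrow> 'a set \<times> ('a \<Rightarrow> 'a) set \<Rightarrow> bool" where
  "pseudo_conjugate M R p q \<longleftrightarrow> (\<exists>\<phi>. in_pseudogroup M R (fst p) (fst q) \<phi> \<and>
      {ae_class M (fst p) (\<phi> \<circ> f) | f. f \<in> snd p} = {ae_class M (fst p) (g \<circ> \<phi>) | g. g \<in> snd q})"

definition countable_mod_conjugacy :: "'a measure \<Rightarrow> ('a \<times> 'a) set \<Rightarrow> ('a set \<times> ('a \<Rightarrow> 'a) set) set \<Rightarrow> bool" where
  "countable_mod_conjugacy M R T \<longleftrightarrow> (\<exists>C. countable C \<and> C \<subseteq> T \<and> (\<forall>p\<in>T. \<exists>q\<in>C. pseudo_conjugate M R p q))"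

end

theory Submission
  imports Defs "HOL-Algebra.Generated_Groups" "HOL-Library.Sublist"
begin

text \<open>Both parts rest on Popa's observation that two actions, by elements of the full pseudogroup, which are close on
  the generators of a rigid group are intertwined by an element of the pseudogroup. For actions \<open>a\<close> and \<open>b\<close> of a group
  \<open>G\<close>, let \<open>v g = b g \<circ> (a g)\<inverse>\<close>. The measure of the set where \<open>v g\<close> and \<open>v h\<close> agree is a positive definite kernel whose
  distance is left invariant, so relative property (T) bounds it on \<open>H\<close>; the circumcenter of the orbit is a limit of convex
  combinations of the graphs of the \<open>v g\<close>, and its values above one half define an equivariant partial isomorphism. As the
  relation is covered by countably many maps, finitely many data separate the actions up to any given precision, so
  uncountably many of them cannot be pairwise non-conjugate. In the first part the actions, on subsets of the amplified
  space of measure \<open>1 / t\<close>, come from the elements \<open>t\<close> of the fundamental group; in the second part the groups vary, and the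
  uniform estimate comes from a compactness argument in the manner of Shalom.\<close>

text \<open>Hilbert spaces do not occur as types: a vector is a finite list of weighted points, an
  inner product is a kernel value, and limits are taken of kernels or pointwise. Property (T),
  however, is tested on the single concrete space \<open>l2space\<close>, so kernels must be turned
  into matrices there; the Cholesky factorization is the bridge. Moreover it is given qualitatively,
  through invariant vectors. In the first part the uniform estimate is won by packing a whole
  sequence of kernels with growing weights into one kernel on the same group: boundedness of the sum
  forces its terms to be small on \<open>H\<close>. In the second part no common group exists. What
  the subgroups can share is a number of generators, finite by property (T), so everything is pulled
  back to words; the codes also record more and more relations, so that a limit kernel descends to
  one fixed group. A third obstacle is that the relation has to be covered by countably many
  measurable maps. This is a selection theorem for sets with countable sections, proved almost
  everywhere, which permits arguments by exhaustion.\<close>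

section \<open>Formal linear combinations and positive semidefinite kernels\<close>

definition lsum :: "('i \<Rightarrow> real) \<Rightarrow> (real \<times> 'i) list \<Rightarrow> real" where
  "lsum f xs = (\<Sum>(c, i)\<leftarrow>xs. c * f i)"

definition lscale :: "real \<Rightarrow> (real \<times> 'i) list \<Rightarrow> (real \<times> 'i) list" where
  "lscale a = map (\<lambda>(c, i). (a * c, i))"

definition lmap :: "('i \<Rightarrow> 'j) \<Rightarrow> (real \<times> 'i) list \<Rightarrow> (real \<times> 'j) list" where
  "lmap f = map (\<lambda>(c, i). (c, f i))"

text \<open>Inner product, in the Hilbert space of the kernel \<open>K\<close>, of the vectors that
  the two lists stand for. Computing with it directly avoids the quotient and the
  completion.\<close>

definition lform :: "('i \<Rightarrow> 'i \<Rightarrow> real) \<Rightarrow> (real \<times> 'i) list \<Rightarrow> (real \<times> 'i) list \<Rightarrow> real" where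
  "lform K xs ys = lsum (\<lambda>i. lsum (K i) ys) xs"

definition psd_on :: "'i set \<Rightarrow> ('i \<Rightarrow> 'i \<Rightarrow> real) \<Rightarrow> bool" where
  "psd_on A K \<longleftrightarrow> (\<forall>i\<in>A. \<forall>j\<in>A. K i j = K j i) \<and>
     (\<forall>xs. snd ` set xs \<subseteq> A \<longrightarrow> 0 \<le> lform K xs xs)"

definition ldiff :: "(real \<times> 'i) list \<Rightarrow> (real \<times> 'i) list \<Rightarrow> (real \<times> 'i) list" where
  "ldiff xs ys = xs @ lscale (-1) ys"

lemma lsum_Nil [simp]: "lsum f [] = 0"
  and lsum_Cons: "lsum f (p # xs) = fst p * f (snd p) + lsum f xs"
  and lsum_append [simp]: "lsum f (xs @ ys) = lsum f xs + lsum f ys"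
  by (simp_all add: lsum_def split_beta)

lemma lsum_single [simp]: "lsum f [(c, i)] = c * f i"
  by (simp add: lsum_def)

lemma lsum_lscale [simp]: "lsum f (lscale a xs) = a * lsum f xs"
  by (induction xs) (auto simp: lscale_def lsum_Cons algebra_simps split_beta)

lemma lsum_lmap [simp]: "lsum f (lmap g xs) = lsum (\<lambda>i. f (g i)) xs"
  by (induction xs) (auto simp: lmap_def lsum_Cons split_beta)

lemma lsum_ldiff [simp]: "lsum f (ldiff xs ys) = lsum f xs - lsum f ys"
  by (simp add: ldiff_def)

lemma lsum_add: "lsum (\<lambda>i. f i + g i) xs = lsum f xs + lsum g xs"
  by (induction xs) (auto simp: lsum_Cons algebra_simps)

lemma lsum_diff: "lsum (\<lambda>i. f i - g i) xs = lsum f xs - lsum g xs"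
  by (induction xs) (auto simp: lsum_Cons algebra_simps)

lemma lsum_mult_left: "lsum (\<lambda>i. a * f i) xs = a * lsum f xs"
  by (induction xs) (auto simp: lsum_Cons algebra_simps)

lemma lsum_mult_right: "lsum (\<lambda>i. f i * a) xs = lsum f xs * a"
  by (induction xs) (auto simp: lsum_Cons algebra_simps)

lemma lsum_divide: "lsum (\<lambda>i. f i / a) xs = lsum f xs / a"
  using lsum_mult_right[of f "inverse a" xs] by (simp add: divide_inverse)

lemma lsum_zero [simp]: "lsum (\<lambda>i. 0) xs = 0"
  by (induction xs) (auto simp: lsum_Cons)

lemma lsum_sum: "lsum (\<lambda>i. \<Sum>j\<in>J. f j i) xs = (\<Sum>j\<in>J. lsum (f j) xs)"
  by (induction xs) (auto simp: lsum_Cons sum.distrib sum_distrib_left)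

lemma lsum_cong: "(\<And>i. i \<in> snd ` set xs \<Longrightarrow> f i = g i) \<Longrightarrow> lsum f xs = lsum g xs"
  by (induction xs) (auto simp: lsum_Cons)

lemma lsum_swap: "lsum (\<lambda>i. lsum (\<lambda>j. K i j) ys) xs = lsum (\<lambda>j. lsum (\<lambda>i. K i j) xs) ys"
  by (induction xs) (auto simp: lsum_Cons lsum_add lsum_mult_left)

lemma lsum_mono:
  assumes "\<And>c i. (c, i) \<in> set xs \<Longrightarrow> 0 \<le> c \<and> f i \<le> g i"
  shows "lsum f xs \<le> lsum g xs"
  using assms
proof (induction xs)
  case (Cons p xs)
  then have "0 \<le> fst p \<and> f (snd p) \<le> g (snd p)" by (metis list.set_intros(1) prod.collapse)
  with Cons show ?case by (auto simp: lsum_Cons intro!: add_mono mult_left_mono)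
qed simp

lemma lsum_tendsto:
  assumes "\<And>i. i \<in> snd ` set xs \<Longrightarrow> ((\<lambda>n. f n i) \<longlongrightarrow> g i) F"
  shows "((\<lambda>n. lsum (f n) xs) \<longlongrightarrow> lsum g xs) F"
  using assms by (induction xs) (auto simp: lsum_Cons intro!: tendsto_intros)

lemma set_lscale [simp]: "snd ` set (lscale a xs) = snd ` set xs"
  by (auto simp: lscale_def image_image split_beta)

lemma set_lmap [simp]: "snd ` set (lmap g xs) = g ` snd ` set xs"
  by (auto simp: lmap_def image_image split_beta)

lemma set_ldiff [simp]: "snd ` set (ldiff xs ys) = snd ` set xs \<union> snd ` set ys"
  unfolding ldiff_def by (simp only: set_append image_Un set_lscale)

lemma lform_append_left [simp]: "lform K (xs @ xs') ys = lform K xs ys + lform K xs' ys"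
  and lform_append_right [simp]: "lform K xs (ys @ ys') = lform K xs ys + lform K xs ys'"
  and lform_lscale_left [simp]: "lform K (lscale a xs) ys = a * lform K xs ys"
  and lform_lscale_right [simp]: "lform K xs (lscale a ys) = a * lform K xs ys"
  and lform_ldiff_left [simp]: "lform K (ldiff xs xs') ys = lform K xs ys - lform K xs' ys"
  and lform_ldiff_right [simp]: "lform K xs (ldiff ys ys') = lform K xs ys - lform K xs ys'"
  and lform_single [simp]: "lform K [(c, i)] [(d, j)] = c * (d * K i j)"
  by (simp_all add: lform_def lsum_add lsum_diff lsum_mult_left)

lemma lform_lmap: "lform K (lmap f xs) (lmap g ys) = lsum (\<lambda>i. lsum (\<lambda>j. K (f i) (g j)) ys) xs"
  by (simp add: lform_def)

lemma lform_sym: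
  assumes "psd_on A K" "snd ` set xs \<subseteq> A" "snd ` set ys \<subseteq> A"
  shows "lform K xs ys = lform K ys xs"
proof -
  have "lform K xs ys = lsum (\<lambda>j. lsum (\<lambda>i. K i j) xs) ys"
    unfolding lform_def by (rule lsum_swap)
  also have "\<dots> = lform K ys xs"
    unfolding lform_def using assms by (intro lsum_cong) (auto simp: psd_on_def)
  finally show ?thesis .
qed

lemma lform_nonneg: "psd_on A K \<Longrightarrow> snd ` set xs \<subseteq> A \<Longrightarrow> 0 \<le> lform K xs xs"
  by (simp add: psd_on_def)

lemma lform_ldiff_self:
  assumes "psd_on A K" "snd ` set xs \<subseteq> A" "snd ` set ys \<subseteq> A"
  shows "lform K (ldiff xs ys) (ldiff xs ys) = lform K xs xs - 2 * lform K xs ys + lform K ys ys"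
  using lform_sym[OF assms] by simp

text \<open>Positivity at \<open>t xs - s ys\<close> for all scalars: the choice
  \<open>t = c\<close>, \<open>s = b\<close> leaves \<open>c\<close> times
  \<open>a * c - b\<^sup>2\<close>.\<close>

lemma lform_Cauchy_Schwarz:
  assumes "psd_on A K" "snd ` set xs \<subseteq> A" "snd ` set ys \<subseteq> A"
  shows "(lform K xs ys)\<^sup>2 \<le> lform K xs xs * lform K ys ys"
proof -
  define a b c where "a = lform K xs xs" and "b = lform K xs ys" and "c = lform K ys ys"
  have pos: "0 \<le> t\<^sup>2 * a - 2 * t * s * b + s\<^sup>2 * c" for t s
  proof -
    have "0 \<le> lform K (ldiff (lscale t xs) (lscale s ys)) (ldiff (lscale t xs) (lscale s ys))"
      by (rule lform_nonneg[OF assms(1)]) (use assms in auto)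
    also have "\<dots> = t\<^sup>2 * a - 2 * t * s * b + s\<^sup>2 * c"
      using assms by (subst lform_ldiff_self[OF assms(1)])
        (auto simp: a_def b_def c_def power2_eq_square)
    finally show ?thesis .
  qed
  have "a \<ge> 0" "c \<ge> 0" using assms by (auto simp: a_def c_def lform_nonneg)
  show ?thesis
  proof (cases "c = 0")
    case True
    have "b = 0"
    proof (rule ccontr)
      assume "b \<noteq> 0"
      \<comment> \<open>For \<open>c = 0\<close> the form is affine in \<open>s\<close>; this value
        of \<open>s\<close> would make it equal to -1.\<close>
      have "0 \<le> a - 2 * ((a + 1) / (2 * b)) * b" using pos[of 1 "(a + 1) / (2 * b)"] True by simp
      also have "\<dots> = -1" using \<open>b \<noteq> 0\<close> by (simp add: field_simps)
      finally show False by simp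
    qed
    then show ?thesis using True by (simp add: b_def c_def)
  next
    case False
    then have "c > 0" using \<open>c \<ge> 0\<close> by simp
    have "0 \<le> c\<^sup>2 * a - 2 * c * b * b + b\<^sup>2 * c" using pos[of c b] by simp
    also have "\<dots> = c * (a * c - b\<^sup>2)" by (simp add: power2_eq_square algebra_simps)
    finally have "b\<^sup>2 \<le> a * c" using \<open>c > 0\<close> by (simp add: zero_le_mult_iff)
    then show ?thesis by (simp add: a_def b_def c_def)
  qed
qed

definition lnorm :: "('i \<Rightarrow> 'i \<Rightarrow> real) \<Rightarrow> (real \<times> 'i) list \<Rightarrow> real" where
  "lnorm K xs = sqrt (lform K xs xs)"

lemma lnorm_sq: "psd_on A K \<Longrightarrow> snd ` set xs \<subseteq> A \<Longrightarrow> (lnorm K xs)\<^sup>2 = lform K xs xs"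
  by (simp add: lnorm_def lform_nonneg)

lemma lnorm_nonneg: "psd_on A K \<Longrightarrow> snd ` set xs \<subseteq> A \<Longrightarrow> 0 \<le> lnorm K xs"
  by (simp add: lnorm_def lform_nonneg)

lemma lform_le_lnorm:
  assumes "psd_on A K" "snd ` set xs \<subseteq> A" "snd ` set ys \<subseteq> A"
  shows "\<bar>lform K xs ys\<bar> \<le> lnorm K xs * lnorm K ys"
proof -
  have "\<bar>lform K xs ys\<bar> = sqrt ((lform K xs ys)\<^sup>2)" by simp
  also have "\<dots> \<le> sqrt (lform K xs xs * lform K ys ys)"
    using lform_Cauchy_Schwarz[OF assms] by (rule real_sqrt_le_mono)
  finally show ?thesis by (simp add: lnorm_def real_sqrt_mult)
qed

lemma lnorm_append:
  assumes "psd_on A K" "snd ` set xs \<subseteq> A" "snd ` set ys \<subseteq> A"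
  shows "lnorm K (xs @ ys) \<le> lnorm K xs + lnorm K ys"
proof (rule power2_le_imp_le)
  have "(lnorm K (xs @ ys))\<^sup>2 = lform K xs xs + 2 * lform K xs ys + lform K ys ys"
    using assms lform_sym[OF assms] by (subst lnorm_sq[OF assms(1)]) auto
  also have "\<dots> \<le> (lnorm K xs + lnorm K ys)\<^sup>2"
    using lform_le_lnorm[OF assms] assms by (simp add: power2_sum lnorm_sq)
  finally show "(lnorm K (xs @ ys))\<^sup>2 \<le> (lnorm K xs + lnorm K ys)\<^sup>2" .
qed (use assms in \<open>simp add: lnorm_nonneg\<close>)

text \<open>Two lists stand for the same vector as soon as all their values \<open>lsum f\<close>
  agree. Order, repeated points and cancelling terms therefore never call for a normal form.\<close>

lemma lform_lsum_cong:
  assumes "\<And>f. lsum f xs = lsum f xs'" "\<And>f. lsum f ys = lsum f ys'"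
  shows "lform K xs ys = lform K xs' ys'"
  using assms by (simp add: lform_def)

lemma lnorm_triangle:
  assumes "psd_on A K" "snd ` set xs \<subseteq> A" "snd ` set ys \<subseteq> A" "snd ` set zs \<subseteq> A"
  shows "lnorm K (ldiff xs zs) \<le> lnorm K (ldiff xs ys) + lnorm K (ldiff ys zs)"
proof -
  have "lnorm K (ldiff xs zs) = lnorm K (ldiff xs ys @ ldiff ys zs)"
    unfolding lnorm_def by (intro arg_cong[where f = sqrt] lform_lsum_cong) auto
  also have "\<dots> \<le> lnorm K (ldiff xs ys) + lnorm K (ldiff ys zs)"
    by (rule lnorm_append[OF assms(1)]) (use assms in auto)
  finally show ?thesis .
qed

lemma psd_onI:
  assumes "\<And>i j. i \<in> A \<Longrightarrow> j \<in> A \<Longrightarrow> K i j = K j i"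
    and "\<And>xs. snd ` set xs \<subseteq> A \<Longrightarrow> 0 \<le> lform K xs xs"
  shows "psd_on A K"
  using assms by (auto simp: psd_on_def)

lemma psd_on_comp:
  fixes f :: "'b \<Rightarrow> 'a"
  assumes "psd_on A K" "f ` B \<subseteq> A"
  shows "psd_on B (\<lambda>i j. K (f i) (f j))"
proof (rule psd_onI)
  fix i j assume "i \<in> B" "j \<in> B" then show "K (f i) (f j) = K (f j) (f i)"
    using assms by (auto simp: psd_on_def image_subset_iff)
next
  fix xs :: "(real \<times> 'b) list" assume "snd ` set xs \<subseteq> B"
  then have "0 \<le> lform K (lmap f xs) (lmap f xs)"
    by (intro lform_nonneg[OF assms(1)]) (use assms(2) in \<open>simp, blast\<close>)
  then show "0 \<le> lform (\<lambda>i j. K (f i) (f j)) xs xs"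
    by (simp add: lform_lmap) (simp add: lform_def)
qed

lemma psd_on_diag_nonneg: "psd_on A K \<Longrightarrow> i \<in> A \<Longrightarrow> 0 \<le> K i i"
  using lform_nonneg[of A K "[(1, i)]"] by simp

lemma psd_on_Cauchy_Schwarz: "psd_on A K \<Longrightarrow> i \<in> A \<Longrightarrow> j \<in> A \<Longrightarrow> (K i j)\<^sup>2 \<le> K i i * K j j"
  using lform_Cauchy_Schwarz[of A K "[(1, i)]" "[(1, j)]"] by simp

lemma psd_on_mult_const: "psd_on A K \<Longrightarrow> a \<ge> 0 \<Longrightarrow> psd_on A (\<lambda>i j. a * K i j)"
  by (auto simp: psd_on_def lform_def lsum_mult_left)

lemma psd_on_sum: "(\<And>k. k \<in> J \<Longrightarrow> psd_on A (K k)) \<Longrightarrow> psd_on A (\<lambda>i j. \<Sum>k\<in>J. K k i j)"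
  by (auto simp: psd_on_def lform_def lsum_sum intro!: sum.cong sum_nonneg)

lemma psd_on_tendsto:
  fixes A :: "'a set"
  assumes "\<And>n. psd_on A (K n)" "\<And>i j. i \<in> A \<Longrightarrow> j \<in> A \<Longrightarrow> (\<lambda>n. K n i j) \<longlonglongrightarrow> L i j"
  shows "psd_on A L"
proof (rule psd_onI)
  fix i j assume ij: "i \<in> A" "j \<in> A"
  have "(\<lambda>n. K n i j) = (\<lambda>n. K n j i)" using assms(1) ij by (auto simp: psd_on_def)
  then show "L i j = L j i" using assms(2) ij by (metis LIMSEQ_unique)
next
  fix xs :: "(real \<times> 'a) list" assume xs: "snd ` set xs \<subseteq> A"
  have "(\<lambda>n. lform (K n) xs xs) \<longlonglongrightarrow> lform L xs xs"
    unfolding lform_def by (intro lsum_tendsto assms(2)) (use xs in blast)+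
  then show "0 \<le> lform L xs xs"
    using lform_nonneg[OF assms(1) xs] by (intro LIMSEQ_le_const) auto
qed

lemma psd_on_rank1: "psd_on A (\<lambda>i j. f i * f j)"
  by (auto simp: psd_on_def lform_def lsum_mult_left lsum_mult_right)


section \<open>Cholesky factorization and the Schur product theorem\<close>

fun schur :: "(nat \<Rightarrow> nat \<Rightarrow> real) \<Rightarrow> nat \<Rightarrow> nat \<Rightarrow> nat \<Rightarrow> real" where
  "schur K 0 i j = K i j"
| "schur K (Suc n) i j = schur K n i j - schur K n i n * schur K n j n / schur K n n n"

text \<open>The columns of the Cholesky factor: the pivot column divided by the root of the pivot.
  Since \<open>x / 0 = 0\<close>, a zero pivot gives a zero column and leaves the matrix unchanged;
  this is the right convention for degenerate kernels, because in a positive kernel a zero pivot has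
  a zero column anyway.\<close>

definition chol :: "(nat \<Rightarrow> nat \<Rightarrow> real) \<Rightarrow> nat \<Rightarrow> nat \<Rightarrow> real" where
  "chol K i n = schur K n i n / sqrt (schur K n n n)"

lemma schur_0: "schur K 0 = K"
  by (intro ext) simp

text \<open>The quadratic form of the next Schur complement at \<open>xs\<close> is the old one
  minus \<open>t\<^sup>2 / k n n\<close>, where \<open>t\<close> is the inner product with the point
  \<open>n\<close>. Cauchy-Schwarz bounds exactly this term.\<close>

lemma psd_on_schur: "psd_on UNIV K \<Longrightarrow> psd_on UNIV (schur K n)"
proof (induction n)
  case (Suc n)
  define k where "k = schur K n"
  have k: "psd_on UNIV k" using Suc by (simp add: k_def)
  show ?case
  proof (rule psd_onI)
    fix i j show "schur K (Suc n) i j = schur K (Suc n) j i"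
      using k by (simp add: psd_on_def flip: k_def)
  next
    fix xs :: "(real \<times> nat) list"
    define t where "t = lform k xs [(1, n)]"
    have t: "lsum (\<lambda>i. k i n) xs = t" by (simp add: t_def lform_def)
    have "0 \<le> k n n" by (rule psd_on_diag_nonneg[OF k]) simp
    have "t\<^sup>2 \<le> lform k xs xs * k n n"
      using lform_Cauchy_Schwarz[OF k, of xs "[(1, n)]"] by (simp add: t_def)
    then have *: "t\<^sup>2 / k n n \<le> lform k xs xs"
      using \<open>0 \<le> k n n\<close> lform_nonneg[OF k, of xs] by (auto simp: divide_le_eq)
    have "schur K (Suc n) = (\<lambda>i j. k i j - (k i n / k n n) * k j n)"
      by (intro ext) (simp add: k_def)
    then have "lform (schur K (Suc n)) xs xs =
        lsum (\<lambda>i. lsum (\<lambda>j. k i j - (k i n / k n n) * k j n) xs) xs"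
      by (simp add: lform_def)
    also have "\<dots> = lform k xs xs - t\<^sup>2 / k n n"
      by (simp add: lform_def lsum_diff lsum_mult_left lsum_mult_right t power2_eq_square lsum_divide)
    finally show "0 \<le> lform (schur K (Suc n)) xs xs" using * by simp
  qed
qed (simp add: schur_0)

text \<open>Row \<open>n\<close> is eliminated in step \<open>n\<close> and stays zero afterwards.
  If the pivot vanishes, nothing is subtracted, but then Cauchy-Schwarz shows that the row was
  already zero.\<close>

lemma schur_zero:
  assumes "psd_on UNIV K" "i < n"
  shows "schur K n i j = 0"
  using assms(2)
proof (induction n arbitrary: i j)
  case (Suc n)
  have psd: "psd_on UNIV (schur K n)" by (rule psd_on_schur[OF assms(1)])
  show ?case
  proof (cases "i < n")
    case True
    then show ?thesis using Suc.IH by simp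
  next
    case False
    then have [simp]: "i = n" using Suc.prems by simp
    have "schur K n n j = schur K n j n" using psd by (simp add: psd_on_def)
    moreover have "schur K n n j = 0" if "schur K n n n = 0"
      using psd_on_Cauchy_Schwarz[OF psd, of n j] that by simp
    ultimately show ?thesis by (cases "schur K n n n = 0") auto
  qed
qed simp

lemma chol_upper_zero: "psd_on UNIV K \<Longrightarrow> i < n \<Longrightarrow> chol K i n = 0"
  by (simp add: chol_def schur_zero)

lemma schur_chol:
  assumes "psd_on UNIV K"
  shows "K i j = (\<Sum>m<n. chol K i m * chol K j m) + schur K n i j"
proof (induction n)
  case (Suc n)
  have "0 \<le> schur K n n n" by (rule psd_on_diag_nonneg[OF psd_on_schur[OF assms]]) simp
  then have "chol K i n * chol K j n = schur K n i n * schur K n j n / schur K n n n"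
    by (simp add: chol_def)
  then show ?case using Suc by simp
qed simp

lemma chol_eq:
  assumes "psd_on UNIV K" "i < n"
  shows "K i j = (\<Sum>m<n. chol K i m * chol K j m)"
  using schur_chol[OF assms(1), of i j n] schur_zero[OF assms] by simp

lemma chol_col_zero: "psd_on UNIV K \<Longrightarrow> chol K n n = 0 \<Longrightarrow> chol K i n = 0"
proof -
  assume K: "psd_on UNIV K" and 0: "chol K n n = 0"
  have psd: "psd_on UNIV (schur K n)" by (rule psd_on_schur[OF K])
  have "schur K n n n = 0" using 0 by (auto simp: chol_def)
  then show ?thesis by (simp add: chol_def)
qed

text \<open>Gram-Schmidt in coordinates: from the point \<open>b\<close> its components along the
  earlier basis vectors are subtracted, and the rest is divided by the pivot. Earlier indices with
  zero pivot have no basis vector, but their columns vanish. The result writes each orthonormal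
  basis vector as a formal combination of points.\<close>

lemma chol_basis:
  assumes "psd_on UNIV K" "chol K b b \<noteq> 0"
  shows "\<exists>xs. \<forall>j. lsum (\<lambda>i. chol K i j) xs = (if j = b then 1 else 0)"
  using assms(2)
proof (induction b rule: less_induct)
  case (less b)
  have "\<forall>m. \<exists>xs. m < b \<longrightarrow> chol K m m \<noteq> 0 \<longrightarrow>
      (\<forall>j. lsum (\<lambda>i. chol K i j) xs = (if j = m then 1 else 0))"
    using less.IH by blast
  then obtain X where X: "\<And>m j. m < b \<Longrightarrow> chol K m m \<noteq> 0 \<Longrightarrow>
      lsum (\<lambda>i. chol K i j) (X m) = (if j = m then 1 else 0)" by metis
  define ys where "ys = concat (map (\<lambda>m. lscale (chol K b m) (X m)) [0..<b])"
  have ys: "lsum (\<lambda>i. chol K i j) ys = (if j < b then chol K b j else 0)" for j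
  proof -
    have "lsum (\<lambda>i. chol K i j) (concat (map (\<lambda>m. lscale (chol K b m) (X m)) [0..<n])) =
        (if j < n then chol K b j else 0)" if "n \<le> b" for n
      using that
    proof (induction n)
      case (Suc n)
      have "chol K b n * lsum (\<lambda>i. chol K i j) (X n) = (if j = n then chol K b n else 0)"
        using X[of n j] Suc.prems chol_col_zero[OF assms(1), of n b]
        by (cases "chol K n n = 0") simp_all
      moreover have "lsum (\<lambda>i. chol K i j) (concat (map (\<lambda>m. lscale (chol K b m) (X m)) [0..<Suc n])) =
          lsum (\<lambda>i. chol K i j) (concat (map (\<lambda>m. lscale (chol K b m) (X m)) [0..<n])) +
          chol K b n * lsum (\<lambda>i. chol K i j) (X n)"
        by simp
      ultimately show ?case using Suc by (simp only: Suc_leD) (simp add: less_Suc_eq)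
    qed simp
    from this[of b] show ?thesis by (simp add: ys_def)
  qed
  show ?case
  proof (intro exI allI)
    fix j
    show "lsum (\<lambda>i. chol K i j) (lscale (1 / chol K b b) (ldiff [(1, b)] ys)) = (if j = b then 1 else 0)"
    proof -
      have "lsum (\<lambda>i. chol K i j) (lscale (1 / chol K b b) (ldiff [(1, b)] ys)) =
          (chol K b j - (if j < b then chol K b j else 0)) / chol K b b"
        by (simp only: lsum_lscale lsum_ldiff lsum_single ys) simp
      also have "\<dots> = (if j = b then 1 else 0)"
        using less.prems chol_upper_zero[OF assms(1), of b j] by (cases j b rule: linorder_cases) simp_all
      finally show ?thesis .
    qed
  qed
qed

text \<open>The Schur product theorem. On finitely many indices \<open>K\<close> is a finite sum of
  rank one kernels, one for each Cholesky column, and multiplying \<open>K'\<close> by a rank one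
  kernel only rescales the coefficients of the list.\<close>

lemma psd_on_mult_nat:
  fixes K K' :: "nat \<Rightarrow> nat \<Rightarrow> real"
  assumes K: "psd_on UNIV K" and K': "psd_on UNIV K'"
  shows "psd_on UNIV (\<lambda>i j. K i j * K' i j)"
proof (rule psd_onI)
  fix i j have "K i j = K j i" "K' i j = K' j i" using K K' by (auto simp: psd_on_def)
  then show "K i j * K' i j = K j i * K' j i" by (simp only:)
next
  fix xs :: "(real \<times> nat) list"
  define n where "n = Suc (Max (insert 0 (snd ` set xs)))"
  have n: "i < n" if "i \<in> snd ` set xs" for i
    unfolding n_def using that by (intro le_imp_less_Suc Max_ge) auto
  have "lform (\<lambda>i j. K i j * K' i j) xs xs =
      lsum (\<lambda>i. lsum (\<lambda>j. \<Sum>m<n. chol K i m * chol K j m * K' i j) xs) xs"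
    unfolding lform_def
  proof (intro lsum_cong)
    fix i j assume "i \<in> snd ` set xs"
    then show "K i j * K' i j = (\<Sum>m<n. chol K i m * chol K j m * K' i j)"
      unfolding sum_distrib_right[symmetric] by (subst chol_eq[OF K n]) auto
  qed
  also have "\<dots> = (\<Sum>m<n. lsum (\<lambda>i. lsum (\<lambda>j. chol K i m * chol K j m * K' i j) xs) xs)"
    by (simp add: lsum_sum)
  also have "\<dots> \<ge> 0"
  proof (rule sum_nonneg)
    fix m
    define ys where "ys = map (\<lambda>(c, i). (c * chol K i m, i)) xs"
    have ys: "lsum f ys = lsum (\<lambda>i. chol K i m * f i) xs" for f
      unfolding ys_def by (induction xs) (auto simp: lsum_Cons split_beta)
    have "0 \<le> lform K' ys ys" by (rule lform_nonneg[OF K']) simp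
    also have "\<dots> = lsum (\<lambda>i. lsum (\<lambda>j. chol K i m * chol K j m * K' i j) xs) xs"
      unfolding lform_def ys by (simp only: lsum_mult_left mult.assoc)
    finally show "0 \<le> lsum (\<lambda>i. lsum (\<lambda>j. chol K i m * chol K j m * K' i j) xs) xs" .
  qed
  finally show "0 \<le> lform (\<lambda>i j. K i j * K' i j) xs xs" .
qed

lemma psd_on_exp_nat:
  fixes K :: "nat \<Rightarrow> nat \<Rightarrow> real"
  assumes "psd_on UNIV K"
  shows "psd_on UNIV (\<lambda>i j. exp (K i j))"
proof -
  have pow: "psd_on UNIV (\<lambda>i j. K i j ^ n)" for n
  proof (induction n)
    case 0
    show ?case using psd_on_rank1[of UNIV "\<lambda>_. 1"] by simp
  next
    case (Suc n)
    then show ?case using psd_on_mult_nat[OF assms Suc] by simp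
  qed
  have "psd_on UNIV (\<lambda>i j. \<Sum>n<m. inverse (fact n) * K i j ^ n)" for m
    by (intro psd_on_sum psd_on_mult_const pow) auto
  moreover have "(\<lambda>m. \<Sum>n<m. inverse (fact n) * K i j ^ n) \<longlonglongrightarrow> exp (K i j)" for i j
    using exp_converges[of "K i j"] by (simp add: sums_def)
  ultimately show ?thesis by (rule psd_on_tendsto)
qed

text \<open>The direction of Schoenberg's theorem that turns squared distances into positive
  definite functions: the Gaussian is a rank one kernel, built from
  \<open>exp (- (t * K i i))\<close>, times the exponential of the positive kernel
  \<open>2 * t * K\<close>.\<close>

lemma psd_on_gaussian_nat:
  fixes K :: "nat \<Rightarrow> nat \<Rightarrow> real"
  assumes "psd_on UNIV K" "t \<ge> 0"
  shows "psd_on UNIV (\<lambda>i j. exp (- (t * (K i i + K j j - 2 * K i j))))"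
proof -
  have "psd_on UNIV (\<lambda>i j. (exp (- (t * K i i)) * exp (- (t * K j j))) * exp ((2 * t) * K i j))"
    by (intro psd_on_mult_nat psd_on_rank1 psd_on_exp_nat psd_on_mult_const) (use assms in auto)
  moreover have "exp (- (t * K i i)) * exp (- (t * K j j)) * exp ((2 * t) * K i j) =
      exp (- (t * (K i i + K j j - 2 * K i j)))" for i j
    by (simp only: exp_add [symmetric]) (simp add: algebra_simps)
  ultimately show ?thesis by simp
qed

section \<open>Orthogonal matrices as unitary representations on the concrete space\<close>

definition mat_op :: "('i \<Rightarrow> 'i \<Rightarrow> real) \<Rightarrow> ('i \<Rightarrow> complex) \<Rightarrow> 'i \<Rightarrow> complex" where
  "mat_op A x i = (\<Sum>j | A i j \<noteq> 0. of_real (A i j) * x j)"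

lemma mat_op_eq_sum:
  assumes "finite T" "{j. A i j \<noteq> 0} \<subseteq> T"
  shows "mat_op A x i = (\<Sum>j\<in>T. of_real (A i j) * x j)"
  unfolding mat_op_def by (rule sum.mono_neutral_left) (use assms in auto)

text \<open>Finite rows and columns reduce the estimate to finite sums: a finite set of output
  coordinates involves finitely many inputs, and on those the orthonormality of the columns is a
  finite Parseval identity.\<close>

lemma mat_op_bound:
  fixes A :: "'i \<Rightarrow> 'i \<Rightarrow> real"
  assumes rows: "\<And>i. finite {j. A i j \<noteq> 0}" and cols: "\<And>j. finite {i. A i j \<noteq> 0}"
    and orth: "\<And>j l. (\<Sum>i | A i j \<noteq> 0. A i j * A i l) = (if j = l then 1 else 0)"
    and x: "x \<in> l2space"
  shows "mat_op A x \<in> l2space \<and> l2norm (mat_op A x) \<le> l2norm x"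
proof -
  define N where "N = (\<Sum>\<^sub>\<infinity>i. (cmod (x i))\<^sup>2)"
  have bound: "(\<Sum>i\<in>J. (cmod (mat_op A x i))\<^sup>2) \<le> N" if J: "finite J" for J
  proof -
    define S where "S = (\<Union>i\<in>J. {j. A i j \<noteq> 0})"
    \<comment> \<open>\<open>T\<close> contains every row that meets a column in \<open>S\<close>,
      so inner products of these columns taken over \<open>T\<close> are the full ones.\<close>
    define T where "T = J \<union> (\<Union>j\<in>S. {i. A i j \<noteq> 0})"
    define y where "y i = (\<Sum>j\<in>S. of_real (A i j) * x j)" for i
    have fS: "finite S" using J rows by (auto simp: S_def)
    have fT: "finite T" using J fS cols by (auto simp: T_def)
    have y: "mat_op A x i = y i" if "i \<in> J" for i
      unfolding y_def by (rule mat_op_eq_sum[OF fS]) (use that in \<open>auto simp: S_def\<close>)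
    have orthT: "(\<Sum>i\<in>T. A i j * A i l) = (if j = l then 1 else 0)" if "j \<in> S" for j l
      unfolding orth[symmetric]
      by (rule sum.mono_neutral_right[OF fT]) (use that in \<open>auto simp: T_def\<close>)
    have "complex_of_real (\<Sum>i\<in>T. (cmod (y i))\<^sup>2) = (\<Sum>i\<in>T. y i * cnj (y i))"
      by (simp add: complex_norm_square del: of_real_power)
    also have "\<dots> = (\<Sum>i\<in>T. \<Sum>j\<in>S. \<Sum>l\<in>S. of_real (A i j * A i l) * (x j * cnj (x l)))"
      by (simp add: y_def sum_product mult_ac)
    also have "\<dots> = (\<Sum>j\<in>S. \<Sum>l\<in>S. of_real (\<Sum>i\<in>T. A i j * A i l) * (x j * cnj (x l)))"
    proof -
      have "(\<Sum>i\<in>T. \<Sum>j\<in>S. \<Sum>l\<in>S. complex_of_real (A i j * A i l) * (x j * cnj (x l))) =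
          (\<Sum>j\<in>S. \<Sum>i\<in>T. \<Sum>l\<in>S. complex_of_real (A i j * A i l) * (x j * cnj (x l)))"
        by (rule sum.swap)
      also have "\<dots> = (\<Sum>j\<in>S. \<Sum>l\<in>S. \<Sum>i\<in>T. complex_of_real (A i j * A i l) * (x j * cnj (x l)))"
        by (rule sum.cong[OF refl]) (rule sum.swap)
      finally show ?thesis by (simp add: sum_distrib_right)
    qed
    also have "\<dots> = (\<Sum>j\<in>S. \<Sum>l\<in>S. if j = l then x j * cnj (x l) else 0)"
      by (intro sum.cong refl) (auto simp: orthT)
    also have "\<dots> = (\<Sum>j\<in>S. x j * cnj (x j))"
      using fS by (simp add: sum.delta)
    also have "\<dots> = complex_of_real (\<Sum>j\<in>S. (cmod (x j))\<^sup>2)"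
      by (simp add: complex_norm_square del: of_real_power)
    finally have eq: "(\<Sum>i\<in>T. (cmod (y i))\<^sup>2) = (\<Sum>j\<in>S. (cmod (x j))\<^sup>2)"
      using of_real_eq_iff by blast
    have "(\<Sum>i\<in>J. (cmod (mat_op A x i))\<^sup>2) = (\<Sum>i\<in>J. (cmod (y i))\<^sup>2)"
      by (simp add: y)
    also have "\<dots> \<le> (\<Sum>i\<in>T. (cmod (y i))\<^sup>2)"
      by (rule sum_mono2[OF fT]) (auto simp: T_def)
    also have "\<dots> = (\<Sum>j\<in>S. (cmod (x j))\<^sup>2)" by (rule eq)
    also have "\<dots> \<le> N"
      unfolding N_def using x fS
      by (intro finite_sum_le_infsum) (auto simp: l2space_def)
    finally show ?thesis .
  qed
  have summ: "(\<lambda>i. (cmod (mat_op A x i))\<^sup>2) summable_on UNIV"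
    by (rule nonneg_bdd_above_summable_on) (auto intro!: bdd_aboveI[where M = N] bound)
  moreover have "(\<Sum>\<^sub>\<infinity>i. (cmod (mat_op A x i))\<^sup>2) \<le> N"
    by (rule infsum_le_finite_sums[OF summ]) (use bound in auto)
  ultimately show ?thesis by (simp add: l2space_def l2norm_def N_def)
qed

text \<open>Inverses are transposes, so multiplicativity at \<open>inv g\<close> and
  \<open>g\<close> says that the columns of \<open>A g\<close> are orthonormal. Both
  \<open>g\<close> and its inverse then act as contractions, hence as isometries.\<close>

lemma unitary_rep_matrix:
  fixes A :: "'g \<Rightarrow> ('g \<times> nat) \<Rightarrow> ('g \<times> nat) \<Rightarrow> real"
  assumes G: "group G"
    and rows: "\<And>g i. g \<in> carrier G \<Longrightarrow> finite {j. A g i j \<noteq> 0}"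
    and tr: "\<And>g i j. g \<in> carrier G \<Longrightarrow> A (inv\<^bsub>G\<^esub> g) i j = A g j i"
    and mult: "\<And>g h i j. g \<in> carrier G \<Longrightarrow> h \<in> carrier G \<Longrightarrow>
        A (g \<otimes>\<^bsub>G\<^esub> h) i j = (\<Sum>l | A g i l \<noteq> 0. A g i l * A h l j)"
    and one: "\<And>i j. A \<one>\<^bsub>G\<^esub> i j = (if i = j then 1 else 0)"
  shows "unitary_rep G (\<lambda>g. mat_op (A g))"
proof -
  interpret group G by (rule G)
  have cols: "finite {i. A g i j \<noteq> 0}" if "g \<in> carrier G" for g j
    using rows[of "inv\<^bsub>G\<^esub> g" j] that by (simp add: tr)
  have orth: "(\<Sum>i | A g i j \<noteq> 0. A g i j * A g i l) = (if j = l then 1 else 0)"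
    if g: "g \<in> carrier G" for g j l
  proof -
    have "A (inv\<^bsub>G\<^esub> g \<otimes>\<^bsub>G\<^esub> g) j l = (\<Sum>i | A g i j \<noteq> 0. A g i j * A g i l)"
      using g by (subst mult) (auto simp: tr)
    then show ?thesis using g by (simp add: one)
  qed
  have bd: "mat_op (A g) x \<in> l2space \<and> l2norm (mat_op (A g) x) \<le> l2norm x"
    if "g \<in> carrier G" "x \<in> l2space" for g x
    by (rule mat_op_bound) (use that rows cols orth in auto)
  have comp: "mat_op (A (g \<otimes>\<^bsub>G\<^esub> h)) x = mat_op (A g) (mat_op (A h) x)"
    if g: "g \<in> carrier G" and h: "h \<in> carrier G" for g h x
  proof
    fix i
    define S where "S = {l. A g i l \<noteq> 0}"
    define T where "T = (\<Union>l\<in>S. {j. A h l j \<noteq> 0})"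
    have fS: "finite S" using rows g by (simp add: S_def)
    have fT: "finite T" using fS rows h by (auto simp: T_def)
    have 1: "mat_op (A h) x l = (\<Sum>j\<in>T. of_real (A h l j) * x j)" if "l \<in> S" for l
      by (rule mat_op_eq_sum[OF fT]) (use that in \<open>auto simp: T_def\<close>)
    have supp: "{j. A (g \<otimes>\<^bsub>G\<^esub> h) i j \<noteq> 0} \<subseteq> T"
    proof
      fix j assume "j \<in> {j. A (g \<otimes>\<^bsub>G\<^esub> h) i j \<noteq> 0}"
      then have "(\<Sum>l\<in>S. A g i l * A h l j) \<noteq> 0" using mult g h by (simp add: S_def)
      then obtain l where "l \<in> S" "A g i l * A h l j \<noteq> 0" by (meson sum.neutral)
      then show "j \<in> T" by (auto simp: T_def)
    qed
    have "mat_op (A g) (mat_op (A h) x) i = (\<Sum>l\<in>S. \<Sum>j\<in>T. of_real (A g i l * A h l j) * x j)"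
      by (simp add: mat_op_def[of "A g"] 1 sum_distrib_left mult.assoc flip: S_def)
    also have "\<dots> = (\<Sum>j\<in>T. of_real (\<Sum>l\<in>S. A g i l * A h l j) * x j)"
      by (subst sum.swap) (simp add: sum_distrib_right)
    also have "\<dots> = (\<Sum>j\<in>T. of_real (A (g \<otimes>\<^bsub>G\<^esub> h) i j) * x j)"
      using mult[OF g h] by (simp add: S_def)
    also have "\<dots> = mat_op (A (g \<otimes>\<^bsub>G\<^esub> h)) x i"
      by (rule mat_op_eq_sum[where A = "A (g \<otimes>\<^bsub>G\<^esub> h)", OF fT supp, symmetric])
    finally show "mat_op (A (g \<otimes>\<^bsub>G\<^esub> h)) x i = mat_op (A g) (mat_op (A h) x) i" by simp
  qed
  have id: "mat_op (A \<one>\<^bsub>G\<^esub>) x = x" for x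
    by (intro ext) (simp add: mat_op_eq_sum[of "{i}" "A \<one>\<^bsub>G\<^esub>" i for i] one)
  have inv1: "mat_op (A (inv\<^bsub>G\<^esub> g)) (mat_op (A g) x) = x" if "g \<in> carrier G" for g x
    using comp[of "inv\<^bsub>G\<^esub> g" g x] that id by simp
  have inv2: "mat_op (A g) (mat_op (A (inv\<^bsub>G\<^esub> g)) x) = x" if "g \<in> carrier G" for g x
    using comp[of g "inv\<^bsub>G\<^esub> g" x] that id by simp
  show ?thesis
    unfolding unitary_rep_def
  proof (intro conjI ballI allI)
    fix g assume g: "g \<in> carrier G"
    then have ig: "inv\<^bsub>G\<^esub> g \<in> carrier G" by simp
    show "bij_betw (mat_op (A g)) l2space l2space"
      by (rule bij_betw_byWitness[where f' = "mat_op (A (inv\<^bsub>G\<^esub> g))"])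
        (use g ig bd inv1 inv2 in auto)
    show "mat_op (A g) (\<lambda>i. x i + y i) = (\<lambda>i. mat_op (A g) x i + mat_op (A g) y i)" for x y
      by (simp add: mat_op_def fun_eq_iff algebra_simps sum.distrib)
    show "mat_op (A g) (\<lambda>i. c * x i) = (\<lambda>i. c * mat_op (A g) x i)" for c x
      by (simp add: mat_op_def fun_eq_iff sum_distrib_left mult_ac)
    show "l2norm (mat_op (A g) x) = l2norm x" if "x \<in> l2space" for x
      using bd[OF g that] bd[OF ig, of "mat_op (A g) x"] inv1[OF g, of x] by simp
  qed (auto simp: comp id)
qed


lemma l2norm_sq_eq_sum:
  fixes x :: "'i \<Rightarrow> complex"
  assumes "finite T" "\<And>i. i \<notin> T \<Longrightarrow> x i = 0"
  shows "x \<in> l2space" "(l2norm x)\<^sup>2 = (\<Sum>i\<in>T. (cmod (x i))\<^sup>2)"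
proof -
  have "((\<lambda>i. (cmod (x i))\<^sup>2) has_sum (\<Sum>i\<in>T. (cmod (x i))\<^sup>2)) UNIV"
    by (rule has_sum_finite_neutralI[OF assms(1)]) (use assms in auto)
  then show "x \<in> l2space" "(l2norm x)\<^sup>2 = (\<Sum>i\<in>T. (cmod (x i))\<^sup>2)"
    by (auto simp: l2space_def l2norm_def has_sum_imp_summable infsumI sum_nonneg)
qed

section \<open>Relative property (T) bounds invariant distances\<close>

definition kdist :: "('i \<Rightarrow> 'i \<Rightarrow> real) \<Rightarrow> 'i \<Rightarrow> 'i \<Rightarrow> real" where
  "kdist K i j = K i i + K j j - 2 * K i j"

lemma kdist_lnorm:
  assumes "psd_on A K" "i \<in> A" "j \<in> A"
  shows "lform K (ldiff [(1, i)] [(1, j)]) (ldiff [(1, i)] [(1, j)]) = kdist K i j"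
  using assms by (subst lform_ldiff_self[OF assms(1)]) (auto simp: kdist_def)

lemma sqrt_kdist_triangle:
  assumes "psd_on A K" "i \<in> A" "j \<in> A" "l \<in> A"
  shows "sqrt (kdist K i l) \<le> sqrt (kdist K i j) + sqrt (kdist K j l)"
proof -
  have "lnorm K (ldiff [(1, i)] [(1, l)]) \<le>
      lnorm K (ldiff [(1, i)] [(1, j)]) + lnorm K (ldiff [(1, j)] [(1, l)])"
    by (rule lnorm_triangle[OF assms(1)]) (use assms in auto)
  then show ?thesis unfolding lnorm_def by (simp only: kdist_lnorm[OF assms(1)] assms)
qed

lemma kdist_nonneg: "psd_on A K \<Longrightarrow> i \<in> A \<Longrightarrow> j \<in> A \<Longrightarrow> 0 \<le> kdist K i j"
  using lform_nonneg[of A K "ldiff [(1, i)] [(1, j)]"] kdist_lnorm[of A K i j] by auto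

lemma kdist_sym: "psd_on A K \<Longrightarrow> i \<in> A \<Longrightarrow> j \<in> A \<Longrightarrow> kdist K i j = kdist K j i"
  by (simp add: kdist_def psd_on_def)

text \<open>Coordinates of a formal combination in the orthonormal basis given by the Cholesky
  factor. The factor is lower triangular, so only finitely many of them are nonzero, which keeps the
  matrices of the representation row finite.\<close>

definition lvec :: "(nat \<Rightarrow> nat \<Rightarrow> real) \<Rightarrow> (real \<times> nat) list \<Rightarrow> nat \<Rightarrow> real" where
  "lvec k xs b = lsum (\<lambda>i. chol k i b) xs"

lemma lvec_eq_0:
  assumes "psd_on UNIV k" "\<And>i. i \<in> snd ` set xs \<Longrightarrow> i < b"
  shows "lvec k xs b = 0"
proof -
  have "lvec k xs b = lsum (\<lambda>i. 0) xs"
    unfolding lvec_def by (intro lsum_cong chol_upper_zero assms)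
  then show ?thesis by simp
qed

lemma finite_lvec: "psd_on UNIV k \<Longrightarrow> finite {b. lvec k xs b \<noteq> 0}"
proof -
  assume k: "psd_on UNIV k"
  define n where "n = Max (insert 0 (snd ` set xs))"
  have "i \<le> n" if "i \<in> snd ` set xs" for i unfolding n_def using that by (intro Max_ge) auto
  then have "lvec k xs b = 0" if "n < b" for b
    by (intro lvec_eq_0[OF k]) (use that in \<open>blast intro: le_less_trans\<close>)
  then have "{b. lvec k xs b \<noteq> 0} \<subseteq> {..n}"
    using not_le by blast
  then show ?thesis by (rule finite_subset) simp
qed

lemma lvec_off_basis: "psd_on UNIV k \<Longrightarrow> chol k b b = 0 \<Longrightarrow> lvec k xs b = 0"
  by (simp add: lvec_def chol_col_zero)

lemma lform_eq_sum_lvec: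
  assumes k: "psd_on UNIV k" and T: "finite T" "{b. lvec k xs b \<noteq> 0 \<and> lvec k ys b \<noteq> 0} \<subseteq> T"
  shows "lform k xs ys = (\<Sum>b\<in>T. lvec k xs b * lvec k ys b)"
proof -
  define n where "n = Suc (Max (insert 0 (snd ` set xs) \<union> T))"
  have n: "i < n" if "i \<in> snd ` set xs \<union> T" for i
    unfolding n_def using that T(1) by (intro le_imp_less_Suc Max_ge) auto
  have "lform k xs ys = lsum (\<lambda>i. lsum (\<lambda>j. \<Sum>m<n. chol k i m * chol k j m) ys) xs"
    unfolding lform_def
  proof (intro lsum_cong)
    fix i j assume "i \<in> snd ` set xs"
    then show "k i j = (\<Sum>m<n. chol k i m * chol k j m)"
      using n by (intro chol_eq[OF k]) auto
  qed
  also have "\<dots> = (\<Sum>m<n. lvec k xs m * lvec k ys m)"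
    by (simp add: lsum_sum lsum_mult_left lsum_mult_right lvec_def)
  also have "\<dots> = (\<Sum>m\<in>T. lvec k xs m * lvec k ys m)"
    by (rule sum.mono_neutral_right) (use n T in auto)
  finally show ?thesis .
qed


text \<open>The representation is the direct sum over \<open>n\<close> of the GNS representations of the positive definite
  functions \<open>exp (- d(1,g) / (n + 1))\<close>, written in the basis obtained from the Cholesky
  factorization and amplified to fill \<open>l2space\<close>. If \<open>d(1, \<cdot>)\<close> were unbounded on \<open>H\<close>, translates by \<open>H\<close>
  would tend weakly to zero, so there would be no \<open>H\<close>-invariant vector.\<close>

lemma relative_T_bounded:
  fixes G (structure) and K :: "'g \<Rightarrow> 'g \<Rightarrow> real"
  assumes relT: "relative_T G H" and cnt: "countable (carrier G)"
    and K: "psd_on (carrier G) K"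
    and inv: "\<And>k g h. k \<in> carrier G \<Longrightarrow> g \<in> carrier G \<Longrightarrow> h \<in> carrier G \<Longrightarrow>
        kdist K (k \<otimes> g) (k \<otimes> h) = kdist K g h"
  shows "\<exists>C. \<forall>h\<in>H. kdist K \<one> h \<le> C"
proof (rule ccontr)
  assume unb: "\<not> ?thesis"
  interpret group G using relT by (simp add: relative_T_def)
  have HG: "H \<subseteq> carrier G" and HI: "\<And>h. h \<in> H \<Longrightarrow> inv h \<in> H"
    using relT by (auto simp: relative_T_def dest: subgroup.subset subgroup.m_inv_closed)
  have "\<forall>l. \<exists>h\<in>H. real l < kdist K \<one> h"
    using unb by (meson linorder_not_le)
  \<comment> \<open>The negated claim as a sequence in \<open>H\<close> that leaves every
    ball.\<close>
  then obtain hs where hs: "\<And>l. hs l \<in> H" "\<And>l. real l < kdist K \<one> (hs l)" by metis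
  have hsG: "hs l \<in> carrier G" for l using hs HG by auto
  define d where "d = kdist K"
  have d_inv: "d (k \<otimes> g) (k \<otimes> h) = d g h" if "k \<in> carrier G" "g \<in> carrier G" "h \<in> carrier G" for k g h
    using inv that by (simp add: d_def)
  \<comment> \<open>Indices are moved to \<open>nat\<close>, where the Cholesky factor lives:
    \<open>e i = (n, g)\<close> names the vector of \<open>g\<close> in the \<open>n\<close>-th
    summand. \<open>idx\<close> selects one index for each pair; the choice is harmless since
    \<open>k\<close> sees an index only through \<open>e\<close>.\<close>
  define I where "I = (UNIV :: nat set) \<times> carrier G"
  have I: "countable I" "I \<noteq> {}" using cnt by (auto simp: I_def)
  define e where "e = from_nat_into I"
  have e_in: "snd (e i) \<in> carrier G" for i
    using from_nat_into[OF I(2), of i] by (auto simp: e_def I_def)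
  have "\<exists>i. e i = (n, g)" if "g \<in> carrier G" for n g
    using from_nat_into_surj[OF I(1), of "(n, g)"] that by (auto simp: e_def I_def)
  then have "\<forall>n g. \<exists>i. g \<in> carrier G \<longrightarrow> e i = (n, g)" by blast
  then obtain idx where idx: "\<And>n g. g \<in> carrier G \<Longrightarrow> e (idx n g) = (n, g)" by metis
  define k where "k i j = (if fst (e i) = fst (e j)
      then exp (- (1 / real (Suc (fst (e i))) * d (snd (e i)) (snd (e j)))) else 0)" for i j
  have k: "psd_on UNIV k"
  proof -
    define f where "f n i = (if fst (e i) = n then 1 else 0 :: real)" for n i
    define g where "g n i j = f n i * f n j * exp (- (1 / real (Suc n) * kdist K (snd (e i)) (snd (e j))))" for n i j
    have "psd_on UNIV (g n)" for n
      unfolding g_def kdist_def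
      by (intro psd_on_mult_nat psd_on_rank1 psd_on_gaussian_nat psd_on_comp[OF K]) (use e_in in auto)
    then have "psd_on UNIV (\<lambda>i j. \<Sum>n<N. g n i j)" for N by (intro psd_on_sum)
    moreover have "(\<lambda>N. \<Sum>n<N. g n i j) \<longlonglongrightarrow> k i j" for i j
    proof (rule tendsto_eventually)
      have "(\<Sum>n<N. g n i j) = k i j" if "N > fst (e i)" for N
      proof -
        have "(\<Sum>n<N. g n i j) = (\<Sum>n<N. if n = fst (e i) then k i j else 0)"
          by (intro sum.cong) (auto simp: g_def f_def k_def d_def)
        then show ?thesis using that by simp
      qed
      then show "\<forall>\<^sub>F N in sequentially. (\<Sum>n<N. g n i j) = k i j"
        unfolding eventually_sequentially by (metis Suc_le_lessD)
    qed
    ultimately show ?thesis by (rule psd_on_tendsto)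
  qed
  have kd: "d g g = 0" for g by (simp add: d_def kdist_def)
  have kii: "k i i = 1" for i by (simp add: k_def kd)
  define act where "act g i = idx (fst (e i)) (g \<otimes> snd (e i))" for g i
  have e_act: "e (act g i) = (fst (e i), g \<otimes> snd (e i))" if "g \<in> carrier G" for g i
    using that e_in idx by (simp add: act_def)
  have k_act: "k (act g i) (act g j) = k i j" if "g \<in> carrier G" for g i j
    using that by (simp add: k_def e_act d_inv e_in)
  have k_cong: "k i j = k i' j'" if "e i = e i'" "e j = e j'" for i j i' j'
    using that by (simp add: k_def)
  have k_shift: "k (act (inv g) i) (act h j) = k i (act (g \<otimes> h) j)"
    if "g \<in> carrier G" "h \<in> carrier G" for g h i j
  proof -
    have "k (act (inv g) i) (act h j) = k (act g (act (inv g) i)) (act g (act h j))"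
      using that by (simp add: k_act)
    also have "\<dots> = k i (act (g \<otimes> h) j)"
      using that e_in by (intro k_cong) (auto simp: e_act m_assoc[symmetric] intro: prod_eqI)
    finally show ?thesis .
  qed
  have e_act1: "e (act \<one> i) = e i" for i using e_in by (auto simp: e_act intro: prod_eqI)
  define L where "L = chol k"
  define B where "B = {b. L b b \<noteq> 0}"
  have "\<exists>xs. \<forall>j. lvec k xs j = (if j = b then 1 else 0)" if "b \<in> B" for b
    using chol_basis[OF k] that by (simp add: B_def L_def lvec_def)
  then obtain X where X: "\<And>b j. b \<in> B \<Longrightarrow> lvec k (X b) j = (if j = b then 1 else 0)" by metis
  have coord: "lform k (X b) ys = lvec k ys b" if "b \<in> B" for b ys
    by (subst lform_eq_sum_lvec[OF k, of "{b}"]) (use that in \<open>auto simp: X\<close>)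
  \<comment> \<open>The matrix of the translation by \<open>g\<close> in the orthonormal basis,
    whose elements are indexed by the nonzero pivots \<open>B\<close>.\<close>
  define A where "A g b c = lform k (X b) (lmap (act g) (X c))" for g b c
  have A_lvec: "A g b c = lvec k (lmap (act g) (X c)) b" if "b \<in> B" for g b c
    unfolding A_def by (rule coord[OF that])
  have A_tr: "A (inv g) b c = A g c b" if "g \<in> carrier G" for g b c
  proof -
    have "A (inv g) b c = lsum (\<lambda>i. lsum (\<lambda>j. k i (act (inv g) j)) (X c)) (X b)"
      by (simp add: A_def lform_def)
    also have "\<dots> = lsum (\<lambda>i. lsum (\<lambda>j. k j (act g i)) (X c)) (X b)"
    proof (intro lsum_cong)
      fix i j
      have "k i (act (inv g) j) = k (act (inv g) j) i" using k by (simp add: psd_on_def)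
      also have "\<dots> = k (act (inv g) j) (act \<one> i)" using e_act1 by (intro k_cong) auto
      also have "\<dots> = k j (act g i)" using k_shift[OF that, of \<one>] that by simp
      finally show "k i (act (inv g) j) = k j (act g i)" .
    qed
    also have "\<dots> = A g c b" by (subst lsum_swap) (simp add: A_def lform_def)
    finally show ?thesis .
  qed
  \<comment> \<open>Row \<open>b\<close> of \<open>g\<close> is the coordinate vector of the basis
    vector \<open>b\<close> translated by \<open>inv g\<close>, and coordinate vectors have finite
    support.\<close>
  have A_rows: "finite {c \<in> B. A g b c \<noteq> 0}" if "g \<in> carrier G" for g b
  proof -
    have "A g b c = lvec k (lmap (act (inv g)) (X b)) c" if "c \<in> B" for c
      using A_tr[OF \<open>g \<in> carrier G\<close>, of c b] A_lvec[OF that] by simp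
    then have "{c \<in> B. A g b c \<noteq> 0} \<subseteq> {c. lvec k (lmap (act (inv g)) (X b)) c \<noteq> 0}" by auto
    then show ?thesis using finite_lvec[OF k] finite_subset by blast
  qed
  have lvec_B: "b \<in> B" if "lvec k xs b \<noteq> 0" for xs b
    using that lvec_off_basis[OF k, of b xs] by (auto simp: B_def L_def)
  have A_mult: "A (g \<otimes> h) b c = (\<Sum>l | l \<in> B \<and> A g b l \<noteq> 0. A g b l * A h l c)"
    if g: "g \<in> carrier G" and h: "h \<in> carrier G" for g h b c
  proof -
    have 1: "A g b l = lvec k (lmap (act (inv g)) (X b)) l" if "l \<in> B" for l
      using A_tr[OF g, of l b] A_lvec[OF that] by simp
    have "A (g \<otimes> h) b c = lform k (lmap (act (inv g)) (X b)) (lmap (act h) (X c))"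
      using k_shift[OF g h] by (simp add: A_def lform_def)
    also have "\<dots> = (\<Sum>l | l \<in> B \<and> A g b l \<noteq> 0. lvec k (lmap (act (inv g)) (X b)) l * lvec k (lmap (act h) (X c)) l)"
      using A_rows[OF g, of b] lvec_B by (intro lform_eq_sum_lvec[OF k]) (auto simp: 1)
    also have "\<dots> = (\<Sum>l | l \<in> B \<and> A g b l \<noteq> 0. A g b l * A h l c)"
      by (intro sum.cong refl) (simp add: 1 A_lvec)
    finally show ?thesis .
  qed
  have A_one: "A \<one> b c = (if b = c then 1 else 0)" if "b \<in> B" "c \<in> B" for b c
  proof -
    have "A \<one> b c = lform k (X b) (X c)"
      unfolding A_def lform_def by (simp, intro lsum_cong k_cong) (simp_all add: e_act1)
    then show ?thesis using that by (simp add: coord X)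
  qed
  have "B \<noteq> {}"
  proof
    assume "B = {}"
    then have "lform k [(1, 0)] [(1, 0)] = 0"
      using lvec_B by (subst lform_eq_sum_lvec[OF k, of "{}"]) auto
    then show False by (simp add: kii)
  qed
  \<comment> \<open>A unitary representation has to act on all of \<open>l2space\<close> over
    \<open>'g \<times> nat\<close>. With infinite multiplicity, \<open>B \<times> nat\<close> is in
    bijection with \<open>nat\<close>, so an index is a triple of a spectator in \<open>'g\<close>,
    a multiplicity and a basis element; the matrices act on the last component only.\<close>
  then have "infinite (B \<times> (UNIV :: nat set))" by (simp add: finite_cartesian_product_iff)
  then have c: "bij_betw (from_nat_into (B \<times> (UNIV :: nat set))) UNIV (B \<times> UNIV)"
    by (intro bij_betw_from_nat_into) auto
  define c where "c = from_nat_into (B \<times> (UNIV :: nat set))"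
  define ci where "ci = the_inv_into UNIV c"
  have c_ci: "c (ci p) = p" if "p \<in> B \<times> UNIV" for p
    using c that unfolding ci_def c_def by (simp add: f_the_inv_into_f_bij_betw)
  have ci_c: "ci (c m) = m" for m
    using c unfolding ci_def c_def by (simp add: the_inv_into_f_f bij_betw_def)
  have c_B: "fst (c m) \<in> B" for m using c unfolding c_def bij_betw_def by (metis mem_Times_iff rangeI)
  define emb where "emb \<gamma> r b = (\<gamma> :: 'g, ci (b, r))" for \<gamma> r b
  define bb where "bb i = fst (c (snd i))" for i :: "'g \<times> nat"
  define rr where "rr i = snd (c (snd i))" for i :: "'g \<times> nat"
  have bb: "bb i \<in> B" for i by (simp add: bb_def c_B)
  have emb_id: "emb (fst i) (rr i) (bb i) = i" for i by (simp add: emb_def bb_def rr_def ci_c)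
  have emb_simps: "fst (emb \<gamma> r b) = \<gamma>" "b \<in> B \<Longrightarrow> bb (emb \<gamma> r b) = b" "b \<in> B \<Longrightarrow> rr (emb \<gamma> r b) = r" for \<gamma> r b
    by (simp_all add: emb_def bb_def rr_def c_ci)
  have emb_inj: "inj_on (emb \<gamma> r) B" for \<gamma> r
    by (rule inj_on_inverseI[where g = bb]) (simp add: emb_simps)
  define AA where "AA g i j = (if fst i = fst j \<and> rr i = rr j then A g (bb i) (bb j) else 0)" for g i j
  have AA_supp: "{j. AA g i j \<noteq> 0} = emb (fst i) (rr i) ` {b \<in> B. A g (bb i) b \<noteq> 0}" (is "?l = ?r") for g i
  proof (rule Set.set_eqI)
    fix j
    show "j \<in> ?l \<longleftrightarrow> j \<in> ?r"
    proof
      assume "j \<in> ?l"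
      then have "fst i = fst j" "rr i = rr j" "A g (bb i) (bb j) \<noteq> 0" by (auto simp: AA_def split: if_splits)
      then show "j \<in> ?r" using emb_id[of j] bb[of j] by (intro image_eqI[where x = "bb j"]) auto
    qed (auto simp: AA_def emb_simps)
  qed
  have AA_sum: "(\<Sum>j | AA g i j \<noteq> 0. f j) = (\<Sum>b | b \<in> B \<and> A g (bb i) b \<noteq> 0. f (emb (fst i) (rr i) b))"
    for f :: "'g \<times> nat \<Rightarrow> 'c::comm_monoid_add" and g i
    unfolding AA_supp by (subst sum.reindex) (auto intro: inj_on_subset[OF emb_inj])
  have AA_op: "mat_op (AA g) x i = (\<Sum>b | b \<in> B \<and> A g (bb i) b \<noteq> 0. of_real (A g (bb i) b) * x (emb (fst i) (rr i) b))" for g x i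
    unfolding mat_op_def AA_sum by (intro sum.cong refl) (simp add: AA_def emb_simps)
  have rep: "unitary_rep G (\<lambda>g. mat_op (AA g))"
  proof (rule unitary_rep_matrix)
    show "group G" by (rule is_group)
    show "finite {j. AA g i j \<noteq> 0}" if "g \<in> carrier G" for g i
      unfolding AA_supp using A_rows[OF that] by simp
    show "AA (inv g) i j = AA g j i" if "g \<in> carrier G" for g i j
      using A_tr[OF that] by (auto simp: AA_def)
    show "AA (g \<otimes> h) i j = (\<Sum>l | AA g i l \<noteq> 0. AA g i l * AA h l j)"
      if "g \<in> carrier G" "h \<in> carrier G" for g h i j
    proof -
      have "(\<Sum>l | AA g i l \<noteq> 0. AA g i l * AA h l j) = (\<Sum>b | b \<in> B \<and> A g (bb i) b \<noteq> 0.
          A g (bb i) b * (if fst i = fst j \<and> rr i = rr j then A h b (bb j) else 0))"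
        unfolding AA_sum by (intro sum.cong refl) (simp add: AA_def emb_simps)
      also have "\<dots> = (if fst i = fst j \<and> rr i = rr j then A (g \<otimes> h) (bb i) (bb j) else 0)"
      proof (cases "fst i = fst j \<and> rr i = rr j")
        case True
        then show ?thesis by (simp only: A_mult[OF that] if_True simp_thms)
      next
        case False
        then show ?thesis by (simp only: False if_False mult_zero_right sum.neutral_const)
      qed
      finally show ?thesis by (simp add: AA_def)
    qed
    show "AA \<one> i j = (if i = j then 1 else 0)" for i j
    proof -
      have "i = j \<longleftrightarrow> fst i = fst j \<and> rr i = rr j \<and> bb i = bb j"
        using emb_id[of i] emb_id[of j] by metis
      then show ?thesis by (simp add: AA_def A_one[OF bb bb])
    qed
  qed
  have A_L: "(\<Sum>b' | b' \<in> B \<and> A g b b' \<noteq> 0. A g b b' * lvec k ys b') = lvec k (lmap (act g) ys) b"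
    if g: "g \<in> carrier G" and b: "b \<in> B" for g b ys
  proof -
    have 1: "A g b l = lvec k (lmap (act (inv g)) (X b)) l" if "l \<in> B" for l
      using A_tr[OF g, of l b] A_lvec[OF that] by simp
    have "(\<Sum>b' | b' \<in> B \<and> A g b b' \<noteq> 0. A g b b' * lvec k ys b') =
        (\<Sum>b' | b' \<in> B \<and> A g b b' \<noteq> 0. lvec k (lmap (act (inv g)) (X b)) b' * lvec k ys b')"
      by (intro sum.cong refl) (simp add: 1)
    also have "\<dots> = lform k (lmap (act (inv g)) (X b)) ys"
      using A_rows[OF g, of b] lvec_B by (intro lform_eq_sum_lvec[OF k, symmetric]) (auto simp: 1)
    also have "\<dots> = lform k (X b) (lmap (act g) ys)"
    proof -
      have "k (act (inv g) i) j = k i (act g j)" for i j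
      proof -
        have "k (act (inv g) i) j = k (act (inv g) i) (act \<one> j)" using e_act1 by (intro k_cong) auto
        then show ?thesis using k_shift[OF g, of \<one>] g by simp
      qed
      then have "k (act (inv g) i) = (\<lambda>j. k i (act g j))" for i by (intro ext)
      then show ?thesis by (simp add: lform_def)
    qed
    finally show ?thesis by (simp add: coord[OF b])
  qed
  \<comment> \<open>One copy, at an arbitrary spectator and multiplicity 0, is enough to hold the
    almost invariant vectors.\<close>
  obtain \<gamma>0 :: 'g where True by blast
  define V where "V xs j = complex_of_real (if fst j = \<gamma>0 \<and> rr j = 0 then lvec k xs (bb j) else 0)" for xs j
  have V_norm: "V xs \<in> l2space" "(l2norm (V xs))\<^sup>2 = lform k xs xs" for xs
  proof -
    define T where "T = {b. lvec k xs b \<noteq> 0}"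
    have T: "finite T" "T \<subseteq> B" using finite_lvec[OF k] lvec_B by (auto simp: T_def)
    have 0: "V xs i = 0" if "i \<notin> emb \<gamma>0 0 ` T" for i
    proof (rule ccontr)
      assume "V xs i \<noteq> 0"
      then have "fst i = \<gamma>0" "rr i = 0" "bb i \<in> T" by (auto simp: V_def T_def split: if_splits)
      then have "i \<in> emb \<gamma>0 0 ` T" using emb_id[of i] by (intro image_eqI[where x = "bb i"]) auto
      then show False using that by simp
    qed
    have fin: "finite (emb \<gamma>0 0 ` T)" using T by simp
    note N = l2norm_sq_eq_sum[OF fin, of "V xs", OF 0]
    show "V xs \<in> l2space" by (rule N(1))
    have "(l2norm (V xs))\<^sup>2 = (\<Sum>i\<in>emb \<gamma>0 0 ` T. (cmod (V xs i))\<^sup>2)" by (rule N(2))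
    also have "\<dots> = (\<Sum>b\<in>T. (cmod (V xs (emb \<gamma>0 0 b)))\<^sup>2)"
      by (subst sum.reindex) (use T in \<open>auto intro: inj_on_subset[OF emb_inj]\<close>)
    also have "\<dots> = (\<Sum>b\<in>T. lvec k xs b * lvec k xs b)"
      by (intro sum.cong refl) (use T in \<open>auto simp: V_def emb_simps power2_eq_square abs_mult_self_eq\<close>)
    also have "\<dots> = lform k xs xs"
      by (rule lform_eq_sum_lvec[OF k T(1), symmetric]) (simp add: T_def)
    finally show "(l2norm (V xs))\<^sup>2 = lform k xs xs" .
  qed
  have V_act: "mat_op (AA g) (V xs) = V (lmap (act g) xs)" if g: "g \<in> carrier G" for g xs
  proof
    fix i
    have "mat_op (AA g) (V xs) i =
        of_real (\<Sum>b | b \<in> B \<and> A g (bb i) b \<noteq> 0. A g (bb i) b * (if fst i = \<gamma>0 \<and> rr i = 0 then lvec k xs b else 0))"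
      unfolding AA_op of_real_sum by (intro sum.cong refl) (simp add: V_def emb_simps)
    also have "\<dots> = V (lmap (act g) xs) i"
    proof (cases "fst i = \<gamma>0 \<and> rr i = 0")
      case True
      then show ?thesis unfolding V_def by (simp only: A_L[OF g bb] if_True simp_thms)
    next
      case False
      then show ?thesis unfolding V_def by (simp only: False if_False mult_zero_right sum.neutral_const)
    qed
    finally show "mat_op (AA g) (V xs) i = V (lmap (act g) xs) i" .
  qed
  have almost: "almost_invariant_vectors G (\<lambda>g. mat_op (AA g))"
    unfolding almost_invariant_vectors_def
  proof (intro allI impI)
    fix F and \<epsilon> :: real assume F: "finite F" "F \<subseteq> carrier G" "\<epsilon> > 0"
    have "\<forall>\<^sub>F n in sequentially. 2 - 2 * exp (- (1 / real (Suc n) * d g \<one>)) < \<epsilon>\<^sup>2" for g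
    proof -
      have "(\<lambda>n. 2 - 2 * exp (- (1 / real (Suc n) * d g \<one>))) \<longlonglongrightarrow> 2 - 2 * exp (- (0 * d g \<one>))"
        by (intro tendsto_intros lim_inverse_n'[THEN LIMSEQ_Suc])
      then show ?thesis using F(3) by (intro order_tendstoD(2)) auto
    qed
    then have "\<forall>\<^sub>F n in sequentially. \<forall>g\<in>F. 2 - 2 * exp (- (1 / real (Suc n) * d g \<one>)) < \<epsilon>\<^sup>2"
      using F(1) by (intro eventually_ball_finite) auto
    then obtain n where n: "\<And>g. g \<in> F \<Longrightarrow> 2 - 2 * exp (- (1 / real (Suc n) * d g \<one>)) < \<epsilon>\<^sup>2"
      by (auto simp: eventually_sequentially)
    \<comment> \<open>The unit vector of the identity in the \<open>n\<close>-th summand. The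
      element \<open>g\<close> moves it by the squared distance
      \<open>2 - 2 * exp (- d g \<one> / Suc n)\<close>, which is small on all of \<open>F\<close>
      for large \<open>n\<close>.\<close>
    define i where "i = idx n \<one>"
    have ei: "e i = (n, \<one>)" by (simp add: i_def idx)
    show "\<exists>\<xi>\<in>l2space. l2norm \<xi> = 1 \<and> (\<forall>g\<in>F. l2norm (\<lambda>i. mat_op (AA g) \<xi> i - \<xi> i) < \<epsilon>)"
    proof (intro bexI conjI ballI)
      have "(l2norm (V [(1, i)]))\<^sup>2 = 1" by (simp add: V_norm kii)
      then show "l2norm (V [(1, i)]) = 1"
        by (simp add: power2_eq_1_iff) (smt (verit) infsum_nonneg l2norm_def real_sqrt_ge_zero zero_le_power2)
      show "V [(1, i)] \<in> l2space" by (rule V_norm)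
      fix g assume "g \<in> F"
      then have g: "g \<in> carrier G" using F by auto
      define ys where "ys = ldiff [(1, act g i)] [(1, i)]"
      have "(\<lambda>j. mat_op (AA g) (V [(1, i)]) j - V [(1, i)] j) = V ys"
        unfolding V_act[OF g] by (auto simp: fun_eq_iff V_def lvec_def ys_def lmap_def)
      moreover have "(l2norm (V ys))\<^sup>2 = 2 - 2 * k (act g i) i"
        unfolding V_norm ys_def by (subst lform_ldiff_self[OF k]) (auto simp: kii)
      moreover have "k (act g i) i = exp (- (1 / real (Suc n) * d g \<one>))"
        using g by (simp add: k_def e_act ei)
      ultimately show "l2norm (\<lambda>j. mat_op (AA g) (V [(1, i)]) j - V [(1, i)] j) < \<epsilon>"
        using n[OF \<open>g \<in> F\<close>] F(3) by (intro power2_less_imp_less[of _ \<epsilon>]) auto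
    qed
  qed
  obtain \<zeta> where \<zeta>: "\<zeta> \<in> l2space" "\<zeta> \<noteq> (\<lambda>i. 0)" "\<And>h. h \<in> H \<Longrightarrow> mat_op (AA h) \<zeta> = \<zeta>"
    using relT rep almost unfolding relative_T_def by blast
  obtain \<iota> where \<iota>: "\<zeta> \<iota> \<noteq> 0" using \<zeta>(2) by (meson ext)
  \<comment> \<open>The matrices are real, so real and imaginary part of the invariant vector are
    invariant separately; one of them is nonzero at \<open>\<iota>\<close>.\<close>
  define p where "p = (if Re (\<zeta> \<iota>) \<noteq> 0 then Re else Im)"
  have p: "p (\<zeta> \<iota>) \<noteq> 0" using \<iota> by (auto simp: p_def complex_eq_iff)
  have p_lin: "p (\<Sum>b\<in>S. of_real (f b) * x b) = (\<Sum>b\<in>S. f b * p (x b))" for S f and x :: "nat \<Rightarrow> complex"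
    by (simp add: p_def)
  have p_le: "(p x)\<^sup>2 \<le> (cmod x)\<^sup>2" for x
    by (simp add: p_def cmod_power2)
  define z where "z b = p (\<zeta> (emb (fst \<iota>) (rr \<iota>) b))" for b
  have z0: "z (bb \<iota>) \<noteq> 0" using p by (simp add: z_def emb_id)
  have z_inv: "(\<Sum>b' | b' \<in> B \<and> A h b b' \<noteq> 0. A h b b' * z b') = z b" if "h \<in> H" "b \<in> B" for h b
  proof -
    have "p (mat_op (AA h) \<zeta> (emb (fst \<iota>) (rr \<iota>) b)) = (\<Sum>b' | b' \<in> B \<and> A h b b' \<noteq> 0. A h b b' * z b')"
      unfolding AA_op p_lin using that by (simp add: emb_simps z_def)
    then show ?thesis using \<zeta>(3)[OF that(1)] by (simp add: z_def)
  qed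
  \<comment> \<open>The pairing of a vector with the invariant \<open>z\<close>. It is a finite sum
    because the vector has finitely many coordinates.\<close>
  define S where "S ys = (\<Sum>b | lvec k ys b \<noteq> 0. lvec k ys b * z b)" for ys
  have S_eq: "S ys = (\<Sum>b\<in>T. lvec k ys b * z b)" if "finite T" "{b. lvec k ys b \<noteq> 0} \<subseteq> T" for ys T
    unfolding S_def by (rule sum.mono_neutral_left) (use that in auto)
  have S_inv: "S (lmap (act h) ys) = S ys" if h: "h \<in> H" for h ys
  proof -
    have hG: "h \<in> carrier G" using h HG by auto
    define W where "W = lmap (act h) ys"
    define T1 where "T1 = {b. lvec k W b \<noteq> 0}"
    define U where "U = (\<Union>b\<in>T1. {b' \<in> B. A h b b' \<noteq> 0}) \<union> {b. lvec k ys b \<noteq> 0}"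
    have T1: "finite T1" "T1 \<subseteq> B" using finite_lvec[OF k] lvec_B by (auto simp: T1_def)
    have U: "finite U" "U \<subseteq> B"
      using T1 A_rows[OF hG] finite_lvec[OF k] lvec_B by (auto simp: U_def)
    have z_U: "z b = (\<Sum>b'\<in>U. A h b b' * z b')" if "b \<in> T1" for b
      using z_inv[OF h, of b] that T1
      by (subst z_inv[OF h, symmetric]) (use U in \<open>auto simp: U_def intro!: sum.mono_neutral_left\<close>)
    have inner: "(\<Sum>b\<in>T1. lvec k W b * A h b b') = lvec k ys b'" if "b' \<in> U" for b'
    proof -
      have b': "b' \<in> B" using that U by auto
      have "(\<Sum>b\<in>T1. lvec k W b * A h b b') = (\<Sum>b\<in>T1. lvec k W b * lvec k (lmap (act h) (X b')) b)"
        using T1 by (intro sum.cong refl) (auto simp: A_lvec)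
      also have "\<dots> = lform k W (lmap (act h) (X b'))"
        using T1 by (intro lform_eq_sum_lvec[OF k, symmetric]) (auto simp: T1_def)
      also have "\<dots> = lform k ys (X b')"
        using k_act[OF hG] by (simp add: W_def lform_def)
      also have "\<dots> = lvec k ys b'"
        using lform_sym[OF k, of ys "X b'"] coord[OF b'] by simp
      finally show ?thesis .
    qed
    have "S W = (\<Sum>b\<in>T1. \<Sum>b'\<in>U. lvec k W b * A h b b' * z b')"
      unfolding S_def T1_def[symmetric]
      by (intro sum.cong refl) (subst z_U, auto simp: sum_distrib_left mult_ac)
    also have "\<dots> = (\<Sum>b'\<in>U. (\<Sum>b\<in>T1. lvec k W b * A h b b') * z b')"
      by (subst sum.swap) (simp add: sum_distrib_right)
    also have "\<dots> = (\<Sum>b'\<in>U. lvec k ys b' * z b')"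
      by (intro sum.cong refl) (simp add: inner)
    also have "\<dots> = S ys"
      by (rule S_eq[symmetric, OF U(1)]) (auto simp: U_def)
    finally show ?thesis by (simp add: W_def)
  qed
  have tail: "\<exists>F. finite F \<and> (\<forall>D. finite D \<longrightarrow> D \<subseteq> B - F \<longrightarrow> (\<Sum>b\<in>D. (z b)\<^sup>2) \<le> \<epsilon>)" if "\<epsilon> > 0" for \<epsilon>
  proof -
    define f where "f = (\<lambda>i. (cmod (\<zeta> i))\<^sup>2)"
    have summ: "f summable_on UNIV" using \<zeta>(1) by (simp add: l2space_def f_def)
    have "(sum f \<longlongrightarrow> infsum f UNIV) (finite_subsets_at_top UNIV)"
      using has_sum_infsum[OF summ] by (simp add: has_sum_def)
    then have "\<forall>\<^sub>F F in finite_subsets_at_top UNIV. dist (sum f F) (infsum f UNIV) < \<epsilon>"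
      using that by (rule tendstoD)
    then obtain F0 where F0: "finite F0" "dist (sum f F0) (infsum f UNIV) < \<epsilon>"
      by (auto simp: eventually_finite_subsets_at_top)
    define F where "F = {b \<in> B. emb (fst \<iota>) (rr \<iota>) b \<in> F0}"
    have "finite F"
      using finite_vimage_IntI[OF F0(1) emb_inj, of "fst \<iota>" "rr \<iota>"]
      by (rule rev_finite_subset) (auto simp: F_def)
    moreover have "(\<Sum>b\<in>D. (z b)\<^sup>2) \<le> \<epsilon>" if D: "finite D" "D \<subseteq> B - F" for D
    proof -
      define D' where "D' = emb (fst \<iota>) (rr \<iota>) ` D"
      have D': "finite D'" "D' \<inter> F0 = {}" using D by (auto simp: D'_def F_def)
      have "(\<Sum>b\<in>D. (z b)\<^sup>2) \<le> (\<Sum>b\<in>D. f (emb (fst \<iota>) (rr \<iota>) b))"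
        by (intro sum_mono) (simp add: z_def f_def p_le)
      also have "\<dots> = sum f D'"
        unfolding D'_def using D by (subst sum.reindex) (auto intro: inj_on_subset[OF emb_inj])
      also have "\<dots> = sum f (D' \<union> F0) - sum f F0"
        using D' F0(1) by (subst sum.union_disjoint) auto
      also have "sum f (D' \<union> F0) \<le> infsum f UNIV"
        using D' F0(1) by (intro finite_sum_le_infsum[OF summ]) (auto simp: f_def)
      finally show ?thesis using F0(2) by (simp add: dist_real_def)
    qed
    ultimately show ?thesis by blast
  qed
  \<comment> \<open>\<open>d\<close> is a squared distance; its root obeys the triangle inequality,
    and left invariance turns the distance from \<open>hs l \<otimes> g'\<close> to
    \<open>hs l\<close> into the constant one from \<open>g'\<close> to the identity.\<close>
  have d_lim: "filterlim (\<lambda>l. d g (hs l \<otimes> g')) at_top sequentially"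
    if g: "g \<in> carrier G" and g': "g' \<in> carrier G" for g g'
  proof -
    define C where "C = sqrt (d \<one> g) + sqrt (d g' \<one>)"
    have ge: "(sqrt (real l) - C)\<^sup>2 \<le> d g (hs l \<otimes> g')" if l: "C\<^sup>2 \<le> real l" for l
    proof -
      have hl: "hs l \<otimes> g' \<in> carrier G" using hsG g' by simp
      have "sqrt (real l) \<le> sqrt (d \<one> (hs l))" using hs(2)[of l] by (simp add: d_def)
      also have "\<dots> \<le> sqrt (d \<one> g) + sqrt (d g (hs l))"
        unfolding d_def by (rule sqrt_kdist_triangle[OF K]) (use g hsG in auto)
      also have "sqrt (d g (hs l)) \<le> sqrt (d g (hs l \<otimes> g')) + sqrt (d (hs l \<otimes> g') (hs l))"
        unfolding d_def by (rule sqrt_kdist_triangle[OF K]) (use g hl hsG in auto)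
      also have "d (hs l \<otimes> g') (hs l) = d g' \<one>"
        using d_inv[OF hsG g', of \<one> l] hsG by simp
      finally have "sqrt (real l) - C \<le> sqrt (d g (hs l \<otimes> g'))" by (simp add: C_def)
      moreover have "C \<le> sqrt (real l)" using l by (rule real_le_rsqrt)
      ultimately have "(sqrt (real l) - C)\<^sup>2 \<le> (sqrt (d g (hs l \<otimes> g')))\<^sup>2"
        by (intro power_mono) auto
      then show ?thesis using kdist_nonneg[OF K g hl] by (simp add: d_def)
    qed
    have "filterlim (\<lambda>l. (sqrt (real l) - C)\<^sup>2) at_top sequentially"
      by real_asymp
    then show ?thesis
    proof (rule filterlim_at_top_mono)
      show "\<forall>\<^sub>F l in sequentially. (sqrt (real l) - C)\<^sup>2 \<le> d g (hs l \<otimes> g')"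
        using eventually_ge_at_top[of "nat \<lceil>C\<^sup>2\<rceil>"] by eventually_elim (intro ge, linarith)
    qed
  qed
  have k_lim: "(\<lambda>l. k j (act (hs l) i)) \<longlonglongrightarrow> 0" for i j
  proof (cases "fst (e i) = fst (e j)")
    case True
    have "filterlim (\<lambda>l. - (1 / real (Suc (fst (e j))) * d (snd (e j)) (hs l \<otimes> snd (e i)))) at_bot sequentially"
      unfolding filterlim_uminus_at_top[symmetric]
      by (intro filterlim_tendsto_pos_mult_at_top[OF tendsto_const] d_lim e_in) auto
    then have "(\<lambda>l. exp (- (1 / real (Suc (fst (e j))) * d (snd (e j)) (hs l \<otimes> snd (e i))))) \<longlonglongrightarrow> 0"
      by (rule filterlim_compose[OF exp_at_bot])
    then show ?thesis using True by (simp add: k_def e_act hsG)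
  next
    case False
    then show ?thesis by (simp add: k_def e_act hsG)
  qed
  \<comment> \<open>Invariance allows the point \<open>i\<close> to be replaced by its translates
    under \<open>hs l\<close>. These tend weakly to zero: on a finite set \<open>F\<close> of
    coordinates their contribution vanishes in the limit, and outside \<open>F\<close>
    Cauchy-Schwarz leaves at most the tail of \<open>z\<close>.\<close>
  have S_0: "S [(1, i)] = 0" for i
  proof -
    have "\<bar>S [(1, i)]\<bar> \<le> \<epsilon>" if \<epsilon>: "\<epsilon> > 0" for \<epsilon>
    proof -
      obtain F where F: "finite F" "\<And>D. finite D \<Longrightarrow> D \<subseteq> B - F \<Longrightarrow> (\<Sum>b\<in>D. (z b)\<^sup>2) \<le> \<epsilon>\<^sup>2"
        using tail[of "\<epsilon>\<^sup>2"] \<epsilon> by auto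
      define y where "y l = [(1 :: real, act (hs l) i)]" for l
      define P where "P l = (\<Sum>b\<in>F \<inter> B. lvec k (y l) b * z b)" for l
      have le: "\<bar>S [(1, i)]\<bar> \<le> \<bar>P l\<bar> + \<epsilon>" for l
      proof -
        define T where "T = {b. lvec k (y l) b \<noteq> 0}"
        have T: "finite T" "T \<subseteq> B" using finite_lvec[OF k] lvec_B by (auto simp: T_def)
        have "S [(1, i)] = S (y l)" using S_inv[OF hs(1)[of l], of "[(1, i)]"] by (simp add: y_def lmap_def)
        also have "\<dots> = (\<Sum>b\<in>(F \<inter> B) \<union> (T - F). lvec k (y l) b * z b)"
          by (rule S_eq) (use T F lvec_B in \<open>auto simp: T_def\<close>)
        also have "\<dots> = P l + (\<Sum>b\<in>T - F. lvec k (y l) b * z b)"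
          unfolding P_def by (rule sum.union_disjoint) (use T F in auto)
        finally have eq: "S [(1, i)] = P l + (\<Sum>b\<in>T - F. lvec k (y l) b * z b)" .
        have "(\<Sum>b\<in>T - F. lvec k (y l) b * z b)\<^sup>2 \<le> (\<Sum>b\<in>T - F. (lvec k (y l) b)\<^sup>2) * (\<Sum>b\<in>T - F. (z b)\<^sup>2)"
          by (rule Cauchy_Schwarz_ineq_sum)
        also have "\<dots> \<le> 1 * \<epsilon>\<^sup>2"
        proof (intro mult_mono)
          have "(\<Sum>b\<in>T - F. (lvec k (y l) b)\<^sup>2) \<le> (\<Sum>b\<in>T. (lvec k (y l) b)\<^sup>2)"
            by (rule sum_mono2) (use T in auto)
          also have "\<dots> = lform k (y l) (y l)"
            unfolding power2_eq_square by (rule lform_eq_sum_lvec[OF k T(1), symmetric]) (simp add: T_def)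
          finally show "(\<Sum>b\<in>T - F. (lvec k (y l) b)\<^sup>2) \<le> 1" by (simp add: y_def kii)
          show "(\<Sum>b\<in>T - F. (z b)\<^sup>2) \<le> \<epsilon>\<^sup>2" by (rule F(2)) (use T in auto)
        qed (auto intro: sum_nonneg)
        finally have "\<bar>\<Sum>b\<in>T - F. lvec k (y l) b * z b\<bar> \<le> \<epsilon>"
          using \<epsilon> abs_le_square_iff[of "\<Sum>b\<in>T - F. lvec k (y l) b * z b" \<epsilon>] by simp
        then show ?thesis using eq by linarith
      qed
      have "(\<lambda>l. lvec k (y l) b) \<longlonglongrightarrow> 0" if "b \<in> B" for b
      proof -
        have "(\<lambda>l. lsum (\<lambda>j. k j (act (hs l) i)) (X b)) \<longlonglongrightarrow> lsum (\<lambda>j. 0) (X b)"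
          by (intro lsum_tendsto k_lim)
        moreover have "lvec k (y l) b = lsum (\<lambda>j. k j (act (hs l) i)) (X b)" for l
          using coord[OF that, of "y l"] by (simp add: lform_def y_def)
        ultimately show ?thesis by simp
      qed
      then have "P \<longlonglongrightarrow> (\<Sum>b\<in>F \<inter> B. 0 * z b)"
        unfolding P_def by (intro tendsto_intros) auto
      then have "(\<lambda>l. \<bar>P l\<bar> + \<epsilon>) \<longlonglongrightarrow> \<bar>0\<bar> + \<epsilon>"
        by (intro tendsto_intros) simp
      then show ?thesis using le by (intro LIMSEQ_le_const) auto
    qed
    then show ?thesis using field_le_epsilon[of "\<bar>S [(1, i)]\<bar>" 0] by simp
  qed
  define b where "b = bb \<iota>"
  have bB: "b \<in> B" by (simp add: b_def bb)
  define T where "T = insert b (\<Union>i\<in>snd ` set (X b). {b. lvec k [(1, i)] b \<noteq> 0})"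
  have fT: "finite T" using finite_lvec[OF k] by (auto simp: T_def)
  \<comment> \<open>The basis vector \<open>b\<close> is the combination \<open>X b\<close> of
    points. Each point pairs to zero with \<open>z\<close>, whereas the basis vector pairs to
    \<open>z b\<close>.\<close>
  have "lsum (\<lambda>i. S [(1, i)]) (X b) = lsum (\<lambda>i. \<Sum>b'\<in>T. lvec k [(1, i)] b' * z b') (X b)"
    by (intro lsum_cong S_eq fT) (auto simp: T_def)
  also have "\<dots> = (\<Sum>b'\<in>T. lvec k (X b) b' * z b')"
    by (simp add: lsum_sum lsum_mult_right lvec_def)
  also have "\<dots> = (\<Sum>b'\<in>T. if b' = b then z b else 0)"
    by (intro sum.cong refl) (simp add: X[OF bB])
  also have "\<dots> = z b" using fT by (simp add: T_def)
  finally have "z b = 0" by (simp add: S_0)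
  then show False using z0 by (simp add: b_def)
qed

section \<open>Finite generation of groups with property (T)\<close>

lemma unitary_rep_permutation:
  fixes \<sigma> :: "'g \<Rightarrow> 'g \<times> nat \<Rightarrow> 'g \<times> nat"
  assumes G: "group G"
    and mult: "\<And>g h i. g \<in> carrier G \<Longrightarrow> h \<in> carrier G \<Longrightarrow> \<sigma> (g \<otimes>\<^bsub>G\<^esub> h) i = \<sigma> g (\<sigma> h i)"
    and one: "\<And>i. \<sigma> \<one>\<^bsub>G\<^esub> i = i"
  defines "A \<equiv> \<lambda>g i j. if i = \<sigma> g j then 1 else 0 :: real"
  shows "unitary_rep G (\<lambda>g. mat_op (A g))"
    and "\<And>g x i. g \<in> carrier G \<Longrightarrow> mat_op (A g) x (\<sigma> g i) = x i"
proof -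
  interpret group G by (rule G)
  have inv1: "\<sigma> (inv\<^bsub>G\<^esub> g) (\<sigma> g i) = i" and inv2: "\<sigma> g (\<sigma> (inv\<^bsub>G\<^esub> g) i) = i"
    if "g \<in> carrier G" for g i
    using mult[of "inv\<^bsub>G\<^esub> g" g i] mult[of g "inv\<^bsub>G\<^esub> g" i] that one by auto
  have eqv: "i = \<sigma> g j \<longleftrightarrow> j = \<sigma> (inv\<^bsub>G\<^esub> g) i" if "g \<in> carrier G" for g i j
    using inv1[OF that, of j] inv2[OF that, of i] by auto
  have supp: "{j. A g i j \<noteq> 0} = {\<sigma> (inv\<^bsub>G\<^esub> g) i}" if "g \<in> carrier G" for g i
    unfolding A_def eqv[OF that] by simp
  show "unitary_rep G (\<lambda>g. mat_op (A g))"
  proof (rule unitary_rep_matrix[OF G])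
    show "A (inv\<^bsub>G\<^esub> g) i j = A g j i" if "g \<in> carrier G" for g i j
      unfolding A_def eqv[OF that] by simp
    show "A (g \<otimes>\<^bsub>G\<^esub> h) i j = (\<Sum>l | A g i l \<noteq> 0. A g i l * A h l j)"
      if "g \<in> carrier G" "h \<in> carrier G" for g h i j
    proof -
      have "i = \<sigma> g (\<sigma> h j) \<longleftrightarrow> \<sigma> (inv\<^bsub>G\<^esub> g) i = \<sigma> h j"
        using eqv[OF that(1), of i "\<sigma> h j"] by auto
      then show ?thesis
        unfolding supp[OF that(1)] by (simp add: A_def mult[OF that] inv2[OF that(1)])
    qed
    show "finite {j. A g i j \<noteq> 0}" if "g \<in> carrier G" for g i
      unfolding supp[OF that] by simp
  qed (simp add: A_def one)
  show "mat_op (A g) x (\<sigma> g i) = x i" if "g \<in> carrier G" for g x i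
    unfolding mat_op_def supp[OF that] inv1[OF that] by (simp add: A_def)
qed

unbundle cardinal_syntax

text \<open>Countability of the group is not yet known when this is applied; a representation
  indexed by finite lists of group elements must still fit into
  \<open>'g \<times> nat\<close>.\<close>

lemma card_of_lists_ordLeq:
  assumes "infinite (UNIV :: 'g set)"
  shows "|UNIV :: 'g list set| \<le>o |UNIV :: 'g set|"
proof -
  have len: "|{l :: 'g list. length l = n}| \<le>o |UNIV :: 'g set|" for n
  proof (induction n)
    case 0
    have "{l :: 'g list. length l = 0} = {[]}" by auto
    then show ?case using assms by (simp add: card_of_singl_ordLeq)
  next
    case (Suc n)
    have "{l :: 'g list. length l = Suc n} = (\<lambda>(a, l). a # l) ` (UNIV \<times> {l. length l = n})"
      by (auto simp: length_Suc_conv image_iff)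
    moreover have "|(\<lambda>(a, l). a # l) ` ((UNIV :: 'g set) \<times> {l. length l = n})| \<le>o |(UNIV :: 'g set) \<times> {l :: 'g list. length l = n}|"
      by (rule card_of_image)
    moreover have "|(UNIV :: 'g set) \<times> {l :: 'g list. length l = n}| \<le>o |UNIV :: 'g set|"
      using assms Suc by (intro card_of_Sigma_ordLeq_infinite) (auto intro: card_of_mono1)
    ultimately show ?case by (metis ordLeq_transitive)
  qed
  have "(UNIV :: 'g list set) = (\<Union>n. {l. length l = n})" by auto
  moreover have "|\<Union>n. {l :: 'g list. length l = n}| \<le>o |UNIV :: 'g set|"
    using assms len by (intro card_of_UNION_ordLeq_infinite) (auto simp: infinite_iff_card_of_nat)
  ultimately show ?thesis by simp
qed

text \<open>Kazhdan's argument. In the sum of the spaces of square summable functions on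
  \<open>G / Sub l\<close> over all finite lists \<open>l\<close>, the unit mass at the trivial
  coset of \<open>Sub l\<close> is fixed by \<open>set l\<close>, so there are almost invariant
  vectors. An invariant vector is constant on orbits, and a nonzero one needs a finite orbit; that
  would be a finitely generated subgroup of finite index, and \<open>G\<close> would be finitely
  generated itself.\<close>

lemma property_T_finitely_generated:
  fixes G (structure)
  assumes T: "property_T G"
  shows "\<exists>F. finite F \<and> F \<subseteq> carrier G \<and> generate G F = carrier G"
proof (rule ccontr)
  assume nfg: "\<not> ?thesis"
  interpret group G using T by (simp add: property_T_def relative_T_def)
  have inf: "infinite (carrier G)" using nfg by (metis generate_incl generate.incl subsetI subset_antisym order_refl)
  have cancel: "g \<otimes> (inv g \<otimes> h) = h" "inv g \<otimes> (g \<otimes> h) = h"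
    if "g \<in> carrier G" "h \<in> carrier G" for g h
    using that by (simp_all add: m_assoc[symmetric])
  define LL where "LL = lists (carrier G)"
  have LL: "l \<in> LL \<longleftrightarrow> set l \<subseteq> carrier G" for l by (auto simp: LL_def)
  define Sub where "Sub l = generate G (set l)" for l
  have Sub: "subgroup (Sub l) G" if "l \<in> LL" for l
    unfolding Sub_def using that LL by (intro generate_is_subgroup) auto
  \<comment> \<open>Cosets are modelled by chosen representatives, the fixed points of
    \<open>rp l\<close>, so that coset spaces consist of elements of \<open>'g\<close>.\<close>
  define rp where "rp l g = (SOME x. x \<in> carrier G \<and> inv x \<otimes> g \<in> Sub l)" for l g
  have rp: "rp l g \<in> carrier G" "inv (rp l g) \<otimes> g \<in> Sub l" if "l \<in> LL" "g \<in> carrier G" for l g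
  proof -
    have "g \<in> carrier G \<and> inv g \<otimes> g \<in> Sub l" using that Sub[OF that(1)] by (simp add: subgroup.one_closed)
    then have "rp l g \<in> carrier G \<and> inv (rp l g) \<otimes> g \<in> Sub l" unfolding rp_def by (rule someI)
    then show "rp l g \<in> carrier G" "inv (rp l g) \<otimes> g \<in> Sub l" by auto
  qed
  have rp_eq: "rp l g = rp l h" if l: "l \<in> LL" and gh: "g \<in> carrier G" "h \<in> carrier G" "inv g \<otimes> h \<in> Sub l" for l g h
  proof -
    interpret S: subgroup "Sub l" G by (rule Sub[OF l])
    have "inv x \<otimes> g \<in> Sub l \<longleftrightarrow> inv x \<otimes> h \<in> Sub l" if x: "x \<in> carrier G" for x
    proof
      assume "inv x \<otimes> g \<in> Sub l"
      then have "(inv x \<otimes> g) \<otimes> (inv g \<otimes> h) \<in> Sub l" using gh by blast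
      then show "inv x \<otimes> h \<in> Sub l" using gh x by (simp add: m_assoc cancel)
    next
      assume "inv x \<otimes> h \<in> Sub l"
      then have "(inv x \<otimes> h) \<otimes> inv (inv g \<otimes> h) \<in> Sub l" using gh by blast
      moreover have "(inv x \<otimes> h) \<otimes> inv (inv g \<otimes> h) = inv x \<otimes> g"
        using gh x by (simp add: inv_mult_group m_assoc cancel)
      ultimately show "inv x \<otimes> g \<in> Sub l" by simp
    qed
    then show ?thesis unfolding rp_def by (metis (no_types, lifting))
  qed
  have rp_mult: "rp l (g \<otimes> rp l h) = rp l (g \<otimes> h)"
    if "l \<in> LL" "g \<in> carrier G" "h \<in> carrier G" for l g h
  proof (rule rp_eq)
    have "inv (g \<otimes> rp l h) \<otimes> (g \<otimes> h) = inv (rp l h) \<otimes> h"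
      using that rp(1)[of l h] by (simp add: inv_mult_group m_assoc cancel)
    then show "inv (g \<otimes> rp l h) \<otimes> (g \<otimes> h) \<in> Sub l" using rp(2)[of l h] that by simp
  qed (use that rp in auto)
  define J where "J = {(l, c). l \<in> LL \<and> c \<in> carrier G \<and> rp l c = c}"
  have "J \<noteq> {}" using rp[of "[]" \<one>] rp_mult[of "[]" \<one> \<one>] LL[of "[]"] by (force simp: J_def)
  have infg: "infinite (UNIV :: 'a set)" using inf by (metis finite_subset subset_UNIV)
  then have infgn: "infinite (UNIV :: ('a \<times> nat) set)" by (simp add: finite_prod)
  have g_le: "|UNIV :: 'a set| \<le>o |UNIV :: ('a \<times> nat) set|"
    by (rule card_of_ordLeqI[where f = "\<lambda>a. (a, 0)"]) (auto simp: inj_on_def)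
  have "|J| \<le>o |(UNIV :: 'a list set) \<times> (UNIV :: 'a set)|"
    by (rule card_of_mono1) auto
  moreover have "|(UNIV :: 'a list set) \<times> (UNIV :: 'a set)| \<le>o |UNIV :: ('a \<times> nat) set|"
    using infgn card_of_lists_ordLeq[OF infg] g_le
    by (intro card_of_Sigma_ordLeq_infinite) (auto intro: ordLeq_transitive)
  ultimately have "|J| \<le>o |UNIV :: ('a \<times> nat) set|" by (rule ordLeq_transitive)
  \<comment> \<open>Multiplicity again serves to fill the whole index set: the copies of
    \<open>J\<close> together have the cardinality of \<open>'g \<times> nat\<close>.\<close>
  then have "|(UNIV :: ('a \<times> nat) set) \<times> J| =o |UNIV :: ('a \<times> nat) set|"
    using card_of_Times_infinite[OF infgn \<open>J \<noteq> {}\<close>] by blast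
  then obtain \<Phi> where \<Phi>: "bij_betw \<Phi> ((UNIV :: ('a \<times> nat) set) \<times> J) (UNIV :: ('a \<times> nat) set)"
    using card_of_ordIso by blast
  define \<Psi> where "\<Psi> = inv_into (UNIV \<times> J) \<Phi>"
  have \<Psi>: "bij_betw \<Psi> UNIV (UNIV \<times> J)" unfolding \<Psi>_def by (rule bij_betw_inv_into[OF \<Phi>])
  have \<Phi>\<Psi>: "\<Phi> (\<Psi> i) = i" for i
    unfolding \<Psi>_def by (rule bij_betw_inv_into_right[OF \<Phi>]) simp
  have \<Psi>\<Phi>: "\<Psi> (\<Phi> p) = p" if "p \<in> UNIV \<times> J" for p
    unfolding \<Psi>_def by (rule bij_betw_inv_into_left[OF \<Phi> that])
  have \<Psi>_in: "\<Psi> i \<in> UNIV \<times> J" for i using \<Psi> by (auto simp: bij_betw_def)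
  define mv where "mv g p = (fst p, fst (snd p), rp (fst (snd p)) (g \<otimes> snd (snd p)))" for g and p :: "('a \<times> nat) \<times> 'a list \<times> 'a"
  have mv_in: "mv g p \<in> UNIV \<times> J" if "g \<in> carrier G" and pin: "p \<in> UNIV \<times> J" for g p
  proof -
    obtain s l c where p: "p = (s, l, c)" "l \<in> LL" "c \<in> carrier G" using pin by (auto simp: J_def)
    then have "rp l (g \<otimes> c) \<in> carrier G" using rp(1) that by simp
    moreover have "rp l (rp l (g \<otimes> c)) = rp l (g \<otimes> c)"
      using rp_mult[of l \<one> "g \<otimes> c"] rp(1)[of l "g \<otimes> c"] p that by simp
    ultimately show ?thesis using p by (simp add: mv_def J_def)
  qed
  have mv_mult: "mv (g \<otimes> h) p = mv g (mv h p)" if "g \<in> carrier G" "h \<in> carrier G" and pin: "p \<in> UNIV \<times> J" for g h p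
  proof -
    obtain s l c where p: "p = (s, l, c)" "l \<in> LL" "c \<in> carrier G" using pin by (auto simp: J_def)
    then have "rp l (g \<otimes> rp l (h \<otimes> c)) = rp l (g \<otimes> h \<otimes> c)"
      using rp_mult[of l g "h \<otimes> c"] that by (simp add: m_assoc)
    then show ?thesis by (simp add: p mv_def)
  qed
  have mv_one: "mv \<one> p = p" if "p \<in> UNIV \<times> J" for p
    using that by (auto simp: mv_def J_def)
  define \<sigma> where "\<sigma> g i = \<Phi> (mv g (\<Psi> i))" for g i
  note \<sigma> = unitary_rep_permutation[OF is_group, of \<sigma>]
  have \<sigma>_mult: "\<sigma> (g \<otimes> h) i = \<sigma> g (\<sigma> h i)" if "g \<in> carrier G" "h \<in> carrier G" for g h i
    using that by (simp add: \<sigma>_def \<Psi>\<Phi> mv_in \<Psi>_in mv_mult)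
  have \<sigma>_one: "\<sigma> \<one> i = i" for i by (simp add: \<sigma>_def mv_one \<Psi>_in \<Phi>\<Psi>)
  define A where "A g i j = (if i = \<sigma> g j then 1 else 0 :: real)" for g i j
  have rep: "unitary_rep G (\<lambda>g. mat_op (A g))"
    unfolding A_def by (rule unitary_rep_permutation(1)[OF is_group \<sigma>_mult \<sigma>_one])
  have act: "mat_op (A g) x (\<sigma> g i) = x i" if "g \<in> carrier G" for g x i
    unfolding A_def by (rule unitary_rep_permutation(2)[OF is_group \<sigma>_mult \<sigma>_one that])
  \<comment> \<open>A finite orbit yields a finite set \<open>D\<close> of coset representatives,
    and \<open>D\<close> together with \<open>set l\<close> generates the group.\<close>
  have orbit: "infinite ((\<lambda>g. \<sigma> g i) ` carrier G)" for i
  proof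
    assume fin: "finite ((\<lambda>g. \<sigma> g i) ` carrier G)"
    obtain s l c where p: "\<Psi> i = (s, l, c)" by (metis prod.exhaust)
    have lc: "l \<in> LL" "c \<in> carrier G" using \<Psi>_in[of i] p by (auto simp: J_def)
    define D where "D = (\<lambda>g. snd (snd (\<Psi> (\<sigma> g i)))) ` carrier G"
    have "finite D" using finite_imageI[OF fin, of "\<lambda>j. snd (snd (\<Psi> j))"] by (simp add: D_def image_image)
    have D: "rp l g \<in> D" if "g \<in> carrier G" for g
    proof -
      have "g \<otimes> inv c \<in> carrier G" using that lc by simp
      moreover have "snd (snd (\<Psi> (\<sigma> (g \<otimes> inv c) i))) = rp l g"
      proof -
        have "\<Psi> (\<sigma> (g \<otimes> inv c) i) = mv (g \<otimes> inv c) (\<Psi> i)"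
          unfolding \<sigma>_def by (intro \<Psi>\<Phi> mv_in \<Psi>_in) (use that lc in auto)
        then show ?thesis using that lc by (simp add: mv_def p m_assoc)
      qed
      ultimately show ?thesis unfolding D_def by (intro image_eqI[where x = "g \<otimes> inv c"]) auto
    qed
    have DG: "D \<subseteq> carrier G"
    proof
      fix x assume "x \<in> D"
      then obtain j where "x = snd (snd (\<Psi> j))" unfolding D_def by blast
      then show "x \<in> carrier G" using \<Psi>_in[of j] by (cases "\<Psi> j") (auto simp: J_def)
    qed
    have "carrier G \<subseteq> generate G (D \<union> set l)"
    proof
      fix g assume g: "g \<in> carrier G"
      have "inv (rp l g) \<otimes> g \<in> generate G (D \<union> set l)"
        using rp(2)[OF lc(1) g] mono_generate[of "set l" "D \<union> set l"] unfolding Sub_def by blast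
      moreover have "rp l g \<in> generate G (D \<union> set l)" using D[OF g] by (auto intro: generate.incl)
      ultimately have "rp l g \<otimes> (inv (rp l g) \<otimes> g) \<in> generate G (D \<union> set l)" by (rule generate.eng[rotated])
      then show "g \<in> generate G (D \<union> set l)"
        using rp(1)[OF lc(1) g] g by (simp add: cancel)
    qed
    moreover have "D \<union> set l \<subseteq> carrier G" using DG lc LL by auto
    moreover from this have "generate G (D \<union> set l) \<subseteq> carrier G" by (rule generate_incl)
    ultimately have "finite (D \<union> set l)" "D \<union> set l \<subseteq> carrier G" "generate G (D \<union> set l) = carrier G"
      using \<open>finite D\<close> by auto
    then show False using nfg by blast
  qed
  have "almost_invariant_vectors G (\<lambda>g. mat_op (A g))"
    unfolding almost_invariant_vectors_def
  proof (intro allI impI)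
    fix F and \<epsilon> :: real assume F: "finite F" "F \<subseteq> carrier G" "\<epsilon> > 0"
    obtain l where l: "set l = F" using finite_list[OF F(1)] by blast
    then have lG: "l \<in> LL" using F LL by auto
    obtain s :: "'a \<times> nat" where True by blast
    have pJ: "(s, l, rp l \<one>) \<in> UNIV \<times> J"
      using lG rp[of l \<one>] rp_mult[of l \<one> \<one>] by (auto simp: J_def)
    define i where "i = \<Phi> (s, l, rp l \<one>)"
    have fix_i: "\<sigma> g i = i" if "g \<in> F" for g
    proof -
      have g: "g \<in> carrier G" using that F by auto
      have "inv \<one> \<otimes> g \<in> Sub l" using that l g by (auto simp: Sub_def intro: generate.incl)
      then have "rp l \<one> = rp l g" by (intro rp_eq) (use lG g in auto)
      then have "rp l (g \<otimes> rp l \<one>) = rp l \<one>" using rp_mult[OF lG g, of \<one>] g by simp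
      then show ?thesis by (simp add: \<sigma>_def i_def \<Psi>\<Phi>[OF pJ]) (simp add: mv_def)
    qed
    define \<xi> where "\<xi> j = (if j = i then 1 else 0 :: complex)" for j
    note N = l2norm_sq_eq_sum[of "{i}" \<xi>]
    have inv: "mat_op (A g) \<xi> j = \<xi> j" if "g \<in> F" for g j
    proof -
      have g: "g \<in> carrier G" using that F by auto
      have j: "\<sigma> g (\<sigma> (inv g) j) = j" using \<sigma>_mult[of g "inv g" j] g \<sigma>_one by simp
      have "mat_op (A g) \<xi> (\<sigma> g (\<sigma> (inv g) j)) = \<xi> (\<sigma> (inv g) j)" by (rule act[OF g])
      moreover have "\<sigma> (inv g) j = i \<longleftrightarrow> j = i"
      proof -
        have "\<sigma> (inv g) (\<sigma> g i) = i" using \<sigma>_mult[of "inv g" g i] g \<sigma>_one[of i] by simp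
        then show ?thesis using fix_i[OF that] j by metis
      qed
      ultimately show ?thesis by (simp add: j \<xi>_def)
    qed
    show "\<exists>\<xi>\<in>l2space. l2norm \<xi> = 1 \<and> (\<forall>g\<in>F. l2norm (\<lambda>i. mat_op (A g) \<xi> i - \<xi> i) < \<epsilon>)"
    proof (intro bexI conjI ballI)
      have "(l2norm \<xi>)\<^sup>2 = 1" by (subst N) (auto simp: \<xi>_def)
      then show "l2norm \<xi> = 1"
        by (simp add: power2_eq_1_iff) (smt (verit) infsum_nonneg l2norm_def real_sqrt_ge_zero zero_le_power2)
      show "\<xi> \<in> l2space" by (rule N) (auto simp: \<xi>_def)
      show "l2norm (\<lambda>i. mat_op (A g) \<xi> i - \<xi> i) < \<epsilon>" if "g \<in> F" for g
        using F(3) by (simp add: inv[OF that] l2norm_def)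
    qed
  qed
  then obtain \<zeta> where \<zeta>: "\<zeta> \<in> l2space" "\<zeta> \<noteq> (\<lambda>i. 0)" "\<And>g. g \<in> carrier G \<Longrightarrow> mat_op (A g) \<zeta> = \<zeta>"
    using T rep unfolding property_T_def relative_T_def by blast
  obtain i where i: "\<zeta> i \<noteq> 0" using \<zeta>(2) by (meson ext)
  define Orb where "Orb = (\<lambda>g. \<sigma> g i) ` carrier G"
  have const: "\<zeta> j = \<zeta> i" if "j \<in> Orb" for j
    using that act[of _ \<zeta> i] \<zeta>(3) by (auto simp: Orb_def)
  define N where "N = (\<Sum>\<^sub>\<infinity>i. (cmod (\<zeta> i))\<^sup>2)"
  have "real n * (cmod (\<zeta> i))\<^sup>2 \<le> N" for n
  proof -
    obtain B where B: "finite B" "card B = n" "B \<subseteq> Orb"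
      using infinite_arbitrarily_large[OF orbit[of i]] by (auto simp: Orb_def)
    have "real n * (cmod (\<zeta> i))\<^sup>2 = (\<Sum>j\<in>B. (cmod (\<zeta> j))\<^sup>2)"
    proof -
      have "(\<Sum>j\<in>B. (cmod (\<zeta> j))\<^sup>2) = (\<Sum>j\<in>B. (cmod (\<zeta> i))\<^sup>2)"
        using B(3) const by (intro sum.cong refl) (metis subsetD)
      then show ?thesis by (simp add: B(2))
    qed
    also have "\<dots> \<le> N" unfolding N_def using \<zeta>(1) B
      by (intro finite_sum_le_infsum) (auto simp: l2space_def)
    finally show ?thesis .
  qed
  moreover obtain n where "real n * (cmod (\<zeta> i))\<^sup>2 > N"
    using reals_Archimedean3[of "(cmod (\<zeta> i))\<^sup>2"] i by auto
  ultimately show False by (meson not_le)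
qed

section \<open>Souslin schemes and measurable covers of countable sections\<close>

definition pth :: "(nat \<Rightarrow> nat) \<Rightarrow> (nat \<Rightarrow> bool) \<Rightarrow> nat \<Rightarrow> (nat \<times> bool) list" where
  "pth u \<beta> n = map (\<lambda>i. (u i, \<beta> i)) [0..<n]"

lemma length_pth [simp]: "length (pth u \<beta> n) = n"
  and nth_pth [simp]: "i < n \<Longrightarrow> pth u \<beta> n ! i = (u i, \<beta> i)"
  by (simp_all add: pth_def)

text \<open>\<open>u\<close> is a branch of hidden witnesses, while the bits of the point
  \<open>\<beta>\<close> itself are carried in the nodes. Each condition on \<open>x\<close> thus
  depends on a finite part of both sequences.\<close>

definition souslin :: "((nat \<times> bool) list \<Rightarrow> 'a set) \<Rightarrow> ('a \<times> (nat \<Rightarrow> bool)) set" where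
  "souslin A = {(x, \<beta>). \<exists>u. \<forall>n. x \<in> A (pth u \<beta> n)}"

definition analytic_over :: "'a measure \<Rightarrow> ('a \<times> (nat \<Rightarrow> bool)) set \<Rightarrow> bool" where
  "analytic_over M R \<longleftrightarrow> (\<exists>A. (\<forall>t. A t \<in> sets M) \<and> R = souslin A)"

lemma analytic_over_UN:
  fixes R :: "nat \<Rightarrow> ('a \<times> (nat \<Rightarrow> bool)) set"
  assumes "\<And>k. analytic_over M (R k)"
  shows "analytic_over M (\<Union>k. R k)"
proof -
  have "\<forall>k. \<exists>A. (\<forall>t. A t \<in> sets M) \<and> R k = souslin A"
    using assms unfolding analytic_over_def by blast
  then obtain A where A: "\<And>k t. A k t \<in> sets M" "\<And>k. R k = souslin (A k)" by metis
  define fx where "fx t = (snd (prod_decode (fst (hd t))), snd (hd t)) # tl t" for t :: "(nat \<times> bool) list"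
  \<comment> \<open>The first letter encodes both the member \<open>k\<close> and the original first
    letter. The empty node cannot know \<open>k\<close>, so the root condition of the chosen scheme
    is checked at all longer nodes instead.\<close>
  define A' where "A' t = (if t = [] then space M
      else A (fst (prod_decode (fst (hd t)))) (fx t) \<inter> A (fst (prod_decode (fst (hd t)))) [])" for t
  have fx: "fx (pth v \<beta> (Suc n)) = pth (\<lambda>i. if i = 0 then snd (prod_decode (v 0)) else v i) \<beta> (Suc n)" for v \<beta> n
    by (simp add: fx_def pth_def upt_conv_Cons del: upt_Suc)
  have A': "A' (pth v \<beta> (Suc n)) = A (fst (prod_decode (v 0))) (fx (pth v \<beta> (Suc n))) \<inter> A (fst (prod_decode (v 0))) []" for v \<beta> n
    by (simp add: A'_def pth_def upt_conv_Cons del: upt_Suc)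
  have "(\<Union>k. R k) = souslin A'"
  proof (intro Set.set_eqI iffI)
    fix p assume "p \<in> (\<Union>k. R k)"
    then obtain x \<beta> k u where p: "p = (x, \<beta>)" and u: "\<And>n. x \<in> A k (pth u \<beta> n)"
      unfolding A souslin_def by auto
    define v where "v i = (if i = 0 then prod_encode (k, u 0) else u i)" for i
    have "(\<lambda>i. if i = 0 then snd (prod_decode (v 0)) else v i) = u" by (auto simp: v_def)
    then have "x \<in> A' (pth v \<beta> (Suc n))" for n
      unfolding A' fx using u[of "Suc n"] u[of 0] by (simp add: v_def) (simp add: pth_def)
    moreover have "x \<in> A' (pth v \<beta> 0)"
      using u[of 0] A(1) sets.sets_into_space by (fastforce simp: A'_def pth_def)
    ultimately have "x \<in> A' (pth v \<beta> n)" for n by (cases n) auto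
    then show "p \<in> souslin A'" by (auto simp: souslin_def p)
  next
    fix p assume "p \<in> souslin A'"
    then obtain x \<beta> v where p: "p = (x, \<beta>)" and v: "\<And>n. x \<in> A' (pth v \<beta> n)"
      unfolding souslin_def by auto
    define u where "u = (\<lambda>i. if i = 0 then snd (prod_decode (v 0)) else v i)"
    have "x \<in> A (fst (prod_decode (v 0))) (pth u \<beta> n)" for n
      using v[of "Suc (n - 1)"] unfolding A' fx u_def[symmetric] by (cases n) (auto simp: pth_def)
    then have "p \<in> R (fst (prod_decode (v 0)))" by (auto simp: A souslin_def p)
    then show "p \<in> (\<Union>k. R k)" by blast
  qed
  moreover have "A' t \<in> sets M" for t using A(1) by (auto simp: A'_def)
  ultimately show ?thesis unfolding analytic_over_def by blast
qed

lemma prod_encode_strict: "m < n \<Longrightarrow> prod_encode (k, m) < prod_encode (k, n)"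
proof -
  assume "m < n"
  have "triangle i \<le> triangle j" if "i \<le> j" for i j using that by (rule lift_Suc_mono_le[rotated]) simp
  moreover have "triangle (k + m) < triangle (Suc (k + m))" if "k + m > 0 \<or> True" for k m by simp
  ultimately have "triangle (k + m) < triangle (k + n)"
    using \<open>m < n\<close> by (metis Suc_leI add_Suc_right less_le_trans nat_add_left_cancel_le)
  then show ?thesis by (simp add: prod_encode_def)
qed

text \<open>Countably many branches are interleaved by \<open>prod_encode\<close>: the node of
  length \<open>prod_encode (k, n)\<close> checks level \<open>n\<close> of the \<open>k\<close>-th
  scheme. Strict monotonicity in the second argument guarantees that the letters to be read are
  already present. The bits of \<open>\<beta>\<close> are common to all schemes and are read
  unshuffled.\<close>

lemma analytic_over_INT:
  fixes R :: "nat \<Rightarrow> ('a \<times> (nat \<Rightarrow> bool)) set"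
  assumes "\<And>k. analytic_over M (R k)"
  shows "analytic_over M (\<Inter>k. R k)"
proof -
  have "\<forall>k. \<exists>A. (\<forall>t. A t \<in> sets M) \<and> R k = souslin A"
    using assms unfolding analytic_over_def by blast
  then obtain A where A: "\<And>k t. A k t \<in> sets M" "\<And>k. R k = souslin (A k)" by metis
  define fx where "fx k n t = map (\<lambda>m. (fst (t ! prod_encode (k, m)), snd (t ! m))) [0..<n]"
    for k n and t :: "(nat \<times> bool) list"
  define A' where "A' t = (case prod_decode (length t) of (k, n) \<Rightarrow> A k (fx k n t))" for t
  have A': "A' (pth v \<beta> (prod_encode (k, n))) = A k (pth (\<lambda>m. v (prod_encode (k, m))) \<beta> n)" for v \<beta> k n
  proof -
    have "m < prod_encode (k, n)" if "m < n" for m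
      using le_prod_encode_2[of n k] that by linarith
    then have "fx k n (pth v \<beta> (prod_encode (k, n))) = pth (\<lambda>m. v (prod_encode (k, m))) \<beta> n"
      by (intro nth_equalityI) (auto simp: fx_def prod_encode_strict)
    then show ?thesis by (simp add: A'_def)
  qed
  have "(\<Inter>k. R k) = souslin A'"
  proof (intro Set.set_eqI iffI)
    fix p assume "p \<in> (\<Inter>k. R k)"
    then obtain x \<beta> where p: "p = (x, \<beta>)" and "\<forall>k. \<exists>u. \<forall>n. x \<in> A k (pth u \<beta> n)"
      unfolding A souslin_def by (cases p) auto
    then obtain u where u: "\<And>k n. x \<in> A k (pth (u k) \<beta> n)" by metis
    define v where "v i = u (fst (prod_decode i)) (snd (prod_decode i))" for i
    have "x \<in> A' (pth v \<beta> (prod_encode (k, n)))" for k n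
      unfolding A' using u[of k n] by (simp add: v_def)
    then have "x \<in> A' (pth v \<beta> n)" for n by (metis prod_decode_inverse surj_pair)
    then show "p \<in> souslin A'" by (auto simp: souslin_def p)
  next
    fix p assume "p \<in> souslin A'"
    then obtain x \<beta> v where p: "p = (x, \<beta>)" and v: "\<And>n. x \<in> A' (pth v \<beta> n)"
      unfolding souslin_def by auto
    have "x \<in> A k (pth (\<lambda>m. v (prod_encode (k, m))) \<beta> n)" for k n
      using v[of "prod_encode (k, n)"] unfolding A' .
    then show "p \<in> (\<Inter>k. R k)" by (auto simp: A souslin_def p)
  qed
  moreover have "A' t \<in> sets M" for t using A(1) by (auto simp: A'_def split: prod.split)
  ultimately show ?thesis unfolding analytic_over_def by blast
qed

lemma analytic_over_cylinder:
  assumes "S \<in> sets M"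
  shows "analytic_over M {(x, \<beta>). x \<in> S \<and> \<beta> n = b}"
proof -
  define A where "A t = (if length t > n \<and> snd (t ! n) \<noteq> b then {} else S)" for t :: "(nat \<times> bool) list"
  have "{(x, \<beta>). x \<in> S \<and> \<beta> n = b} = souslin A"
  proof -
    have "(\<forall>m. x \<in> A (pth u \<beta> m)) \<longleftrightarrow> x \<in> S \<and> \<beta> n = b" for x u \<beta>
    proof
      assume "\<forall>m. x \<in> A (pth u \<beta> m)"
      then have "x \<in> A (pth u \<beta> (Suc n))" by blast
      then show "x \<in> S \<and> \<beta> n = b" by (auto simp: A_def split: if_splits)
    qed (auto simp: A_def)
    then show ?thesis by (auto simp: souslin_def)
  qed
  moreover have "A t \<in> sets M" for t using assms by (auto simp: A_def)
  ultimately show ?thesis unfolding analytic_over_def by blast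
qed

lemma analytic_over_Un: "analytic_over M R \<Longrightarrow> analytic_over M S \<Longrightarrow> analytic_over M (R \<union> S)"
proof -
  assume *: "analytic_over M R" "analytic_over M S"
  have "(\<Union>k::nat. if k = 0 then R else S) = R \<union> S" by (auto split: if_splits)
  then show ?thesis using analytic_over_UN[of M "\<lambda>k. if k = 0 then R else S"] * by auto
qed

lemma analytic_over_Int: "analytic_over M R \<Longrightarrow> analytic_over M S \<Longrightarrow> analytic_over M (R \<inter> S)"
proof -
  assume *: "analytic_over M R" "analytic_over M S"
  have "(\<Inter>k::nat. if k = 0 then R else S) = R \<inter> S" by (auto split: if_splits)
  then show ?thesis using analytic_over_INT[of M "\<lambda>k. if k = 0 then R else S"] * by auto
qed

definition Cantor :: "(nat \<Rightarrow> bool) measure" where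
  "Cantor = sigma UNIV (range (\<lambda>n. {\<beta>. \<beta> n}))"

lemma space_Cantor [simp]: "space Cantor = UNIV"
  and sets_Cantor: "sets Cantor = sigma_sets UNIV (range (\<lambda>n. {\<beta>. \<beta> n}))"
  by (simp_all add: Cantor_def)

lemma Cantor_coord: "Measurable.pred Cantor (\<lambda>\<beta>. \<beta> n)"
  unfolding pred_def sets_Cantor by (auto intro: sigma_sets.Basic)

text \<open>A complement of a Souslin set need not be Souslin, so the induction runs over sets that
  are Souslin together with their complement. Closure under countable unions and intersections makes
  these a sigma-algebra, and it contains the rectangles.\<close>

lemma analytic_over_pair_sets:
  assumes "R \<in> sets (M \<Otimes>\<^sub>M Cantor)"
  shows "analytic_over M R"
proof -
  define \<Omega> where "\<Omega> = space M \<times> (UNIV :: (nat \<Rightarrow> bool) set)"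
  define an2 where "an2 R \<longleftrightarrow> R \<subseteq> \<Omega> \<and> analytic_over M R \<and> analytic_over M (\<Omega> - R)" for R
  have compl: "an2 (\<Omega> - R)" if "an2 R" for R
    using that by (auto simp: an2_def double_diff)
  have UN: "an2 (\<Union>k. R k)" if "\<And>k::nat. an2 (R k)" for R
  proof -
    have "\<Omega> - (\<Union>k. R k) = (\<Inter>k. \<Omega> - R k)" by auto
    moreover have "analytic_over M (\<Inter>k. \<Omega> - R k)" "analytic_over M (\<Union>k. R k)"
      using that unfolding an2_def by (blast intro: analytic_over_UN analytic_over_INT)+
    ultimately show ?thesis using that unfolding an2_def by auto
  qed
  have cyl: "an2 {(x, \<beta>). x \<in> S \<and> \<beta> n}" if S: "S \<in> sets M" for S n
  proof -
    have 1: "analytic_over M {(x, \<beta>). x \<in> S \<and> \<beta> n}"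
      using analytic_over_cylinder[OF S, of n True] by simp
    have "\<Omega> - {(x, \<beta>). x \<in> S \<and> \<beta> n} = {(x, \<beta>). x \<in> space M \<and> \<beta> n = False} \<union>
        ({(x, \<beta>). x \<in> space M - S \<and> \<beta> n = False} \<union> {(x, \<beta>). x \<in> space M - S \<and> \<beta> n = True})"
      by (auto simp: \<Omega>_def)
    moreover have "analytic_over M \<dots>"
      using S by (intro analytic_over_Un analytic_over_cylinder) auto
    ultimately show ?thesis using 1 S sets.sets_into_space[OF S] by (auto simp: an2_def \<Omega>_def)
  qed
  have Int: "an2 (R \<inter> S)" if "an2 R" "an2 S" for R S
    using that by (auto simp: an2_def Diff_Int intro: analytic_over_Int analytic_over_Un)
  have Un: "an2 (R \<union> S)" if "an2 R" "an2 S" for R S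
    using that by (auto simp: an2_def Diff_Un intro: analytic_over_Int analytic_over_Un)
  have full: "an2 (S \<times> UNIV)" if S: "S \<in> sets M" for S
  proof -
    have 1: "analytic_over M (S \<times> UNIV)" if "S \<in> sets M" for S :: "'a set"
    proof -
      have "S \<times> (UNIV :: (nat \<Rightarrow> bool) set) =
          {(x, \<beta>). x \<in> S \<and> \<beta> 0 = True} \<union> {(x, \<beta>). x \<in> S \<and> \<beta> 0 = False}" by auto
      moreover have "analytic_over M \<dots>"
        by (intro analytic_over_Un analytic_over_cylinder that)
      ultimately show ?thesis by simp
    qed
    have "\<Omega> - S \<times> UNIV = (space M - S) \<times> UNIV" by (auto simp: \<Omega>_def)
    then show ?thesis using S 1[OF S] 1[of "space M - S"] sets.sets_into_space[OF S]
      by (auto simp: an2_def \<Omega>_def)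
  qed
  have top: "an2 \<Omega>" using full[of "space M"] by (simp add: \<Omega>_def)
  have empty: "an2 {}" using compl[OF top] by simp
  have vert: "an2 (space M \<times> b)" if "b \<in> sets Cantor" for b
    using that unfolding sets_Cantor
  proof (induction rule: sigma_sets.induct)
    case (Basic a)
    then obtain n where "a = {\<beta>. \<beta> n}" by auto
    then have "space M \<times> a = {(x, \<beta>). x \<in> space M \<and> \<beta> n}" by auto
    then show ?case using cyl[of "space M" n] by simp
  next
    case Empty
    then show ?case using empty by simp
  next
    case (Compl a)
    have "space M \<times> (UNIV - a) = \<Omega> - space M \<times> a" by (auto simp: \<Omega>_def)
    then show ?case using compl[OF Compl.IH] by simp
  next
    case (Union a)
    have "space M \<times> (\<Union>i. a i) = (\<Union>i. space M \<times> a i)" by auto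
    then show ?case using UN[OF Union.IH] by simp
  qed
  have "an2 R"
    using assms unfolding sets_pair_measure
  proof (induction rule: sigma_sets.induct)
    case (Basic r)
    then obtain a b where ab: "r = a \<times> b" "a \<in> sets M" "b \<in> sets Cantor" by auto
    have "r = (a \<times> UNIV) \<inter> (space M \<times> b)" using ab sets.sets_into_space by auto
    then show ?case using Int[OF full[OF ab(2)] vert[OF ab(3)]] by simp
  next
    case Empty
    then show ?case by (rule empty)
  next
    case (Compl a)
    then show ?case using compl[of a] by (simp add: \<Omega>_def)
  next
    case (Union a)
    then show ?case using UN[of a] by simp
  qed
  then show ?thesis by (simp add: an2_def)
qed

text \<open>Exhaustion: the union of members whose measures approach the supremum. A member sticking
  out of it by positive measure would push the union above the supremum.\<close>

lemma (in finite_measure) ideal_has_essential_maximum: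
  assumes "{} \<in> I" "I \<subseteq> sets M" and UN: "\<And>S :: nat \<Rightarrow> 'a set. (\<And>n. S n \<in> I) \<Longrightarrow> (\<Union>n. S n) \<in> I"
  shows "\<exists>A\<in>I. \<forall>S\<in>I. AE x in M. x \<in> S \<longrightarrow> x \<in> A"
proof -
  define s where "s = (SUP S\<in>I. measure M S)"
  have bdd: "bdd_above (measure M ` I)" by (auto intro!: bdd_aboveI[where M = "measure M (space M)"] bounded_measure)
  have "\<exists>S\<in>I. s - 1 / Suc n < measure M S" for n
    using assms(1) bdd less_cSUP_iff[of I "measure M" "s - 1 / Suc n"] by (auto simp: s_def)
  then obtain S where S: "\<And>n. S n \<in> I" "\<And>n. s - 1 / Suc n < measure M (S n)" by metis
  define A where "A = (\<Union>n. S n)"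
  have A: "A \<in> I" "A \<in> sets M" using UN[of S] S assms(2) by (auto simp: A_def)
  have ge: "s \<le> measure M A"
  proof (rule field_le_epsilon)
    fix e :: real assume "e > 0"
    then obtain n where "1 / Suc n < e" using nat_approx_posE by blast
    moreover have "measure M (S n) \<le> measure M A"
      using A(2) by (intro finite_measure_mono) (auto simp: A_def)
    ultimately show "s \<le> measure M A + e" using S(2)[of n] by linarith
  qed
  have "AE x in M. x \<in> T \<longrightarrow> x \<in> A" if T: "T \<in> I" for T
  proof -
    have TM: "T \<in> sets M" using T assms(2) by auto
    have "(\<Union>n::nat. if n = 0 then A else T) \<in> I" by (rule UN) (use A T in auto)
    moreover have "(\<Union>n::nat. if n = 0 then A else T) = A \<union> T" by (auto split: if_splits)
    ultimately have "measure M (A \<union> T) \<le> s" unfolding s_def using bdd by (intro cSUP_upper) auto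
    moreover have "measure M (A \<union> T) = measure M A + measure M (T - A)"
      using finite_measure_Union[of A "T - A"] A(2) TM by (simp add: Un_Diff_cancel)
    ultimately have "measure M (T - A) = 0" using ge measure_nonneg[of M "T - A"] by linarith
    then have "T - A \<in> null_sets M" using A(2) TM by (auto simp: null_sets_def emeasure_eq_measure)
    then show ?thesis by (rule AE_I') auto
  qed
  then show ?thesis using A(1) by blast
qed


definition meas_fun :: "'a measure \<Rightarrow> ('a \<Rightarrow> nat \<Rightarrow> bool) \<Rightarrow> bool" where
  "meas_fun M f \<longleftrightarrow> (\<forall>m. {x \<in> space M. f x m} \<in> sets M)"

text \<open>Let \<open>E t\<close> be the essential complement of the largest set over which the part of the sections below
  the node \<open>t\<close> is covered by countably many measurable functions. Almost surely the nodes \<open>t\<close> with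
  \<open>x \<in> E t\<close> form a tree without leaves in which every node splits, so if the root belonged to it, a diagonal
  construction would show that the section at \<open>x\<close> is uncountable.\<close>

lemma (in finite_measure) countable_sections_covered_Cantor:
  assumes A: "\<And>t. A t \<in> sets M"
    and cnt: "\<And>x. x \<in> space M \<Longrightarrow> countable {\<beta>. (x, \<beta>) \<in> souslin A}"
  shows "\<exists>f :: nat \<Rightarrow> 'a \<Rightarrow> nat \<Rightarrow> bool. (\<forall>n. meas_fun M (f n)) \<and>
    (AE x in M. \<forall>\<beta>. (x, \<beta>) \<in> souslin A \<longrightarrow> (\<exists>n. \<beta> = f n x))"
proof -
  define Sec where "Sec t x = {\<beta>. \<exists>u. pth u \<beta> (length t) = t \<and> (\<forall>n. x \<in> A (pth u \<beta> n))}" for t x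
  \<comment> \<open>A sigma-ideal of base sets: those over which the part of the section with a
    witness branch through \<open>t\<close> is covered by countably many measurable
    functions.\<close>
  define I where "I t = {S \<in> sets M. \<exists>f. (\<forall>n. meas_fun M (f n)) \<and> (\<forall>x\<in>S. \<forall>\<beta>\<in>Sec t x. \<exists>n::nat. \<beta> = f n x)}" for t
  have IM: "I t \<subseteq> sets M" for t by (auto simp: I_def)
  have I_cover: "S \<in> I t" if S: "S \<in> sets M" and c: "\<And>c. meas_fun M (g c)"
    and cov: "\<And>x \<beta>. x \<in> S \<Longrightarrow> \<beta> \<in> Sec t x \<Longrightarrow> \<exists>c. \<beta> = g c x" for S t and g :: "'c::countable \<Rightarrow> _"
  proof -
    have "\<forall>x\<in>S. \<forall>\<beta>\<in>Sec t x. \<exists>n. \<beta> = g (from_nat n) x"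
      using cov by (metis from_nat_to_nat)
    then show ?thesis using S c unfolding I_def by blast
  qed
  have I_choose: "\<exists>f. (\<forall>n. meas_fun M (f n)) \<and> (\<forall>x\<in>S. \<forall>\<beta>\<in>Sec t x. \<exists>n::nat. \<beta> = f n x)" if "S \<in> I t" for S t
    using that by (simp add: I_def)
  have "\<exists>Z\<in>I t. \<forall>S\<in>I t. AE x in M. x \<in> S \<longrightarrow> x \<in> Z" for t
  proof (rule ideal_has_essential_maximum[OF _ IM])
    show "{} \<in> I t" by (rule I_cover[where g = "\<lambda>_::nat. \<lambda>_ _. False"]) (auto simp: meas_fun_def)
    fix S :: "nat \<Rightarrow> 'a set" assume S: "\<And>n. S n \<in> I t"
    then obtain f where f: "\<And>k n. meas_fun M (f k n)" "\<And>k x \<beta>. x \<in> S k \<Longrightarrow> \<beta> \<in> Sec t x \<Longrightarrow> \<exists>n::nat. \<beta> = f k n x"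
      using I_choose[OF S] by metis
    show "(\<Union>n. S n) \<in> I t"
    proof (rule I_cover[where g = "\<lambda>(k, n). f k n"])
      show "(\<Union>n. S n) \<in> sets M" using S IM by auto
      show "\<exists>c. \<beta> = (case c of (k, n) \<Rightarrow> f k n) x" if x: "x \<in> (\<Union>n. S n)" and \<beta>: "\<beta> \<in> Sec t x" for x \<beta>
      proof -
        obtain k n where "\<beta> = f k n x" using f(2) x \<beta> by blast
        then show ?thesis by (intro exI[of _ "(k, n)"]) simp
      qed
    qed (use f in \<open>auto split: prod.split\<close>)
  qed
  then obtain Z where Z: "\<And>t. Z t \<in> I t" "\<And>t S. S \<in> I t \<Longrightarrow> AE x in M. x \<in> S \<longrightarrow> x \<in> Z t" by metis
  obtain F where F: "\<And>t n. meas_fun M (F t n)" "\<And>t x \<beta>. x \<in> Z t \<Longrightarrow> \<beta> \<in> Sec t x \<Longrightarrow> \<exists>n::nat. \<beta> = F t n x"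
    using I_choose[OF Z(1)] by metis
  have ZM: "Z t \<in> sets M" for t using Z(1) IM by auto
  define E where "E t = space M - Z t" for t
  have EM: "E t \<in> sets M" for t using ZM by (auto simp: E_def)
  have avoid: "AE x in M. x \<in> S \<longrightarrow> x \<notin> E t" if "S \<in> I t" for S t
    using Z(2)[OF that] by eventually_elim (auto simp: E_def)
  \<comment> \<open>The part of a section below \<open>t\<close> is the union of the parts below its
    countably many children, so a node all of whose children are covered is covered.\<close>
  have prune: "AE x in M. x \<in> E t \<longrightarrow> (\<exists>p. x \<in> E (t @ [p]))" for t
  proof -
    have "(\<Inter>p. Z (t @ [p])) \<in> I t"
    proof (rule I_cover[where g = "\<lambda>(p, n). F (t @ [p]) n"])
      fix x \<beta> assume x: "x \<in> (\<Inter>p. Z (t @ [p]))" and "\<beta> \<in> Sec t x"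
      then obtain u where u: "pth u \<beta> (length t) = t" "\<And>n. x \<in> A (pth u \<beta> n)" by (auto simp: Sec_def)
      define p where "p = (u (length t), \<beta> (length t))"
      have "pth u \<beta> (length (t @ [p])) = t @ [p]" using u(1) by (simp add: pth_def p_def)
      then have "\<beta> \<in> Sec (t @ [p]) x" using u(2) by (auto simp: Sec_def)
      then obtain n where "\<beta> = F (t @ [p]) n x" using F(2) x by blast
      then show "\<exists>c. \<beta> = (case c of (p, n) \<Rightarrow> F (t @ [p]) n) x" by (intro exI[of _ "(p, n)"]) simp
    qed (use ZM F(1) in \<open>auto split: prod.split\<close>)
    then have "AE x in M. x \<in> (\<Inter>p. Z (t @ [p])) \<longrightarrow> x \<notin> E t" by (rule avoid)
    then show ?thesis using AE_space by eventually_elim (auto simp: E_def)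
  qed
  have nodes: "AE x in M. x \<in> E t \<longrightarrow> x \<in> A t" for t
  proof -
    have "space M - A t \<in> I t"
      by (rule I_cover[where g = "\<lambda>_::nat. \<lambda>_ _. False"]) (use A in \<open>auto simp: meas_fun_def Sec_def, metis\<close>)
    then have "AE x in M. x \<in> space M - A t \<longrightarrow> x \<notin> E t" by (rule avoid)
    then show ?thesis using AE_space by eventually_elim auto
  qed
  have downward: "AE x in M. x \<in> E t \<longrightarrow> x \<in> E s" if st: "prefix s t" for s t
  proof -
    have "Sec t x \<subseteq> Sec s x" for x
    proof
      fix \<beta> assume "\<beta> \<in> Sec t x"
      then obtain u where u: "pth u \<beta> (length t) = t" "\<And>n. x \<in> A (pth u \<beta> n)" by (auto simp: Sec_def)
      have "pth u \<beta> (length s) = take (length s) (pth u \<beta> (length t))"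
        using prefix_length_le[OF st] by (simp add: pth_def take_map)
      also have "\<dots> = s" using st by (simp add: u(1) prefix_def) fastforce
      finally show "\<beta> \<in> Sec s x" using u(2) by (auto simp: Sec_def)
    qed
    then have "Z s \<in> I t"
      using Z(1)[of s] unfolding I_def by blast
    then have "AE x in M. x \<in> Z s \<longrightarrow> x \<notin> E t" by (rule avoid)
    then show ?thesis using AE_space by eventually_elim (auto simp: E_def)
  qed
  define splits where "splits x t \<longleftrightarrow> (\<exists>t1 t2 i. prefix t t1 \<and> prefix t t2 \<and> x \<in> E t1 \<and> x \<in> E t2 \<and>
      i < length t1 \<and> i < length t2 \<and> snd (t1 ! i) \<noteq> snd (t2 ! i))" for x t
  have split: "AE x in M. x \<in> E t \<longrightarrow> splits x t" for t
  proof -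
    define Bd where "Bd = {x \<in> E t. \<not> splits x t}"
    \<comment> \<open>If no two surviving nodes below \<open>t\<close> disagree in a bit, the bits
      along all surviving branches are forced, and \<open>g\<close> reads them off measurably. A
      point of the section either leaves \<open>E\<close> at some node, where \<open>F\<close> lists
      it, or it equals \<open>g x\<close>.\<close>
    define g where "g x i \<longleftrightarrow> (\<exists>t'. prefix t t' \<and> x \<in> E t' \<and> i < length t' \<and> snd (t' ! i))" for x i
    have E_pred: "Measurable.pred M (\<lambda>x. x \<in> E s)" for s using EM by simp
    have "Measurable.pred M (\<lambda>x. x \<in> E t \<and> \<not> splits x t)"
      unfolding splits_def using E_pred by measurable
    moreover have "Bd = {x \<in> space M. x \<in> E t \<and> \<not> splits x t}"
      using sets.sets_into_space[OF EM] by (auto simp: Bd_def)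
    ultimately have BdM: "Bd \<in> sets M" by (simp add: pred_def)
    have g: "meas_fun M g"
      unfolding meas_fun_def g_def pred_def[symmetric] using E_pred by (intro allI) measurable
    have "Bd \<in> I t"
    proof (rule I_cover[where g = "case_option g (\<lambda>(t', n). F t' n)", OF BdM])
      show "meas_fun M (case c of None \<Rightarrow> g | Some x \<Rightarrow> (case x of (t', n) \<Rightarrow> F t' n))" for c
        using g F(1) by (auto split: option.split)
      fix x \<beta> assume x: "x \<in> Bd" and "\<beta> \<in> Sec t x"
      then obtain u where u: "pth u \<beta> (length t) = t" "\<And>n. x \<in> A (pth u \<beta> n)" by (auto simp: Sec_def)
      have pre: "prefix t (pth u \<beta> n)" if "length t \<le> n" for n
      proof -
        have "take (length t) (pth u \<beta> n) = t"
          using u(1) that by (simp add: pth_def take_map)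
        then show ?thesis by (metis take_is_prefix)
      qed
      have ns: "\<not> splits x t" using x by (simp add: Bd_def)
      show "\<exists>c. \<beta> = (case c of None \<Rightarrow> g | Some x \<Rightarrow> (case x of (t', n) \<Rightarrow> F t' n)) x"
      proof (cases "\<exists>n\<ge>length t. x \<notin> E (pth u \<beta> n)")
        case True
        then obtain n where n: "x \<notin> E (pth u \<beta> n)" by blast
        have "x \<in> space M" using x sets.sets_into_space[OF BdM] by auto
        then have "x \<in> Z (pth u \<beta> n)" using n by (simp add: E_def)
        moreover have "\<beta> \<in> Sec (pth u \<beta> n) x" using u(2) by (auto simp: Sec_def)
        ultimately obtain m where "\<beta> = F (pth u \<beta> n) m x" using F(2) by blast
        then show ?thesis by (intro exI[of _ "Some (pth u \<beta> n, m)"]) simp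
      next
        case False
        then have inE: "x \<in> E (pth u \<beta> n)" if "n \<ge> length t" for n using that by blast
        have "\<beta> i = g x i" for i
        proof
          define n where "n = max (length t) (Suc i)"
          have n: "n \<ge> length t" "i < n" by (auto simp: n_def)
          show "g x i" if "\<beta> i"
            unfolding g_def by (intro exI[of _ "pth u \<beta> n"]) (use n pre inE that in auto)
          show "\<beta> i" if "g x i"
          proof (rule ccontr)
            assume nb: "\<not> \<beta> i"
            obtain t' where t': "prefix t t'" "x \<in> E t'" "i < length t'" "snd (t' ! i)"
              using \<open>g x i\<close> by (auto simp: g_def)
            have "splits x t" unfolding splits_def
              by (intro exI[of _ t'] exI[of _ "pth u \<beta> n"] exI[of _ i]) (use n pre inE nb t' in auto)
            then show False using ns by simp
          qed
        qed
        then have "\<beta> = g x" by blast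
        then show ?thesis by (intro exI[of _ None]) simp
      qed
    qed
    then have "AE x in M. x \<in> Bd \<longrightarrow> x \<notin> E t" by (rule avoid)
    then show ?thesis by eventually_elim (auto simp: Bd_def)
  qed
  have "AE x in M. x \<in> space M \<and> (\<forall>t. x \<in> E t \<longrightarrow> (\<exists>p. x \<in> E (t @ [p]))) \<and> (\<forall>t. x \<in> E t \<longrightarrow> x \<in> A t) \<and>
      (\<forall>s t. prefix s t \<longrightarrow> x \<in> E t \<longrightarrow> x \<in> E s) \<and> (\<forall>t. x \<in> E t \<longrightarrow> splits x t)"
    unfolding AE_conj_iff AE_all_countable
    using prune nodes downward split AE_space by (auto intro!: AE_impI)
  then have root: "AE x in M. x \<notin> E []"
  proof eventually_elim
    case (elim x)
    then have prune: "\<And>t. x \<in> E t \<Longrightarrow> \<exists>p. x \<in> E (t @ [p])" and nodes: "\<And>t. x \<in> E t \<Longrightarrow> x \<in> A t"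
      and downward: "\<And>s t. prefix s t \<Longrightarrow> x \<in> E t \<Longrightarrow> x \<in> E s" and split: "\<And>t. x \<in> E t \<Longrightarrow> splits x t" by auto
    show ?case
    proof
      assume root: "x \<in> E []"
      obtain r :: "nat \<Rightarrow> nat \<Rightarrow> bool" where r: "{\<beta>. (x, \<beta>) \<in> souslin A} \<subseteq> range r"
        using subset_range_from_nat_into[OF cnt[of x]] elim by blast
      \<comment> \<open>Two nodes with different bits at position \<open>i\<close> cannot both agree
        with the \<open>n\<close>-th enumerated point; the one that disagrees excludes this point,
        and a child of it makes the node strictly longer.\<close>
      have step: "\<exists>t'. x \<in> E t' \<and> prefix t t' \<and> length t < length t' \<and> (\<exists>i<length t'. snd (t' ! i) \<noteq> r n i)"
        if t: "x \<in> E t" for t n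
      proof -
        obtain t1 t2 i where s: "prefix t t1" "prefix t t2" "x \<in> E t1" "x \<in> E t2"
          "i < length t1" "i < length t2" "snd (t1 ! i) \<noteq> snd (t2 ! i)"
          using split[OF t] unfolding splits_def by blast
        have "snd (t1 ! i) \<noteq> r n i \<or> snd (t2 ! i) \<noteq> r n i" using s(7) by auto
        then obtain t3 where t3: "prefix t t3" "x \<in> E t3" "i < length t3" "snd (t3 ! i) \<noteq> r n i" using s by blast
        obtain p where p: "x \<in> E (t3 @ [p])" using prune[OF t3(2)] by blast
        have "prefix t (t3 @ [p])" using t3(1) by simp
        moreover have "length t < length (t3 @ [p])" using prefix_length_le[OF t3(1)] by simp
        moreover have "i < length (t3 @ [p])" "snd ((t3 @ [p]) ! i) \<noteq> r n i" using t3 by (auto simp: nth_append)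
        ultimately show ?thesis using p by blast
      qed
      obtain T where T: "\<And>n. x \<in> E (T n)" "\<And>n. prefix (T n) (T (Suc n))" "\<And>n. length (T n) < length (T (Suc n))"
        "\<And>n. \<exists>i<length (T (Suc n)). snd (T (Suc n) ! i) \<noteq> r n i"
      proof -
        have "\<exists>T. \<forall>n. x \<in> E (T n) \<and> (prefix (T n) (T (Suc n)) \<and> length (T n) < length (T (Suc n)) \<and>
            (\<exists>i<length (T (Suc n)). snd (T (Suc n) ! i) \<noteq> r n i))"
          by (rule dependent_nat_choice) (use root step in blast)+
        then show ?thesis using that by blast
      qed
      have mono: "prefix (T m) (T n)" if "m \<le> n" for m n
        using that by (induction rule: dec_induct) (use T(2) prefix_order.trans in blast)+
      have len: "n \<le> length (T n)" for n
      proof (induction n)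
        case (Suc n)
        then show ?case using T(3)[of n] by simp
      qed simp
      define w where "w i = T (Suc i) ! i" for i
      have w: "T n ! i = w i" if "i < length (T n)" for n i
      proof -
        have "i < length (T (Suc i))" using len[of "Suc i"] by simp
        then show ?thesis using that mono[of n "Suc i"] mono[of "Suc i" n]
          by (cases "n \<le> Suc i") (auto simp: w_def prefix_def nth_append)
      qed
      define u \<beta> where "u = fst \<circ> w" and "\<beta> = snd \<circ> w"
      have "pth u \<beta> n = take n (T n)" for n
        using len[of n] by (intro nth_equalityI) (auto simp: u_def \<beta>_def w[symmetric])
      then have "x \<in> A (pth u \<beta> n)" for n
        using downward[of "take n (T n)" "T n"] T(1)[of n] nodes take_is_prefix by metis
      then have "(x, \<beta>) \<in> souslin A" by (auto simp: souslin_def)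
      then obtain n where "\<beta> = r n" using r by auto
      then have "snd (w i) = r n i" for i by (auto simp: \<beta>_def fun_eq_iff)
      then show False using T(4)[of n] w by metis
    qed
  qed
  show ?thesis
  proof (intro exI conjI allI)
    show "meas_fun M (F [] n)" for n by (rule F(1))
    show "AE x in M. \<forall>\<beta>. (x, \<beta>) \<in> souslin A \<longrightarrow> (\<exists>n. \<beta> = F [] n x)"
      using root AE_space
    proof eventually_elim
      case (elim x)
      then have "x \<in> Z []" by (simp add: E_def)
      moreover have "\<beta> \<in> Sec [] x" if "(x, \<beta>) \<in> souslin A" for \<beta>
        using that by (auto simp: Sec_def souslin_def pth_def)
      ultimately show ?case using F(2) by blast
    qed
  qed
qed

text \<open>An almost everywhere form of the Lusin-Novikov theorem. The second coordinate is encoded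
  by its position relative to the rationals, which moves the relation into the product with the
  Cantor space, where the Souslin argument applies.\<close>

lemma countable_sections_covered:
  assumes std: "standard_prob_space M" and R: "R \<in> sets (M \<Otimes>\<^sub>M M)"
    and cnt: "\<And>x. x \<in> space M \<Longrightarrow> countable (R `` {x})"
  shows "\<exists>f :: nat \<Rightarrow> 'a \<Rightarrow> 'a. (\<forall>n. f n \<in> M \<rightarrow>\<^sub>M M) \<and>
    (AE x in M. \<forall>y. (x, y) \<in> R \<longrightarrow> (\<exists>n. y = f n x))"
proof -
  interpret prob_space M using std by (simp add: standard_prob_space_def)
  obtain e :: "'a \<Rightarrow> real" and B where e: "B \<in> sets borel" "bij_betw e (space M) B" "e \<in> M \<rightarrow>\<^sub>M borel"
    "\<And>A. A \<in> sets M \<Longrightarrow> e ` A \<in> sets borel"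
    using std by (auto simp: standard_prob_space_def standard_borel_def)
  obtain y0 where y0: "y0 \<in> space M" using not_empty by blast
  define q where "q n = real_of_rat (from_nat n)" for n
  have q_dense: "\<exists>n. a < q n \<and> q n < b" if "a < b" for a b
    using of_rat_dense[OF that] unfolding q_def by (metis from_nat_to_nat)
  define bits where "bits y n \<longleftrightarrow> q n < e y" for y n
  define rb where "rb \<beta> = (SUP n. if \<beta> n then ereal (q n) else -\<infinity>)" for \<beta> :: "nat \<Rightarrow> bool"
  have rb_meas: "rb \<in> borel_measurable Cantor"
    unfolding rb_def using Cantor_coord by (intro borel_measurable_SUP measurable_If) (auto simp: pred_def)
  have rb_bits: "rb (bits y) = ereal (e y)" for y
    unfolding rb_def
  proof (rule antisym)
    show "(SUP n. if bits y n then ereal (q n) else -\<infinity>) \<le> ereal (e y)"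
      by (rule SUP_least) (auto simp: bits_def)
    show "ereal (e y) \<le> (SUP n. if bits y n then ereal (q n) else -\<infinity>)"
    proof (rule dense_le)
      fix z assume z: "z < ereal (e y)"
      show "z \<le> (SUP n. if bits y n then ereal (q n) else -\<infinity>)"
      proof (cases z)
        case (real a)
        then obtain n where "a < q n" "q n < e y" using q_dense[of a "e y"] z by auto
        then have "z \<le> (if bits y n then ereal (q n) else -\<infinity>)" using real by (simp add: bits_def)
        then show ?thesis by (rule order_trans) (rule SUP_upper, simp)
      qed (use z in auto)
    qed
  qed
  \<comment> \<open>The range of \<open>bits\<close>, described by measurable conditions:
    \<open>rb\<close> recovers the real number as a supremum of rationals, and the bits must be
    those of that number. Outside this range the decoding takes the default value \<open>y0\<close>,
    which keeps it total and measurable.\<close>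
  define Gs where "Gs = {\<beta>. (\<forall>n. \<beta> n \<longleftrightarrow> ereal (q n) < rb \<beta>) \<and> \<bar>rb \<beta>\<bar> \<noteq> \<infinity> \<and> real_of_ereal (rb \<beta>) \<in> B}"
  have Gs: "Gs \<in> sets Cantor"
  proof -
    note Cantor_coord[measurable] rb_meas[measurable] e(1)[measurable]
    have "Measurable.pred Cantor (\<lambda>\<beta>. (\<forall>n. \<beta> n \<longleftrightarrow> ereal (q n) < rb \<beta>) \<and> \<bar>rb \<beta>\<bar> \<noteq> \<infinity> \<and> real_of_ereal (rb \<beta>) \<in> B)"
      by measurable
    then show ?thesis by (simp add: pred_def Gs_def)
  qed
  define dec where "dec \<beta> = (if \<beta> \<in> Gs then the_inv_into (space M) e (real_of_ereal (rb \<beta>)) else y0)" for \<beta>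
  have e_inj: "inj_on e (space M)" and e_im: "e ` space M = B" using e(2) by (auto simp: bij_betw_def)
  have dec_in: "dec \<beta> \<in> space M" for \<beta>
    using the_inv_into_into[OF e_inj, of "real_of_ereal (rb \<beta>)" "space M"] y0 by (auto simp: dec_def Gs_def e_im)
  have e_dec: "e (dec \<beta>) = real_of_ereal (rb \<beta>)" if "\<beta> \<in> Gs" for \<beta>
    using f_the_inv_into_f[OF e_inj, of "real_of_ereal (rb \<beta>)"] that by (simp add: dec_def Gs_def e_im)
  have bits_Gs: "bits y \<in> Gs" if "y \<in> space M" for y
    using that e_im by (auto simp: Gs_def rb_bits bits_def)
  have dec_bits: "dec (bits y) = y" if "y \<in> space M" for y
    using that bits_Gs[OF that] the_inv_into_f_f[OF e_inj that] by (simp add: dec_def rb_bits)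
  have bits_dec: "bits (dec \<beta>) = \<beta>" if "\<beta> \<in> Gs" for \<beta>
  proof
    fix n
    have "bits (dec \<beta>) n \<longleftrightarrow> ereal (q n) < rb \<beta>"
    proof -
      have "\<bar>rb \<beta>\<bar> \<noteq> \<infinity>"
        using that by (simp only: Gs_def mem_Collect_eq not_False_eq_True)
      then have "rb \<beta> = ereal (e (dec \<beta>))" unfolding e_dec[OF that] by (cases "rb \<beta>") auto
      then show ?thesis by (simp only: bits_def ereal_less_eq less_ereal.simps)
    qed
    moreover have "\<beta> n \<longleftrightarrow> ereal (q n) < rb \<beta>" using that by (simp only: Gs_def mem_Collect_eq)
    ultimately show "bits (dec \<beta>) n = \<beta> n" by blast
  qed
  have dec_meas: "dec \<in> Cantor \<rightarrow>\<^sub>M M"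
  proof (rule measurableI)
    fix S assume S: "S \<in> sets M"
    note Cantor_coord[measurable] rb_meas[measurable] Gs[measurable] e(4)[OF S, measurable]
    have "dec \<beta> \<in> S \<longleftrightarrow> (if \<beta> \<in> Gs then real_of_ereal (rb \<beta>) \<in> e ` S else y0 \<in> S)" for \<beta>
    proof (cases "\<beta> \<in> Gs")
      case True
      have "e (dec \<beta>) \<in> e ` S \<longleftrightarrow> dec \<beta> \<in> S"
        using inj_on_image_mem_iff[OF e_inj dec_in sets.sets_into_space[OF S]] .
      then show ?thesis using True e_dec[OF True] by simp
    qed (simp add: dec_def)
    then have "dec -` S \<inter> space Cantor = {\<beta> \<in> space Cantor. (if \<beta> \<in> Gs then real_of_ereal (rb \<beta>) \<in> e ` S else y0 \<in> S)}"
      by auto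
    also have "\<dots> \<in> sets Cantor" by measurable
    finally show "dec -` S \<inter> space Cantor \<in> sets Cantor" .
  qed (rule dec_in)
  define R' where "R' = {p \<in> space (M \<Otimes>\<^sub>M Cantor). snd p \<in> Gs \<and> (fst p, dec (snd p)) \<in> R}"
  have "R' \<in> sets (M \<Otimes>\<^sub>M Cantor)"
  proof -
    note dec_meas[measurable] Gs[measurable] R[measurable]
    show ?thesis unfolding R'_def by measurable
  qed
  then obtain A where A: "\<And>t. A t \<in> sets M" "R' = souslin A"
    using analytic_over_pair_sets unfolding analytic_over_def by blast
  have cntS: "countable {\<beta>. (x, \<beta>) \<in> souslin A}" if "x \<in> space M" for x
  proof (rule countable_subset)
    show "{\<beta>. (x, \<beta>) \<in> souslin A} \<subseteq> bits ` (R `` {x})"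
    proof
      fix \<beta> assume "\<beta> \<in> {\<beta>. (x, \<beta>) \<in> souslin A}"
      then have "\<beta> \<in> Gs" "(x, dec \<beta>) \<in> R" by (auto simp: A(2)[symmetric] R'_def)
      then show "\<beta> \<in> bits ` (R `` {x})" using bits_dec by (intro image_eqI[of _ _ "dec \<beta>"]) auto
    qed
  qed (simp add: cnt[OF that])
  obtain F where F: "\<And>n::nat. meas_fun M (F n)" "AE x in M. \<forall>\<beta>. (x, \<beta>) \<in> souslin A \<longrightarrow> (\<exists>n. \<beta> = F n x)"
    using countable_sections_covered_Cantor[OF A(1) cntS] by auto
  have "F n \<in> M \<rightarrow>\<^sub>M Cantor" for n
    unfolding Cantor_def
  proof (rule measurable_measure_of)
    fix S :: "(nat \<Rightarrow> bool) set" assume "S \<in> range (\<lambda>m. {\<beta>. \<beta> m})"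
    then obtain m where "S = {\<beta>. \<beta> m}" by auto
    then have "F n -` S \<inter> space M = {x \<in> space M. F n x m}" by auto
    then show "F n -` S \<inter> space M \<in> sets M" using F(1) by (simp add: meas_fun_def)
  qed auto
  then have meas: "(\<lambda>x. dec (F n x)) \<in> M \<rightarrow>\<^sub>M M" for n
    using dec_meas by (rule measurable_compose)
  have "AE x in M. \<forall>y. (x, y) \<in> R \<longrightarrow> (\<exists>n. y = dec (F n x))"
    using F(2)
  proof eventually_elim
    case (elim x)
    show ?case
    proof (intro allI impI)
      fix y assume xy: "(x, y) \<in> R"
      then have sp: "x \<in> space M" "y \<in> space M" using sets.sets_into_space[OF R] by (auto simp: space_pair_measure)
      then have "(x, bits y) \<in> souslin A"
        using xy by (auto simp: A(2)[symmetric] R'_def space_pair_measure bits_Gs dec_bits)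
      then obtain n where "bits y = F n x" using elim by blast
      then have "y = dec (F n x)" using dec_bits[OF sp(2)] by simp
      then show "\<exists>n. y = dec (F n x)" ..
    qed
  qed
  then show ?thesis using meas by (intro exI[of _ "\<lambda>n x. dec (F n x)"]) simp
qed

section \<open>Convex combinations and circumcenters of orbits\<close>

lemma lsum_const: "lsum (\<lambda>_. c) xs = c * lsum (\<lambda>_. 1) xs"
  using lsum_mult_left[of c "\<lambda>_. 1" xs] by simp

definition lconv :: "'i set \<Rightarrow> (real \<times> 'i) list \<Rightarrow> bool" where
  "lconv A xs \<longleftrightarrow> snd ` set xs \<subseteq> A \<and> (\<forall>(c, i)\<in>set xs. 0 \<le> c) \<and> lsum (\<lambda>_. 1) xs = 1"

lemma lconvD:
  assumes "lconv A xs"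
  shows "snd ` set xs \<subseteq> A" "\<And>c i. (c, i) \<in> set xs \<Longrightarrow> 0 \<le> c" "lsum (\<lambda>_. 1) xs = 1"
    "lsum (\<lambda>_. c) xs = c"
proof -
  show 1: "lsum (\<lambda>_. 1) xs = 1" using assms by (simp add: lconv_def)
  then show "lsum (\<lambda>_. c) xs = c" by (subst lsum_const) simp
qed (use assms in \<open>unfold lconv_def, blast\<close>)+

lemma lconv_single: "i \<in> A \<Longrightarrow> lconv A [(1, i)]"
  by (simp add: lconv_def)

lemma lconv_lmap: "lconv A xs \<Longrightarrow> f ` A \<subseteq> B \<Longrightarrow> lconv B (lmap f xs)"
proof -
  assume *: "lconv A xs" "f ` A \<subseteq> B"
  have "f ` snd ` set xs \<subseteq> B" using image_mono[OF lconvD(1)[OF *(1)]] *(2) by (rule order_trans)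
  then have "snd ` set (lmap f xs) \<subseteq> B" unfolding set_lmap .
  moreover have "0 \<le> c" if "(c, i) \<in> set (lmap f xs)" for c i
    using that lconvD(2)[OF *(1)] by (auto simp: lmap_def)
  moreover have "lsum (\<lambda>_. 1) (lmap f xs) = 1" using lconvD(3)[OF *(1)] by simp
  ultimately show ?thesis unfolding lconv_def by blast
qed

lemma lconv_midpoint: "lconv A xs \<Longrightarrow> lconv A ys \<Longrightarrow> lconv A (lscale (1/2) (xs @ ys))"
proof -
  assume *: "lconv A xs" "lconv A ys"
  have "0 \<le> c" if "(c, i) \<in> set (lscale (1/2) (xs @ ys))" for c i
    using that lconvD(2)[OF *(1)] lconvD(2)[OF *(2)] by (auto simp: lscale_def)
  moreover have "snd ` set (lscale (1/2) (xs @ ys)) \<subseteq> A"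
    using lconvD(1)[OF *(1)] lconvD(1)[OF *(2)] by (simp add: image_Un)
  moreover have "lsum (\<lambda>_. 1) (lscale (1/2) (xs @ ys)) = 1"
    using lconvD(3)[OF *(1)] lconvD(3)[OF *(2)] by (simp only: lsum_lscale lsum_append) simp
  ultimately show ?thesis unfolding lconv_def by blast
qed

lemma lsum_conv_le:
  assumes "lconv A xs" "\<And>i. i \<in> A \<Longrightarrow> f i \<le> C"
  shows "lsum f xs \<le> C"
proof -
  have "lsum f xs \<le> lsum (\<lambda>_. C) xs"
    by (rule lsum_mono) (use assms lconvD(1,2)[OF assms(1)] in force)
  then show ?thesis by (simp add: lconvD(4)[OF assms(1)])
qed

text \<open>Polarization: on combinations of total mass zero the terms \<open>K i i\<close> and
  \<open>K j j\<close> of the squared distance cancel. Hence an action that preserves only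
  distances, an affine isometric one, still acts isometrically on differences.\<close>

lemma lform_zero_sum:
  assumes "lsum (\<lambda>_. 1) zs = 0"
  shows "lform K zs zs = - (1/2) * lsum (\<lambda>i. lsum (\<lambda>j. kdist K i j) zs) zs"
proof -
  have c: "lsum (\<lambda>_. c) zs = 0" for c using assms by (simp add: lsum_const[of c])
  have "lsum (\<lambda>i. lsum (\<lambda>j. kdist K i j) zs) zs = - 2 * lform K zs zs"
    unfolding kdist_def lform_def by (simp add: lsum_diff lsum_add lsum_mult_left c)
  then show ?thesis by simp
qed

lemma lform_zero_sum_invariant:
  assumes "lsum (\<lambda>_. 1) zs = 0" "\<And>i j. i \<in> snd ` set zs \<Longrightarrow> j \<in> snd ` set zs \<Longrightarrow> kdist K' (f i) (f j) = kdist K i j"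
  shows "lform K' (lmap f zs) (lmap f zs) = lform K zs zs"
proof -
  have "lsum (\<lambda>_. 1) (lmap f zs) = 0" using assms(1) by simp
  then have "lform K' (lmap f zs) (lmap f zs) = - (1/2) * lsum (\<lambda>i. lsum (\<lambda>j. kdist K' (f i) (f j)) zs) zs"
    by (subst lform_zero_sum) simp_all
  also have "lsum (\<lambda>i. lsum (\<lambda>j. kdist K' (f i) (f j)) zs) zs = lsum (\<lambda>i. lsum (\<lambda>j. kdist K i j) zs) zs"
    by (intro lsum_cong assms(2))
  finally show ?thesis by (simp add: lform_zero_sum[OF assms(1)])
qed

text \<open>Balls are convex. All mixed inner products of the vectors \<open>i - zs\<close> are
  bounded by \<open>C\<close> since the square of a difference is nonnegative, and the form at
  \<open>xs - zs\<close> is a convex average of them.\<close>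

lemma lform_conv_le:
  assumes K: "psd_on A K" and xs: "lconv B xs" "B \<subseteq> A" and zs: "snd ` set zs \<subseteq> A"
    and C: "\<And>i. i \<in> B \<Longrightarrow> lform K (ldiff [(1, i)] zs) (ldiff [(1, i)] zs) \<le> C"
  shows "lform K (ldiff xs zs) (ldiff xs zs) \<le> C"
proof -
  define b where "b i j = lform K (ldiff [(1, i)] zs) (ldiff [(1, j)] zs)" for i j
  have b_le: "b i j \<le> C" if "i \<in> B" "j \<in> B" for i j
  proof -
    have D: "snd ` set (ldiff [(1, i)] zs) \<subseteq> A" if "i \<in> B" for i
      using zs xs(2) that by auto
    have "0 \<le> lform K (ldiff (ldiff [(1, i)] zs) (ldiff [(1, j)] zs)) (ldiff (ldiff [(1, i)] zs) (ldiff [(1, j)] zs))"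
      by (rule lform_nonneg[OF K]) (use D that in auto)
    also have "\<dots> = b i i - 2 * b i j + b j j"
      unfolding b_def by (rule lform_ldiff_self[OF K]) (use D that in auto)
    finally show ?thesis using C[OF that(1)] C[OF that(2)] by (simp add: b_def)
  qed
  have "lform K (ldiff xs zs) (ldiff xs zs) = lsum (\<lambda>i. lsum (b i) xs) xs"
  proof -
    have b: "b i j = K i j - lsum (K i) zs - lsum (\<lambda>z. K z j) zs + lform K zs zs" for i j
      by (simp add: b_def) (simp add: lform_def)
    have "lsum (\<lambda>i. lsum (b i) xs) xs =
        lform K xs xs - lform K xs zs - lsum (\<lambda>j. lsum (\<lambda>z. K z j) zs) xs + lform K zs zs"
      unfolding b by (simp add: lsum_add lsum_diff lconvD(4)[OF xs(1)] lform_def)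
    also have "lsum (\<lambda>j. lsum (\<lambda>z. K z j) zs) xs = lform K zs xs"
      by (subst lsum_swap) (simp add: lform_def)
    finally show ?thesis by simp
  qed
  also have "\<dots> \<le> C"
    by (intro lsum_conv_le[OF xs(1)] b_le)
  finally show ?thesis .
qed

text \<open>The convex combinations minimize the circumradius of the orbit approximately; by the parallelogram
  identity almost minimizers are close to each other, and so to their translates.\<close>

lemma circumcenter:
  fixes G (structure)
  assumes G: "group G" and H: "subgroup H G" and K: "psd_on (carrier G) K"
    and inv: "\<And>k g h. k \<in> carrier G \<Longrightarrow> g \<in> carrier G \<Longrightarrow> h \<in> carrier G \<Longrightarrow>
        kdist K (k \<otimes> g) (k \<otimes> h) = kdist K g h"
    and bdd: "\<And>h. h \<in> H \<Longrightarrow> kdist K \<one> h \<le> C"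
  shows "\<exists>xs :: nat \<Rightarrow> (real \<times> 'a) list. \<forall>n. lconv H (xs n) \<and>
    lform K (ldiff (xs (Suc n)) (xs n)) (ldiff (xs (Suc n)) (xs n)) \<le> 4 * (1/4)^n \<and>
    (\<forall>h\<in>H. lform K (ldiff (lmap ((\<otimes>) h) (xs n)) (xs n)) (ldiff (lmap ((\<otimes>) h) (xs n)) (xs n)) \<le> 4 * (1/4)^n) \<and>
    lform K (ldiff (xs n) [(1, \<one>)]) (ldiff (xs n) [(1, \<one>)]) \<le> C"
proof -
  interpret group G by (rule G)
  interpret H: subgroup H G by (rule H)
  define q where "q xs = lform K xs xs" for xs
  have HG: "h \<in> carrier G" if "h \<in> H" for h using that by (rule H.mem_carrier)
  have dist: "q (ldiff [(1, g)] [(1, h)]) \<le> C" if "g \<in> H" "h \<in> H" for g h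
  proof -
    have "q (ldiff [(1, g)] [(1, h)]) = kdist K g h"
      unfolding q_def using that HG by (intro kdist_lnorm[OF K]) auto
    also have "\<dots> = kdist K (inv g \<otimes> g) (inv g \<otimes> h)"
      by (rule inv[symmetric]) (use that HG in auto)
    also have "\<dots> \<le> C" using that HG by (simp add: bdd)
    finally show ?thesis .
  qed
  have qC: "q (ldiff [(1, g)] xs) \<le> C" if "lconv H xs" "g \<in> H" for g xs
  proof -
    have sub: "snd ` set xs \<subseteq> carrier G" using lconvD(1)[OF that(1)] HG by blast
    have "q (ldiff [(1, g)] xs) = q (ldiff xs [(1, g)])"
      unfolding q_def using sub that HG by (simp add: lform_ldiff_self[OF K] lform_sym[OF K, of "[(1, g)]" xs])
    also have "\<dots> \<le> C"
      unfolding q_def using that HG dist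
      by (intro lform_conv_le[OF K that(1)]) (auto simp: q_def)
    finally show ?thesis .
  qed
  define R where "R xs = (SUP g\<in>H. q (ldiff [(1, g)] xs))" for xs
  have bR: "bdd_above ((\<lambda>g. q (ldiff [(1, g)] xs)) ` H)" if "lconv H xs" for xs
    using qC[OF that] by (auto intro!: bdd_aboveI)
  have R_ge: "q (ldiff [(1, g)] xs) \<le> R xs" if "lconv H xs" "g \<in> H" for xs g
    unfolding R_def by (rule cSUP_upper[OF that(2) bR[OF that(1)]])
  have q_nonneg: "0 \<le> q xs" if "snd ` set xs \<subseteq> carrier G" for xs
    unfolding q_def by (rule lform_nonneg[OF K that])
  have convG: "snd ` set xs \<subseteq> carrier G" if "lconv H xs" for xs
    using lconvD(1)[OF that] HG by blast
  have R_nonneg: "0 \<le> R xs" if "lconv H xs" for xs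
  proof -
    have "0 \<le> q (ldiff [(1, \<one>)] xs)" using convG[OF that] by (intro q_nonneg) auto
    also have "\<dots> \<le> R xs" by (rule R_ge[OF that H.one_closed])
    finally show ?thesis .
  qed
  define r where "r = (INF xs\<in>{xs. lconv H xs}. R xs)"
  have conv1: "lconv H [(1, \<one>)]" by (rule lconv_single) simp
  have bI: "bdd_below (R ` {xs. lconv H xs})" using R_nonneg by (auto intro!: bdd_belowI)
  have r_le: "r \<le> R xs" if "lconv H xs" for xs
    unfolding r_def using that by (intro cINF_lower[OF bI]) auto
  have close: "q (ldiff xs ys) \<le> 4 * \<eta>"
    if xs: "lconv H xs" "\<And>g. g \<in> H \<Longrightarrow> q (ldiff [(1, g)] xs) \<le> r + \<eta>"
      and ys: "lconv H ys" "\<And>g. g \<in> H \<Longrightarrow> q (ldiff [(1, g)] ys) \<le> r + \<eta>" for xs ys \<eta>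
  proof -
    define m where "m = lscale (1/2) (xs @ ys)"
    have m: "lconv H m" unfolding m_def by (rule lconv_midpoint[OF xs(1) ys(1)])
    have para: "q (ldiff [(1, g)] m) = 1/2 * q (ldiff [(1, g)] xs) + 1/2 * q (ldiff [(1, g)] ys) - 1/4 * q (ldiff xs ys)"
      for g
      by (simp add: q_def m_def) (simp add: field_simps)
    have "r \<le> r + \<eta> - 1/4 * q (ldiff xs ys)"
    proof -
      have "R m \<le> r + \<eta> - 1/4 * q (ldiff xs ys)"
        unfolding R_def
      proof (rule cSUP_least)
        show "H \<noteq> {}" using H.one_closed by blast
        fix g assume g: "g \<in> H"
        then show "q (ldiff [(1, g)] m) \<le> r + \<eta> - 1/4 * q (ldiff xs ys)"
          using xs(2)[OF g] ys(2)[OF g] unfolding para by linarith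
      qed
      then show ?thesis using r_le[OF m] by linarith
    qed
    then show ?thesis by linarith
  qed
  \<comment> \<open>The excess \<open>(1/4)^n\<close> over the infimum becomes, through
    \<open>close\<close>, a squared distance of at most \<open>4 * (1/4)^n\<close>. This geometric
    rate is what later gives pointwise convergence almost everywhere.\<close>
  have "\<exists>xs. lconv H xs \<and> R xs < r + (1/4)^n" for n
  proof (rule ccontr)
    assume "\<not> ?thesis"
    then have "r + (1/4)^n \<le> R xs" if "lconv H xs" for xs using that by (meson not_le)
    then have "r + (1/4)^n \<le> r"
      unfolding r_def using conv1 by (intro cINF_greatest) (auto simp: r_def)
    then show False using zero_less_power[of "1/4::real" n] by linarith
  qed
  then have "\<exists>xs. \<forall>n. lconv H (xs n) \<and> R (xs n) < r + (1/4)^n" by (intro choice allI)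
  then obtain xs where xs: "\<And>n. lconv H (xs n)" "\<And>n. R (xs n) < r + (1/4)^n" by blast
  have xs_le: "q (ldiff [(1, g)] (xs n)) \<le> r + (1/4)^n" if "g \<in> H" for g n
    using R_ge[OF xs(1) that, of n] xs(2)[of n] by linarith
  have xs_le': "q (ldiff [(1, g)] (xs (Suc n))) \<le> r + (1/4)^n" if "g \<in> H" for g n
  proof -
    have "(1/4 :: real)^Suc n \<le> (1/4)^n" by (rule power_decreasing) auto
    then show ?thesis using xs_le[OF that, of "Suc n"] by linarith
  qed
  show ?thesis
  proof (intro exI allI conjI ballI)
    fix n
    show "lconv H (xs n)" by (rule xs)
    show "lform K (ldiff (xs (Suc n)) (xs n)) (ldiff (xs (Suc n)) (xs n)) \<le> 4 * (1/4)^n"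
      using close[OF xs(1) xs_le' xs(1) xs_le, of n] by (simp add: q_def)
    fix h assume h: "h \<in> H"
    have conv_h: "lconv H (lmap ((\<otimes>) h) (xs n))"
      by (rule lconv_lmap[OF xs(1)]) (use h in auto)
    have "q (ldiff [(1, g)] (lmap ((\<otimes>) h) (xs n))) \<le> r + (1/4)^n" if g: "g \<in> H" for g
    proof -
      \<comment> \<open>Only distances are invariant, so the translation by \<open>h\<close> is
        applied to a combination of total mass zero.\<close>
      have zs: "lsum (\<lambda>_. 1) (ldiff [(1, inv h \<otimes> g)] (xs n)) = 0"
        using lconvD(3)[OF xs(1)] by simp
      have "q (lmap ((\<otimes>) h) (ldiff [(1, inv h \<otimes> g)] (xs n))) = q (ldiff [(1, inv h \<otimes> g)] (xs n))"
        unfolding q_def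
      proof (rule lform_zero_sum_invariant[OF zs inv])
        show "h \<in> carrier G" using h HG by blast
      qed (use convG[OF xs(1), of n] h g HG in auto)
      moreover have "lmap ((\<otimes>) h) (ldiff [(1, inv h \<otimes> g)] (xs n)) = ldiff [(1, g)] (lmap ((\<otimes>) h) (xs n))"
        using h g HG by (simp add: ldiff_def lmap_def lscale_def split_beta m_assoc[symmetric])
      ultimately show ?thesis using xs_le[of "inv h \<otimes> g" n] h g by simp
    qed
    then show "lform K (ldiff (lmap ((\<otimes>) h) (xs n)) (xs n)) (ldiff (lmap ((\<otimes>) h) (xs n)) (xs n)) \<le> 4 * (1/4)^n"
      using close[OF conv_h _ xs(1) xs_le, of n] by (simp add: q_def)
  next
    fix n
    show "lform K (ldiff (xs n) [(1, \<one>)]) (ldiff (xs n) [(1, \<one>)]) \<le> C"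
      using dist HG by (intro lform_conv_le[OF K xs(1)]) (auto simp: q_def)
  qed
qed

section \<open>Two actions compared: the kernel of agreement and the equivariant map\<close>

definition separating :: "'b measure \<Rightarrow> (nat \<Rightarrow> 'b set) \<Rightarrow> bool" where
  "separating \<Omega> Q \<longleftrightarrow> (\<forall>n. Q n \<in> sets \<Omega>) \<and>
     (\<forall>x\<in>space \<Omega>. \<forall>y\<in>space \<Omega>. (\<forall>n. x \<in> Q n \<longleftrightarrow> y \<in> Q n) \<longrightarrow> x = y)"

text \<open>The diagonal of a general measurable space need not be measurable; a countable family
  separating points reduces equality of two maps to countably many measurable conditions.\<close>

lemma separating_pred_eq:
  assumes Q: "separating \<Omega> Q" and f: "f \<in> \<Omega> \<rightarrow>\<^sub>M \<Omega>" and g: "g \<in> \<Omega> \<rightarrow>\<^sub>M \<Omega>"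
  shows "Measurable.pred \<Omega> (\<lambda>x. f x = g x)"
proof -
  have QM: "Q n \<in> sets \<Omega>" for n using Q by (simp add: separating_def)
  have "f x = g x \<longleftrightarrow> (\<forall>n. f x \<in> Q n \<longleftrightarrow> g x \<in> Q n)" if "x \<in> space \<Omega>" for x
    using Q measurable_space[OF f that] measurable_space[OF g that] by (auto simp: separating_def)
  moreover have "Measurable.pred \<Omega> (\<lambda>x. \<forall>n. f x \<in> Q n \<longleftrightarrow> g x \<in> Q n)"
    using QM f g by measurable
  ultimately show ?thesis by (subst measurable_cong) auto
qed

text \<open>The sum of the functions \<open>2^n * f n\<close> has finite integral, hence is finite
  almost everywhere; half of the decay in the exponent is traded for a pointwise bound.\<close>

lemma AE_geometric:
  fixes f :: "nat \<Rightarrow> 'b \<Rightarrow> real"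
  assumes int: "\<And>n. integrable M (f n)" and nonneg: "\<And>n x. 0 \<le> f n x"
    and le: "\<And>n. (\<integral>x. f n x \<partial>M) \<le> C * (1/4)^n"
  shows "AE x in M. \<exists>B. \<forall>n. f n x \<le> B * (1/2)^n"
proof -
  have "0 \<le> (\<integral>x. f 0 x \<partial>M)" using nonneg by (intro integral_nonneg_AE AE_I2)
  then have C: "0 \<le> C" using le[of 0] by simp
  define S where "S x = (\<Sum>n. ennreal (2^n * f n x))" for x
  have meas: "f n \<in> borel_measurable M" for n using int by blast
  have "(\<integral>\<^sup>+x. S x \<partial>M) = (\<Sum>n. \<integral>\<^sup>+x. ennreal (2^n * f n x) \<partial>M)"
    unfolding S_def using meas by (intro nn_integral_suminf) measurable
  also have "\<dots> \<le> (\<Sum>n. ennreal (C * (1/2)^n))"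
  proof (rule suminf_le)
    fix n
    have "(\<integral>\<^sup>+x. ennreal (2^n * f n x) \<partial>M) = ennreal (\<integral>x. 2^n * f n x \<partial>M)"
      using int nonneg by (intro nn_integral_eq_integral) auto
    also have "(\<integral>x. 2^n * f n x \<partial>M) = 2^n * (\<integral>x. f n x \<partial>M)" by simp
    also have "\<dots> \<le> 2^n * (C * (1/4)^n)" by (intro mult_left_mono le) simp
    also have "\<dots> = C * (1/2)^n" by (simp add: power_divide power_mult_distrib[symmetric] field_simps)
    finally show "(\<integral>\<^sup>+x. ennreal (2^n * f n x) \<partial>M) \<le> ennreal (C * (1/2)^n)"
      by (simp add: ennreal_leI)
  qed auto
  also have "\<dots> = ennreal (\<Sum>n. C * (1/2)^n)"
    using C by (intro suminf_ennreal2) (auto intro!: summable_mult summable_geometric)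
  also have "\<dots> < \<infinity>" by simp
  finally have "(\<integral>\<^sup>+x. S x \<partial>M) \<noteq> \<infinity>" by simp
  moreover have "S \<in> borel_measurable M" unfolding S_def using meas by measurable
  ultimately have "AE x in M. S x \<noteq> \<infinity>" by (intro nn_integral_noteq_infinite)
  then show ?thesis
  proof eventually_elim
    case (elim x)
    have "f n x \<le> enn2real (S x) * (1/2)^n" for n
    proof -
      have "ennreal (2^n * f n x) \<le> S x"
        unfolding S_def using sum_le_suminf[of "\<lambda>n. ennreal (2^n * f n x)" "{n}"] by auto
      then have "enn2real (ennreal (2^n * f n x)) \<le> enn2real (S x)"
        using elim by (intro enn2real_mono) (auto simp: top.not_eq_extremum)
      then have "2^n * f n x \<le> enn2real (S x)" using nonneg by simp
      then show ?thesis by (simp add: power_divide field_simps)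
    qed
    then show ?case by blast
  qed
qed

locale paired_actions =
  fixes \<Omega> :: "'b measure" and Q :: "nat \<Rightarrow> 'b set"
    and G :: "'w set" and mult :: "'w \<Rightarrow> 'w \<Rightarrow> 'w" and unit :: 'w and iv :: "'w \<Rightarrow> 'w"
    and a b :: "'w \<Rightarrow> 'b \<Rightarrow> 'b" and Y1 Y2 :: "'b set"
  assumes sep: "separating \<Omega> Q"
    and cG: "countable G" and unit_in: "unit \<in> G"
    and mult_in: "\<And>g h. g \<in> G \<Longrightarrow> h \<in> G \<Longrightarrow> mult g h \<in> G" and iv_in: "\<And>g. g \<in> G \<Longrightarrow> iv g \<in> G"
    and aM: "\<And>g. g \<in> G \<Longrightarrow> a g \<in> \<Omega> \<rightarrow>\<^sub>M \<Omega>" and bM: "\<And>g. g \<in> G \<Longrightarrow> b g \<in> \<Omega> \<rightarrow>\<^sub>M \<Omega>"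
    and a_mult: "\<And>g h x. g \<in> G \<Longrightarrow> h \<in> G \<Longrightarrow> x \<in> space \<Omega> \<Longrightarrow> a (mult g h) x = a g (a h x)"
    and b_mult: "\<And>g h x. g \<in> G \<Longrightarrow> h \<in> G \<Longrightarrow> x \<in> space \<Omega> \<Longrightarrow> b (mult g h) x = b g (b h x)"
    and a_unit: "\<And>x. x \<in> space \<Omega> \<Longrightarrow> a unit x = x" and b_unit: "\<And>x. x \<in> space \<Omega> \<Longrightarrow> b unit x = x"
    and a_iv: "\<And>g x. g \<in> G \<Longrightarrow> x \<in> space \<Omega> \<Longrightarrow> a (iv g) (a g x) = x"
    and a_iv': "\<And>g x. g \<in> G \<Longrightarrow> x \<in> space \<Omega> \<Longrightarrow> a g (a (iv g) x) = x"
    and b_iv: "\<And>g x. g \<in> G \<Longrightarrow> x \<in> space \<Omega> \<Longrightarrow> b (iv g) (b g x) = x"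
    and b_iv': "\<And>g x. g \<in> G \<Longrightarrow> x \<in> space \<Omega> \<Longrightarrow> b g (b (iv g) x) = x"
    and a_mp: "\<And>g A. g \<in> G \<Longrightarrow> A \<in> sets \<Omega> \<Longrightarrow> emeasure \<Omega> (a g -` A \<inter> space \<Omega>) = emeasure \<Omega> A"
    and b_mp: "\<And>g A. g \<in> G \<Longrightarrow> A \<in> sets \<Omega> \<Longrightarrow> emeasure \<Omega> (b g -` A \<inter> space \<Omega>) = emeasure \<Omega> A"
    and Y1: "Y1 \<in> sets \<Omega>" "emeasure \<Omega> Y1 < \<infinity>" and Y2: "Y2 \<in> sets \<Omega>" "emeasure \<Omega> Y2 < \<infinity>"
    and a_Y1: "\<And>g x. g \<in> G \<Longrightarrow> x \<in> Y1 \<Longrightarrow> a g x \<in> Y1" and b_Y2: "\<And>g x. g \<in> G \<Longrightarrow> x \<in> Y2 \<Longrightarrow> b g x \<in> Y2"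
begin

lemma Y1_space: "x \<in> Y1 \<Longrightarrow> x \<in> space \<Omega>" and Y2_space: "x \<in> Y2 \<Longrightarrow> x \<in> space \<Omega>"
  using Y1 Y2 sets.sets_into_space by auto

lemma a_space: "g \<in> G \<Longrightarrow> x \<in> space \<Omega> \<Longrightarrow> a g x \<in> space \<Omega>"
  and b_space: "g \<in> G \<Longrightarrow> x \<in> space \<Omega> \<Longrightarrow> b g x \<in> space \<Omega>"
  using aM bM by (auto dest: measurable_space)

lemma a_iv_mult: "k \<in> G \<Longrightarrow> g \<in> G \<Longrightarrow> x \<in> space \<Omega> \<Longrightarrow> a (iv (mult k g)) x = a (iv g) (a (iv k) x)"
proof -
  assume *: "k \<in> G" "g \<in> G" "x \<in> space \<Omega>"
  define y where "y = a (iv g) (a (iv k) x)"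
  have y: "y \<in> space \<Omega>" using * by (simp add: y_def a_space iv_in)
  have "a (mult k g) y = x" using * by (simp add: y_def a_mult a_space iv_in a_iv')
  then show ?thesis using a_iv[of "mult k g" y] * y mult_in by (simp add: y_def)
qed

definition v :: "'w \<Rightarrow> 'b \<Rightarrow> 'b" where
  "v g x = b g (a (iv g) x)"

text \<open>The domain of \<open>v g\<close> as a partial map from \<open>Y1\<close> to
  \<open>Y2\<close>. The condition is imposed before \<open>b g\<close> is applied, which is enough
  because \<open>b g\<close> maps \<open>Y2\<close> into itself.\<close>

definition dm :: "'w \<Rightarrow> 'b set" where
  "dm g = {x \<in> Y1. a (iv g) x \<in> Y2}"

definition ind :: "'b \<Rightarrow> 'w \<Rightarrow> 'w \<Rightarrow> real" where
  "ind x g h = (if x \<in> dm g \<and> x \<in> dm h \<and> v g x = v h x then 1 else 0)"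

text \<open>The inner product of the graphs of \<open>v g\<close> and \<open>v h\<close>, each
  regarded as a function with value 1 at the points \<open>(x, v g x)\<close>; over a single
  \<open>x\<close> this is \<open>ind x g h\<close>.\<close>

definition kern :: "'w \<Rightarrow> 'w \<Rightarrow> real" where
  "kern g h = (\<integral>x. ind x g h \<partial>\<Omega>)"

lemma v_meas: "g \<in> G \<Longrightarrow> v g \<in> \<Omega> \<rightarrow>\<^sub>M \<Omega>"
  unfolding v_def using aM[of "iv g"] bM[of g] iv_in[of g] by measurable

lemma dm_sets: "g \<in> G \<Longrightarrow> dm g \<in> sets \<Omega>"
proof -
  assume g: "g \<in> G"
  have "dm g = Y1 \<inter> (a (iv g) -` Y2 \<inter> space \<Omega>)" using Y1_space by (auto simp: dm_def)
  then show ?thesis using measurable_sets[OF aM[OF iv_in[OF g]] Y2(1)] Y1(1) by simp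
qed

lemma dm_space: "x \<in> dm g \<Longrightarrow> x \<in> space \<Omega>"
  by (simp add: dm_def Y1_space)

lemma agree_sets: "g \<in> G \<Longrightarrow> h \<in> G \<Longrightarrow> {x. x \<in> dm g \<and> x \<in> dm h \<and> v g x = v h x} \<in> sets \<Omega>"
proof -
  assume *: "g \<in> G" "h \<in> G"
  note [measurable] = dm_sets[OF *(1)] dm_sets[OF *(2)] separating_pred_eq[OF sep v_meas[OF *(1)] v_meas[OF *(2)]]
  have "{x. x \<in> dm g \<and> x \<in> dm h \<and> v g x = v h x} = {x \<in> space \<Omega>. x \<in> dm g \<and> x \<in> dm h \<and> v g x = v h x}"
    using dm_space by auto
  also have "\<dots> \<in> sets \<Omega>" by measurable
  finally show ?thesis .
qed

lemma ind_eq_indicator: "ind x g h = indicator {x. x \<in> dm g \<and> x \<in> dm h \<and> v g x = v h x} x"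
  unfolding ind_def by (simp split: split_indicator)

lemma agree_finite: "g \<in> G \<Longrightarrow> h \<in> G \<Longrightarrow> emeasure \<Omega> {x. x \<in> dm g \<and> x \<in> dm h \<and> v g x = v h x} < \<infinity>"
  by (rule le_less_trans[OF emeasure_mono[OF _ Y1(1)] Y1(2)]) (auto simp: dm_def)

lemma ind_integrable: "g \<in> G \<Longrightarrow> h \<in> G \<Longrightarrow> integrable \<Omega> (\<lambda>x. ind x g h)"
  unfolding ind_eq_indicator by (intro integrable_real_indicator agree_sets agree_finite)

lemma kern_measure: "g \<in> G \<Longrightarrow> h \<in> G \<Longrightarrow> kern g h = measure \<Omega> {x. x \<in> dm g \<and> x \<in> dm h \<and> v g x = v h x}"
proof -
  assume *: "g \<in> G" "h \<in> G"
  define S where "S = {x. x \<in> dm g \<and> x \<in> dm h \<and> v g x = v h x}"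
  have "S \<inter> space \<Omega> = S" using sets.sets_into_space[OF agree_sets[OF *]] by (simp only: S_def Int_absorb2)
  moreover have "kern g h = measure \<Omega> (S \<inter> space \<Omega>)"
    unfolding kern_def ind_eq_indicator S_def[symmetric] by (rule Bochner_Integration.integral_indicator)
  ultimately show ?thesis by (simp add: S_def)
qed

lemma lsum_integral:
  assumes "\<And>i. i \<in> snd ` set xs \<Longrightarrow> integrable \<Omega> (f i)"
  shows "integrable \<Omega> (\<lambda>x. lsum (\<lambda>i. f i x) xs)" "(\<integral>x. lsum (\<lambda>i. f i x) xs \<partial>\<Omega>) = lsum (\<lambda>i. \<integral>x. f i x \<partial>\<Omega>) xs"
proof -
  have "integrable \<Omega> (\<lambda>x. lsum (\<lambda>i. f i x) xs) \<and> (\<integral>x. lsum (\<lambda>i. f i x) xs \<partial>\<Omega>) = lsum (\<lambda>i. \<integral>x. f i x \<partial>\<Omega>) xs"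
    using assms
  proof (induction xs)
    case (Cons p xs)
    then have 1: "integrable \<Omega> (f (snd p))" and 2: "integrable \<Omega> (\<lambda>x. lsum (\<lambda>i. f i x) xs)"
      "(\<integral>x. lsum (\<lambda>i. f i x) xs \<partial>\<Omega>) = lsum (\<lambda>i. \<integral>x. f i x \<partial>\<Omega>) xs" by simp_all
    show ?case unfolding lsum_Cons using 1 2 by simp
  qed simp
  then show "integrable \<Omega> (\<lambda>x. lsum (\<lambda>i. f i x) xs)" "(\<integral>x. lsum (\<lambda>i. f i x) xs \<partial>\<Omega>) = lsum (\<lambda>i. \<integral>x. f i x \<partial>\<Omega>) xs"
    by blast+
qed


lemma lform_ind_integral:
  assumes "snd ` set xs \<subseteq> G" "snd ` set ys \<subseteq> G"
  shows "integrable \<Omega> (\<lambda>x. lform (ind x) xs ys)" "(\<integral>x. lform (ind x) xs ys \<partial>\<Omega>) = lform kern xs ys"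
proof -
  have 1: "integrable \<Omega> (\<lambda>x. lsum (ind x g) ys)" if "g \<in> G" for g
    using lsum_integral(1)[of ys "\<lambda>h x. ind x g h"] ind_integrable[OF that] assms(2) by blast
  have 2: "(\<integral>x. lsum (ind x g) ys \<partial>\<Omega>) = lsum (kern g) ys" if "g \<in> G" for g
    unfolding kern_def
    using lsum_integral(2)[of ys "\<lambda>h x. ind x g h"] ind_integrable[OF that] assms(2) by blast
  show "integrable \<Omega> (\<lambda>x. lform (ind x) xs ys)"
    unfolding lform_def by (rule lsum_integral(1)) (use 1 assms(1) in blast)
  have "(\<integral>x. lform (ind x) xs ys \<partial>\<Omega>) = lsum (\<lambda>g. \<integral>x. lsum (ind x g) ys \<partial>\<Omega>) xs"
    unfolding lform_def by (rule lsum_integral(2)) (use 1 assms(1) in blast)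
  also have "\<dots> = lform kern xs ys"
    unfolding lform_def by (intro lsum_cong 2) (use assms(1) in blast)
  finally show "(\<integral>x. lform (ind x) xs ys \<partial>\<Omega>) = lform kern xs ys" .
qed

definition fib :: "(real \<times> 'w) list \<Rightarrow> 'b \<Rightarrow> 'b \<Rightarrow> real" where
  "fib xs x y = lsum (\<lambda>g. of_bool (x \<in> dm g \<and> v g x = y)) xs"

text \<open>Over a single point \<open>x\<close> the form is the sum of the squares of the values
  that the combination of graphs takes at \<open>(x, z)\<close>, over the finitely many relevant
  \<open>z\<close>. Each value is therefore controlled by the form.\<close>

lemma lform_ind: "(fib xs x y)\<^sup>2 \<le> lform (ind x) xs xs" "0 \<le> lform (ind x) xs xs"
proof -
  define V where "V = insert y ((\<lambda>g. v g x) ` snd ` set xs)"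
  have V: "finite V" by (simp add: V_def)
  have "lform (ind x) xs xs = lsum (\<lambda>g. lsum (\<lambda>h. \<Sum>z\<in>V. of_bool (x \<in> dm g \<and> v g x = z) * of_bool (x \<in> dm h \<and> v h x = z)) xs) xs"
    unfolding lform_def
  proof (intro lsum_cong)
    fix g h assume g: "g \<in> snd ` set xs"
    have "(\<Sum>z\<in>V. of_bool (x \<in> dm g \<and> v g x = z) * of_bool (x \<in> dm h \<and> v h x = z)) =
        (\<Sum>z\<in>V. if z = v g x then ind x g h else 0)"
      by (intro sum.cong refl) (auto simp: ind_def)
    also have "\<dots> = ind x g h" using V g by (simp add: V_def)
    finally show "ind x g h = (\<Sum>z\<in>V. of_bool (x \<in> dm g \<and> v g x = z) * of_bool (x \<in> dm h \<and> v h x = z))" by simp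
  qed
  also have "\<dots> = (\<Sum>z\<in>V. (fib xs x z)\<^sup>2)"
    by (simp only: lsum_sum lsum_mult_left lsum_mult_right fib_def power2_eq_square)
  finally have eq: "lform (ind x) xs xs = (\<Sum>z\<in>V. (fib xs x z)\<^sup>2)" .
  show "0 \<le> lform (ind x) xs xs" unfolding eq by (simp add: sum_nonneg)
  show "(fib xs x y)\<^sup>2 \<le> lform (ind x) xs xs"
    unfolding eq using V by (intro member_le_sum) (auto simp: V_def)
qed

lemma kern_psd: "psd_on G kern"
proof (rule psd_onI)
  fix g h assume "g \<in> G" "h \<in> G"
  have "ind x g h = ind x h g" for x by (simp add: ind_def conj_ac eq_commute)
  then show "kern g h = kern h g" by (simp add: kern_def)
next
  fix xs :: "(real \<times> 'w) list" assume "snd ` set xs \<subseteq> G"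
  then have "lform kern xs xs = (\<integral>x. lform (ind x) xs xs \<partial>\<Omega>)" using lform_ind_integral(2) by simp
  then show "0 \<le> lform kern xs xs" using lform_ind(2) by simp
qed

lemma dm_mult: "k \<in> G \<Longrightarrow> g \<in> G \<Longrightarrow> x \<in> space \<Omega> \<Longrightarrow> x \<in> dm (mult k g) \<longleftrightarrow> a (iv k) x \<in> dm g"
proof -
  assume *: "k \<in> G" "g \<in> G" "x \<in> space \<Omega>"
  have "x \<in> Y1 \<longleftrightarrow> a (iv k) x \<in> Y1" using a_Y1[of k "a (iv k) x"] a_Y1[of "iv k" x] a_iv'[of k x] * iv_in by auto
  then show ?thesis using a_iv_mult[OF *] by (simp add: dm_def)
qed

lemma v_mult: "k \<in> G \<Longrightarrow> g \<in> G \<Longrightarrow> x \<in> space \<Omega> \<Longrightarrow> v (mult k g) x = b k (v g (a (iv k) x))"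
  by (simp add: v_def a_iv_mult b_mult a_space iv_in)

lemma v_space: "g \<in> G \<Longrightarrow> x \<in> space \<Omega> \<Longrightarrow> v g x \<in> space \<Omega>"
  by (simp add: v_def a_space b_space iv_in)

lemma b_inj: "k \<in> G \<Longrightarrow> y \<in> space \<Omega> \<Longrightarrow> z \<in> space \<Omega> \<Longrightarrow> b k y = b k z \<longleftrightarrow> y = z"
  by (metis b_iv)

lemma ind_mult: "k \<in> G \<Longrightarrow> g \<in> G \<Longrightarrow> h \<in> G \<Longrightarrow> x \<in> space \<Omega> \<Longrightarrow>
    ind x (mult k g) (mult k h) = ind (a (iv k) x) g h"
  by (simp add: ind_def dm_mult v_mult b_inj v_space a_space iv_in)

text \<open>On graphs, multiplication by \<open>k\<close> is the map from \<open>(x, y)\<close> to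
  \<open>(a k x, b k y)\<close>; it preserves the measure in the first coordinate and is injective
  in the second.\<close>

lemma kern_mult:
  assumes "k \<in> G" "g \<in> G" "h \<in> G"
  shows "kern (mult k g) (mult k h) = kern g h"
proof -
  define S where "S g h = {x. x \<in> dm g \<and> x \<in> dm h \<and> v g x = v h x}" for g h
  have "S (mult k g) (mult k h) = a (iv k) -` S g h \<inter> space \<Omega>"
  proof (rule Set.set_eqI)
    fix x
    show "x \<in> S (mult k g) (mult k h) \<longleftrightarrow> x \<in> a (iv k) -` S g h \<inter> space \<Omega>"
    proof (cases "x \<in> space \<Omega>")
      case True
      then show ?thesis using assms by (simp add: S_def dm_mult v_mult b_inj v_space a_space iv_in)
    next
      case False
      then show ?thesis using dm_space by (auto simp: S_def)
    qed
  qed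
  then have "measure \<Omega> (S (mult k g) (mult k h)) = measure \<Omega> (S g h)"
    using a_mp[OF iv_in[OF assms(1)], of "S g h"] agree_sets[OF assms(2,3)] by (simp add: S_def measure_def)
  then show ?thesis using assms mult_in by (simp add: kern_measure S_def)
qed

definition w :: "'w \<Rightarrow> 'b \<Rightarrow> 'b" where
  "w g y = a g (b (iv g) y)"

lemma w_v: "g \<in> G \<Longrightarrow> x \<in> space \<Omega> \<Longrightarrow> w g (v g x) = x"
  and v_w: "g \<in> G \<Longrightarrow> y \<in> space \<Omega> \<Longrightarrow> v g (w g y) = y"
  by (simp_all add: w_def v_def a_iv b_iv a_iv' b_iv' a_space b_space iv_in)

lemma v_inj: "g \<in> G \<Longrightarrow> x \<in> space \<Omega> \<Longrightarrow> y \<in> space \<Omega> \<Longrightarrow> v g x = v g y \<Longrightarrow> x = y"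
  by (metis w_v)

lemma w_meas: "g \<in> G \<Longrightarrow> w g \<in> \<Omega> \<rightarrow>\<^sub>M \<Omega>"
  unfolding w_def using aM[of g] bM[of "iv g"] iv_in[of g] by measurable

lemma v_image:
  assumes g: "g \<in> G" and A: "A \<in> sets \<Omega>"
  shows "v g ` A \<in> sets \<Omega>" "emeasure \<Omega> (v g ` A) = emeasure \<Omega> A"
proof -
  have sub: "A \<subseteq> space \<Omega>" using A by (rule sets.sets_into_space)
  have eq: "v g ` A = w g -` A \<inter> space \<Omega>"
  proof (intro Set.set_eqI iffI)
    fix y assume "y \<in> v g ` A" then show "y \<in> w g -` A \<inter> space \<Omega>"
      using sub g w_v v_space by auto
  next
    fix y assume "y \<in> w g -` A \<inter> space \<Omega>"
    then show "y \<in> v g ` A" using v_w[OF g, of y] by (intro image_eqI[of _ _ "w g y"]) auto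
  qed
  show "v g ` A \<in> sets \<Omega>" unfolding eq by (rule measurable_sets[OF w_meas[OF g] A])
  have "w g -` A \<inter> space \<Omega> = b (iv g) -` (a g -` A \<inter> space \<Omega>) \<inter> space \<Omega>"
    using g b_space iv_in by (auto simp: w_def)
  then show "emeasure \<Omega> (v g ` A) = emeasure \<Omega> A"
    unfolding eq
    by (simp only: b_mp[OF iv_in[OF g] measurable_sets[OF aM[OF g] A]] a_mp[OF g A])
qed

lemma AE_a: "g \<in> G \<Longrightarrow> (AE x in \<Omega>. P x) \<Longrightarrow> AE x in \<Omega>. P (a g x)"
  and AE_b: "g \<in> G \<Longrightarrow> (AE x in \<Omega>. P x) \<Longrightarrow> AE x in \<Omega>. P (b g x)"
proof -
  have *: "AE x in \<Omega>. P (f x)"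
    if P: "AE x in \<Omega>. P x" and f: "f \<in> \<Omega> \<rightarrow>\<^sub>M \<Omega>" and mp: "\<And>A. A \<in> sets \<Omega> \<Longrightarrow> emeasure \<Omega> (f -` A \<inter> space \<Omega>) = emeasure \<Omega> A" for f
  proof -
    obtain N where N: "{x \<in> space \<Omega>. \<not> P x} \<subseteq> N" "emeasure \<Omega> N = 0" "N \<in> sets \<Omega>"
      using P by (rule AE_E)
    show ?thesis
    proof (rule AE_I)
      show "{x \<in> space \<Omega>. \<not> P (f x)} \<subseteq> f -` N \<inter> space \<Omega>" using N(1) measurable_space[OF f] by auto
    qed (use N mp measurable_sets[OF f] in auto)
  qed
  show "g \<in> G \<Longrightarrow> (AE x in \<Omega>. P x) \<Longrightarrow> AE x in \<Omega>. P (a g x)" by (rule *[OF _ aM a_mp])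
  show "g \<in> G \<Longrightarrow> (AE x in \<Omega>. P x) \<Longrightarrow> AE x in \<Omega>. P (b g x)" by (rule *[OF _ bM b_mp])
qed

end

context paired_actions
begin

text \<open>Convex combinations of the graphs of the partial injections \<open>v g\<close> are doubly substochastic, and so is
  their limit; hence its values above one half select the graph of a partial injection.\<close>

lemma equivariant_map:
  fixes xs :: "nat \<Rightarrow> (real \<times> 'w) list"
  assumes conv: "\<And>n. lconv G (xs n)"
    and step: "\<And>n. lform kern (ldiff (xs (Suc n)) (xs n)) (ldiff (xs (Suc n)) (xs n)) \<le> C * (1/4)^n"
    and inv: "\<And>g. g \<in> G \<Longrightarrow> \<exists>C. \<forall>n. lform kern (ldiff (lmap (mult g) (xs n)) (xs n))
        (ldiff (lmap (mult g) (xs n)) (xs n)) \<le> C * (1/4)^n"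
    and close: "\<And>n. lform kern (ldiff (xs n) [(1, unit)]) (ldiff (xs n) [(1, unit)]) \<le> \<epsilon>"
    and \<epsilon>: "4 * \<epsilon> < measure \<Omega> (Y1 \<inter> Y2)"
    and erg1: "\<And>A. A \<in> sets \<Omega> \<Longrightarrow> A \<subseteq> Y1 \<Longrightarrow>
        (\<And>g. g \<in> G \<Longrightarrow> AE x in \<Omega>. x \<in> Y1 \<longrightarrow> (a g x \<in> A \<longleftrightarrow> x \<in> A)) \<Longrightarrow>
        emeasure \<Omega> A = 0 \<or> emeasure \<Omega> (Y1 - A) = 0"
    and erg2: "\<And>A. A \<in> sets \<Omega> \<Longrightarrow> A \<subseteq> Y2 \<Longrightarrow>
        (\<And>g. g \<in> G \<Longrightarrow> AE x in \<Omega>. x \<in> Y2 \<longrightarrow> (b g x \<in> A \<longleftrightarrow> x \<in> A)) \<Longrightarrow>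
        emeasure \<Omega> A = 0 \<or> emeasure \<Omega> (Y2 - A) = 0"
  shows "\<exists>D D' \<phi>. D \<in> sets \<Omega> \<and> D \<subseteq> Y1 \<and> emeasure \<Omega> (Y1 - D) = 0 \<and>
    D = (\<Union>g\<in>G. D' g) \<and> (\<forall>g\<in>G. D' g \<in> sets \<Omega>) \<and> (\<forall>g\<in>G. \<forall>x\<in>D' g. \<phi> x = v g x) \<and>
    inj_on \<phi> D \<and> \<phi> ` D \<subseteq> Y2 \<and> emeasure \<Omega> (Y2 - \<phi> ` D) = 0 \<and>
    (\<forall>A\<in>sets \<Omega>. A \<subseteq> D \<longrightarrow> \<phi> ` A \<in> sets \<Omega> \<and> emeasure \<Omega> (\<phi> ` A) = emeasure \<Omega> A) \<and>
    (\<forall>g\<in>G. AE x in \<Omega>. x \<in> Y1 \<longrightarrow> \<phi> (a g x) = b g (\<phi> x)) \<and>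
    emeasure \<Omega> Y1 = emeasure \<Omega> Y2"
proof -
  \<comment> \<open>The value of the combination \<open>zs\<close> of graphs at the point
    \<open>(x, v g x)\<close>, set to zero off the domain of \<open>v g\<close>. All limits are
    taken along these countably many graphs.\<close>
  define cc where "cc zs g x = lsum (\<lambda>h. ind x h g) zs" for zs g x
  define c where "c n g x = cc (xs n) g x" for n g x
  have xsG: "snd ` set (xs n) \<subseteq> G" for n by (rule lconvD(1)[OF conv])
  have cc_sq: "(cc zs g x)\<^sup>2 \<le> lform (ind x) zs zs" for zs g x
  proof (cases "x \<in> dm g")
    case True
    have "cc zs g x = fib zs x (v g x)"
      unfolding cc_def fib_def by (rule lsum_cong) (use True in \<open>simp add: ind_def\<close>)
    then show ?thesis using lform_ind(1) by simp
  next
    case False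
    then have "cc zs g x = 0" by (simp add: cc_def ind_def)
    then show ?thesis using lform_ind(2) by simp
  qed
  have c_le1: "c n g x \<le> 1" for n g x
    unfolding c_def cc_def by (rule lsum_conv_le[OF conv]) (simp add: ind_def)
  have c_ge0: "0 \<le> c n g x" for n g x
  proof -
    have "lsum (\<lambda>h. - ind x h g) (xs n) \<le> 0" by (rule lsum_conv_le[OF conv]) (simp add: ind_def)
    then show ?thesis using lsum_mult_left[of "-1" "\<lambda>h. ind x h g" "xs n"] by (simp add: c_def cc_def)
  qed
  have c_meas: "c n g \<in> borel_measurable \<Omega>" if "g \<in> G" for n g
    unfolding c_def cc_def
    by (rule borel_measurable_integrable[OF lsum_integral(1)[of "xs n" "\<lambda>h x. ind x h g"]])
      (use ind_integrable[OF _ that] xsG in blast)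
  define L where "L g x = lim (\<lambda>n. c n g x)" for g x
  have L_meas: "L g \<in> borel_measurable \<Omega>" if "g \<in> G" for g
    unfolding L_def by (intro borel_measurable_lim_metric c_meas that)
  define good where "good x \<longleftrightarrow> (\<forall>g\<in>G. (\<lambda>n. c n g x) \<longlonglongrightarrow> L g x) \<and>
      (\<forall>k\<in>G. \<forall>g\<in>G. (\<lambda>n. c n g (a (iv k) x) - c n (mult k g) x) \<longlonglongrightarrow> 0)" for x
  have "AE x in \<Omega>. (\<forall>g\<in>G. (\<lambda>n. c n g x) \<longlonglongrightarrow> L g x)"
  proof -
    \<comment> \<open>The integrated squares decay like \<open>(1/4)^n\<close>, hence almost
      everywhere the squares decay like \<open>(1/2)^n\<close>, and the differences of successive
      values along each graph are summable.\<close>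
    define E where "E n = ldiff (xs (Suc n)) (xs n)" for n
    have EG: "snd ` set (E n) \<subseteq> G" for n using xsG[of n] xsG[of "Suc n"] by (simp add: E_def)
    have "AE x in \<Omega>. \<exists>B. \<forall>n. lform (ind x) (E n) (E n) \<le> B * (1/2)^n"
    proof (rule AE_geometric)
      show "(\<integral>x. lform (ind x) (E n) (E n) \<partial>\<Omega>) \<le> C * (1/4)^n" for n
        unfolding lform_ind_integral(2)[OF EG EG] unfolding E_def by (rule step)
    qed (use lform_ind_integral(1)[OF EG EG] lform_ind(2) in auto)
    then show ?thesis
    proof eventually_elim
      case (elim x)
      then obtain B where B: "\<And>n. lform (ind x) (E n) (E n) \<le> B * (1/2)^n" by blast
      have B0: "0 \<le> B" using B[of 0] lform_ind(2)[of x "E 0"] by simp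
      show ?case
      proof
        fix g assume "g \<in> G"
        have diff: "\<bar>c (Suc n) g x - c n g x\<bar> \<le> sqrt B * (sqrt (1/2))^n" for n
        proof -
          have "\<bar>c (Suc n) g x - c n g x\<bar> = sqrt ((cc (E n) g x)\<^sup>2)" by (simp add: c_def cc_def E_def)
          also have "\<dots> \<le> sqrt (B * (1/2)^n)"
            by (rule real_sqrt_le_mono, rule order_trans[OF cc_sq B])
          also have "\<dots> = sqrt B * (sqrt (1/2))^n" by (simp only: real_sqrt_mult real_sqrt_power)
          finally show ?thesis .
        qed
        have "sqrt (1/2) < sqrt (1::real)" by (rule real_sqrt_less_mono) simp
        then have "summable (\<lambda>n. sqrt B * (sqrt (1/2))^n)"
          by (intro summable_mult summable_geometric) simp
        then have "summable (\<lambda>n. c (Suc n) g x - c n g x)"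
          by (rule summable_comparison_test'[where N = 0]) (use diff in simp)
        then have "convergent (\<lambda>n. \<Sum>i<n. c (Suc i) g x - c i g x)"
          by (simp add: summable_iff_convergent)
        then have "convergent (\<lambda>n. c n g x - c 0 g x)" by (simp only: sum_lessThan_telescope[of "\<lambda>n. c n g x"])
        from convergent_add[OF this convergent_const[of "c 0 g x"]]
        have "convergent (\<lambda>n. c n g x)" by simp
        then show "(\<lambda>n. c n g x) \<longlonglongrightarrow> L g x" by (simp add: L_def convergent_LIMSEQ_iff)
      qed
    qed
  qed
  moreover have "AE x in \<Omega>. \<forall>k\<in>G. \<forall>g\<in>G. (\<lambda>n. c n g (a (iv k) x) - c n (mult k g) x) \<longlonglongrightarrow> 0"
  proof (subst AE_ball_countable[OF cG], rule ballI)
    fix k assume k: "k \<in> G"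
    define E where "E n = ldiff (lmap (mult k) (xs n)) (xs n)" for n
    have EG: "snd ` set (E n) \<subseteq> G" for n
      using xsG[of n] mult_in[OF k] unfolding E_def set_ldiff set_lmap by blast
    obtain C' where C': "\<And>n. lform kern (E n) (E n) \<le> C' * (1/4)^n"
      using inv[OF k] unfolding E_def by blast
    have "AE x in \<Omega>. \<exists>B. \<forall>n. lform (ind x) (E n) (E n) \<le> B * (1/2)^n"
    proof (rule AE_geometric)
      show "(\<integral>x. lform (ind x) (E n) (E n) \<partial>\<Omega>) \<le> C' * (1/4)^n" for n
        unfolding lform_ind_integral(2)[OF EG EG] by (rule C')
    qed (use lform_ind_integral(1)[OF EG EG] lform_ind(2) in auto)
    then show "AE x in \<Omega>. \<forall>g\<in>G. (\<lambda>n. c n g (a (iv k) x) - c n (mult k g) x) \<longlonglongrightarrow> 0"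
      using AE_space
    proof eventually_elim
      case (elim x)
      then obtain B where B: "\<And>n. lform (ind x) (E n) (E n) \<le> B * (1/2)^n" by blast
      show ?case
      proof
        fix g assume g: "g \<in> G"
        have eq: "c n g (a (iv k) x) - c n (mult k g) x = cc (E n) (mult k g) x" for n
        proof -
          have "cc (lmap (mult k) (xs n)) (mult k g) x = lsum (\<lambda>h. ind x (mult k h) (mult k g)) (xs n)"
            by (simp add: cc_def)
          also have "\<dots> = c n g (a (iv k) x)"
            unfolding c_def cc_def by (rule lsum_cong) (use xsG[of n] k g elim in \<open>auto intro!: ind_mult\<close>)
          finally show ?thesis by (simp add: c_def cc_def E_def)
        qed
        have "(\<lambda>n. B * (1/2)^n) \<longlonglongrightarrow> B * 0"
          by (intro tendsto_mult tendsto_const LIMSEQ_realpow_zero) auto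
        then have "(\<lambda>n. B * (1/2)^n) \<longlonglongrightarrow> 0" by simp
        moreover have "\<And>n. (cc (E n) (mult k g) x)\<^sup>2 \<le> B * (1/2)^n" by (rule order_trans[OF cc_sq B])
        moreover from this have "\<forall>\<^sub>F n in sequentially. norm ((cc (E n) (mult k g) x)\<^sup>2) \<le> B * (1/2)^n"
          by (intro always_eventually allI) simp
        ultimately have "(\<lambda>n. (cc (E n) (mult k g) x)\<^sup>2) \<longlonglongrightarrow> 0"
          by (rule_tac Lim_null_comparison)
        then have "(\<lambda>n. sqrt ((cc (E n) (mult k g) x)\<^sup>2)) \<longlonglongrightarrow> sqrt 0" by (intro tendsto_real_sqrt)
        then have "(\<lambda>n. cc (E n) (mult k g) x) \<longlonglongrightarrow> 0"
          by (simp add: tendsto_rabs_zero_iff)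
        then show "(\<lambda>n. c n g (a (iv k) x) - c n (mult k g) x) \<longlonglongrightarrow> 0" unfolding eq .
      qed
    qed
  qed
  ultimately have "AE x in \<Omega>. good x" unfolding good_def by eventually_elim blast
  then obtain N where N: "{x \<in> space \<Omega>. \<not> good x} \<subseteq> N" "emeasure \<Omega> N = 0" "N \<in> sets \<Omega>" by (rule AE_E)
  have lim: "(\<lambda>n. c n g x) \<longlonglongrightarrow> L g x" if "x \<in> space \<Omega>" "x \<notin> N" "g \<in> G" for g x
    using that N(1) unfolding good_def by blast
  have lim_inv: "(\<lambda>n. c n g (a (iv k) x) - c n (mult k g) x) \<longlonglongrightarrow> 0"
    if "x \<in> space \<Omega>" "x \<notin> N" "k \<in> G" "g \<in> G" for k g x
    using that N(1) unfolding good_def by blast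
  define D0 where "D0 g = {x \<in> Y1 - N. L g x > 1/2}" for g
  define D where "D = (\<Union>g\<in>G. D0 g)"
  have D0M: "D0 g \<in> sets \<Omega>" if "g \<in> G" for g
  proof -
    note [measurable] = L_meas[OF that] Y1(1) N(3)
    have "D0 g = {x \<in> space \<Omega>. x \<in> Y1 - N \<and> L g x > 1/2}" using Y1_space by (auto simp: D0_def)
    also have "\<dots> \<in> sets \<Omega>" by measurable
    finally show ?thesis .
  qed
  have D0_sp: "x \<in> space \<Omega>" "x \<notin> N" "x \<in> Y1" if "x \<in> D0 g" for x g
    using that Y1_space by (auto simp: D0_def)
  have DM: "D \<in> sets \<Omega>" unfolding D_def using cG D0M by (intro sets.countable_UN') auto
  have DY: "D \<subseteq> Y1" by (auto simp: D_def D0_def)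
  have D_dm: "x \<in> dm g" if x: "x \<in> D0 g" and g: "g \<in> G" for x g
  proof (rule ccontr)
    assume "x \<notin> dm g"
    then have "c n g x = 0" for n by (simp add: c_def cc_def ind_def)
    then have "L g x = 0" by (simp add: L_def)
    then show False using x by (simp add: D0_def)
  qed
  \<comment> \<open>\<open>c n g x\<close> is the total weight of those \<open>h\<close> whose map
    agrees with \<open>v g\<close> at \<open>x\<close>. Two such weights that exceed one half in the
    limit must share an \<open>h\<close>. For \<open>x = x'\<close> this makes \<open>\<phi>\<close>
    single valued; for equal images it makes \<open>\<phi>\<close> injective, since
    \<open>v h\<close> is injective.\<close>
  have half: "\<exists>h\<in>G. ind x h g = 1 \<and> ind x' h g' = 1"
    if x: "x \<in> D0 g" and x': "x' \<in> D0 g'" and g: "g \<in> G" "g' \<in> G" for x x' g g'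
  proof (rule ccontr)
    assume no: "\<not> ?thesis"
    have "ind x h g + ind x' h g' \<le> 1" if "h \<in> G" for h
      using no that unfolding ind_def by (auto split: if_splits)
    then have "lsum (\<lambda>h. ind x h g + ind x' h g') (xs n) \<le> 1" for n by (rule lsum_conv_le[OF conv])
    then have "c n g x + c n g' x' \<le> 1" for n by (simp add: c_def cc_def lsum_add)
    moreover have "(\<lambda>n. c n g x + c n g' x') \<longlonglongrightarrow> L g x + L g' x'"
      using x x' g D0_sp by (intro tendsto_add lim) auto
    ultimately have "L g x + L g' x' \<le> 1" by (intro LIMSEQ_le_const2) auto
    then show False using x x' by (simp add: D0_def)
  qed
  have uniq: "v g x = v g' x" if "x \<in> D0 g" "x \<in> D0 g'" "g \<in> G" "g' \<in> G" for x g g'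
    using half[OF that] by (auto simp: ind_def split: if_splits)
  define \<phi> where "\<phi> x = v (SOME g. g \<in> G \<and> x \<in> D0 g) x" for x
  have \<phi>: "\<phi> x = v g x" if "x \<in> D0 g" "g \<in> G" for x g
  proof -
    have "(SOME g. g \<in> G \<and> x \<in> D0 g) \<in> G \<and> x \<in> D0 (SOME g. g \<in> G \<and> x \<in> D0 g)"
      by (rule someI[of _ g]) (use that in blast)
    then show ?thesis unfolding \<phi>_def using that by (intro uniq) auto
  qed
  have inj: "inj_on \<phi> D"
  proof (rule inj_onI)
    fix x x' assume "x \<in> D" "x' \<in> D" and eq: "\<phi> x = \<phi> x'"
    then obtain g g' where g: "g \<in> G" "x \<in> D0 g" "g' \<in> G" "x' \<in> D0 g'" by (auto simp: D_def)
    obtain h where h: "h \<in> G" "ind x h g = 1" "ind x' h g' = 1" using half[OF g(2,4,1,3)] by blast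
    then have "v h x = v g x" "v h x' = v g' x'" by (auto simp: ind_def split: if_splits)
    then have "v h x = v h x'" using eq \<phi>[OF g(2,1)] \<phi>[OF g(4,3)] by simp
    then show "x = x'" using v_inj[OF h(1)] D0_sp g by blast
  qed
  have range: "\<phi> ` D \<subseteq> Y2"
  proof
    fix y assume "y \<in> \<phi> ` D"
    then obtain x g where g: "g \<in> G" "x \<in> D0 g" "y = \<phi> x" by (auto simp: D_def)
    then have "a (iv g) x \<in> Y2" using D_dm[OF g(2,1)] by (simp add: dm_def)
    then show "y \<in> Y2" using \<phi>[OF g(2,1)] g(3) b_Y2[OF g(1)] by (simp add: v_def)
  qed
  have "G \<noteq> {}" using unit_in by blast
  define e where "e = from_nat_into G"
  have eG: "e n \<in> G" for n unfolding e_def by (rule from_nat_into[OF \<open>G \<noteq> {}\<close>])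
  have D_e: "D = (\<Union>n. D0 (e n))"
  proof -
    have "range e = G" unfolding e_def by (rule range_from_nat_into[OF \<open>G \<noteq> {}\<close> cG])
    then have "D = (\<Union>g\<in>range e. D0 g)" by (simp only: D_def)
    then show ?thesis by simp
  qed
  have image: "\<phi> ` A \<in> sets \<Omega> \<and> emeasure \<Omega> (\<phi> ` A) = emeasure \<Omega> A" if A: "A \<in> sets \<Omega>" "A \<subseteq> D" for A
  proof -
    define P where "P n = A \<inter> disjointed (\<lambda>n. D0 (e n)) n" for n
    have P_sub: "P n \<subseteq> D0 (e n)" for n using disjointed_subset[of "\<lambda>n. D0 (e n)" n] by (auto simp: P_def)
    have PM: "P n \<in> sets \<Omega>" for n
    proof -
      have "range (disjointed (\<lambda>n. D0 (e n))) \<subseteq> sets \<Omega>"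
        by (rule sets.range_disjointed_sets) (use D0M eG in auto)
      then show ?thesis unfolding P_def using A(1) by blast
    qed
    have disj: "disjoint_family P" unfolding P_def using disjoint_family_disjointed[of "\<lambda>n. D0 (e n)"]
      by (auto simp: disjoint_family_on_def)
    have UP: "(\<Union>n. P n) = A" using A(2) unfolding P_def D_e Int_UN_distrib[symmetric] UN_disjointed_eq by blast
    have im: "\<phi> ` P n = v (e n) ` P n" for n
      using P_sub[of n] \<phi>[OF _ eG] by (intro image_cong) auto
    have imM: "\<phi> ` P n \<in> sets \<Omega>" "emeasure \<Omega> (\<phi> ` P n) = emeasure \<Omega> (P n)" for n
      unfolding im using v_image[OF eG PM] by auto
    have PA: "P n \<subseteq> D" for n using A(2) by (auto simp: P_def)
    have "disjoint_family (\<lambda>n. \<phi> ` P n)"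
      unfolding disjoint_family_on_def
    proof (intro ballI impI)
      fix m n :: nat assume "m \<noteq> n"
      then have "P m \<inter> P n = {}" using disj by (simp add: disjoint_family_on_def)
      then show "\<phi> ` P m \<inter> \<phi> ` P n = {}" using inj_on_image_Int[OF inj PA PA, of m n] by simp
    qed
    then have "emeasure \<Omega> (\<Union>n. \<phi> ` P n) = (\<Sum>n. emeasure \<Omega> (\<phi> ` P n))"
      using imM by (intro suminf_emeasure[symmetric]) auto
    also have "\<dots> = emeasure \<Omega> (\<Union>n. P n)"
      unfolding imM(2) by (rule suminf_emeasure) (use PM disj in auto)
    finally have "emeasure \<Omega> (\<Union>n. \<phi> ` P n) = emeasure \<Omega> A" by (simp add: UP)
    moreover have "\<phi> ` A = (\<Union>n. \<phi> ` P n)" unfolding UP[symmetric] by blast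
    moreover have "(\<Union>n. \<phi> ` P n) \<in> sets \<Omega>" using imM by auto
    ultimately show ?thesis by simp
  qed
  have iviv: "a (iv (iv g)) x = a g x" "b (iv (iv g)) x = b g x" if "g \<in> G" "x \<in> space \<Omega>" for g x
    using a_iv[of "iv g" "a g x"] a_iv[of g x] b_iv[of "iv g" "b g x"] b_iv[of g x] that a_space b_space iv_in by auto
  have equiv: "a g x \<in> D \<and> \<phi> (a g x) = b g (\<phi> x)" if g: "g \<in> G" and x: "x \<in> D" and xN: "a g x \<notin> N" for g x
  proof -
    obtain f where f: "f \<in> G" "x \<in> D0 f" using x by (auto simp: D_def)
    have xs: "x \<in> space \<Omega>" "x \<notin> N" "x \<in> Y1" using D0_sp[OF f(2)] by auto
    define k where "k = iv g"
    define z where "z = a g x"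
    \<comment> \<open>\<open>mult k h\<close> need not equal \<open>f\<close>, as inverses cancel
      only in the actions. At \<open>x\<close> it has the same domain condition and the same value
      as \<open>f\<close>, which is all that \<open>ind\<close> sees.\<close>
    define h where "h = mult g f"
    have kG: "k \<in> G" and hG: "h \<in> G" using g f iv_in mult_in by (auto simp: k_def h_def)
    have ak: "a (iv k) x = z" unfolding k_def z_def by (rule iviv(1)[OF g xs(1)])
    have zs: "z \<in> space \<Omega>" unfolding z_def by (rule a_space[OF g xs(1)])
    have az: "a (iv g) z = x" unfolding z_def by (rule a_iv[OF g xs(1)])
    have vz: "v h z = b g (v f x)" unfolding h_def using v_mult[OF g f(1) zs] az by simp
    have "v (mult k h) x = v f x"
      using v_mult[OF kG hG xs(1)] ak vz b_iv[OF g v_space[OF f(1) xs(1)]] by (simp add: k_def)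
    moreover have "x \<in> dm (mult k h) \<longleftrightarrow> x \<in> dm f"
      using dm_mult[OF kG hG xs(1)] dm_mult[OF g f(1) zs] ak az by (simp add: h_def)
    ultimately have "ind x j (mult k h) = ind x j f" for j by (simp add: ind_def)
    then have "c n (mult k h) x = c n f x" for n by (simp add: c_def cc_def)
    then have "(\<lambda>n. c n h z - c n f x) \<longlonglongrightarrow> 0" using lim_inv[OF xs(1,2) kG hG] by (simp add: ak)
    then have "(\<lambda>n. (c n h z - c n f x) + c n f x) \<longlonglongrightarrow> 0 + L f x"
      by (intro tendsto_add lim xs f)
    then have "(\<lambda>n. c n h z) \<longlonglongrightarrow> L f x" by simp
    moreover have "(\<lambda>n. c n h z) \<longlonglongrightarrow> L h z" using xN zs hG by (intro lim) (auto simp: z_def)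
    ultimately have "L h z = L f x" by (rule LIMSEQ_unique[rotated])
    then have zD: "z \<in> D0 h" using f(2) xN a_Y1[OF g xs(3)] by (simp add: D0_def z_def)
    then show ?thesis
      using hG \<phi>[OF zD hG] \<phi>[OF f(2,1)] vz by (auto simp: D_def z_def)
  qed
  have AE_N: "AE x in \<Omega>. x \<notin> N" using N(2,3) by (intro AE_not_in) auto
  have D_inv: "AE x in \<Omega>. x \<in> Y1 \<longrightarrow> (a g x \<in> D \<longleftrightarrow> x \<in> D)" if g: "g \<in> G" for g
    using AE_a[OF g AE_N] AE_N AE_space
  proof eventually_elim
    case (elim x)
    show ?case
    proof (intro impI iffI)
      assume "a g x \<in> D"
      then show "x \<in> D" using equiv[OF iv_in[OF g], of "a g x"] a_iv[OF g elim(3)] elim(2) by simp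
    next
      assume "x \<in> D" then show "a g x \<in> D" using equiv[OF g] elim(1) by blast
    qed
  qed
  have pos: "emeasure \<Omega> D \<noteq> 0"
  proof
    assume D0: "emeasure \<Omega> D = 0"
    define Y where "Y = Y1 \<inter> Y2"
    have YM: "Y \<in> sets \<Omega>" using Y1 Y2 by (simp add: Y_def)
    have Yfin: "emeasure \<Omega> Y < \<infinity>"
      by (rule le_less_trans[OF emeasure_mono[OF _ Y1(1)] Y1(2)]) (simp add: Y_def)
    \<comment> \<open>On \<open>Y1 \<inter> Y2\<close> the values along the diagonal differ from 1
      by at most \<open>\<epsilon>\<close> in integrated square. If \<open>D\<close> were null, the
      limit would be at most one half there, and the integrated square at least a quarter of the
      measure; this is the origin of the factor 4 in the hypothesis.\<close>
    define f where "f n x = indicator Y x * (c n unit x - 1)\<^sup>2" for n x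
    have unit_dm: "a (iv unit) x = x" if "x \<in> space \<Omega>" for x
      using a_iv[OF unit_in that] a_unit[OF that] by simp
    have iY: "integrable \<Omega> (indicator Y :: 'b \<Rightarrow> real)" using YM Yfin by (rule integrable_real_indicator)
    have fM: "f n \<in> borel_measurable \<Omega>" for n
      unfolding f_def using c_meas[OF unit_in] YM by measurable
    have f_le: "\<bar>f n x\<bar> \<le> indicator Y x" for n x
    proof -
      have "(c n unit x - 1)\<^sup>2 \<le> 1"
        using c_le1[of n unit x] c_ge0[of n unit x] by (simp add: abs_square_le_1)
      then show ?thesis by (simp add: f_def indicator_def)
    qed
    have f_int: "integrable \<Omega> (f n)" for n
      by (rule Bochner_Integration.integrable_bound[OF iY fM]) (use f_le in auto)
    have f_eps: "(\<integral>x. f n x \<partial>\<Omega>) \<le> \<epsilon>" for n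
    proof -
      define E where "E = ldiff (xs n) [(1, unit)]"
      have EG: "snd ` set E \<subseteq> G" using xsG[of n] unit_in by (simp add: E_def)
      have "f n x \<le> lform (ind x) E E" for x
      proof (cases "x \<in> Y")
        case True
        then have "ind x unit unit = 1" using unit_dm[of x] Y1_space by (simp add: ind_def dm_def Y_def)
        then have "cc E unit x = c n unit x - 1" by (simp add: cc_def c_def E_def)
        then show ?thesis using cc_sq[of E unit x] True by (simp add: f_def)
      next
        case False
        then show ?thesis using lform_ind(2) by (simp add: f_def)
      qed
      then have "(\<integral>x. f n x \<partial>\<Omega>) \<le> (\<integral>x. lform (ind x) E E \<partial>\<Omega>)"
        by (intro integral_mono f_int lform_ind_integral(1)[OF EG EG])
      also have "\<dots> \<le> \<epsilon>" unfolding lform_ind_integral(2)[OF EG EG] unfolding E_def by (rule close)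
      finally show ?thesis .
    qed
    define F where "F x = indicator Y x * (L unit x - 1)\<^sup>2" for x
    have FM: "F \<in> borel_measurable \<Omega>" unfolding F_def using L_meas[OF unit_in] YM by measurable
    have conv_f: "AE x in \<Omega>. (\<lambda>n. f n x) \<longlonglongrightarrow> F x"
      using AE_N AE_space
    proof eventually_elim
      case (elim x)
      then show ?case unfolding f_def F_def by (intro tendsto_intros lim unit_in)
    qed
    have "(\<lambda>n. \<integral>x. f n x \<partial>\<Omega>) \<longlonglongrightarrow> (\<integral>x. F x \<partial>\<Omega>)"
      by (rule integral_dominated_convergence[OF FM fM iY conv_f]) (use f_le in auto)
    then have F_eps: "(\<integral>x. F x \<partial>\<Omega>) \<le> \<epsilon>" using f_eps by (intro LIMSEQ_le_const2) auto
    have F_int: "integrable \<Omega> F"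
      by (rule integrable_dominated_convergence[OF FM fM iY conv_f]) (use f_le in auto)
    have "AE x in \<Omega>. x \<notin> D" using D0 DM by (intro AE_not_in) auto
    then have "AE x in \<Omega>. 1/4 * indicator Y x \<le> F x"
      using AE_N
    proof eventually_elim
      case (elim x)
      show ?case
      proof (cases "x \<in> Y")
        case True
        then have "L unit x \<le> 1/2" using elim unit_in by (auto simp: D_def D0_def Y_def not_less)
        then have "(1/2)\<^sup>2 \<le> (1 - L unit x)\<^sup>2" by (intro power_mono) auto
        then show ?thesis using True by (simp add: F_def power2_commute power_divide)
      qed (simp add: F_def)
    qed
    then have "(\<integral>x. 1/4 * indicator Y x \<partial>\<Omega>) \<le> (\<integral>x. F x \<partial>\<Omega>)"
      using iY F_int by (intro integral_mono_AE) auto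
    moreover have "(\<integral>x. 1/4 * indicator Y x \<partial>\<Omega>) = 1/4 * measure \<Omega> Y"
      using sets.sets_into_space[OF YM] by (simp add: Int_absorb2)
    ultimately show False using F_eps \<epsilon> by (simp add: Y_def)
  qed
  then have D_full: "emeasure \<Omega> (Y1 - D) = 0" using erg1[OF DM DY D_inv] by blast
  have imD: "\<phi> ` D \<in> sets \<Omega>" "emeasure \<Omega> (\<phi> ` D) = emeasure \<Omega> D" using image[OF DM] by auto
  \<comment> \<open>Equivariance can fail only over a null set, whose image is null because
    \<open>\<phi>\<close> preserves measure. So the image of \<open>\<phi>\<close> is invariant
    under \<open>b\<close>, and ergodicity on \<open>Y2\<close> makes it conull.\<close>
  have push: "AE y in \<Omega>. y \<in> \<phi> ` D \<longrightarrow> b g y \<in> \<phi> ` D" if g: "g \<in> G" for g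
  proof -
    define Bd where "Bd = D \<inter> (a g -` N \<inter> space \<Omega>)"
    have BM: "a g -` N \<inter> space \<Omega> \<in> sets \<Omega>" by (rule measurable_sets[OF aM[OF g] N(3)])
    have "Bd \<in> sets \<Omega>" using BM DM by (simp add: Bd_def)
    moreover have "emeasure \<Omega> Bd = 0"
    proof -
      have "emeasure \<Omega> Bd \<le> emeasure \<Omega> (a g -` N \<inter> space \<Omega>)" by (rule emeasure_mono[OF _ BM]) (auto simp: Bd_def)
      then show ?thesis using a_mp[OF g N(3)] N(2) by simp
    qed
    ultimately have "\<phi> ` Bd \<in> null_sets \<Omega>" using image[of Bd] by (auto simp: Bd_def null_sets_def)
    then have "AE y in \<Omega>. y \<notin> \<phi> ` Bd" by (rule AE_not_in)
    then show ?thesis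
    proof eventually_elim
      case (elim y)
      show ?case
      proof
        assume "y \<in> \<phi> ` D"
        then obtain x where x: "x \<in> D" "y = \<phi> x" by blast
        then have "a g x \<notin> N" using elim DY Y1_space by (auto simp: Bd_def)
        then show "b g y \<in> \<phi> ` D" using equiv[OF g x(1)] x(2) by (metis imageI)
      qed
    qed
  qed
  have im_inv: "AE y in \<Omega>. y \<in> Y2 \<longrightarrow> (b g y \<in> \<phi> ` D \<longleftrightarrow> y \<in> \<phi> ` D)" if g: "g \<in> G" for g
    using push[OF g] AE_b[OF g push[OF iv_in[OF g]]] AE_space
  proof eventually_elim
    case (elim y)
    then show ?case using b_iv[OF g elim(3)] by auto
  qed
  have im_full: "emeasure \<Omega> (Y2 - \<phi> ` D) = 0"
    using erg2[OF imD(1) range im_inv] pos imD(2) by simp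
  have "emeasure \<Omega> Y1 = emeasure \<Omega> D"
    using emeasure_Diff_null_set[of "Y1 - D" \<Omega> Y1] D_full DM Y1(1) DY by (auto simp: null_sets_def double_diff)
  moreover have "emeasure \<Omega> Y2 = emeasure \<Omega> (\<phi> ` D)"
    using emeasure_Diff_null_set[of "Y2 - \<phi> ` D" \<Omega> Y2] im_full imD Y2(1) range by (auto simp: null_sets_def double_diff)
  ultimately have eqY: "emeasure \<Omega> Y1 = emeasure \<Omega> Y2" using imD by simp
  have AE_D: "AE x in \<Omega>. x \<in> Y1 \<longrightarrow> x \<in> D"
  proof -
    have "AE x in \<Omega>. x \<notin> Y1 - D" using D_full DM Y1(1) by (intro AE_not_in) auto
    then show ?thesis by eventually_elim blast
  qed
  have AE_eq: "AE x in \<Omega>. x \<in> Y1 \<longrightarrow> \<phi> (a g x) = b g (\<phi> x)" if g: "g \<in> G" for g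
    using AE_D AE_a[OF g AE_N] by eventually_elim (use equiv[OF g] in blast)
  show ?thesis
    by (rule exI[of _ D], rule exI[of _ D0], rule exI[of _ \<phi>])
      (intro conjI ballI impI DM DY D_full D_def D0M \<phi> inj range im_full AE_eq eqY; (use image in blast)?)
qed

end

section \<open>Countable codes for sets and maps; the amplified space\<close>

definition approximating :: "'b measure \<Rightarrow> (nat \<Rightarrow> 'b set) \<Rightarrow> bool" where
  "approximating \<Omega> A \<longleftrightarrow> (\<forall>n. A n \<in> sets \<Omega>) \<and> (\<forall>B\<in>sets \<Omega>. emeasure \<Omega> B < \<infinity> \<longrightarrow>
     (\<forall>\<epsilon>>0. \<exists>n. emeasure \<Omega> (sym_diff B (A n)) < ennreal \<epsilon>))"

lemma standard_separating:
  assumes "standard_prob_space M"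
  shows "\<exists>Q. separating M Q"
proof -
  obtain e :: "'a \<Rightarrow> real" and B where e: "bij_betw e (space M) B" "e \<in> M \<rightarrow>\<^sub>M borel"
    using assms unfolding standard_prob_space_def standard_borel_def by blast
  define q where "q n = real_of_rat (from_nat n)" for n
  define Q where "Q n = {x \<in> space M. q n < e x}" for n
  have "Q n \<in> sets M" for n unfolding Q_def using e(2) by measurable
  moreover have "x = y" if x: "x \<in> space M" and y: "y \<in> space M" and xy: "\<And>n. x \<in> Q n \<longleftrightarrow> y \<in> Q n" for x y
  proof -
    have nl: "\<not> e u < e w" if u: "u \<in> space M" and w: "w \<in> space M" and uw: "\<And>n. w \<in> Q n \<Longrightarrow> u \<in> Q n" for u w
    proof
      assume "e u < e w"
      then obtain r where r: "e u < real_of_rat r" "real_of_rat r < e w" using of_rat_dense by blast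
      have q: "q (to_nat r) = real_of_rat r" by (simp add: q_def)
      have "w \<in> Q (to_nat r)" using r w q by (simp add: Q_def)
      then have "u \<in> Q (to_nat r)" by (rule uw)
      then show False using r q by (simp add: Q_def)
    qed
    have "\<not> e x < e y" by (rule nl) (use x y xy in auto)
    moreover have "\<not> e y < e x" by (rule nl) (use x y xy in auto)
    ultimately have "e x = e y" by simp
    then show ?thesis using e(1) x y by (auto simp: bij_betw_def inj_on_def)
  qed
  ultimately show ?thesis unfolding separating_def by blast
qed

text \<open>The measure is pushed to the reals, where it is outer regular. A set is close to an open
  set, which is exhausted by finite unions of basic open sets, and there are countably many such
  unions.\<close>

lemma standard_approximating:
  assumes std: "standard_prob_space M"
  shows "\<exists>A. approximating M A"
proof -
  interpret prob_space M using std by (simp add: standard_prob_space_def)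
  obtain e :: "'a \<Rightarrow> real" and B0 where e: "bij_betw e (space M) B0" "e \<in> M \<rightarrow>\<^sub>M borel"
    "\<And>A. A \<in> sets M \<Longrightarrow> e ` A \<in> sets borel"
    using std unfolding standard_prob_space_def standard_borel_def by blast
  have e_inj: "inj_on e (space M)" using e(1) by (simp add: bij_betw_def)
  obtain \<B> :: "real set set" where \<B>: "countable \<B>" "topological_basis \<B>" using ex_countable_basis by blast
  have \<B>_open: "open U" if "U \<in> \<B>" for U using \<B>(2) that by (rule topological_basis_open)
  define \<F> where "\<F> = {S. finite S \<and> S \<subseteq> \<B>}"
  have \<F>: "countable \<F>" unfolding \<F>_def using \<B>(1) by (rule countable_Collect_finite_subset)
  have \<F>0: "\<F> \<noteq> {}" by (auto simp: \<F>_def)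
  define A where "A n = e -` (\<Union>(from_nat_into \<F> n)) \<inter> space M" for n
  have vim: "e -` U \<inter> space M \<in> sets M" if "open U" for U
    using e(2) that by (rule measurable_sets[OF _ borel_open])
  have AM: "A n \<in> sets M" for n
  proof -
    have "from_nat_into \<F> n \<in> \<F>" by (rule from_nat_into[OF \<F>0])
    then have "open (\<Union>(from_nat_into \<F> n))" using \<B>_open by (auto simp: \<F>_def)
    then show ?thesis unfolding A_def by (rule vim)
  qed
  have "\<exists>n. emeasure M (sym_diff B (A n)) < ennreal \<epsilon>" if B: "B \<in> sets M" and \<epsilon>: "\<epsilon> > 0" for B \<epsilon>
  proof -
    define N where "N = distr M borel e"
    interpret N: prob_space N unfolding N_def using e(2) by (rule prob_space_distr)
    have N_em: "emeasure N U = emeasure M (e -` U \<inter> space M)" if "U \<in> sets borel" for U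
      unfolding N_def using e(2) that by (rule emeasure_distr)
    define C where "C = e ` B"
    have C: "C \<in> sets borel" unfolding C_def by (rule e(3)[OF B])
    have Bsub: "B \<subseteq> space M" by (rule sets.sets_into_space[OF B])
    have eC: "e -` C \<inter> space M = B" using inj_on_image_mem_iff[OF e_inj _ Bsub] Bsub by (auto simp: C_def)
    have "emeasure N C = (INF U\<in>{U. C \<subseteq> U \<and> open U}. emeasure N U)"
      using C N.emeasure_finite by (intro outer_regular) (auto simp: N_def)
    moreover have "emeasure N C < emeasure N C + ennreal (\<epsilon>/2)"
      using \<epsilon> by (simp add: N.emeasure_eq_measure ennreal_plus[symmetric] ennreal_less_iff del: ennreal_plus)
    ultimately obtain U where U: "C \<subseteq> U" "open U" "emeasure N U < emeasure N C + ennreal (\<epsilon>/2)"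
      by (auto simp: INF_less_iff)
    define V where "V = e -` U \<inter> space M"
    have VM: "V \<in> sets M" unfolding V_def by (rule vim[OF U(2)])
    have BV: "B \<subseteq> V" using U(1) Bsub by (auto simp: V_def C_def)
    have "emeasure M V < emeasure M B + ennreal (\<epsilon>/2)"
      using U(3) N_em[OF C] N_em[OF borel_open[OF U(2)]] by (simp add: eC V_def)
    then have VB: "measure M (V - B) < \<epsilon>/2"
      using finite_measure_Diff[OF VM B BV] \<epsilon>
      by (simp add: emeasure_eq_measure ennreal_plus[symmetric] ennreal_less_iff del: ennreal_plus)
    obtain \<S> where \<S>: "\<S> \<subseteq> \<B>" "\<Union>\<S> = U" using \<B>(2) U(2) by (auto simp: topological_basis_def)
    have "countable \<S>" using \<S>(1) \<B>(1) by (rule countable_subset)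
    define W where "W n = e -` (\<Union>(from_nat_into (insert {} \<S>) ` {..n})) \<inter> space M" for n
    have fn: "from_nat_into (insert {} \<S>) i \<in> insert {} \<S>" for i by (rule from_nat_into) simp
    have op: "open (from_nat_into (insert {} \<S>) i)" for i using fn[of i] \<S>(1) \<B>_open by auto
    have WM: "W n \<in> sets M" for n unfolding W_def using op by (intro vim open_Union) auto
    have "range (from_nat_into (insert {} \<S>)) = insert {} \<S>"
      using \<open>countable \<S>\<close> by (intro range_from_nat_into) auto
    then have UW: "(\<Union>n. W n) = V" 
    proof -
      have "\<Union>(range (from_nat_into (insert {} \<S>))) = U"
        using \<open>range (from_nat_into (insert {} \<S>)) = insert {} \<S>\<close> \<S>(2) by simp
      then have V: "V = e -` (\<Union>(range (from_nat_into (insert {} \<S>)))) \<inter> space M" by (simp add: V_def)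
      show ?thesis
      proof (intro Set.set_eqI iffI)
        fix x assume "x \<in> (\<Union>n. W n)"
        then show "x \<in> V" unfolding V W_def by blast
      next
        fix x assume "x \<in> V"
        then obtain i where "e x \<in> from_nat_into (insert {} \<S>) i" "x \<in> space M" unfolding V by blast
        then have "x \<in> W i" unfolding W_def by blast
        then show "x \<in> (\<Union>n. W n)" by blast
      qed
    qed
    have "incseq W" 
      unfolding incseq_def W_def by (intro allI impI Int_mono vimage_mono Union_mono image_mono) auto
    then have "(\<lambda>n. measure M (W n)) \<longlonglongrightarrow> measure M V"
      unfolding UW[symmetric] using WM by (intro finite_Lim_measure_incseq) auto
    then have "\<forall>\<^sub>F n in sequentially. measure M V - \<epsilon>/2 < measure M (W n)"
      using \<epsilon> by (intro order_tendstoD(1)) auto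
    then obtain n where n: "measure M V - \<epsilon>/2 < measure M (W n)" by (auto simp: eventually_sequentially)
    have WV: "W n \<subseteq> V" using UW by auto
    have VW: "measure M (V - W n) < \<epsilon>/2" using finite_measure_Diff[OF VM WM WV] n by simp
    define F where "F = from_nat_into (insert {} \<S>) ` {..n} - {{}}"
    have "F \<in> \<F>" using fn \<S>(1) by (fastforce simp: F_def \<F>_def)
    then obtain m where m: "from_nat_into \<F> m = F" using from_nat_into_surj[OF \<F>] by blast
    have "\<Union>F = \<Union>(from_nat_into (insert {} \<S>) ` {..n})" by (auto simp: F_def)
    then have Am: "A m = W n" by (simp add: A_def W_def m)
    have "measure M (sym_diff B (A m)) \<le> measure M ((V - W n) \<union> (V - B))"
      using BV WV VM WM B unfolding Am by (intro finite_measure_mono) auto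
    also have "\<dots> \<le> measure M (V - W n) + measure M (V - B)"
      using VM WM B by (intro measure_Un_le) auto
    also have "\<dots> < \<epsilon>" using VW VB by simp
    finally have "emeasure M (sym_diff B (A m)) < ennreal \<epsilon>"
      using \<epsilon> by (simp add: emeasure_eq_measure ennreal_less_iff)
    then show ?thesis by blast
  qed
  then show ?thesis using AM unfolding approximating_def by blast
qed

text \<open>The amplification: \<open>X \<times> \<nat>\<close> with countably many copies of the measure, which carries the relation
  \<open>R\<^sup>\<infinity>\<close>.\<close>

definition amp :: "'a measure \<Rightarrow> ('a \<times> nat) measure" where
  "amp M = M \<Otimes>\<^sub>M count_space UNIV"

definition slice :: "nat \<Rightarrow> ('a \<times> nat) set \<Rightarrow> 'a set" where
  "slice n A = {x. (x, n) \<in> A}"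

lemma space_amp: "space (amp M) = space M \<times> UNIV"
  by (simp add: amp_def space_pair_measure)

lemma slice_sets: "A \<in> sets (amp M) \<Longrightarrow> slice n A \<in> sets M"
proof -
  assume A: "A \<in> sets (amp M)"
  have "(\<lambda>x. (x, n)) -` A \<in> sets M"
    using A unfolding amp_def by (intro sets_Pair2) 
  moreover have "slice n A = (\<lambda>x. (x, n)) -` A" by (auto simp: slice_def)
  ultimately show ?thesis by simp
qed

lemma times_amp: "B \<in> sets M \<Longrightarrow> B \<times> {n} \<in> sets (amp M)"
  unfolding amp_def by (intro pair_measureI) auto

lemma emeasure_times_amp: "B \<in> sets M \<Longrightarrow> emeasure (amp M) (B \<times> {n}) = emeasure M B"
proof -
  interpret C: sigma_finite_measure "count_space (UNIV :: nat set)"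
    by (rule sigma_finite_measure_count_space_countable) simp
  show "B \<in> sets M \<Longrightarrow> emeasure (amp M) (B \<times> {n}) = emeasure M B"
    unfolding amp_def by (subst C.emeasure_pair_measure_Times) auto
qed

lemma UN_slice: "(\<Union>n. slice n A \<times> {n}) = A"
  by (auto simp: slice_def)

lemma emeasure_amp:
  assumes "A \<in> sets (amp M)"
  shows "emeasure (amp M) A = (\<Sum>n. emeasure M (slice n A))"
proof -
  have "emeasure (amp M) (\<Union>n. slice n A \<times> {n}) = (\<Sum>n. emeasure (amp M) (slice n A \<times> {n}))"
    by (rule suminf_emeasure[symmetric])
      (use assms in \<open>auto intro: times_amp slice_sets simp: disjoint_family_on_def\<close>)
  then show ?thesis unfolding UN_slice by (simp add: emeasure_times_amp slice_sets[OF assms])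
qed

lemma separating_amp:
  assumes "separating M Q"
  shows "\<exists>Q'. separating (amp M) Q'"
proof -
  define Q' where "Q' n = (case prod_decode n of (i, j) \<Rightarrow>
      if i = 0 then Q j \<times> UNIV else space M \<times> {j})" for n
  have Q: "Q n \<in> sets M" for n using assms by (simp add: separating_def)
  have 1: "Q j \<times> UNIV \<in> sets (amp M)" "space M \<times> {j} \<in> sets (amp M)" for j
    unfolding amp_def using Q by (auto intro!: pair_measureI)
  have "Q' n \<in> sets (amp M)" for n unfolding Q'_def using 1 by (auto split: prod.split)
  moreover have "p = r" if p: "p \<in> space (amp M)" and r: "r \<in> space (amp M)"
    and pr: "\<And>n. p \<in> Q' n \<longleftrightarrow> r \<in> Q' n" for p r
  proof -
    have "fst p \<in> Q j \<longleftrightarrow> fst r \<in> Q j" for j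
      using pr[of "prod_encode (0, j)"] by (cases p; cases r) (simp add: Q'_def)
    then have "fst p = fst r" using assms p r by (auto simp: separating_def space_amp mem_Times_iff)
    moreover have "snd p = snd r"
      using pr[of "prod_encode (1, snd p)"] p r by (cases p; cases r) (simp add: Q'_def space_amp)
    ultimately show ?thesis by (rule prod_eqI)
  qed
  ultimately show ?thesis unfolding separating_def by blast
qed

text \<open>A set of finite measure has a small tail over the slices; the remaining finitely many
  slices are approximated one by one. A finite list of indices describes the result, so the family
  stays countable.\<close>

lemma approximating_amp:
  assumes "approximating M A"
  shows "\<exists>A'. approximating (amp M) A'"
proof -
  have AM: "A n \<in> sets M" for n using assms by (simp add: approximating_def)
  define A' where "A' n = (let l = from_nat n in \<Union>i\<in>{..<length l}. A (l ! i) \<times> {i})" for n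
  have A'M: "A' n \<in> sets (amp M)" for n
    unfolding A'_def Let_def using AM by (intro sets.finite_UN times_amp) auto
  have "\<exists>n. emeasure (amp M) (sym_diff B (A' n)) < ennreal \<epsilon>"
    if B: "B \<in> sets (amp M)" and fin: "emeasure (amp M) B < \<infinity>" and \<epsilon>: "\<epsilon> > 0" for B \<epsilon>
  proof -
    have sB: "slice n B \<in> sets M" for n by (rule slice_sets[OF B])
    have sum: "(\<Sum>n. emeasure M (slice n B)) < \<infinity>" using fin emeasure_amp[OF B] by simp
    have sfin: "emeasure M (slice n B) < \<infinity>" for n
      using sum_le_suminf[of "\<lambda>n. emeasure M (slice n B)" "{n}"] sum by (auto intro: le_less_trans)
    define f where "f n = measure M (slice n B)" for n
    have f: "emeasure M (slice n B) = ennreal (f n)" for n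
      using sfin[of n] by (simp add: f_def emeasure_eq_ennreal_measure less_top)
    have summ: "summable f"
      using sum unfolding f by (intro summable_suminf_not_top) (auto simp: f_def)
    obtain N where N: "norm (\<Sum>i. f (i + N)) < \<epsilon>/2"
      using suminf_exist_split[OF half_gt_zero[OF \<epsilon>] summ] by (metis order_refl)
    \<comment> \<open>The tail costs at most half of \<open>\<epsilon>\<close>, and the
      \<open>N\<close> slices together at most a quarter.\<close>
    define \<delta> where "\<delta> = \<epsilon> / (4 * real (Suc N))"
    have \<delta>: "\<delta> > 0" using \<epsilon> by (simp add: \<delta>_def)
    have "\<exists>k. emeasure M (sym_diff (slice n B) (A k)) < ennreal \<delta>" for n
      using assms sB sfin \<delta> unfolding approximating_def by blast
    then obtain k where k: "\<And>n. emeasure M (sym_diff (slice n B) (A (k n))) < ennreal \<delta>" by metis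
    define l where "l = map k [0..<N]"
    define D where "D = sym_diff B (A' (to_nat l))"
    have DM: "D \<in> sets (amp M)" unfolding D_def using B A'M by auto
    have sA: "slice n (A' (to_nat l)) = (if n < N then A (k n) else {})" for n
      by (auto simp: A'_def slice_def l_def Let_def)
    have sD: "slice n D = (if n < N then sym_diff (slice n B) (A (k n)) else slice n B)" for n
      using sA[of n] by (auto simp: D_def slice_def split: if_splits)
    have "emeasure (amp M) D = (\<Sum>n. emeasure M (slice n D))" by (rule emeasure_amp[OF DM])
    also have "\<dots> = (\<Sum>n. emeasure M (slice (n + N) D)) + (\<Sum>n<N. emeasure M (slice n D))"
      by (rule suminf_offset) simp
    also have "(\<Sum>n. emeasure M (slice (n + N) D)) = (\<Sum>n. ennreal (f (n + N)))"
      by (simp add: sD f)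
    also have "\<dots> = ennreal (\<Sum>n. f (n + N))"
      by (intro suminf_ennreal2 summable_iff_shift[THEN iffD2, OF summ]) (simp add: f_def)
    finally have D1: "emeasure (amp M) D = ennreal (\<Sum>n. f (n + N)) + (\<Sum>n<N. emeasure M (slice n D))" .
    have D2: "ennreal (\<Sum>n. f (n + N)) \<le> ennreal (\<epsilon>/2)" using N by (intro ennreal_leI) auto
    have "(\<Sum>n<N. emeasure M (slice n D)) \<le> (\<Sum>n<N. ennreal \<delta>)"
      by (intro sum_mono) (use k in \<open>simp add: sD less_imp_le\<close>)
    also have "\<dots> = ennreal (real N * \<delta>)" using \<delta> by (simp add: ennreal_mult ennreal_of_nat_eq_real_of_nat)
    also have "\<dots> \<le> ennreal (\<epsilon>/4)"
      using \<epsilon> by (intro ennreal_leI) (simp add: \<delta>_def field_simps)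
    finally have "emeasure (amp M) D \<le> ennreal (\<epsilon>/2) + ennreal (\<epsilon>/4)"
      unfolding D1 using D2 by (rule add_mono[rotated])
    also have "\<dots> = ennreal (\<epsilon>/2 + \<epsilon>/4)" using \<epsilon> by (intro ennreal_plus[symmetric]) auto
    also have "\<dots> < ennreal \<epsilon>" using \<epsilon> by (intro ennreal_lessI) auto
    finally show ?thesis unfolding D_def by blast
  qed
  then show ?thesis using A'M unfolding approximating_def by blast
qed

definition covered_map :: "'b measure \<Rightarrow> (nat \<Rightarrow> 'b \<Rightarrow> 'b) \<Rightarrow> ('b \<Rightarrow> 'b) \<times> 'b set \<Rightarrow> bool" where
  "covered_map \<Omega> F p \<longleftrightarrow> fst p \<in> \<Omega> \<rightarrow>\<^sub>M \<Omega> \<and> snd p \<in> sets \<Omega> \<and> emeasure \<Omega> (snd p) < \<infinity> \<and>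
     (AE x in \<Omega>. x \<in> snd p \<longrightarrow> (\<exists>k. fst p x = F k x))"

text \<open>A map covered by the \<open>F k\<close> is known, up to a small set, from its domain and
  from finitely many of the sets where it agrees with \<open>F k\<close>. Approximating these from a
  countable family leaves countably many codes for each precision.\<close>

lemma covered_maps_code:
  assumes sep: "separating \<Omega> Q" and app: "approximating \<Omega> A" and FM: "\<And>k. F k \<in> \<Omega> \<rightarrow>\<^sub>M \<Omega>"
    and \<epsilon>: "\<epsilon> > (0 :: real)"
  shows "\<exists>\<kappa> :: ('b \<Rightarrow> 'b) \<times> 'b set \<Rightarrow> nat. \<forall>p r. covered_map \<Omega> F p \<longrightarrow> covered_map \<Omega> F r \<longrightarrow> \<kappa> p = \<kappa> r \<longrightarrow>
    emeasure \<Omega> (sym_diff (snd p) (snd r)) < ennreal \<epsilon> \<and>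
    emeasure \<Omega> {x \<in> snd p \<inter> snd r. fst p x \<noteq> fst r x} < ennreal \<epsilon>"
proof -
  define \<delta> where "\<delta> = \<epsilon> / 4"
  have \<delta>: "\<delta> > 0" using \<epsilon> by (simp add: \<delta>_def)
  have AM: "A n \<in> sets \<Omega>" for n using app by (simp add: approximating_def)
  define E where "E p k = {x \<in> snd p. fst p x = F k x}" for p k
  have EM: "E p k \<in> sets \<Omega>" if p: "covered_map \<Omega> F p" for p k
  proof -
    have 1: "snd p \<in> sets \<Omega>" using p by (simp add: covered_map_def)
    have "fst p \<in> \<Omega> \<rightarrow>\<^sub>M \<Omega>" using p by (simp add: covered_map_def)
    note [measurable] = 1 separating_pred_eq[OF sep this FM[of k]]
    have "E p k = {x \<in> space \<Omega>. x \<in> snd p \<and> fst p x = F k x}"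
      using sets.sets_into_space[OF 1] by (auto simp: E_def)
    also have "\<dots> \<in> sets \<Omega>" by measurable
    finally show ?thesis .
  qed
  \<comment> \<open>The code consists of \<open>N\<close>, an approximant of the domain and a list
    of approximants for the first \<open>N\<close> agreement sets, outside of which less than
    \<open>\<delta>\<close> remains. With the bound \<open>\<delta> / (2 * Suc N)\<close>, the
    errors of two maps on all \<open>N\<close> sets add up to at most
    \<open>\<delta>\<close>.\<close>
  define ok where "ok p c \<longleftrightarrow> (case c of (N, y, l) \<Rightarrow>
      emeasure \<Omega> (snd p - (\<Union>k<N. E p k)) < ennreal \<delta> \<and> emeasure \<Omega> (sym_diff (snd p) (A y)) < ennreal \<delta> \<and>
      (\<forall>k<N. emeasure \<Omega> (sym_diff (E p k) (A (l ! k))) < ennreal (\<delta> / real (2 * Suc N))))" for p c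
  have "\<exists>c. ok p c" if p: "covered_map \<Omega> F p" for p
  proof -
    have pM: "snd p \<in> sets \<Omega>" and fin: "emeasure \<Omega> (snd p) < \<infinity>" using p by (auto simp: covered_map_def)
    have fin': "emeasure \<Omega> S < \<infinity>" if "S \<subseteq> snd p" for S
      using emeasure_mono[OF that pM] fin by (rule le_less_trans)
    define Z where "Z N = snd p - (\<Union>k<N. E p k)" for N
    have ZM: "Z N \<in> sets \<Omega>" for N unfolding Z_def using pM EM[OF p] by auto
    have "AE x in \<Omega>. x \<in> snd p \<longrightarrow> (\<exists>k. fst p x = F k x)" using p by (simp add: covered_map_def)
    then have "AE x in \<Omega>. x \<notin> (\<Inter>N. Z N)"
    proof eventually_elim
      case (elim x)
      show ?case
      proof
        assume x: "x \<in> (\<Inter>N. Z N)"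
        then have "x \<in> Z 0" by blast
        then have "x \<in> snd p" by (simp add: Z_def)
        then obtain k where "x \<in> E p k" using elim by (auto simp: E_def)
        then have "x \<notin> Z (Suc k)" by (auto simp: Z_def)
        then show False using x by blast
      qed
    qed
    then have "(\<Inter>N. Z N) \<in> null_sets \<Omega>" using ZM by (subst AE_iff_null_sets) auto
    then have "emeasure \<Omega> (\<Inter>N. Z N) = 0" by auto
    moreover have "(\<lambda>N. emeasure \<Omega> (Z N)) \<longlonglongrightarrow> emeasure \<Omega> (\<Inter>N. Z N)"
    proof (rule Lim_emeasure_decseq)
      show "decseq Z" unfolding decseq_def Z_def by (auto; meson order_less_le_trans)
      show "emeasure \<Omega> (Z N) \<noteq> \<infinity>" for N using fin'[of "Z N"] by (auto simp: Z_def)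
    qed (use ZM in auto)
    ultimately have "(\<lambda>N. emeasure \<Omega> (Z N)) \<longlonglongrightarrow> 0" by simp
    then have "\<forall>\<^sub>F N in sequentially. emeasure \<Omega> (Z N) < ennreal \<delta>"
      using \<delta> by (intro order_tendstoD(2)) auto
    then obtain N where N: "emeasure \<Omega> (Z N) < ennreal \<delta>" by (auto simp: eventually_sequentially)
    obtain y where y: "emeasure \<Omega> (sym_diff (snd p) (A y)) < ennreal \<delta>"
      using app pM fin \<delta> unfolding approximating_def by blast
    have "\<exists>j. emeasure \<Omega> (sym_diff (E p k) (A j)) < ennreal (\<delta> / real (2 * Suc N))" for k
    proof -
      have "emeasure \<Omega> (E p k) < \<infinity>" by (rule fin') (auto simp: E_def)
      moreover have "\<delta> / real (2 * Suc N) > 0" using \<delta> by simp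
      ultimately show ?thesis using app EM[OF p] unfolding approximating_def by blast
    qed
    then obtain j where j: "\<And>k. emeasure \<Omega> (sym_diff (E p k) (A (j k))) < ennreal (\<delta> / real (2 * Suc N))" by metis
    have "ok p (N, y, map j [0..<N])"
      unfolding ok_def prod.case using N y j by (auto simp: Z_def)
    then show ?thesis by blast
  qed
  then have ok: "ok p (SOME c. ok p c)" if "covered_map \<Omega> F p" for p using that by (meson someI_ex)
  define \<kappa> where "\<kappa> p = to_nat (SOME c. ok p c)" for p
  have "emeasure \<Omega> (sym_diff (snd p) (snd r)) < ennreal \<epsilon> \<and>
      emeasure \<Omega> {x \<in> snd p \<inter> snd r. fst p x \<noteq> fst r x} < ennreal \<epsilon>"
    if p: "covered_map \<Omega> F p" and r: "covered_map \<Omega> F r" and eq: "\<kappa> p = \<kappa> r" for p r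
  proof -
    obtain N y l where c: "(SOME c. ok p c) = (N, y, l)" by (metis prod_cases3)
    have "(SOME c. ok r c) = (N, y, l)" using eq c by (simp add: \<kappa>_def)
    then have okp: "ok p (N, y, l)" and okr: "ok r (N, y, l)" using ok[OF p] ok[OF r] c by auto
    have pM: "snd p \<in> sets \<Omega>" "snd r \<in> sets \<Omega>" using p r by (auto simp: covered_map_def)
    have "emeasure \<Omega> (sym_diff (snd p) (snd r)) \<le> emeasure \<Omega> (sym_diff (snd p) (A y) \<union> sym_diff (snd r) (A y))"
      using pM AM by (intro emeasure_mono) auto
    also have "\<dots> \<le> emeasure \<Omega> (sym_diff (snd p) (A y)) + emeasure \<Omega> (sym_diff (snd r) (A y))"
      using pM AM by (intro emeasure_subadditive) auto
    also have "\<dots> \<le> ennreal \<delta> + ennreal \<delta>"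
      using okp okr unfolding ok_def prod.case by (intro add_mono less_imp_le) blast+
    also have "\<dots> = ennreal (2 * \<delta>)" using \<delta> by (simp add: ennreal_plus[symmetric] del: ennreal_plus)
    also have "\<dots> < ennreal \<epsilon>" using \<epsilon> by (intro ennreal_lessI) (auto simp: \<delta>_def)
    finally have 1: "emeasure \<Omega> (sym_diff (snd p) (snd r)) < ennreal \<epsilon>" .
    define Z where "Z = snd p - (\<Union>k<N. E p k)"
    have ZM: "Z \<in> sets \<Omega>" unfolding Z_def using pM EM[OF p] by auto
    define D where "D k = sym_diff (E p k) (A (l ! k)) \<union> sym_diff (E r k) (A (l ! k))" for k
    have DM: "D k \<in> sets \<Omega>" for k unfolding D_def using EM[OF p] EM[OF r] AM by auto
    have "emeasure \<Omega> {x \<in> snd p \<inter> snd r. fst p x \<noteq> fst r x} \<le> emeasure \<Omega> (Z \<union> (\<Union>k<N. D k))"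
    proof (rule emeasure_mono)
      show "{x \<in> snd p \<inter> snd r. fst p x \<noteq> fst r x} \<subseteq> Z \<union> (\<Union>k<N. D k)"
      proof
        fix x assume x: "x \<in> {x \<in> snd p \<inter> snd r. fst p x \<noteq> fst r x}"
        show "x \<in> Z \<union> (\<Union>k<N. D k)"
        proof (cases "x \<in> Z")
          case False
          then obtain k where k: "k < N" "x \<in> E p k" using x unfolding Z_def by blast
          then have "x \<notin> E r k" using x unfolding E_def by auto
          then have "x \<in> D k" using k(2) unfolding D_def by blast
          then show ?thesis using k(1) by blast
        qed simp
      qed
      show "Z \<union> (\<Union>k<N. D k) \<in> sets \<Omega>" using ZM DM by auto
    qed
    also have "\<dots> \<le> emeasure \<Omega> Z + emeasure \<Omega> (\<Union>k<N. D k)"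
      using ZM DM by (intro emeasure_subadditive) auto
    also have "emeasure \<Omega> (\<Union>k<N. D k) \<le> (\<Sum>k<N. emeasure \<Omega> (D k))"
      using DM by (intro emeasure_subadditive_finite) auto
    also have "\<dots> \<le> (\<Sum>k<N. ennreal (\<delta> / real (Suc N)))"
    proof (rule sum_mono)
      fix k assume "k \<in> {..<N}"
      then have k: "emeasure \<Omega> (sym_diff (E p k) (A (l ! k))) \<le> ennreal (\<delta> / real (2 * Suc N))"
        "emeasure \<Omega> (sym_diff (E r k) (A (l ! k))) \<le> ennreal (\<delta> / real (2 * Suc N))"
        using okp okr unfolding ok_def prod.case by (blast intro: less_imp_le)+
      have "emeasure \<Omega> (D k) \<le> emeasure \<Omega> (sym_diff (E p k) (A (l ! k))) + emeasure \<Omega> (sym_diff (E r k) (A (l ! k)))"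
        unfolding D_def using EM[OF p] EM[OF r] AM by (intro emeasure_subadditive) auto
      also have "\<dots> \<le> ennreal (\<delta> / real (2 * Suc N)) + ennreal (\<delta> / real (2 * Suc N))"
        by (intro add_mono k)
      also have "\<dots> = ennreal (\<delta> / real (2 * Suc N) + \<delta> / real (2 * Suc N))"
        using \<delta> by (intro ennreal_plus[symmetric]) auto
      also have "\<delta> / real (2 * Suc N) + \<delta> / real (2 * Suc N) = \<delta> / real (Suc N)"
        by (simp only: of_nat_mult of_nat_numeral) (simp add: divide_simps del: of_nat_Suc)
      finally show "emeasure \<Omega> (D k) \<le> ennreal (\<delta> / real (Suc N))" .
    qed
    also have "\<dots> = ennreal (real N * (\<delta> / real (Suc N)))"
      using \<delta> by (simp only: sum_constant card_lessThan ennreal_of_nat_eq_real_of_nat) (rule ennreal_mult[symmetric], auto)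
    also have "\<dots> \<le> ennreal \<delta>"
      using \<delta> by (intro ennreal_leI) (simp add: field_simps)
    also have "emeasure \<Omega> Z \<le> ennreal \<delta>" using okp unfolding ok_def prod.case Z_def by (blast intro: less_imp_le)
    finally have "emeasure \<Omega> {x \<in> snd p \<inter> snd r. fst p x \<noteq> fst r x} \<le> ennreal \<delta> + ennreal \<delta>"
      by (simp add: add_right_mono)
    also have "\<dots> = ennreal (2 * \<delta>)" using \<delta> by (simp add: ennreal_plus[symmetric] del: ennreal_plus)
    also have "\<dots> < ennreal \<epsilon>" using \<epsilon> by (intro ennreal_lessI) (auto simp: \<delta>_def)
    finally show ?thesis using 1 by blast
  qed
  then show ?thesis by blast
qed

section \<open>From classes of maps to an action valid at every point\<close>

definition rel_action :: "'a measure \<Rightarrow> ('a \<times> 'a) set \<Rightarrow> 'a set \<Rightarrow> ('a \<Rightarrow> 'a) set \<Rightarrow> 'a set \<Rightarrow>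
    (('a \<Rightarrow> 'a) set \<Rightarrow> 'a \<Rightarrow> 'a) \<Rightarrow> bool" where
  "rel_action M R Y S Z a \<longleftrightarrow> Z \<in> sets M \<and> Z \<subseteq> Y \<and> emeasure M (Y - Z) = 0 \<and>
    (\<forall>c\<in>carrier (class_group M Y S). a c \<in> M \<rightarrow>\<^sub>M M \<and> a c \<in> c \<and>
      (\<forall>x\<in>space M. (x, a c x) \<in> R) \<and> (\<forall>x\<in>Z. a c x \<in> Z) \<and> (\<forall>x\<in>space M - Z. a c x = x) \<and>
      (\<forall>A\<in>sets M. emeasure M (a c -` A \<inter> space M) = emeasure M A)) \<and>
    (\<forall>c\<in>carrier (class_group M Y S). \<forall>d\<in>carrier (class_group M Y S). \<forall>x\<in>space M.
      a (c \<otimes>\<^bsub>class_group M Y S\<^esub> d) x = a c (a d x)) \<and>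
    (\<forall>x\<in>space M. a \<one>\<^bsub>class_group M Y S\<^esub> x = x)"

lemma AE_ballI: "countable I \<Longrightarrow> (\<And>i. i \<in> I \<Longrightarrow> AE x in M. P i x) \<Longrightarrow> AE x in M. \<forall>i\<in>I. P i x"
  by (subst AE_ball_countable) blast+

lemma ae_class_self: "f \<in> ae_class M Y f"
  by (simp add: ae_class_def)

text \<open>Countably many laws that hold almost everywhere hold together off a null set. Removing
  all points whose orbit meets that set leaves an invariant part \<open>Z\<close>, conull in
  \<open>Y\<close>, on which the laws hold everywhere; elsewhere the identity is used. The maps are
  then bijections with graph in \<open>R\<close>, so \<open>pmp_rel\<close> makes them measure
  preserving.\<close>

lemma pseudo_subgroup_action:
  assumes R: "II1_rel M R" and S: "pseudo_subgroup M R Y S"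
    and G: "group (class_group M Y S)" and cnt: "countable (carrier (class_group M Y S))"
  shows "\<exists>Z a. rel_action M R Y S Z a"
proof -
  define G where "G = class_group M Y S"
  interpret group G using G by (simp add: G_def)
  have cG: "countable (carrier G)" using cnt by (simp add: G_def)
  have YM: "Y \<in> sets M" using S by (simp add: pseudo_subgroup_def)
  have carr: "carrier G = ae_class M Y ` S" by (simp add: G_def class_group_def)
  have "\<exists>s. s \<in> S \<and> c = ae_class M Y s" if "c \<in> carrier G" for c using that carr by auto
  then obtain s where s: "\<And>c. c \<in> carrier G \<Longrightarrow> s c \<in> S" "\<And>c. c \<in> carrier G \<Longrightarrow> c = ae_class M Y (s c)" by metis
  have s_in: "s c \<in> c" if "c \<in> carrier G" for c using s(2)[OF that] ae_class_self by metis
  \<comment> \<open>\<open>f c\<close> is the representative that the product of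
    \<open>class_group\<close> happens to choose, of which nothing but its class is known;
    \<open>s c\<close> is one from \<open>S\<close>, hence nonsingular. They agree almost everywhere
    on \<open>Y\<close>.\<close>
  define f where "f c = (SOME f. f \<in> c)" for c :: "('a \<Rightarrow> 'a) set"
  have f_in: "f c \<in> c" if "c \<in> carrier G" for c unfolding f_def by (rule someI[of "\<lambda>f. f \<in> c", OF s_in[OF that]])
  have f_s: "AE x in M. x \<in> Y \<longrightarrow> f c x = s c x" if "c \<in> carrier G" for c
    using f_in[OF that] s(2)[OF that] by (simp add: ae_class_def set_eq_iff)
  have mult: "c \<otimes>\<^bsub>G\<^esub> d = ae_class M Y (f c \<circ> f d)" for c d by (simp add: G_def class_group_def f_def)
  have one: "\<one>\<^bsub>G\<^esub> = ae_class M Y id" by (simp add: G_def class_group_def)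
  have ps: "in_pseudogroup M R Y Y (s c)" if "c \<in> carrier G" for c
    using S s(1)[OF that] by (simp add: pseudo_subgroup_def)
  have "\<exists>D0 E0. D0 \<in> sets M \<and> E0 \<subseteq> Y \<and> D0 \<subseteq> Y \<and> emeasure M (Y - D0) = 0 \<and> bij_betw (s c) D0 E0 \<and>
      s c \<in> restrict_space M D0 \<rightarrow>\<^sub>M M \<and>
      (\<forall>A\<in>sets M. A \<subseteq> D0 \<longrightarrow> s c ` A \<in> sets M \<and> (emeasure M (s c ` A) = 0 \<longleftrightarrow> emeasure M A = 0))"
    if "c \<in> carrier G" for c
    using ps[OF that] unfolding in_pseudogroup_def by blast
  then obtain D0 E0 where D0: "\<And>c. c \<in> carrier G \<Longrightarrow> D0 c \<in> sets M \<and> E0 c \<subseteq> Y \<and> D0 c \<subseteq> Y \<and>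
      emeasure M (Y - D0 c) = 0 \<and> bij_betw (s c) (D0 c) (E0 c) \<and> s c \<in> restrict_space M (D0 c) \<rightarrow>\<^sub>M M \<and>
      (\<forall>A\<in>sets M. A \<subseteq> D0 c \<longrightarrow> s c ` A \<in> sets M \<and> (emeasure M (s c ` A) = 0 \<longleftrightarrow> emeasure M A = 0))"
    by metis
  define t where "t c x = (if x \<in> D0 c then s c x else x)" for c x
  have tM: "t c \<in> M \<rightarrow>\<^sub>M M" if c: "c \<in> carrier G" for c
  proof -
    have DM: "D0 c \<in> sets M" using D0[OF c] by blast
    have "{x \<in> space M. x \<in> D0 c} = D0 c" using sets.sets_into_space[OF DM] by blast
    then have "{x \<in> space M. x \<in> D0 c} \<in> sets M" using DM by simp
    then show ?thesis
      unfolding t_def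
      by (subst measurable_If_restrict_space_iff) (use D0[OF c] in \<open>auto intro: measurable_restrict_space1\<close>)
  qed
  have AE_D0: "AE x in M. x \<in> Y \<longrightarrow> x \<in> D0 c" if "c \<in> carrier G" for c
  proof -
    have "AE x in M. x \<notin> Y - D0 c" using D0[OF that] YM by (intro AE_not_in) auto
    then show ?thesis by eventually_elim blast
  qed
  have t_s: "AE x in M. x \<in> Y \<longrightarrow> t c x = s c x" if "c \<in> carrier G" for c
    using AE_D0[OF that] by eventually_elim (simp add: t_def)
  have t_Y: "AE x in M. x \<in> Y \<longrightarrow> t c x \<in> Y" if "c \<in> carrier G" for c
    using AE_D0[OF that]
  proof eventually_elim
    case (elim x)
    then show ?case using D0[OF that] by (auto simp: t_def bij_betw_def)
  qed
  \<comment> \<open>Null sets pull back to null sets, so a law valid almost everywhere may be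
    evaluated at \<open>t c x\<close>. This is what allows the laws to be composed.\<close>
  have nonsing: "AE x in M. x \<in> Y \<longrightarrow> P (t c x)" if c: "c \<in> carrier G" and P: "AE y in M. y \<in> Y \<longrightarrow> P y" for c P
  proof -
    obtain N where N: "{y \<in> space M. \<not> (y \<in> Y \<longrightarrow> P y)} \<subseteq> N" "emeasure M N = 0" "N \<in> sets M" using P by (rule AE_E)
    define Bx where "Bx = D0 c \<inter> (t c -` N \<inter> space M)"
    have BM: "Bx \<in> sets M" unfolding Bx_def using D0[OF c] measurable_sets[OF tM[OF c] N(3)] by blast
    have sub: "Bx \<subseteq> D0 c" by (simp add: Bx_def)
    have "s c ` Bx \<subseteq> N" by (auto simp: Bx_def t_def)
    then have "emeasure M (s c ` Bx) \<le> emeasure M N" using N(3) by (rule emeasure_mono)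
    then have "emeasure M (s c ` Bx) = 0" using N(2) by simp
    then have "emeasure M Bx = 0" using D0[OF c] BM sub by blast
    then have "AE x in M. x \<notin> Bx" using BM by (intro AE_not_in) auto
    then show ?thesis using AE_D0[OF c] t_Y[OF c] AE_space
    proof eventually_elim
      case (elim x)
      show ?case
      proof
        assume x: "x \<in> Y"
        have "t c x \<in> space M" using measurable_space[OF tM[OF c]] elim by blast
        moreover have "t c x \<notin> N" using elim x by (auto simp: Bx_def)
        ultimately show "P (t c x)" using N(1) elim x by blast
      qed
    qed
  qed
  have t_mult: "AE x in M. x \<in> Y \<longrightarrow> t c (t d x) = t (c \<otimes>\<^bsub>G\<^esub> d) x" if c: "c \<in> carrier G" and d: "d \<in> carrier G" for c d
  proof -
    have cd: "c \<otimes>\<^bsub>G\<^esub> d \<in> carrier G" using c d by (rule m_closed)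
    have "s (c \<otimes>\<^bsub>G\<^esub> d) \<in> ae_class M Y (f c \<circ> f d)" using s_in[OF cd] mult by metis
    then have 1: "AE x in M. x \<in> Y \<longrightarrow> s (c \<otimes>\<^bsub>G\<^esub> d) x = f c (f d x)" by (simp add: ae_class_def)
    have 2: "AE x in M. x \<in> Y \<longrightarrow> f c (t d x) = s c (t d x)" by (rule nonsing[OF d f_s[OF c]])
    have 3: "AE x in M. x \<in> Y \<longrightarrow> t c (t d x) = s c (t d x)" by (rule nonsing[OF d t_s[OF c]])
    show ?thesis using 1 2 3 f_s[OF d] t_s[OF d] t_s[OF cd] by eventually_elim simp
  qed
  have t_one: "AE x in M. x \<in> Y \<longrightarrow> t \<one>\<^bsub>G\<^esub> x = x"
  proof -
    have "s \<one>\<^bsub>G\<^esub> \<in> ae_class M Y id" using s_in[OF one_closed] one by metis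
    then have "AE x in M. x \<in> Y \<longrightarrow> s \<one>\<^bsub>G\<^esub> x = x" by (simp add: ae_class_def)
    then show ?thesis using t_s[OF one_closed] by eventually_elim simp
  qed
  have t_R: "AE x in M. x \<in> Y \<longrightarrow> (x, t c x) \<in> R" if c: "c \<in> carrier G" for c
  proof -
    have "AE x in M. x \<in> Y \<longrightarrow> (x, s c x) \<in> R" using ps[OF c] by (simp add: in_pseudogroup_def)
    then show ?thesis using t_s[OF c] by eventually_elim simp
  qed
  define good where "good x \<longleftrightarrow> (\<forall>c\<in>carrier G. \<forall>d\<in>carrier G. t c (t d x) = t (c \<otimes>\<^bsub>G\<^esub> d) x) \<and>
      t \<one>\<^bsub>G\<^esub> x = x \<and> (\<forall>c\<in>carrier G. t c x \<in> Y \<and> (x, t c x) \<in> R)" for x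
  have "AE x in M. \<forall>c\<in>carrier G. \<forall>d\<in>carrier G. x \<in> Y \<longrightarrow> t c (t d x) = t (c \<otimes>\<^bsub>G\<^esub> d) x"
    by (rule AE_ballI[OF cG], rule AE_ballI[OF cG], rule t_mult)
  moreover have "AE x in M. \<forall>c\<in>carrier G. x \<in> Y \<longrightarrow> t c x \<in> Y"
    by (rule AE_ballI[OF cG], rule t_Y)
  moreover have "AE x in M. \<forall>c\<in>carrier G. x \<in> Y \<longrightarrow> (x, t c x) \<in> R"
    by (rule AE_ballI[OF cG], rule t_R)
  ultimately have "AE x in M. x \<in> Y \<longrightarrow> good x" using t_one unfolding good_def by eventually_elim blast
  then obtain N where N: "{x \<in> space M. \<not> (x \<in> Y \<longrightarrow> good x)} \<subseteq> N" "emeasure M N = 0" "N \<in> sets M" by (rule AE_E)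
  \<comment> \<open>The points whose entire orbit stays in \<open>Y\<close> and avoids the
    exceptional set. Because the product law holds at them, the set is invariant.\<close>
  define Z where "Z = (Y - N) \<inter> (\<Inter>c\<in>carrier G. t c -` (Y - N) \<inter> space M)"
  have YN: "Y - N \<in> sets M" using YM N by simp
  have ZM: "Z \<in> sets M"
  proof -
    have "(\<Inter>c\<in>carrier G. t c -` (Y - N) \<inter> space M) \<in> sets M"
      using cG one_closed measurable_sets[OF tM YN] by (intro sets.countable_INT') auto
    then show ?thesis unfolding Z_def using YN by blast
  qed
  have ZY: "Z \<subseteq> Y" by (auto simp: Z_def)
  have Ysp: "x \<in> space M" if "x \<in> Y" for x using that sets.sets_into_space[OF YM] by blast
  have Z_iff: "x \<in> Z \<longleftrightarrow> x \<in> Y - N \<and> (\<forall>c\<in>carrier G. t c x \<in> Y - N)" for x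
    unfolding Z_def using Ysp by blast
  have Zgood: "good x" "x \<in> space M" if "x \<in> Z" for x using that N(1) Ysp by (auto simp: Z_iff)
  have Zt: "t c x \<in> Z" if c: "c \<in> carrier G" and x: "x \<in> Z" for c x
  proof -
    have 1: "t d x \<in> Y - N" if "d \<in> carrier G" for d using that x unfolding Z_iff by blast
    have "t d (t c x) \<in> Y - N" if d: "d \<in> carrier G" for d
      using Zgood(1)[OF x] c d 1[of "d \<otimes>\<^bsub>G\<^esub> c"] by (simp add: good_def)
    then show ?thesis using 1[OF c] unfolding Z_iff by blast
  qed
  have YZ: "emeasure M (Y - Z) = 0"
  proof -
    have AE_N: "AE x in M. x \<in> Y \<longrightarrow> x \<notin> N"
    proof -
      have "AE x in M. x \<notin> N" using N by (intro AE_not_in) auto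
      then show ?thesis by eventually_elim blast
    qed
    have "AE x in M. \<forall>c\<in>carrier G. x \<in> Y \<longrightarrow> t c x \<notin> N"
      by (rule AE_ballI[OF cG], rule nonsing[OF _ AE_N])
    moreover have "AE x in M. \<forall>c\<in>carrier G. x \<in> Y \<longrightarrow> t c x \<in> Y"
      by (rule AE_ballI[OF cG], rule t_Y)
    ultimately have "AE x in M. x \<notin> Y - Z" using AE_N AE_space
    proof eventually_elim
      case (elim x)
      then have "x \<in> Y \<Longrightarrow> x \<in> Z" unfolding Z_iff by blast
      then show ?case by blast
    qed
    then have "Y - Z \<in> null_sets M" using YM ZM by (subst AE_iff_null_sets) auto
    then show ?thesis by auto
  qed
  define a where "a c x = (if x \<in> Z then t c x else x)" for c x
  have aM: "a c \<in> M \<rightarrow>\<^sub>M M" if c: "c \<in> carrier G" for c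
  proof -
    note [measurable] = tM[OF c] ZM
    show ?thesis unfolding a_def by measurable
  qed
  have a_mult: "a (c \<otimes>\<^bsub>G\<^esub> d) x = a c (a d x)" if "c \<in> carrier G" "d \<in> carrier G" for c d x
    using Zgood(1)[of x] Zt[OF that(2), of x] that by (simp add: a_def good_def)
  have a_one: "a \<one>\<^bsub>G\<^esub> x = x" for x using Zgood(1)[of x] by (simp add: a_def good_def)
  have a_inv: "a (inv\<^bsub>G\<^esub> c) (a c x) = x" "a c (a (inv\<^bsub>G\<^esub> c) x) = x" if "c \<in> carrier G" for c x
    using a_mult[of "inv\<^bsub>G\<^esub> c" c x] a_mult[of c "inv\<^bsub>G\<^esub> c" x] that a_one by simp_all
  have aR: "(x, a c x) \<in> R" if "c \<in> carrier G" "x \<in> space M" for c x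
  proof (cases "x \<in> Z")
    case True
    then show ?thesis using Zgood(1)[OF True] that(1) by (simp add: a_def good_def)
  next
    case False
    then show ?thesis using R that(2) by (auto simp: a_def II1_rel_def equiv_def refl_on_def)
  qed
  have a_mp: "emeasure M (a c -` A \<inter> space M) = emeasure M A" if c: "c \<in> carrier G" and A: "A \<in> sets M" for c A
  proof -
    have ic: "inv\<^bsub>G\<^esub> c \<in> carrier G" using c by simp
    have Asp: "A \<subseteq> space M" by (rule sets.sets_into_space[OF A])
    have eq: "a (inv\<^bsub>G\<^esub> c) ` A = a c -` A \<inter> space M"
    proof (intro Set.set_eqI iffI)
      fix y assume "y \<in> a (inv\<^bsub>G\<^esub> c) ` A"
      then show "y \<in> a c -` A \<inter> space M"
        using a_inv(2)[OF c] measurable_space[OF aM[OF ic]] Asp by auto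
    next
      fix y assume "y \<in> a c -` A \<inter> space M"
      then show "y \<in> a (inv\<^bsub>G\<^esub> c) ` A" using a_inv(1)[OF c, of y] by (intro image_eqI[of _ _ "a c y"]) auto
    qed
    have "pmp_rel M R" using R by (simp add: II1_rel_def)
    moreover have "inj_on (a (inv\<^bsub>G\<^esub> c)) A" by (rule inj_on_inverseI[of _ "a c"]) (rule a_inv(2)[OF c])
    moreover have "\<forall>x\<in>A. (x, a (inv\<^bsub>G\<^esub> c) x) \<in> R" using aR[OF ic] Asp by blast
    moreover have "a (inv\<^bsub>G\<^esub> c) ` A \<in> sets M" unfolding eq by (rule measurable_sets[OF aM[OF c] A])
    ultimately have "emeasure M (a (inv\<^bsub>G\<^esub> c) ` A) = emeasure M A"
      using A aM[OF ic] unfolding pmp_rel_def by blast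
    then show ?thesis by (simp add: eq)
  qed
  have a_in: "a c \<in> c" if c: "c \<in> carrier G" for c
  proof -
    have "AE x in M. x \<notin> Y - Z" using YZ YM ZM by (intro AE_not_in) auto
    then have "AE x in M. x \<in> Y \<longrightarrow> a c x = s c x"
      using t_s[OF c] by eventually_elim (auto simp: a_def)
    then have "a c \<in> ae_class M Y (s c)" by (simp add: ae_class_def)
    then show ?thesis using s(2)[OF c] by simp
  qed
  have "rel_action M R Y S Z a"
    unfolding rel_action_def G_def[symmetric]
    by (intro conjI ballI ZM ZY YZ aM a_in aR a_mp a_mult a_one) (simp_all add: a_def Zt)
  then show ?thesis by blast
qed

context paired_actions
begin

lemma unit_fix: "x \<in> space \<Omega> \<Longrightarrow> a (iv unit) x = x" "x \<in> space \<Omega> \<Longrightarrow> v unit x = x"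
  using a_iv[OF unit_in, of x] a_unit[of x] b_unit[of x] by (simp_all add: v_def)

lemma dm_unit: "dm unit = Y1 \<inter> Y2"
  using unit_fix(1) Y1_space by (auto simp: dm_def)

lemma kern_diag: "g \<in> G \<Longrightarrow> kern g g = measure \<Omega> (Y1 \<inter> Y2)"
proof -
  assume g: "g \<in> G"
  define S where "S = {x. x \<in> dm unit \<and> x \<in> dm unit \<and> v unit x = v unit x}"
  have "dm g = a (iv g) -` (Y1 \<inter> Y2) \<inter> space \<Omega>"
  proof (intro Set.set_eqI iffI)
    fix x assume x: "x \<in> dm g"
    then show "x \<in> a (iv g) -` (Y1 \<inter> Y2) \<inter> space \<Omega>"
      using a_Y1[OF iv_in[OF g], of x] dm_space[OF x] by (simp add: dm_def)
  next
    fix x assume "x \<in> a (iv g) -` (Y1 \<inter> Y2) \<inter> space \<Omega>"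
    then show "x \<in> dm g" using a_Y1[OF g, of "a (iv g) x"] a_iv'[OF g, of x] by (simp add: dm_def)
  qed
  then have "measure \<Omega> (dm g) = measure \<Omega> (Y1 \<inter> Y2)"
    using a_mp[OF iv_in[OF g], of "Y1 \<inter> Y2"] Y1(1) Y2(1) by (simp add: measure_def)
  moreover have "{x. x \<in> dm g \<and> x \<in> dm g \<and> v g x = v g x} = dm g" by simp
  ultimately show ?thesis by (simp only: kern_measure[OF g g])
qed

lemma kdist_kern_mult: "k \<in> G \<Longrightarrow> g \<in> G \<Longrightarrow> h \<in> G \<Longrightarrow> kdist kern (mult k g) (mult k h) = kdist kern g h"
  by (simp add: kdist_def kern_mult)

text \<open>Every \<open>kern g g\<close> is the measure of the overlap
  \<open>Y1 \<inter> Y2\<close>. The distance is therefore twice the measure of the part of the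
  overlap where \<open>v g\<close> is undefined or moves the point, and at such points the two
  actions of \<open>iv g\<close> differ.\<close>

lemma kdist_kern_le:
  assumes g: "g \<in> G"
  shows "kdist kern unit g \<le> 2 * measure \<Omega> {x \<in> Y1 \<inter> Y2. a (iv g) x \<noteq> b (iv g) x}"
proof -
  define S where "S = {x. x \<in> dm unit \<and> x \<in> dm g \<and> v unit x = v g x}"
  define D where "D = {x \<in> Y1 \<inter> Y2. a (iv g) x \<noteq> b (iv g) x}"
  have YM: "Y1 \<inter> Y2 \<in> sets \<Omega>" using Y1 Y2 by simp
  have DM: "D \<in> sets \<Omega>"
  proof -
    note [measurable] = YM separating_pred_eq[OF sep aM[OF iv_in[OF g]] bM[OF iv_in[OF g]]]
    have "D = {x \<in> space \<Omega>. x \<in> Y1 \<inter> Y2 \<and> \<not> a (iv g) x = b (iv g) x}"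
      using Y1_space by (auto simp: D_def)
    also have "\<dots> \<in> sets \<Omega>" by measurable
    finally show ?thesis .
  qed
  have SM: "S \<in> sets \<Omega>" unfolding S_def by (rule agree_sets[OF unit_in g])
  have fin: "emeasure \<Omega> B \<noteq> \<infinity>" if "B \<subseteq> Y1" for B
    using le_less_trans[OF emeasure_mono[OF that Y1(1)] Y1(2)] by simp
  have "Y1 \<inter> Y2 \<subseteq> S \<union> D"
  proof
    fix x assume x: "x \<in> Y1 \<inter> Y2"
    show "x \<in> S \<union> D"
    proof (cases "x \<in> D")
      case False
      then have eq: "a (iv g) x = b (iv g) x" using x unfolding D_def by blast
      have xs: "x \<in> space \<Omega>" using x Y1_space by blast
      have "x \<in> dm g" using x b_Y2[OF iv_in[OF g]] eq by (simp add: dm_def)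
      moreover have "v g x = x" using b_iv'[OF g xs] by (simp add: v_def eq)
      ultimately show ?thesis using x unit_fix(2)[OF xs] by (simp add: S_def dm_unit)
    qed simp
  qed
  then have "measure \<Omega> (Y1 \<inter> Y2) \<le> measure \<Omega> (S \<union> D)"
    using SM DM fin[of "S \<union> D"] by (intro measure_mono_fmeasurable) (auto simp: fmeasurable_def less_top[symmetric] S_def D_def dm_def YM)
  also have "\<dots> \<le> measure \<Omega> S + measure \<Omega> D" using SM DM by (rule measure_Un_le)
  finally show ?thesis
    unfolding kdist_def kern_diag[OF unit_in] kern_diag[OF g] kern_measure[OF unit_in g] S_def D_def by simp
qed

end

section \<open>Actions on the amplified space from elements of the fundamental group\<close>

lemma ergodic_measure_relation:
  assumes "c \<in> carrier (class_group M Y S)" "f \<in> c" "g \<in> c"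
  shows "AE x in M. x \<in> Y \<longrightarrow> f x = g x"
proof -
  obtain s where "c = ae_class M Y s" using assms(1) by (auto simp: class_group_def)
  then have "AE x in M. x \<in> Y \<longrightarrow> f x = s x" "AE x in M. x \<in> Y \<longrightarrow> g x = s x"
    using assms by (auto simp: ae_class_def)
  then show ?thesis by eventually_elim auto
qed

text \<open>The measure of the support records the parameter: a measure preserving isomorphism
  between the supports of two such actions forces equal \<open>t\<close>. Membership in
  \<open>R\<close> is asked of first coordinates only, which describes the amplified
  relation.\<close>

definition amp_action :: "'a measure \<Rightarrow> ('a \<times> 'a) set \<Rightarrow> 'g monoid \<Rightarrow> 'g set \<Rightarrow> real \<Rightarrow> ('a \<times> nat) set \<Rightarrow>
    ('g \<Rightarrow> 'a \<times> nat \<Rightarrow> 'a \<times> nat) \<Rightarrow> bool" where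
  "amp_action M R G H t X b \<longleftrightarrow> t > 0 \<and> X \<in> sets (amp M) \<and> emeasure (amp M) X = ennreal (1 / t) \<and>
    (\<forall>c\<in>carrier G. b c \<in> amp M \<rightarrow>\<^sub>M amp M \<and> (\<forall>x\<in>X. b c x \<in> X) \<and> (\<forall>x\<in>X. (fst x, fst (b c x)) \<in> R) \<and>
      (\<forall>A\<in>sets (amp M). emeasure (amp M) (b c -` A \<inter> space (amp M)) = emeasure (amp M) A)) \<and>
    (\<forall>c\<in>carrier G. \<forall>d\<in>carrier G. \<forall>x\<in>space (amp M). b (c \<otimes>\<^bsub>G\<^esub> d) x = b c (b d x)) \<and>
    (\<forall>x\<in>space (amp M). b \<one>\<^bsub>G\<^esub> x = x) \<and>
    (\<forall>A\<in>sets (amp M). A \<subseteq> X \<longrightarrow> (\<forall>h\<in>H. AE x in amp M. x \<in> X \<longrightarrow> (b h x \<in> A \<longleftrightarrow> x \<in> A)) \<longrightarrow>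
      emeasure (amp M) A = 0 \<or> emeasure (amp M) (X - A) = 0)"

text \<open>A point \<open>x\<close> is sent to \<open>(\<theta> y, n)\<close>, where \<open>y\<close> is the first point in \<open>Y0\<close> among the images of \<open>x\<close> under the
  enumerated group elements and \<open>n\<close> its index; this maps \<open>R\<close> into \<open>R\<^sup>\<infinity>\<close> and scales the measure by \<open>1 / t\<close>.\<close>

lemma fundamental_group_embedding:
  assumes std: "standard_prob_space M" and R: "II1_rel M R"
    and act: "rel_action M R (space M) S Z a" and grp: "group (class_group M (space M) S)"
    and cnt: "countable (carrier (class_group M (space M) S))"
    and H: "H \<subseteq> carrier (class_group M (space M) S)" and erg: "ergodic_on M (space M) (\<Union>H)"
    and t: "t \<in> fundamental_group M R"
  defines "G \<equiv> class_group M (space M) S"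
  shows "\<exists>X b. amp_action M R G H t X b"
proof -
  interpret prob_space M using std by (simp add: standard_prob_space_def)
  interpret group G using grp by (simp add: G_def)
  have HG: "h \<in> carrier G" if "h \<in> H" for h using that H by (auto simp: G_def)
  have cG: "countable (carrier G)" using cnt by (simp add: G_def)
  have aM: "a c \<in> M \<rightarrow>\<^sub>M M" and a_in: "a c \<in> c" and aR: "\<And>x. x \<in> space M \<Longrightarrow> (x, a c x) \<in> R"
    and a_mp: "\<And>A. A \<in> sets M \<Longrightarrow> emeasure M (a c -` A \<inter> space M) = emeasure M A" if "c \<in> carrier G" for c
    using act that unfolding rel_action_def G_def by blast+
  have a_mult: "a (c \<otimes>\<^bsub>G\<^esub> d) x = a c (a d x)" if "c \<in> carrier G" "d \<in> carrier G" "x \<in> space M" for c d x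
    using act that unfolding rel_action_def G_def by blast
  have a_one: "a \<one>\<^bsub>G\<^esub> x = x" if "x \<in> space M" for x using act that unfolding rel_action_def G_def by blast
  have a_sp: "a c x \<in> space M" if "c \<in> carrier G" "x \<in> space M" for c x by (rule measurable_space[OF aM[OF that(1)] that(2)])
  have a_inv: "a (inv\<^bsub>G\<^esub> c) (a c x) = x" "a c (a (inv\<^bsub>G\<^esub> c) x) = x" if "c \<in> carrier G" "x \<in> space M" for c x
    using a_mult[of "inv\<^bsub>G\<^esub> c" c x] a_mult[of c "inv\<^bsub>G\<^esub> c" x] a_one that by simp_all
  have eqR: "sym R" "trans R" using R by (auto simp: II1_rel_def equiv_def)
  obtain Y Z' where YZ: "t = measure M Y / measure M Z'" "Y \<in> sets M" "Z' \<in> sets M"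
    "measure M Y > 0" "measure M Z' > 0" "restr_iso M R Y Z'"
    using t unfolding fundamental_group_def by blast
  obtain \<theta> Y0 Z0 where th0: "Y0 \<in> sets M \<and> Z0 \<in> sets M \<and> Y0 \<subseteq> Y \<and> Z0 \<subseteq> Z' \<and>
      emeasure M (Y - Y0) = 0 \<and> emeasure M (Z' - Z0) = 0 \<and> bij_betw \<theta> Y0 Z0 \<and>
      \<theta> \<in> restrict_space M Y0 \<rightarrow>\<^sub>M M \<and>
      (\<forall>A\<in>sets M. A \<subseteq> Y0 \<longrightarrow> \<theta> ` A \<in> sets M \<and>
          measure M (\<theta> ` A) / measure M Z' = measure M A / measure M Y) \<and>
      (\<forall>x\<in>Y0. \<forall>y\<in>Y0. (x, y) \<in> R \<longleftrightarrow> (\<theta> x, \<theta> y) \<in> R)"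
    using YZ(6) unfolding restr_iso_def by (elim exE) (rule that)
  have th: "Y0 \<in> sets M" "Z0 \<in> sets M" "Y0 \<subseteq> Y" "Z0 \<subseteq> Z'" "emeasure M (Y - Y0) = 0"
    "bij_betw \<theta> Y0 Z0" "\<theta> \<in> restrict_space M Y0 \<rightarrow>\<^sub>M M"
    using th0 by simp_all
  have th8: "\<theta> ` A \<in> sets M \<and> measure M (\<theta> ` A) / measure M Z' = measure M A / measure M Y"
    if "A \<in> sets M" "A \<subseteq> Y0" for A
    using th0 that by blast
  have th9: "(x, y) \<in> R \<longleftrightarrow> (\<theta> x, \<theta> y) \<in> R" if "x \<in> Y0" "y \<in> Y0" for x y
    using th0 that by blast
  define r where "r = measure M Z' / measure M Y"
  have r: "r > 0" "1 / t = r" "t > 0" using YZ by (auto simp: r_def)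
  have th_em: "\<theta> ` A \<in> sets M" "emeasure M (\<theta> ` A) = ennreal r * emeasure M A" if "A \<in> sets M" "A \<subseteq> Y0" for A
  proof -
    show "\<theta> ` A \<in> sets M" using th8[OF that] by blast
    have "measure M (\<theta> ` A) = r * measure M A" using th8[OF that] YZ(4,5) by (simp add: r_def field_simps)
    then show "emeasure M (\<theta> ` A) = ennreal r * emeasure M A"
      using r by (simp add: emeasure_eq_measure ennreal_mult)
  qed
  have th_vim: "{y \<in> Y0. \<theta> y \<in> B} \<in> sets M" if "B \<in> sets M" for B
  proof -
    have "\<theta> -` B \<inter> space (restrict_space M Y0) \<in> sets (restrict_space M Y0)"
      by (rule measurable_sets[OF th(7) that])
    moreover have "\<theta> -` B \<inter> space (restrict_space M Y0) = {y \<in> Y0. \<theta> y \<in> B}"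
      using sets.sets_into_space[OF th(1)] by (auto simp: space_restrict_space)
    ultimately show ?thesis using th(1) by (auto simp: sets_restrict_space_iff)
  qed
  have "carrier G \<noteq> {}" using one_closed by blast
  define e where "e = from_nat_into (carrier G)"
  have eG: "e n \<in> carrier G" for n unfolding e_def by (rule from_nat_into[OF \<open>carrier G \<noteq> {}\<close>])
  have e_surj: "\<exists>n. e n = c" if "c \<in> carrier G" for c
    unfolding e_def using from_nat_into_surj[OF cG that] .
  define V where "V n = a (e n) -` Y0 \<inter> space M" for n
  have VM: "V n \<in> sets M" for n unfolding V_def by (rule measurable_sets[OF aM[OF eG] th(1)])
  define W where "W = (\<Union>n. V n)"
  have WM: "W \<in> sets M" unfolding W_def using VM by blast
  have Wsp: "x \<in> space M" if "x \<in> W" for x using that by (auto simp: W_def V_def)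
  have W_iff: "x \<in> W \<longleftrightarrow> (\<exists>c\<in>carrier G. a c x \<in> Y0)" if "x \<in> space M" for x
    using that e_surj eG unfolding W_def V_def by blast
  have W_inv: "a c x \<in> W \<longleftrightarrow> x \<in> W" if c: "c \<in> carrier G" and x: "x \<in> space M" for c x
  proof
    assume "a c x \<in> W"
    then obtain d where "d \<in> carrier G" "a d (a c x) \<in> Y0" using W_iff[OF a_sp[OF c x]] by blast
    then show "x \<in> W" using W_iff[OF x] a_mult[of d c x] c x m_closed[of d c] by metis
  next
    assume "x \<in> W"
    then obtain d where d: "d \<in> carrier G" "a d x \<in> Y0" using W_iff[OF x] by blast
    have "a (d \<otimes>\<^bsub>G\<^esub> inv\<^bsub>G\<^esub> c) (a c x) = a d x"
      using a_mult[of d "inv\<^bsub>G\<^esub> c" "a c x"] a_inv(1)[OF c x] a_sp[OF c x] d(1) c by simp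
    then show "a c x \<in> W" using W_iff[OF a_sp[OF c x]] d c by (metis inv_closed m_closed)
  qed
  have AE_rel: "AE x in M. f x = a h x" if "h \<in> H" "f \<in> h" for h f
  proof -
    have "AE x in M. x \<in> space M \<longrightarrow> f x = a h x"
      using that HG[OF that(1)] a_in[OF HG[OF that(1)]] unfolding G_def by (intro ergodic_measure_relation) auto
    then show ?thesis using AE_space by eventually_elim blast
  qed
  have erg_a: "emeasure M A = 0 \<or> emeasure M (space M - A) = 0"
    if A: "A \<in> sets M" and inv: "\<And>h. h \<in> H \<Longrightarrow> AE x in M. a h x \<in> A \<longleftrightarrow> x \<in> A" for A
  proof -
    have "AE x in M. x \<in> space M \<longrightarrow> (f x \<in> A \<longleftrightarrow> x \<in> A)" if "f \<in> \<Union>H" for f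
    proof -
      obtain h where h: "h \<in> H" "f \<in> h" using \<open>f \<in> \<Union>H\<close> by blast
      show ?thesis using AE_rel[OF h] inv[OF h(1)] by eventually_elim simp
    qed
    then show ?thesis using erg A sets.sets_into_space[OF A] unfolding ergodic_on_def by blast
  qed
  have Y0_pos: "emeasure M Y0 > 0"
  proof -
    have "emeasure M Y = emeasure M Y0"
      using emeasure_Diff_null_set[of "Y - Y0" M Y] th(1,3,5) YZ(2) by (auto simp: null_sets_def double_diff)
    then show ?thesis using YZ(4) by (simp add: emeasure_eq_measure)
  qed
  \<comment> \<open>\<open>W\<close> is the saturation of \<open>Y0\<close> under the whole group
    and so is invariant under \<open>H\<close> in particular. It has positive measure, and
    ergodicity of \<open>H\<close> makes it conull.\<close>
  have W_full: "emeasure M (space M - W) = 0"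
  proof -
    have "Y0 \<subseteq> W"
      using W_iff a_one sets.sets_into_space[OF th(1)] one_closed by (metis subset_iff)
    then have "emeasure M W \<noteq> 0" using Y0_pos emeasure_mono[OF _ WM, of Y0] by auto
    moreover have "AE x in M. a h x \<in> W \<longleftrightarrow> x \<in> W" if "h \<in> H" for h
      by (rule AE_I2) (rule W_inv[OF HG[OF that]])
    ultimately show ?thesis using erg_a[OF WM] by blast
  qed
  define n where "n x = (LEAST n. x \<in> V n)" for x
  have n_V: "x \<in> V (n x)" if "x \<in> W" for x
  proof -
    have "\<exists>k. x \<in> V k" using that by (simp add: W_def)
    then show ?thesis unfolding n_def by (rule LeastI_ex)
  qed
  define Qs where "Qs k = disjointed V k" for k
  have QM: "Qs k \<in> sets M" for k
    unfolding Qs_def using sets.range_disjointed_sets[of V M] VM by blast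
  have Q_iff: "x \<in> Qs k \<longleftrightarrow> x \<in> W \<and> n x = k" for x k
  proof
    assume "x \<in> Qs k"
    then have "x \<in> V k" "\<And>j. j < k \<Longrightarrow> x \<notin> V j" by (auto simp: Qs_def disjointed_def)
    then show "x \<in> W \<and> n x = k" unfolding n_def W_def by (auto intro!: Least_equality leI)
  next
    assume "x \<in> W \<and> n x = k"
    then have x: "x \<in> V k" and nk: "n x = k" using n_V by blast+
    have "x \<notin> V j" if "j < k" for j
      using not_less_Least[of j "\<lambda>n. x \<in> V n"] that nk unfolding n_def by blast
    then have "x \<notin> (\<Union>j\<in>{0..<k}. V j)" by simp
    then show "x \<in> Qs k" using x unfolding Qs_def disjointed_def by blast
  qed
  define \<Theta> where "\<Theta> x = (\<theta> (a (e (n x)) x), n x)" for x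
  have aY0: "a (e (n x)) x \<in> Y0" if "x \<in> W" for x using n_V[OF that] by (simp add: V_def)
  have \<Theta>_inj: "inj_on \<Theta> W"
  proof (rule inj_onI)
    fix x y assume x: "x \<in> W" and y: "y \<in> W" and eq: "\<Theta> x = \<Theta> y"
    have n: "n x = n y" and th': "\<theta> (a (e (n x)) x) = \<theta> (a (e (n y)) y)" using eq unfolding \<Theta>_def prod.inject by blast+
    have "a (e (n x)) x = a (e (n y)) y"
      using th' aY0[OF x] aY0[OF y] th(6) by (meson bij_betw_def inj_on_eq_iff)
    then show "x = y" using a_inv(1)[OF eG Wsp[OF x], of "n x"] a_inv(1)[OF eG Wsp[OF y], of "n y"] n by metis
  qed
  have a_im: "a c ` A \<in> sets M" "emeasure M (a c ` A) = emeasure M A" if c: "c \<in> carrier G" and A: "A \<in> sets M" for c A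
  proof -
    have ic: "inv\<^bsub>G\<^esub> c \<in> carrier G" using c by simp
    have "a c ` A = a (inv\<^bsub>G\<^esub> c) -` A \<inter> space M"
    proof (intro Set.set_eqI iffI)
      fix y assume "y \<in> a c ` A"
      then obtain x where x: "x \<in> A" "y = a c x" by blast
      then have "x \<in> space M" using sets.sets_into_space[OF A] by blast
      then show "y \<in> a (inv\<^bsub>G\<^esub> c) -` A \<inter> space M" using x a_inv(1)[OF c] a_sp[OF c] by simp
    next
      fix y assume "y \<in> a (inv\<^bsub>G\<^esub> c) -` A \<inter> space M"
      then show "y \<in> a c ` A" using a_inv(2)[OF c, of y] by (intro image_eqI[of _ _ "a (inv\<^bsub>G\<^esub> c) y"]) auto
    qed
    then show "a c ` A \<in> sets M" "emeasure M (a c ` A) = emeasure M A"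
      using measurable_sets[OF aM[OF ic] A] a_mp[OF ic A] by auto
  qed
  have \<Theta>_im: "\<Theta> ` A \<in> sets (amp M)" "emeasure (amp M) (\<Theta> ` A) = ennreal r * emeasure M A"
    if A: "A \<in> sets M" "A \<subseteq> W" for A
  proof -
    define P where "P k = a (e k) ` (A \<inter> Qs k)" for k
    have AQ: "A \<inter> Qs k \<in> sets M" for k using A(1) QM by blast
    have PM: "P k \<in> sets M" "emeasure M (P k) = emeasure M (A \<inter> Qs k)" for k
      unfolding P_def using a_im[OF eG AQ] by auto
    have PY: "P k \<subseteq> Y0" for k
    proof
      fix y assume "y \<in> P k"
      then obtain x where "x \<in> Qs k" "y = a (e k) x" by (auto simp: P_def)
      then show "y \<in> Y0" using aY0[of x] Q_iff[of x k] by auto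
    qed
    have eq: "\<Theta> ` A = (\<Union>k. \<theta> ` P k \<times> {k})"
    proof (intro Set.set_eqI iffI)
      fix p assume "p \<in> \<Theta> ` A"
      then obtain x where x: "x \<in> A" "p = \<Theta> x" by blast
      then have "x \<in> Qs (n x)" using Q_iff A(2) by blast
      then have "a (e (n x)) x \<in> P (n x)" using x(1) unfolding P_def by blast
      then show "p \<in> (\<Union>k. \<theta> ` P k \<times> {k})" unfolding x(2) \<Theta>_def by blast
    next
      fix p assume "p \<in> (\<Union>k. \<theta> ` P k \<times> {k})"
      then obtain k x where x: "x \<in> A" "x \<in> Qs k" "p = (\<theta> (a (e k) x), k)" unfolding P_def by blast
      then have "p = \<Theta> x" using Q_iff[of x k] by (simp add: \<Theta>_def)
      then show "p \<in> \<Theta> ` A" using x(1) by blast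
    qed
    show M: "\<Theta> ` A \<in> sets (amp M)" unfolding eq using th_em(1)[OF PM(1) PY] by (intro sets.countable_UN) (auto intro: times_amp)
    have sl: "slice k (\<Theta> ` A) = \<theta> ` P k" for k unfolding eq slice_def by blast
    have "emeasure (amp M) (\<Theta> ` A) = (\<Sum>k. ennreal r * emeasure M (A \<inter> Qs k))"
      unfolding emeasure_amp[OF M] sl th_em(2)[OF PM(1) PY] PM(2) ..
    also have "\<dots> = ennreal r * (\<Sum>k. emeasure M (A \<inter> Qs k))" by (rule ennreal_suminf_cmult)
    also have "(\<Sum>k. emeasure M (A \<inter> Qs k)) = emeasure M (\<Union>k. A \<inter> Qs k)"
      by (rule suminf_emeasure) (use AQ Q_iff in \<open>auto simp: disjoint_family_on_def\<close>)
    also have "(\<Union>k. A \<inter> Qs k) = A" using Q_iff A(2) by blast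
    finally show "emeasure (amp M) (\<Theta> ` A) = ennreal r * emeasure M A" .
  qed
  have \<Theta>_vim: "{x \<in> W. \<Theta> x \<in> A} \<in> sets M" if A: "A \<in> sets (amp M)" for A
  proof -
    have 1: "Qs k \<inter> (a (e k) -` {y \<in> Y0. \<theta> y \<in> slice k A} \<inter> space M) \<in> sets M" for k
      using QM measurable_sets[OF aM[OF eG] th_vim[OF slice_sets[OF A]]] by blast
    have "{x \<in> W. \<Theta> x \<in> A} = (\<Union>k. Qs k \<inter> (a (e k) -` {y \<in> Y0. \<theta> y \<in> slice k A} \<inter> space M))"
      using Q_iff aY0 Wsp by (auto simp: slice_def \<Theta>_def)
    then show ?thesis using 1 by (simp add: sets.countable_UN)
  qed
  define X where "X = \<Theta> ` W"
  have XM: "X \<in> sets (amp M)" "emeasure (amp M) X = ennreal (1 / t)"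
  proof -
    have "emeasure M W = 1"
      using W_full prob_compl[OF WM] by (simp add: emeasure_eq_measure)
    then show "X \<in> sets (amp M)" "emeasure (amp M) X = ennreal (1 / t)"
      using \<Theta>_im[OF WM order_refl] r by (auto simp: X_def)
  qed
  define \<psi> where "\<psi> = the_inv_into W \<Theta>"
  have \<psi>: "\<psi> (\<Theta> x) = x" if "x \<in> W" for x unfolding \<psi>_def by (rule the_inv_into_f_f[OF \<Theta>_inj that])
  \<comment> \<open>The action is carried over by \<open>\<Theta>\<close> on \<open>X\<close> and is
    the identity elsewhere, so that it is defined and measure preserving on the entire amplified
    space.\<close>
  define b where "b c p = (if p \<in> X then \<Theta> (a c (\<psi> p)) else p)" for c p
  have b_\<Theta>: "b c (\<Theta> x) = \<Theta> (a c x)" if "x \<in> W" for c x using that \<psi>[OF that] by (simp add: b_def X_def)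
  have b_off: "b c p = p" if "p \<notin> X" for c p using that by (simp add: b_def)
  have b_X: "b c p \<in> X" if c: "c \<in> carrier G" and p: "p \<in> X" for c p
  proof -
    obtain x where x: "x \<in> W" "p = \<Theta> x" using p by (auto simp: X_def)
    have "a c x \<in> W" using W_inv[OF c Wsp[OF x(1)]] x(1) by simp
    then show ?thesis using b_\<Theta>[OF x(1)] x(2) by (simp add: X_def)
  qed
  have Xsp: "p \<in> space (amp M)" if "p \<in> X" for p using sets.sets_into_space[OF XM(1)] that by blast
  have b_vim: "b c -` A \<inter> space (amp M) = \<Theta> ` (a c -` {x \<in> W. \<Theta> x \<in> A} \<inter> space M) \<union> (A - X)"
    if c: "c \<in> carrier G" and A: "A \<in> sets (amp M)" for c A
  proof (intro Set.set_eqI iffI)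
    fix p assume p: "p \<in> b c -` A \<inter> space (amp M)"
    show "p \<in> \<Theta> ` (a c -` {x \<in> W. \<Theta> x \<in> A} \<inter> space M) \<union> (A - X)"
    proof (cases "p \<in> X")
      case True
      then obtain x where x: "x \<in> W" "p = \<Theta> x" by (auto simp: X_def)
      then have "\<Theta> (a c x) \<in> A" "a c x \<in> W" using p b_\<Theta>[OF x(1)] W_inv[OF c Wsp[OF x(1)]] by auto
      then show ?thesis using x Wsp[OF x(1)] by blast
    next
      case False
      then show ?thesis using p b_off[OF False] by simp
    qed
  next
    fix p assume "p \<in> \<Theta> ` (a c -` {x \<in> W. \<Theta> x \<in> A} \<inter> space M) \<union> (A - X)"
    then show "p \<in> b c -` A \<inter> space (amp M)"
    proof
      assume "p \<in> \<Theta> ` (a c -` {x \<in> W. \<Theta> x \<in> A} \<inter> space M)"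
      then obtain x where x: "p = \<Theta> x" "a c x \<in> W" "\<Theta> (a c x) \<in> A" "x \<in> space M" by blast
      then have xW: "x \<in> W" using W_inv[OF c x(4)] by simp
      then have "p \<in> X" using x(1) by (simp add: X_def)
      then show ?thesis using b_\<Theta>[OF xW] x Xsp by simp
    next
      assume "p \<in> A - X"
      then show ?thesis using b_off sets.sets_into_space[OF A] by auto
    qed
  qed
  have vM: "a c -` {x \<in> W. \<Theta> x \<in> A} \<inter> space M \<in> sets M" "a c -` {x \<in> W. \<Theta> x \<in> A} \<inter> space M \<subseteq> W"
    if c: "c \<in> carrier G" and A: "A \<in> sets (amp M)" for c A
    using measurable_sets[OF aM[OF c] \<Theta>_vim[OF A]] W_inv[OF c] by auto
  have bM: "b c \<in> amp M \<rightarrow>\<^sub>M amp M" if c: "c \<in> carrier G" for c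
  proof (rule measurableI)
    fix p assume "p \<in> space (amp M)"
    then show "b c p \<in> space (amp M)" using b_off[of p c] b_X[OF c, of p] Xsp by (cases "p \<in> X") auto
  next
    fix A assume A: "A \<in> sets (amp M)"
    show "b c -` A \<inter> space (amp M) \<in> sets (amp M)"
      unfolding b_vim[OF c A] using \<Theta>_im(1)[OF vM[OF c A]] A XM(1) by blast
  qed
  have imW: "\<Theta> ` {x \<in> W. \<Theta> x \<in> A} = A \<inter> X" for A by (auto simp: X_def)
  have b_mp: "emeasure (amp M) (b c -` A \<inter> space (amp M)) = emeasure (amp M) A"
    if c: "c \<in> carrier G" and A: "A \<in> sets (amp M)" for c A
  proof -
    have "emeasure (amp M) (b c -` A \<inter> space (amp M)) =
        emeasure (amp M) (\<Theta> ` (a c -` {x \<in> W. \<Theta> x \<in> A} \<inter> space M)) + emeasure (amp M) (A - X)"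
      unfolding b_vim[OF c A] using \<Theta>_im(1)[OF vM[OF c A]] A XM(1) vM(2)[OF c A]
      by (intro plus_emeasure[symmetric]) (auto simp: X_def)
    also have "emeasure (amp M) (\<Theta> ` (a c -` {x \<in> W. \<Theta> x \<in> A} \<inter> space M)) = emeasure (amp M) (\<Theta> ` {x \<in> W. \<Theta> x \<in> A})"
      unfolding \<Theta>_im(2)[OF vM[OF c A]] using a_mp[OF c \<Theta>_vim[OF A]] by (subst \<Theta>_im(2)[OF \<Theta>_vim[OF A]]) auto
    also have "\<dots> + emeasure (amp M) (A - X) = emeasure (amp M) A"
      unfolding imW using A XM(1) by (subst plus_emeasure) (auto intro!: arg_cong[where f = "emeasure (amp M)"])
    finally show ?thesis .
  qed
  have b_mult: "b (c \<otimes>\<^bsub>G\<^esub> d) p = b c (b d p)" if c: "c \<in> carrier G" and d: "d \<in> carrier G" for c d p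
  proof (cases "p \<in> X")
    case True
    then obtain x where x: "x \<in> W" "p = \<Theta> x" by (auto simp: X_def)
    have "a d x \<in> W" using W_inv[OF d Wsp[OF x(1)]] x(1) by simp
    then show ?thesis using x b_\<Theta> a_mult[OF c d Wsp[OF x(1)]] by simp
  qed (simp add: b_off)
  have b_one: "b \<one>\<^bsub>G\<^esub> p = p" for p
  proof (cases "p \<in> X")
    case True
    then obtain x where x: "x \<in> W" "p = \<Theta> x" by (auto simp: X_def)
    then show ?thesis using b_\<Theta> a_one[OF Wsp[OF x(1)]] by simp
  qed (simp add: b_off)
  have bR: "(fst p, fst (b c p)) \<in> R" if c: "c \<in> carrier G" and p: "p \<in> X" for c p
  proof -
    obtain x where x: "x \<in> W" "p = \<Theta> x" using p by (auto simp: X_def)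
    define y where "y = a c x"
    have y: "y \<in> W" unfolding y_def using W_inv[OF c Wsp[OF x(1)]] x(1) by simp
    have "(x, a (e (n x)) x) \<in> R" "(y, a (e (n y)) y) \<in> R" "(x, y) \<in> R"
      unfolding y_def using aR[OF eG] aR[OF c] Wsp[OF x(1)] Wsp[OF y] by (auto simp: y_def)
    then have "(a (e (n x)) x, a (e (n y)) y) \<in> R" using eqR by (meson symD transD)
    then have "(\<theta> (a (e (n x)) x), \<theta> (a (e (n y)) y)) \<in> R" using th9[OF aY0[OF x(1)] aY0[OF y]] by blast
    then show ?thesis using b_\<Theta>[OF x(1)] by (simp add: x(2) \<Theta>_def y_def)
  qed
  have ergX: "emeasure (amp M) A = 0 \<or> emeasure (amp M) (X - A) = 0"
    if A: "A \<in> sets (amp M)" "A \<subseteq> X" and inv: "\<And>h. h \<in> H \<Longrightarrow> AE p in amp M. p \<in> X \<longrightarrow> (b h p \<in> A \<longleftrightarrow> p \<in> A)" for A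
  proof -
    \<comment> \<open>Invariant sets in \<open>X\<close> are pulled back along
      \<open>\<Theta>\<close>. As \<open>\<Theta>\<close> multiplies measures by the positive number
      \<open>r\<close>, null sets correspond in both directions and the ergodicity of
      \<open>H\<close> on \<open>M\<close> applies.\<close>
    define B where "B = {x \<in> W. \<Theta> x \<in> A}"
    have BM: "B \<in> sets M" "B \<subseteq> W" unfolding B_def using \<Theta>_vim[OF A(1)] by auto
    have imB: "\<Theta> ` B = A" unfolding B_def imW using A(2) by blast
    have AE_W: "AE x in M. x \<in> W"
    proof -
      have "AE x in M. x \<notin> space M - W" using W_full WM by (intro AE_not_in) auto
      then show ?thesis using AE_space by eventually_elim blast
    qed
    have "AE x in M. a h x \<in> B \<longleftrightarrow> x \<in> B" if h: "h \<in> H" for h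
    proof -
      have hG: "h \<in> carrier G" by (rule HG[OF h])
      obtain N where N: "{p \<in> space (amp M). \<not> (p \<in> X \<longrightarrow> (b h p \<in> A \<longleftrightarrow> p \<in> A))} \<subseteq> N" "emeasure (amp M) N = 0" "N \<in> sets (amp M)"
        using inv[OF h] by (rule AE_E)
      define B' where "B' = {x \<in> W. \<Theta> x \<in> N}"
      have B'M: "B' \<in> sets M" "B' \<subseteq> W" unfolding B'_def using \<Theta>_vim[OF N(3)] by auto
      have "ennreal r * emeasure M B' = emeasure (amp M) (N \<inter> X)"
        using \<Theta>_im(2)[OF B'M] imW[of N] by (simp add: B'_def)
      also have "\<dots> \<le> emeasure (amp M) N" by (rule emeasure_mono[OF _ N(3)]) blast
      finally have "emeasure M B' = 0" using N(2) r(1) by simp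
      then have "AE x in M. x \<notin> B'" using B'M by (intro AE_not_in) auto
      then show ?thesis using AE_W
      proof eventually_elim
        case (elim x)
        have \<Theta>X: "\<Theta> x \<in> X" using elim by (simp add: X_def)
        have "\<Theta> x \<notin> N" using elim by (simp add: B'_def)
        then have "b h (\<Theta> x) \<in> A \<longleftrightarrow> \<Theta> x \<in> A" using N(1) \<Theta>X Xsp by blast
        moreover have "a h x \<in> W" using W_inv[OF hG Wsp] elim by blast
        ultimately show ?case using b_\<Theta> elim by (simp add: B_def)
      qed
    qed
    then have "emeasure M B = 0 \<or> emeasure M (space M - B) = 0" by (rule erg_a[OF BM(1)])
    then show ?thesis
    proof
      assume "emeasure M B = 0"
      then show ?thesis using \<Theta>_im(2)[OF BM] by (simp add: imB)
    next
      assume 0: "emeasure M (space M - B) = 0"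
      have "\<Theta> ` (W - B) = X - A" using inj_on_image_set_diff[OF \<Theta>_inj, of W B] BM(2) by (simp add: imB X_def)
      moreover have "emeasure M (W - B) = 0"
        using emeasure_mono[of "W - B" "space M - B" M] 0 BM(1) Wsp by auto
      ultimately show ?thesis using \<Theta>_im(2)[of "W - B"] WM BM(1) by auto
    qed
  qed
  show ?thesis
    unfolding amp_action_def
  proof (intro exI[of _ X] exI[of _ b] conjI ballI allI impI)
    fix A assume A: "A \<in> sets (amp M)" "A \<subseteq> X"
      and inv: "\<forall>h\<in>H. AE x in amp M. x \<in> X \<longrightarrow> (b h x \<in> A \<longleftrightarrow> x \<in> A)"
    show "emeasure (amp M) A = 0 \<or> emeasure (amp M) (X - A) = 0"
      by (rule ergX[OF A]) (use inv in blast)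
  qed (fact r(3) XM b_mp bM b_X bR | (rule b_mult; assumption) | rule b_one)+
qed

section \<open>Countability of the fundamental group\<close>

lemma countable_representatives_by_codes:
  fixes code :: "nat \<Rightarrow> 't \<Rightarrow> 'c::countable"
  assumes "\<And>p. p \<in> T \<Longrightarrow> \<exists>m. \<forall>q\<in>T. code m q = code m p \<longrightarrow> P p q"
  shows "\<exists>C. countable C \<and> C \<subseteq> T \<and> (\<forall>p\<in>T. \<exists>q\<in>C. P p q)"
proof -
  \<comment> \<open>One representative is chosen for every attained pair of a level and a code.
    There are countably many such pairs, although the level that suffices may vary with
    \<open>p\<close>.\<close>
  define I where "I = {(m, c). \<exists>q. q \<in> T \<and> code m q = c}"
  define r where "r i = (SOME q. q \<in> T \<and> code (fst i) q = snd i)" for i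
  have r: "r i \<in> T \<and> code (fst i) (r i) = snd i" if "i \<in> I" for i
    unfolding r_def by (rule someI_ex) (use that in \<open>simp add: I_def case_prod_beta\<close>)
  have "countable (r ` I)" by (rule countable_image) simp
  moreover have "r ` I \<subseteq> T" using r by blast
  moreover have "\<exists>q\<in>r ` I. P p q" if p: "p \<in> T" for p
  proof -
    obtain m where m: "\<forall>q\<in>T. code m q = code m p \<longrightarrow> P p q" using assms[OF p] by blast
    have i: "(m, code m p) \<in> I" using p by (auto simp: I_def)
    have "P p (r (m, code m p))" using m r[OF i] by simp
    then show ?thesis using i by blast
  qed
  ultimately show ?thesis by (intro exI[of _ "r ` I"] conjI ballI)
qed

lemma amp_actionD:
  assumes "amp_action M R G H t X b"
  shows "t > 0" "X \<in> sets (amp M)" "emeasure (amp M) X = ennreal (1 / t)"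
    and "c \<in> carrier G \<Longrightarrow> b c \<in> amp M \<rightarrow>\<^sub>M amp M"
    and "c \<in> carrier G \<Longrightarrow> x \<in> X \<Longrightarrow> b c x \<in> X"
    and "c \<in> carrier G \<Longrightarrow> x \<in> X \<Longrightarrow> (fst x, fst (b c x)) \<in> R"
    and "c \<in> carrier G \<Longrightarrow> A \<in> sets (amp M) \<Longrightarrow> emeasure (amp M) (b c -` A \<inter> space (amp M)) = emeasure (amp M) A"
    and "c \<in> carrier G \<Longrightarrow> d \<in> carrier G \<Longrightarrow> x \<in> space (amp M) \<Longrightarrow> b (c \<otimes>\<^bsub>G\<^esub> d) x = b c (b d x)"
    and "x \<in> space (amp M) \<Longrightarrow> b \<one>\<^bsub>G\<^esub> x = x"
    and "A \<in> sets (amp M) \<Longrightarrow> A \<subseteq> X \<Longrightarrow> (\<And>h. h \<in> H \<Longrightarrow> AE x in amp M. x \<in> X \<longrightarrow> (b h x \<in> A \<longleftrightarrow> x \<in> A)) \<Longrightarrow>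
      emeasure (amp M) A = 0 \<or> emeasure (amp M) (X - A) = 0"
proof -
  note * = assms[unfolded amp_action_def]
  have u1: "t > 0" "X \<in> sets (amp M)" "emeasure (amp M) X = ennreal (1 / t)"
    subgoal using * by (elim conjE) assumption
    subgoal using * by (elim conjE) assumption
    subgoal using * by (elim conjE) assumption
    done
  have u2: "\<forall>c\<in>carrier G. b c \<in> amp M \<rightarrow>\<^sub>M amp M \<and> (\<forall>x\<in>X. b c x \<in> X) \<and> (\<forall>x\<in>X. (fst x, fst (b c x)) \<in> R) \<and>
      (\<forall>A\<in>sets (amp M). emeasure (amp M) (b c -` A \<inter> space (amp M)) = emeasure (amp M) A)"
    using * by (elim conjE) assumption
  have u3: "\<forall>c\<in>carrier G. \<forall>d\<in>carrier G. \<forall>x\<in>space (amp M). b (c \<otimes>\<^bsub>G\<^esub> d) x = b c (b d x)"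
    using * by (elim conjE) assumption
  have u4: "\<forall>x\<in>space (amp M). b \<one>\<^bsub>G\<^esub> x = x" using * by (elim conjE) assumption
  have u5: "\<forall>A\<in>sets (amp M). A \<subseteq> X \<longrightarrow> (\<forall>h\<in>H. AE x in amp M. x \<in> X \<longrightarrow> (b h x \<in> A \<longleftrightarrow> x \<in> A)) \<longrightarrow>
      emeasure (amp M) A = 0 \<or> emeasure (amp M) (X - A) = 0"
    using * by (elim conjE) assumption
  show "t > 0" "X \<in> sets (amp M)" "emeasure (amp M) X = ennreal (1 / t)" by (fact u1)+
  show "c \<in> carrier G \<Longrightarrow> b c \<in> amp M \<rightarrow>\<^sub>M amp M"
    "c \<in> carrier G \<Longrightarrow> x \<in> X \<Longrightarrow> b c x \<in> X"
    "c \<in> carrier G \<Longrightarrow> x \<in> X \<Longrightarrow> (fst x, fst (b c x)) \<in> R"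
    "c \<in> carrier G \<Longrightarrow> A \<in> sets (amp M) \<Longrightarrow> emeasure (amp M) (b c -` A \<inter> space (amp M)) = emeasure (amp M) A"
    using u2 by blast+
  show "c \<in> carrier G \<Longrightarrow> d \<in> carrier G \<Longrightarrow> x \<in> space (amp M) \<Longrightarrow> b (c \<otimes>\<^bsub>G\<^esub> d) x = b c (b d x)"
    using u3 by blast
  show "x \<in> space (amp M) \<Longrightarrow> b \<one>\<^bsub>G\<^esub> x = x" using u4 by blast
  show "emeasure (amp M) A = 0 \<or> emeasure (amp M) (X - A) = 0"
    if "A \<in> sets (amp M)" "A \<subseteq> X" "\<And>h. h \<in> H \<Longrightarrow> AE x in amp M. x \<in> X \<longrightarrow> (b h x \<in> A \<longleftrightarrow> x \<in> A)"
    by (rule u5[rule_format, OF that])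
qed

text \<open>Stated for a subgroup because it is used twice: with the whole group for the kernel, to
  which the relative property (T) is applied, and with \<open>H\<close>, whose action is ergodic,
  for the equivariant map.\<close>

lemma paired_amp_actions:
  assumes G: "group G" and K: "subgroup K G" and cK: "countable K" and Q: "separating (amp M) Q"
    and 1: "amp_action M R G H t X b" and 2: "amp_action M R G H s X' b'"
  shows "paired_actions (amp M) Q K (\<lambda>g h. g \<otimes>\<^bsub>G\<^esub> h) \<one>\<^bsub>G\<^esub> (\<lambda>g. inv\<^bsub>G\<^esub> g) b b' X X'"
proof -
  interpret group G by (rule G)
  interpret K: subgroup K G by (rule K)
  have KG: "g \<in> carrier G" if "g \<in> K" for g using that by (rule K.mem_carrier)
  note D = amp_actionD
  have A: "b g \<in> amp M \<rightarrow>\<^sub>M amp M" "\<And>x. x \<in> X \<Longrightarrow> b g x \<in> X"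
    "\<And>A. A \<in> sets (amp M) \<Longrightarrow> emeasure (amp M) (b g -` A \<inter> space (amp M)) = emeasure (amp M) A"
    "\<And>h x. h \<in> K \<Longrightarrow> x \<in> space (amp M) \<Longrightarrow> b (g \<otimes>\<^bsub>G\<^esub> h) x = b g (b h x)"
    "\<And>x. x \<in> space (amp M) \<Longrightarrow> b \<one>\<^bsub>G\<^esub> x = x"
    if g: "g \<in> K" and act: "amp_action M R G H t X b" for g t X b
  proof -
    show "b g \<in> amp M \<rightarrow>\<^sub>M amp M" by (rule D(4)[OF act KG[OF g]])
    show "\<And>x. x \<in> X \<Longrightarrow> b g x \<in> X" by (rule D(5)[OF act KG[OF g]])
    show "\<And>A. A \<in> sets (amp M) \<Longrightarrow> emeasure (amp M) (b g -` A \<inter> space (amp M)) = emeasure (amp M) A"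
      by (rule D(7)[OF act KG[OF g]])
    show "\<And>h x. h \<in> K \<Longrightarrow> x \<in> space (amp M) \<Longrightarrow> b (g \<otimes>\<^bsub>G\<^esub> h) x = b g (b h x)"
      by (rule D(8)[OF act KG[OF g] KG])
    show "\<And>x. x \<in> space (amp M) \<Longrightarrow> b \<one>\<^bsub>G\<^esub> x = x" by (rule D(9)[OF act])
  qed
  have inv: "b (inv\<^bsub>G\<^esub> g) (b g x) = x" "b g (b (inv\<^bsub>G\<^esub> g) x) = x"
    if g: "g \<in> K" and x: "x \<in> space (amp M)" and act: "amp_action M R G H t X b" for g x t X b
  proof -
    have ig: "inv\<^bsub>G\<^esub> g \<in> K" using g by simp
    show "b (inv\<^bsub>G\<^esub> g) (b g x) = x" "b g (b (inv\<^bsub>G\<^esub> g) x) = x"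
      using A(4)[OF ig act g x] A(4)[OF g act ig x] A(5)[OF g act x] KG[OF g] by simp_all
  qed
  have X: "X \<in> sets (amp M)" "emeasure (amp M) X < \<infinity>" if "amp_action M R G H t X b" for t X b
    using D(2,3)[OF that] by simp_all
  note one = K.one_closed
  show ?thesis
    by (rule paired_actions.intro)
      (fact Q cK one K.m_closed K.m_inv_closed A(1)[OF _ 1] A(1)[OF _ 2] A(4)[OF _ 1] A(4)[OF _ 2]
        A(5)[OF one 1] A(5)[OF one 2] inv(1)[OF _ _ 1] inv(2)[OF _ _ 1] inv(1)[OF _ _ 2] inv(2)[OF _ _ 2]
        A(3)[OF _ 1] A(3)[OF _ 2] X(1)[OF 1] X(2)[OF 1] X(1)[OF 2] X(2)[OF 2] A(2)[OF _ 1] A(2)[OF _ 2])+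
qed

text \<open>Were there parameters \<open>s m \<noteq> t\<close> whose actions agree with that of \<open>t\<close> ever better, then the displacements of
  the diagonal vectors, summed with weights \<open>2 ^ m\<close>, would form a kernel that is finite on \<open>G\<close>, hence bounded on
  \<open>H\<close>; so for large \<open>m\<close> the diagonal is uniformly almost \<open>H\<close>-invariant.\<close>

lemma countable_fundamental_group:
  assumes std: "standard_prob_space M" and R: "II1_rel M R" and S: "pseudo_subgroup M R (space M) S"
    and cnt: "countable (carrier (class_group M (space M) S))"
    and relT: "relative_T (class_group M (space M) S) H" and erg: "ergodic_on M (space M) (\<Union>H)"
  shows "countable (fundamental_group M R)"
proof -
  define G where "G = class_group M (space M) S"
  have grp: "group G" and HG: "subgroup H G" using relT by (auto simp: relative_T_def G_def)
  interpret group G by (rule grp)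
  interpret H: subgroup H G by (rule HG)
  have cG: "countable (carrier G)" using cnt by (simp add: G_def)
  have cH: "countable H" using H.subset cG by (rule countable_subset)
  obtain Z a where act: "rel_action M R (space M) S Z a"
    using pseudo_subgroup_action[OF R S] grp cG unfolding G_def by blast
  define F where "F = fundamental_group M R"
  have "\<exists>X b. amp_action M R G H t X b" if "t \<in> F" for t
    using fundamental_group_embedding[OF std R act _ cnt _ erg, of t] that grp H.subset unfolding F_def G_def by blast
  then have "\<forall>t. \<exists>p. t \<in> F \<longrightarrow> amp_action M R G H t (fst p) (snd p)" by simp
  then obtain Xb where Xb: "\<And>t. t \<in> F \<Longrightarrow> amp_action M R G H t (fst (Xb t)) (snd (Xb t))" by metis
  define X b where "X t = fst (Xb t)" and "b t = snd (Xb t)" for t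
  have amp: "amp_action M R G H t (X t) (b t)" if "t \<in> F" for t using Xb[OF that] by (simp add: X_def b_def)
  obtain Q0 where "separating M Q0" using standard_separating[OF std] by blast
  then obtain Q where Q: "separating (amp M) Q" using separating_amp by blast
  obtain A0 where "approximating M A0" using standard_approximating[OF std] by blast
  then obtain A where A: "approximating (amp M) A" using approximating_amp by blast
  have Rs: "R \<in> sets (M \<Otimes>\<^sub>M M)" and Rc: "\<And>x. x \<in> space M \<Longrightarrow> countable (R `` {x})"
    using R unfolding II1_rel_def by blast+
  have "\<exists>f :: nat \<Rightarrow> 'a \<Rightarrow> 'a. (\<forall>n. f n \<in> M \<rightarrow>\<^sub>M M) \<and> (AE x in M. \<forall>y. (x, y) \<in> R \<longrightarrow> (\<exists>n. y = f n x))"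
    by (rule countable_sections_covered[OF std Rs Rc])
  then obtain f :: "nat \<Rightarrow> 'a \<Rightarrow> 'a" where f0: "(\<forall>n. f n \<in> M \<rightarrow>\<^sub>M M) \<and> (AE x in M. \<forall>y. (x, y) \<in> R \<longrightarrow> (\<exists>n. y = f n x))"
    by (elim exE)
  have f: "\<And>n. f n \<in> M \<rightarrow>\<^sub>M M" "AE x in M. \<forall>y. (x, y) \<in> R \<longrightarrow> (\<exists>n. y = f n x)"
    using f0 by blast+
  \<comment> \<open>The amplified relation is covered by applying a covering map of \<open>R\<close>
    to the first coordinate and moving to an arbitrary level.\<close>
  define FF where "FF k p = (f (fst (prod_decode k)) (fst p), snd (prod_decode k))" for k and p :: "'a \<times> nat"
  have FFM: "FF k \<in> amp M \<rightarrow>\<^sub>M amp M" for k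
    unfolding FF_def amp_def using f(1) by measurable
  have f_amp: "AE p in amp M. \<forall>y. (fst p, y) \<in> R \<longrightarrow> (\<exists>n. y = f n (fst p))"
  proof -
    obtain N where N: "{x \<in> space M. \<not> (\<forall>y. (x, y) \<in> R \<longrightarrow> (\<exists>n. y = f n x))} \<subseteq> N" "emeasure M N = 0" "N \<in> sets M"
      using f(2) by (rule AE_E)
    have NM: "N \<times> UNIV \<in> sets (amp M)" unfolding amp_def using N(3) by (intro pair_measureI) auto
    have "slice n (N \<times> UNIV) = N" for n by (auto simp: slice_def)
    then have "emeasure (amp M) (N \<times> UNIV) = 0" using emeasure_amp[OF NM] N(2) by simp
    moreover have "{p \<in> space (amp M). \<not> (\<forall>y. (fst p, y) \<in> R \<longrightarrow> (\<exists>n. y = f n (fst p)))} \<subseteq> N \<times> UNIV"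
    proof
      fix p assume "p \<in> {p \<in> space (amp M). \<not> (\<forall>y. (fst p, y) \<in> R \<longrightarrow> (\<exists>n. y = f n (fst p)))}"
      then have "fst p \<in> {x \<in> space M. \<not> (\<forall>y. (x, y) \<in> R \<longrightarrow> (\<exists>n. y = f n x))}" by (simp add: space_amp mem_Times_iff)
      then have "fst p \<in> N" using N(1) by blast
      then show "p \<in> N \<times> UNIV" by (simp add: mem_Times_iff)
    qed
    ultimately show ?thesis by (intro AE_I[OF _ _ NM])
  qed
  have cov: "covered_map (amp M) FF (b t c, X t)" if t: "t \<in> F" and c: "c \<in> carrier G" for t c
  proof -
    have 1: "b t c \<in> amp M \<rightarrow>\<^sub>M amp M" "X t \<in> sets (amp M)" "emeasure (amp M) (X t) < \<infinity>"
      "\<And>x. x \<in> X t \<Longrightarrow> (fst x, fst (b t c x)) \<in> R"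
      using amp_actionD(2-4,6)[OF amp[OF t]] c by simp_all
    have "AE p in amp M. p \<in> X t \<longrightarrow> (\<exists>k. b t c p = FF k p)"
      using f_amp
    proof eventually_elim
      case (elim p)
      show ?case
      proof
        assume "p \<in> X t"
        then obtain n where "fst (b t c p) = f n (fst p)" using 1(4) elim by blast
        then have "b t c p = FF (prod_encode (n, snd (b t c p))) p" by (simp add: FF_def prod_eq_iff)
        then show "\<exists>k. b t c p = FF k p" ..
      qed
    qed
    then show ?thesis unfolding covered_map_def using 1(1-3) by simp
  qed
  have "\<exists>\<kappa> :: (('a \<times> nat \<Rightarrow> 'a \<times> nat) \<times> ('a \<times> nat) set) \<Rightarrow> nat. \<forall>p r. covered_map (amp M) FF p \<longrightarrow> covered_map (amp M) FF r \<longrightarrow> \<kappa> p = \<kappa> r \<longrightarrow>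
      emeasure (amp M) (sym_diff (snd p) (snd r)) < ennreal ((1/4)^m) \<and>
      emeasure (amp M) {x \<in> snd p \<inter> snd r. fst p x \<noteq> fst r x} < ennreal ((1/4)^m)" for m
    by (rule covered_maps_code[OF Q A FFM]) simp
  then have "\<forall>m. \<exists>\<kappa> :: (('a \<times> nat \<Rightarrow> 'a \<times> nat) \<times> ('a \<times> nat) set) \<Rightarrow> nat. \<forall>p r. covered_map (amp M) FF p \<longrightarrow> covered_map (amp M) FF r \<longrightarrow> \<kappa> p = \<kappa> r \<longrightarrow>
      emeasure (amp M) (sym_diff (snd p) (snd r)) < ennreal ((1/4)^m) \<and>
      emeasure (amp M) {x \<in> snd p \<inter> snd r. fst p x \<noteq> fst r x} < ennreal ((1/4)^m)" by blast
  from choice[OF this] obtain \<kappa> :: "nat \<Rightarrow> (('a \<times> nat \<Rightarrow> 'a \<times> nat) \<times> ('a \<times> nat) set) \<Rightarrow> nat" where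
    \<kappa>0: "\<forall>m p r. covered_map (amp M) FF p \<longrightarrow> covered_map (amp M) FF r \<longrightarrow> \<kappa> m p = \<kappa> m r \<longrightarrow>
      emeasure (amp M) (sym_diff (snd p) (snd r)) < ennreal ((1/4)^m) \<and>
      emeasure (amp M) {x \<in> snd p \<inter> snd r. fst p x \<noteq> fst r x} < ennreal ((1/4)^m)" by (elim exE)
  have \<kappa>: "emeasure (amp M) (sym_diff (snd p) (snd r)) < ennreal ((1/4)^m) \<and>
      emeasure (amp M) {x \<in> snd p \<inter> snd r. fst p x \<noteq> fst r x} < ennreal ((1/4)^m)"
    if "covered_map (amp M) FF p" "covered_map (amp M) FF r" "\<kappa> m p = \<kappa> m r" for m p r
    by (rule \<kappa>0[rule_format, OF that])
  have "carrier G \<noteq> {}" using one_closed by blast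
  define e where "e = from_nat_into (carrier G)"
  have eG: "e n \<in> carrier G" for n unfolding e_def by (rule from_nat_into[OF \<open>carrier G \<noteq> {}\<close>])
  have e_surj: "\<exists>n. e n = c" if "c \<in> carrier G" for c
    unfolding e_def using from_nat_into_surj[OF cG that] .
  \<comment> \<open>Level \<open>m\<close> looks at the first \<open>m + 1\<close> group elements
    with precision \<open>(1/4)^m\<close>, so every fixed element is eventually controlled at a
    geometric rate.\<close>
  define code where "code m t = map (\<lambda>i. \<kappa> m (b t (e i), X t)) [0..<Suc m]" for m t
  have "\<exists>m. \<forall>s\<in>F. code m s = code m t \<longrightarrow> s = t" if t: "t \<in> F" for t
  proof (rule ccontr)
    assume "\<not> ?thesis"
    then have "\<forall>m. \<exists>s. s \<in> F \<and> code m s = code m t \<and> s \<noteq> t" by blast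
    then obtain s where s: "\<And>m. s m \<in> F" "\<And>m. code m (s m) = code m t" "\<And>m. s m \<noteq> t" by metis
    have at: "amp_action M R G H t (X t) (b t)" and as: "amp_action M R G H (s m) (X (s m)) (b (s m))" for m
      using amp t s(1) by auto
    have t0: "t > 0" "X t \<in> sets (amp M)" "emeasure (amp M) (X t) = ennreal (1 / t)"
      using amp_actionD(1-3)[OF at] by simp_all
    have sX: "X (s m) \<in> sets (amp M)" "emeasure (amp M) (X (s m)) = ennreal (1 / s m)" "s m > 0" for m
      using amp_actionD(1-3)[OF as[of m]] by simp_all
    define Y where "Y m = X t \<inter> X (s m)" for m
    have near: "emeasure (amp M) (sym_diff (X t) (X (s m))) < ennreal ((1/4)^m) \<and>
        emeasure (amp M) {x \<in> Y m. b t (e i) x \<noteq> b (s m) (e i) x} < ennreal ((1/4)^m)" if i: "i \<le> m" for i m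
    proof -
      have "code m (s m) ! i = code m t ! i" using s(2) by simp
      moreover have "code m u ! i = \<kappa> m (b u (e i), X u)" for u
        using i unfolding code_def by (subst nth_map) (auto simp del: upt_Suc)
      ultimately have "\<kappa> m (b t (e i), X t) = \<kappa> m (b (s m) (e i), X (s m))" by simp
      from \<kappa>[OF cov[OF t eG] cov[OF s(1) eG] this] show ?thesis by (simp add: Y_def)
    qed
    note PA = paired_amp_actions[OF grp _ _ Q at as]
    have paG: "paired_actions (amp M) Q (carrier G) (\<lambda>g h. g \<otimes>\<^bsub>G\<^esub> h) \<one>\<^bsub>G\<^esub> (\<lambda>g. inv\<^bsub>G\<^esub> g) (b t) (b (s m)) (X t) (X (s m))" for m
      by (rule PA[OF subgroup_self cG])
    have paH: "paired_actions (amp M) Q H (\<lambda>g h. g \<otimes>\<^bsub>G\<^esub> h) \<one>\<^bsub>G\<^esub> (\<lambda>g. inv\<^bsub>G\<^esub> g) (b t) (b (s m)) (X t) (X (s m))" for m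
      by (rule PA[OF HG cH])
    define K where "K m = paired_actions.kern (amp M) (\<lambda>g. inv\<^bsub>G\<^esub> g) (b t) (b (s m)) (X t) (X (s m))" for m
    have Kpsd: "psd_on (carrier G) (K m)" for m unfolding K_def by (rule paired_actions.kern_psd[OF paG])
    have Kinv: "kdist (K m) (k \<otimes>\<^bsub>G\<^esub> g) (k \<otimes>\<^bsub>G\<^esub> h) = kdist (K m) g h"
      if "k \<in> carrier G" "g \<in> carrier G" "h \<in> carrier G" for k g h m
      unfolding K_def by (rule paired_actions.kdist_kern_mult[OF paG that])
    have Kle: "kdist (K m) \<one>\<^bsub>G\<^esub> g \<le> 2 * measure (amp M) {x \<in> Y m. b t (inv\<^bsub>G\<^esub> g) x \<noteq> b (s m) (inv\<^bsub>G\<^esub> g) x}"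
      if "g \<in> carrier G" for g m
      unfolding K_def Y_def by (rule paired_actions.kdist_kern_le[OF paG that])
    have Knn: "0 \<le> kdist (K m) g h" if "g \<in> carrier G" "h \<in> carrier G" for g h m
      by (rule kdist_nonneg[OF Kpsd that])
    have Ksmall: "\<exists>m0. \<forall>m\<ge>m0. kdist (K m) \<one>\<^bsub>G\<^esub> g \<le> 2 * (1/4)^m" if g: "g \<in> carrier G" for g
    proof -
      obtain i where i: "e i = inv\<^bsub>G\<^esub> g" using e_surj g by blast
      have "kdist (K m) \<one>\<^bsub>G\<^esub> g \<le> 2 * (1/4)^m" if "m \<ge> i" for m
      proof -
        have "emeasure (amp M) {x \<in> Y m. b t (inv\<^bsub>G\<^esub> g) x \<noteq> b (s m) (inv\<^bsub>G\<^esub> g) x} < ennreal ((1/4)^m)"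
          using near[OF that] by (simp add: i)
        then have "measure (amp M) {x \<in> Y m. b t (inv\<^bsub>G\<^esub> g) x \<noteq> b (s m) (inv\<^bsub>G\<^esub> g) x} \<le> (1/4)^m"
          unfolding measure_def by (intro enn2real_leI) (auto intro: less_imp_le)
        then show ?thesis using Kle[OF g, of m] by linarith
      qed
      then show ?thesis by blast
    qed
    \<comment> \<open>Inner products of the displacements of \<open>g\<close> and \<open>h\<close>
      from the identity. Distances are unchanged, but unlike \<open>K m\<close>, whose diagonal is
      the measure of the overlap, these kernels tend to zero and can be summed with weights.\<close>
    define B where "B m g h = K m g h - K m g \<one>\<^bsub>G\<^esub> - K m \<one>\<^bsub>G\<^esub> h + K m \<one>\<^bsub>G\<^esub> \<one>\<^bsub>G\<^esub>" for m g h
    have B_form: "B m g h = lform (K m) (ldiff [(1, g)] [(1, \<one>\<^bsub>G\<^esub>)]) (ldiff [(1, h)] [(1, \<one>\<^bsub>G\<^esub>)])" for m g h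
      by (simp add: B_def)
    have Bpsd: "psd_on (carrier G) (B m)" for m
    proof (rule psd_onI)
      fix g h assume "g \<in> carrier G" "h \<in> carrier G"
      then show "B m g h = B m h g" unfolding B_form by (intro lform_sym[OF Kpsd]) auto
    next
      fix xs :: "(real \<times> ('a \<Rightarrow> 'a) set) list" assume xs: "snd ` set xs \<subseteq> carrier G"
      define c where "c = lsum (\<lambda>_. 1) xs"
      \<comment> \<open>The list with its total mass subtracted at the identity: evaluating
        \<open>B m\<close> on \<open>xs\<close> amounts to evaluating \<open>K m\<close> on this
        recentred list.\<close>
      define E where "E = ldiff xs (lscale c [(1, \<one>\<^bsub>G\<^esub>)])"
      have cc: "lsum (\<lambda>_. z) xs = z * c" for z unfolding c_def by (rule lsum_const)
      have "lform (B m) xs xs = lform (K m) E E"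
        unfolding lform_def B_def E_def
        by (simp add: lsum_diff lsum_add cc lsum_mult_right lsum_mult_left) (simp add: algebra_simps)
      moreover have "0 \<le> lform (K m) E E" using xs by (intro lform_nonneg[OF Kpsd]) (simp add: E_def)
      ultimately show "0 \<le> lform (B m) xs xs" by simp
    qed
    have kdB: "kdist (B m) g h = kdist (K m) g h" if "g \<in> carrier G" "h \<in> carrier G" for m g h
    proof -
      have "K m g h = K m h g" "K m g \<one>\<^bsub>G\<^esub> = K m \<one>\<^bsub>G\<^esub> g" "K m h \<one>\<^bsub>G\<^esub> = K m \<one>\<^bsub>G\<^esub> h"
        using Kpsd[of m] that one_closed unfolding psd_on_def by blast+
      then show ?thesis by (simp add: kdist_def B_def)
    qed
    have Bdiag: "B m g g = kdist (K m) \<one>\<^bsub>G\<^esub> g" if "g \<in> carrier G" for m g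
    proof -
      have "K m g \<one>\<^bsub>G\<^esub> = K m \<one>\<^bsub>G\<^esub> g" using Kpsd[of m] that one_closed unfolding psd_on_def by blast
      then show ?thesis by (simp add: kdist_def B_def)
    qed
    \<comment> \<open>Cauchy-Schwarz transfers the bound \<open>2 * (1/4)^m\<close> from the
      diagonal to all pairs, for large \<open>m\<close>; after the weight \<open>2^m\<close> a
      summable \<open>2 * (1/2)^m\<close> is left.\<close>
    have Bsum: "summable (\<lambda>m. 2^m * B m g h)" if g: "g \<in> carrier G" and h: "h \<in> carrier G" for g h
    proof -
      obtain m1 where m1: "\<And>m. m \<ge> m1 \<Longrightarrow> kdist (K m) \<one>\<^bsub>G\<^esub> g \<le> 2 * (1/4)^m" using Ksmall[OF g] by blast
      obtain m2 where m2: "\<And>m. m \<ge> m2 \<Longrightarrow> kdist (K m) \<one>\<^bsub>G\<^esub> h \<le> 2 * (1/4)^m" using Ksmall[OF h] by blast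
      show ?thesis
      proof (rule summable_comparison_test'[where N = "max m1 m2"])
        show "summable (\<lambda>m. 2 * (1/2::real)^m)" by (intro summable_mult summable_geometric) simp
        fix m assume m: "max m1 m2 \<le> m"
        have "(B m g h)\<^sup>2 \<le> B m g g * B m h h" by (rule psd_on_Cauchy_Schwarz[OF Bpsd g h])
        also have "\<dots> \<le> (2 * (1/4)^m) * (2 * (1/4)^m)"
          using m1 m2 m Knn g h by (intro mult_mono) (auto simp: Bdiag)
        also have "\<dots> = (2 * (1/4)^m)\<^sup>2" by (simp add: power2_eq_square)
        finally have "\<bar>B m g h\<bar> \<le> 2 * (1/4)^m" using abs_le_square_iff[of "B m g h" "2 * (1/4)^m"] by simp
        then have "2^m * \<bar>B m g h\<bar> \<le> 2^m * (2 * (1/4)^m)" by (intro mult_left_mono) auto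
        also have "\<dots> = 2 * (1/2)^m" by (simp add: power_divide power_mult_distrib[symmetric] field_simps)
        finally show "norm (2^m * B m g h) \<le> 2 * (1/2)^m" by (simp add: abs_mult)
      qed
    qed
    define KK where "KK g h = (\<Sum>m. 2^m * B m g h)" for g h
    have KKpsd: "psd_on (carrier G) KK"
    proof (rule psd_on_tendsto)
      show "psd_on (carrier G) (\<lambda>g h. \<Sum>m<n. 2^m * B m g h)" for n
        by (intro psd_on_sum psd_on_mult_const Bpsd) simp
      show "(\<lambda>n. \<Sum>m<n. 2^m * B m g h) \<longlonglongrightarrow> KK g h" if "g \<in> carrier G" "h \<in> carrier G" for g h
        unfolding KK_def by (rule summable_LIMSEQ[OF Bsum[OF that]])
    qed
    have KKd: "(\<lambda>m. 2^m * kdist (K m) g h) sums kdist KK g h" if g: "g \<in> carrier G" and h: "h \<in> carrier G" for g h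
    proof -
      have "(\<lambda>m. 2^m * B m g g + 2^m * B m h h - 2 * (2^m * B m g h)) sums (KK g g + KK h h - 2 * KK g h)"
        unfolding KK_def using g h by (intro sums_diff sums_add sums_mult summable_sums Bsum)
      moreover have "2^m * B m g g + 2^m * B m h h - 2 * (2^m * B m g h) = 2^m * kdist (K m) g h" for m
        unfolding kdB[OF g h, symmetric] by (simp add: kdist_def algebra_simps)
      ultimately show ?thesis by (simp add: kdist_def)
    qed
    have KKinv: "kdist KK (k \<otimes>\<^bsub>G\<^esub> g) (k \<otimes>\<^bsub>G\<^esub> h) = kdist KK g h"
      if "k \<in> carrier G" "g \<in> carrier G" "h \<in> carrier G" for k g h
    proof -
      have "(\<lambda>m. 2^m * kdist (K m) (k \<otimes>\<^bsub>G\<^esub> g) (k \<otimes>\<^bsub>G\<^esub> h)) sums kdist KK (k \<otimes>\<^bsub>G\<^esub> g) (k \<otimes>\<^bsub>G\<^esub> h)"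
        using that by (intro KKd) auto
      then have "(\<lambda>m. 2^m * kdist (K m) g h) sums kdist KK (k \<otimes>\<^bsub>G\<^esub> g) (k \<otimes>\<^bsub>G\<^esub> h)"
        by (simp add: Kinv[OF that])
      then show ?thesis using KKd[OF that(2,3)] by (rule sums_unique2)
    qed
    obtain C where C: "\<And>h. h \<in> H \<Longrightarrow> kdist KK \<one>\<^bsub>G\<^esub> h \<le> C"
      using relative_T_bounded[OF relT[folded G_def] cG KKpsd KKinv] by blast
    have small: "kdist (K m) \<one>\<^bsub>G\<^esub> h \<le> C / 2^m" if h: "h \<in> H" for h m
    proof -
      have hG: "h \<in> carrier G" using h by (rule H.mem_carrier)
      \<comment> \<open>A single term of a sum of nonnegative terms is at most the sum, which
        \<open>C\<close> bounds on all of \<open>H\<close>; the weight then turns boundedness into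
        the decay \<open>C / 2^m\<close>.\<close>
      have "(\<Sum>i\<in>{m}. 2^i * kdist (K i) \<one>\<^bsub>G\<^esub> h) \<le> kdist KK \<one>\<^bsub>G\<^esub> h"
        unfolding sums_unique[OF KKd[OF one_closed hG]]
        by (rule sum_le_suminf) (use KKd[OF one_closed hG] Knn hG in \<open>auto intro: sums_summable\<close>)
      also have "\<dots> \<le> C" by (rule C[OF h])
      finally show ?thesis by (simp add: field_simps)
    qed
    have lim1: "(\<lambda>m. 4 * (C / 2^m)) \<longlonglongrightarrow> 0" and lim2: "(\<lambda>m. (1/4::real)^m) \<longlonglongrightarrow> 0"
      by real_asymp+
    have "\<forall>\<^sub>F m in sequentially. 4 * (C / 2^m) < 1 / (2 * t) \<and> (1/4)^m < 1 / (2 * t)"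
      using order_tendstoD(2)[OF lim1, of "1 / (2 * t)"] order_tendstoD(2)[OF lim2, of "1 / (2 * t)"] t0(1)
      by (auto intro: eventually_conj)
    \<comment> \<open>The supports overlap in more than half of \<open>1 / t\<close>, because they
      differ by less than the other half; four times the displacement bound must stay below that
      overlap.\<close>
    then obtain m where m: "4 * (C / 2^m) < 1 / (2 * t)" "(1/4)^m < 1 / (2 * t)" by (auto simp: eventually_sequentially)
    have Ym: "1 / (2 * t) < measure (amp M) (Y m)"
    proof -
      have YM: "Y m \<in> sets (amp M)" "X t - X (s m) \<in> sets (amp M)" using t0(2) sX(1) by (auto simp: Y_def)
      have "ennreal (1 / t) = emeasure (amp M) (Y m) + emeasure (amp M) (X t - X (s m))"
        unfolding t0(3)[symmetric] using YM by (subst plus_emeasure) (auto simp: Y_def intro!: arg_cong[where f = "emeasure (amp M)"])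
      also have "emeasure (amp M) (X t - X (s m)) \<le> emeasure (amp M) (sym_diff (X t) (X (s m)))"
        using t0(2) sX(1)[of m] by (intro emeasure_mono) auto
      also have "\<dots> \<le> ennreal ((1/4)^m)" using near[of 0 m] by (simp add: less_imp_le)
      finally have 1: "ennreal (1 / t) \<le> emeasure (amp M) (Y m) + ennreal ((1/4)^m)" by (simp add: add_left_mono)
      have "emeasure (amp M) (Y m) \<le> emeasure (amp M) (X t)" using t0(2) by (intro emeasure_mono) (auto simp: Y_def)
      then have "emeasure (amp M) (Y m) \<noteq> \<top>" using t0(3) by (auto simp: top_unique)
      then have 2: "emeasure (amp M) (Y m) = ennreal (measure (amp M) (Y m))" by (rule emeasure_eq_ennreal_measure)
      have "ennreal (1 / t) \<le> ennreal (measure (amp M) (Y m) + (1/4)^m)"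
        using 1 unfolding 2 by (simp add: ennreal_plus)
      then have "1 / t \<le> measure (amp M) (Y m) + (1/4)^m" by (subst (asm) ennreal_le_iff) auto
      moreover have "1 / t = 1 / (2 * t) + 1 / (2 * t)" by simp
      ultimately show ?thesis using m(2) by linarith
    qed
    obtain xs :: "nat \<Rightarrow> (real \<times> ('a \<Rightarrow> 'a) set) list" where xs: "\<And>n. lconv H (xs n)"
      "\<And>n. lform (K m) (ldiff (xs (Suc n)) (xs n)) (ldiff (xs (Suc n)) (xs n)) \<le> 4 * (1/4)^n"
      "\<And>h n. h \<in> H \<Longrightarrow> lform (K m) (ldiff (lmap (\<lambda>g. h \<otimes>\<^bsub>G\<^esub> g) (xs n)) (xs n)) (ldiff (lmap (\<lambda>g. h \<otimes>\<^bsub>G\<^esub> g) (xs n)) (xs n)) \<le> 4 * (1/4)^n"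
      "\<And>n. lform (K m) (ldiff (xs n) [(1, \<one>\<^bsub>G\<^esub>)]) (ldiff (xs n) [(1, \<one>\<^bsub>G\<^esub>)]) \<le> C / 2^m"
      using circumcenter[OF grp HG Kpsd[of m] Kinv small[of _ m]] by blast
    have eq: "emeasure (amp M) (X t) = emeasure (amp M) (X (s m))"
    proof -
      have e1: "emeasure (amp M) A = 0 \<or> emeasure (amp M) (X t - A) = 0"
        if "A \<in> sets (amp M)" "A \<subseteq> X t" "\<And>g. g \<in> H \<Longrightarrow> AE x in amp M. x \<in> X t \<longrightarrow> (b t g x \<in> A \<longleftrightarrow> x \<in> A)" for A
        using amp_actionD(10)[OF at that] .
      have e2: "emeasure (amp M) A = 0 \<or> emeasure (amp M) (X (s m) - A) = 0"
        if "A \<in> sets (amp M)" "A \<subseteq> X (s m)" "\<And>g. g \<in> H \<Longrightarrow> AE x in amp M. x \<in> X (s m) \<longrightarrow> (b (s m) g x \<in> A \<longleftrightarrow> x \<in> A)" for A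
        using amp_actionD(10)[OF as that] .
      have inv: "\<exists>C. \<forall>n. lform (K m) (ldiff (lmap (\<lambda>g. h \<otimes>\<^bsub>G\<^esub> g) (xs n)) (xs n)) (ldiff (lmap (\<lambda>g. h \<otimes>\<^bsub>G\<^esub> g) (xs n)) (xs n)) \<le> C * (1/4)^n"
        if "h \<in> H" for h using xs(3)[OF that] by blast
      have eps: "4 * (C / 2^m) < measure (amp M) (X t \<inter> X (s m))" using m(1) Ym by (simp add: Y_def)
      \<comment> \<open>\<open>kern\<close> does not depend on the index set, so the kernel obtained
        for the whole group is also the one of the pair restricted to \<open>H\<close>.\<close>
      show ?thesis
        using paired_actions.equivariant_map[OF paH, folded K_def, OF xs(1) xs(2) inv xs(4) eps e1 e2] by blast
    qed
    then have "1 / t = 1 / s m" using t0 sX[of m] by (simp add: ennreal_inj)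
    then show False using s(3)[of m] t0(1) sX(3)[of m] by (simp add: field_simps)
  qed
  from countable_representatives_by_codes[of F code "\<lambda>t s. s = t", OF this]
  have "\<exists>C. countable C \<and> F \<subseteq> C" by blast
  then show ?thesis unfolding F_def[symmetric] using countable_subset by blast
qed

section \<open>Kernels on words and averaging operators\<close>

definition lbind :: "(real \<times> 'i) list \<Rightarrow> ('i \<Rightarrow> (real \<times> 'j) list) \<Rightarrow> (real \<times> 'j) list" where
  "lbind xs f = concat (map (\<lambda>(c, i). lscale c (f i)) xs)"

lemma lsum_lbind [simp]: "lsum g (lbind xs f) = lsum (\<lambda>i. lsum g (f i)) xs"
proof (induction xs)
  case (Cons p xs)
  have "lbind (p # xs) f = lscale (fst p) (f (snd p)) @ lbind xs f" by (simp add: lbind_def case_prod_beta)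
  then show ?case using Cons by (simp add: lsum_def[of _ "p # xs"] lsum_def[of _ xs] case_prod_beta)
qed (simp add: lbind_def)

lemma set_lbind: "snd ` set (lbind xs f) = (\<Union>i\<in>snd ` set xs. snd ` set (f i))"
proof -
  have "snd ` set (lbind xs f) = (\<Union>p\<in>set xs. snd ` set (lscale (fst p) (f (snd p))))"
    by (simp add: lbind_def case_prod_beta image_UN)
  then show ?thesis by simp
qed

lemma lconv_lbind:
  assumes xs: "lconv A xs" and f: "\<And>i. i \<in> A \<Longrightarrow> lconv B (f i)"
  shows "lconv B (lbind xs f)"
  unfolding lconv_def
proof (intro conjI)
  show "snd ` set (lbind xs f) \<subseteq> B"
    unfolding set_lbind using lconvD(1)[OF xs] lconvD(1)[OF f] by blast
  show "\<forall>(c, j)\<in>set (lbind xs f). 0 \<le> c"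
  proof (intro ballI, clarify)
    fix c j assume "(c, j) \<in> set (lbind xs f)"
    then obtain d i e where *: "(d, i) \<in> set xs" "(e, j) \<in> set (f i)" "c = d * e"
      unfolding lbind_def lscale_def by auto
    have "i \<in> A" using *(1) lconvD(1)[OF xs] by force
    then show "0 \<le> c" using * lconvD(2)[OF xs *(1)] lconvD(2)[OF f *(2)] by simp
  qed
  have "lsum (\<lambda>i. lsum (\<lambda>_. 1) (f i)) xs = lsum (\<lambda>_. 1) xs"
    using lconvD(1)[OF xs] lconvD(3)[OF f] by (intro lsum_cong) auto
  then show "lsum (\<lambda>_. 1) (lbind xs f) = 1" using lconvD(3)[OF xs] by simp
qed

lemma lform_lbind: "lform K (lbind xs f) (lbind ys g) = lform (\<lambda>i j. lform K (f i) (g j)) xs ys"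
proof -
  have "lform K (f i) (lbind ys g) = lsum (\<lambda>j. lform K (f i) (g j)) ys" for i
    unfolding lform_def lsum_lbind by (rule lsum_swap)
  then show ?thesis unfolding lform_def[of K "lbind xs f"] lsum_lbind lform_def[of "\<lambda>i j. lform K (f i) (g j)"]
    by (simp add: lform_def)
qed

lemma psd_on_lform:
  assumes K: "psd_on A K" and f: "\<And>i. i \<in> B \<Longrightarrow> snd ` set (f i) \<subseteq> A"
  shows "psd_on B (\<lambda>i j. lform K (f i) (f j))"
proof (rule psd_onI)
  fix i j assume "i \<in> B" "j \<in> B"
  then show "lform K (f i) (f j) = lform K (f j) (f i)" using f by (intro lform_sym[OF K]) auto
next
  fix xs :: "(real \<times> 'b) list" assume "snd ` set xs \<subseteq> B"
  then have "snd ` set (lbind xs f) \<subseteq> A" unfolding set_lbind using f by blast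
  then show "0 \<le> lform (\<lambda>i j. lform K (f i) (f j)) xs xs"
    unfolding lform_lbind[symmetric] by (rule lform_nonneg[OF K])
qed

text \<open>Points at distance zero are the same vector: Cauchy-Schwarz applied to their difference
  and \<open>y\<close>.\<close>

lemma kdist_zero_row:
  assumes K: "psd_on A K" and A: "i \<in> A" "j \<in> A" "y \<in> A" and 0: "kdist K i j = 0"
  shows "K i y = K j y"
proof -
  have "(lform K (ldiff [(1, i)] [(1, j)]) [(1, y)])\<^sup>2 \<le> kdist K i j * lform K [(1, y)] [(1, y)]"
    unfolding kdist_lnorm[OF K A(1,2), symmetric] using A by (intro lform_Cauchy_Schwarz[OF K]) auto
  then have "(lform K (ldiff [(1, i)] [(1, j)]) [(1, y)])\<^sup>2 \<le> 0" by (simp add: 0)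
  then have "lform K (ldiff [(1, i)] [(1, j)]) [(1, y)] = 0" by simp
  then show ?thesis by (simp add: lform_def)
qed

lemma kdist_rows:
  assumes K: "psd_on A K" and A: "i \<in> A" "i' \<in> A" "j \<in> A" "j' \<in> A"
    and 0: "kdist K i i' = 0" "kdist K j j' = 0"
  shows "K i j = K i' j'" "kdist K i j = kdist K i' j'"
proof -
  have sym: "K x y = K y x" if "x \<in> A" "y \<in> A" for x y using K that by (simp add: psd_on_def)
  have r: "K x y = K x' y'" if "x \<in> A" "x' \<in> A" "y \<in> A" "y' \<in> A" "kdist K x x' = 0" "kdist K y y' = 0" for x x' y y'
    using kdist_zero_row[OF K that(1,2,3,5)] kdist_zero_row[OF K that(3,4,2,6)] sym that by simp
  show "K i j = K i' j'" by (rule r) (use A 0 in auto)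
  then show "kdist K i j = kdist K i' j'"
    unfolding kdist_def using r[of i i' i i'] r[of j j' j j'] A 0 by simp
qed

text \<open>Used to exchange one lift of group elements to words for another: if corresponding
  points are at distance zero, the two lists stand for the same vector.\<close>

lemma lform_rows:
  assumes K: "psd_on A K" and f: "\<And>i. i \<in> snd ` set xs \<Longrightarrow> f i \<in> A \<and> g i \<in> A \<and> kdist K (f i) (g i) = 0"
  shows "lform K (lmap f xs) (lmap f xs) = lform K (lmap g xs) (lmap g xs)"
proof -
  have e: "K (f i) (f j) = K (g i) (g j)" if i: "i \<in> snd ` set xs" and j: "j \<in> snd ` set xs" for i j
    by (rule kdist_rows(1)[OF K]) (use f[OF i] f[OF j] in simp_all)
  show ?thesis unfolding lform_lmap by (intro lsum_cong e)
qed

text \<open>Tychonoff: the product of the intervals is compact, and a product over a countable index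
  set is metrizable, so it is also sequentially compact.\<close>

lemma pointwise_convergent_subsequence:
  fixes f :: "nat \<Rightarrow> 'i::countable \<Rightarrow> real"
  assumes bdd: "\<And>n i. \<bar>f n i\<bar> \<le> B i"
  shows "\<exists>s g. strict_mono (s :: nat \<Rightarrow> nat) \<and> (\<forall>i. (\<lambda>n. f (s n) i) \<longlonglongrightarrow> g i)"
proof -
  have "compactin (product_topology (\<lambda>_. euclidean) UNIV) (PiE UNIV (\<lambda>i. {- B i .. B i}))"
    unfolding compactin_PiE by auto
  then have c: "compact (PiE UNIV (\<lambda>i. {- B i .. B i}))"
    unfolding euclidean_product_topology by simp
  have "f n \<in> PiE UNIV (\<lambda>i. {- B i .. B i})" for n using bdd[of n] by (auto simp: abs_le_iff minus_le_iff)
  then obtain g s where "strict_mono (s :: nat \<Rightarrow> nat)" "(f \<circ> s) \<longlonglongrightarrow> g"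
    using compact_imp_seq_compact[OF c] unfolding seq_compact_def by blast
  moreover have "(\<lambda>n. f (s n) i) \<longlonglongrightarrow> g i" for i
  proof -
    have "continuous_on UNIV (\<lambda>h :: 'i \<Rightarrow> real. h i)" by (rule continuous_on_product_coordinates)
    from continuous_on_tendsto_compose[OF this \<open>(f \<circ> s) \<longlonglongrightarrow> g\<close>]
    have "(\<lambda>n. (f \<circ> s) n i) \<longlonglongrightarrow> g i" by simp
    then show ?thesis by (simp only: o_def)
  qed
  ultimately show ?thesis by blast
qed

abbreviation lact :: "nat list \<Rightarrow> (real \<times> nat list) list \<Rightarrow> (real \<times> nat list) list" where
  "lact u \<equiv> lmap (\<lambda>x. u @ x)"

text \<open>The combination \<open>ys\<close> of words acting on the vector \<open>v\<close>. For
  convex \<open>ys\<close> this is an average of translates of \<open>v\<close>.\<close>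

definition lconvolve :: "(real \<times> nat list) list \<Rightarrow> (real \<times> nat list) list \<Rightarrow> (real \<times> nat list) list" where
  "lconvolve ys v = lbind ys (\<lambda>u. lact u v)"

definition dirichlet :: "nat \<Rightarrow> (nat list \<Rightarrow> nat list \<Rightarrow> real) \<Rightarrow> (real \<times> nat list) list \<Rightarrow> real" where
  "dirichlet k K v = (\<Sum>l<k. lform K (ldiff (lact [l] v) v) (ldiff (lact [l] v) v))"

text \<open>The kernel of the affine action on displacements \<open>u v - v\<close>: it only depends on \<open>v\<close> through inner products.\<close>

definition displacement :: "(nat list \<Rightarrow> nat list \<Rightarrow> real) \<Rightarrow> (real \<times> nat list) list \<Rightarrow> nat list \<Rightarrow> nat list \<Rightarrow> real" where
  "displacement K v u w = lform K (ldiff (lact u v) v) (ldiff (lact w v) v)"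

lemma lsum_lconvolve [simp]: "lsum f (lconvolve ys v) = lsum (\<lambda>u. lsum (\<lambda>x. f (u @ x)) v) ys"
  by (simp add: lconvolve_def)

text \<open>Since \<open>zs\<close> has total mass zero, \<open>v\<close> may be subtracted from
  each of its translates, so only displacements enter.\<close>

lemma lform_lconvolve_zero_sum:
  assumes "lsum (\<lambda>_. 1) zs = 0"
  shows "lform K (lconvolve zs v) (lconvolve zs v) = lform (displacement K v) zs zs"
proof -
  have "lsum f (lconvolve zs v) = lsum f (lbind zs (\<lambda>u. ldiff (lact u v) v))" for f
    using assms by (simp add: lsum_diff lsum_const[of "lsum f v"])
  then have "lform K (lconvolve zs v) (lconvolve zs v) =
      lform K (lbind zs (\<lambda>u. ldiff (lact u v) v)) (lbind zs (\<lambda>u. ldiff (lact u v) v))"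
    by (intro lform_lsum_cong)
  moreover have "displacement K v = (\<lambda>u w. lform K (ldiff (lact u v) v) (ldiff (lact w v) v))"
    by (intro ext) (rule displacement_def)
  ultimately show ?thesis unfolding lform_lbind by (simp only:)
qed

lemma lform_lconvolve_translate:
  assumes "lsum (\<lambda>_. 1) ys = 1"
  shows "lform K (ldiff (lact u (lconvolve ys v)) (lconvolve ys v)) (ldiff (lact u (lconvolve ys v)) (lconvolve ys v)) =
    lform (displacement K v) (ldiff (lact u ys) ys) (ldiff (lact u ys) ys)"
proof -
  have "lform K (ldiff (lact u (lconvolve ys v)) (lconvolve ys v)) (ldiff (lact u (lconvolve ys v)) (lconvolve ys v)) =
      lform K (lconvolve (ldiff (lact u ys) ys) v) (lconvolve (ldiff (lact u ys) ys) v)"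
    by (intro lform_lsum_cong) simp_all
  also have "\<dots> = lform (displacement K v) (ldiff (lact u ys) ys) (ldiff (lact u ys) ys)"
    by (rule lform_lconvolve_zero_sum) simp
  finally show ?thesis .
qed

lemma lform_lconvolve_ldiff:
  assumes "lsum (\<lambda>_. 1) ys = 1"
  shows "lform K (ldiff (lconvolve ys v) v) (ldiff (lconvolve ys v) v) =
    lform (displacement K v) (ldiff ys [(1, [])]) (ldiff ys [(1, [])])"
proof -
  have "lform K (ldiff (lconvolve ys v) v) (ldiff (lconvolve ys v) v) =
      lform K (lconvolve (ldiff ys [(1, [])]) v) (lconvolve (ldiff ys [(1, [])]) v)"
    by (intro lform_lsum_cong) simp_all
  also have "\<dots> = lform (displacement K v) (ldiff ys [(1, [])]) (ldiff ys [(1, [])])"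
    by (rule lform_lconvolve_zero_sum) (simp add: assms)
  finally show ?thesis .
qed

text \<open>Words in \<open>k\<close> letters cover all groups with \<open>k\<close> marked
  generators at once. The kernels of paired actions are themselves invariant, not only their
  distances, so translation acts linearly and isometrically.\<close>

locale word_kernel =
  fixes k :: nat and K :: "nat list \<Rightarrow> nat list \<Rightarrow> real"
  assumes psd: "psd_on (lists {..<k}) K"
    and kernel_mult: "\<And>g u w. g \<in> lists {..<k} \<Longrightarrow> u \<in> lists {..<k} \<Longrightarrow> w \<in> lists {..<k} \<Longrightarrow> K (g @ u) (g @ w) = K u w"
begin

abbreviation words :: "nat list set" where "words \<equiv> lists {..<k}"

lemma set_lact:
  assumes "u \<in> words" "snd ` set v \<subseteq> words"
  shows "snd ` set (lact u v) \<subseteq> words"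
proof
  fix y assume "y \<in> snd ` set (lact u v)"
  then obtain x where x: "x \<in> snd ` set v" "y = u @ x" unfolding set_lmap by blast
  then have "x \<in> words" using assms(2) by blast
  then show "y \<in> words" using assms(1) x(2) by simp
qed

lemma set_displacement:
  assumes "u \<in> words" "w \<in> words" "snd ` set v \<subseteq> words"
  shows "snd ` set (ldiff (lact u v) v) \<subseteq> words" "snd ` set (ldiff (lact u v) (lact w v)) \<subseteq> words"
  by (simp_all only: set_ldiff Un_subset_iff set_lact[OF assms(1,3)] set_lact[OF assms(2,3)] assms(3) simp_thms)

lemma lform_lact:
  assumes "g \<in> words" "snd ` set xs \<subseteq> words" "snd ` set ys \<subseteq> words"
  shows "lform K (lact g xs) (lact g ys) = lform K xs ys"
proof -
  have e: "K (g @ i) (g @ j) = K i j" if i: "i \<in> snd ` set xs" and j: "j \<in> snd ` set ys" for i j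
    by (rule kernel_mult[OF assms(1) subsetD[OF assms(2) i] subsetD[OF assms(3) j]])
  show ?thesis unfolding lform_lmap unfolding lform_def by (intro lsum_cong e)
qed

lemma lconv_lconvolve: "lconv words ys \<Longrightarrow> lconv words v \<Longrightarrow> lconv words (lconvolve ys v)"
  unfolding lconvolve_def by (rule lconv_lbind[of words]) (auto intro!: lconv_lmap[of words])

lemma dirichlet_nonneg: "snd ` set v \<subseteq> words \<Longrightarrow> 0 \<le> dirichlet k K v"
  unfolding dirichlet_def by (intro sum_nonneg lform_nonneg[OF psd] set_displacement(1)[where w = "[]"]) simp_all

text \<open>The letters of \<open>u\<close> are applied one after the other. By invariance each
  contributes the displacement by a single letter, which is at most the root of the Dirichlet
  form.\<close>

lemma lnorm_displacement_le:
  assumes v: "snd ` set v \<subseteq> words"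
  shows "u \<in> words \<Longrightarrow> lnorm K (ldiff (lact u v) v) \<le> real (length u) * sqrt (dirichlet k K v)"
proof (induction u)
  case Nil
  have "lnorm K (ldiff (lact [] v) v) = lnorm K []"
    unfolding lnorm_def by (subst lform_lsum_cong[where xs' = "[]" and ys' = "[]"]) simp_all
  then show ?case by (simp add: lnorm_def lform_def)
next
  case (Cons l u)
  then have l: "[l] \<in> words" "l < k" and u: "u \<in> words" by auto
  have "lform K (ldiff (lact [l] v) v) (ldiff (lact [l] v) v) \<le> dirichlet k K v"
    unfolding dirichlet_def
  proof (rule member_le_sum[of l "{..<k}" "\<lambda>l. lform K (ldiff (lact [l] v) v) (ldiff (lact [l] v) v)"])
    fix x assume "x \<in> {..<k} - {l}"
    then show "0 \<le> lform K (ldiff (lact [x] v) v) (ldiff (lact [x] v) v)"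
      using v by (intro lform_nonneg[OF psd] set_displacement(1)[where w = "[]"]) simp_all
  qed (use l in simp_all)
  then have 1: "lnorm K (ldiff (lact [l] v) v) \<le> sqrt (dirichlet k K v)" by (simp add: lnorm_def)
  have "lnorm K (ldiff (lact (l # u) v) (lact [l] v)) = lnorm K (lact [l] (ldiff (lact u v) v))"
    unfolding lnorm_def by (intro arg_cong[where f = sqrt] lform_lsum_cong) simp_all
  also have "\<dots> = lnorm K (ldiff (lact u v) v)"
    by (simp only: lnorm_def lform_lact[OF l(1) set_displacement(1)[OF u u v] set_displacement(1)[OF u u v]])
  also have "\<dots> \<le> real (length u) * sqrt (dirichlet k K v)" by (rule Cons.IH[OF u])
  finally have 2: "lnorm K (ldiff (lact (l # u) v) (lact [l] v)) \<le> real (length u) * sqrt (dirichlet k K v)" .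
  have "lnorm K (ldiff (lact (l # u) v) v) \<le> lnorm K (ldiff (lact (l # u) v) (lact [l] v)) + lnorm K (ldiff (lact [l] v) v)"
    by (rule lnorm_triangle[OF psd set_lact[OF Cons.prems v] set_lact[OF l(1) v] v])
  then show ?case using 1 2 by (simp add: algebra_simps)
qed

lemma lform_displacement_le:
  assumes v: "snd ` set v \<subseteq> words" and u: "u \<in> words"
  shows "lform K (ldiff (lact u v) v) (ldiff (lact u v) v) \<le> (real (length u))\<^sup>2 * dirichlet k K v"
proof -
  have S: "snd ` set (ldiff (lact u v) v) \<subseteq> words" by (rule set_displacement(1)[OF u u v])
  have "(lnorm K (ldiff (lact u v) v))\<^sup>2 \<le> (real (length u) * sqrt (dirichlet k K v))\<^sup>2"
    by (rule power_mono[OF lnorm_displacement_le[OF v u] lnorm_nonneg[OF psd S]])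
  then show ?thesis using dirichlet_nonneg[OF v] by (simp add: lnorm_sq[OF psd S] power_mult_distrib)
qed

lemma psd_displacement: "snd ` set v \<subseteq> words \<Longrightarrow> psd_on words (displacement K v)"
  unfolding displacement_def by (rule psd_on_lform[OF psd set_displacement(1)])

lemma abs_displacement_le:
  assumes v: "snd ` set v \<subseteq> words" and u: "u \<in> words" "w \<in> words"
  shows "\<bar>displacement K v u w\<bar> \<le> real (length u) * real (length w) * dirichlet k K v"
proof -
  have "\<bar>displacement K v u w\<bar> \<le> lnorm K (ldiff (lact u v) v) * lnorm K (ldiff (lact w v) v)"
    unfolding displacement_def by (rule lform_le_lnorm[OF psd set_displacement(1)[OF u v] set_displacement(1)[OF u(2,1) v]])
  also have "\<dots> \<le> (real (length u) * sqrt (dirichlet k K v)) * (real (length w) * sqrt (dirichlet k K v))"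
    using u v dirichlet_nonneg[OF v]
    by (intro mult_mono lnorm_displacement_le lnorm_nonneg[OF psd] set_displacement(1)[OF u(2,1) v]) simp_all
  also have "\<dots> = real (length u) * real (length w) * dirichlet k K v"
    using dirichlet_nonneg[OF v] by (simp add: algebra_simps)
  finally show ?thesis .
qed

lemma kdist_displacement:
  assumes v: "snd ` set v \<subseteq> words" and u: "u \<in> words" "w \<in> words"
  shows "kdist (displacement K v) u w = lform K (ldiff (lact u v) (lact w v)) (ldiff (lact u v) (lact w v))"
proof -
  define A where "A u = ldiff (lact u v) v" for u
  have S: "snd ` set (A u) \<subseteq> words" "snd ` set (A w) \<subseteq> words" 
    unfolding A_def by (rule set_displacement(1)[OF u v], rule set_displacement(1)[OF u(2,1) v])
  have "kdist (displacement K v) u w = lform K (A u) (A u) - 2 * lform K (A u) (A w) + lform K (A w) (A w)"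
    by (simp add: kdist_def displacement_def A_def)
  also have "\<dots> = lform K (ldiff (A u) (A w)) (ldiff (A u) (A w))" by (rule lform_ldiff_self[OF psd S, symmetric])
  also have "\<dots> = lform K (ldiff (lact u v) (lact w v)) (ldiff (lact u v) (lact w v))"
    unfolding A_def by (intro lform_lsum_cong) simp_all
  finally show ?thesis .
qed

lemma kdist_displacement_mult:
  assumes v: "snd ` set v \<subseteq> words" and u: "g \<in> words" "u \<in> words" "w \<in> words"
  shows "kdist (displacement K v) (g @ u) (g @ w) = kdist (displacement K v) u w"
proof -
  have "lform K (ldiff (lact (g @ u) v) (lact (g @ w) v)) (ldiff (lact (g @ u) v) (lact (g @ w) v)) =
      lform K (lact g (ldiff (lact u v) (lact w v))) (lact g (ldiff (lact u v) (lact w v)))"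
    by (intro lform_lsum_cong) simp_all
  also have "\<dots> = lform K (ldiff (lact u v) (lact w v)) (ldiff (lact u v) (lact w v))"
    by (rule lform_lact[OF u(1) set_displacement(2)[OF u(2,3) v] set_displacement(2)[OF u(2,3) v]])
  finally show ?thesis using u v by (simp add: kdist_displacement)
qed

text \<open>If prefixing \<open>u\<close> or \<open>w\<close> gives the same vector for each point,
  then the two translates of \<open>v\<close> coincide. In the limit this makes the displacement
  kernel descend from words to the group.\<close>

lemma kdist_displacement_zero:
  assumes v: "snd ` set v \<subseteq> words" and u: "u \<in> words" "w \<in> words"
    and 0: "\<And>x. x \<in> words \<Longrightarrow> kdist K (u @ x) (w @ x) = 0"
  shows "kdist (displacement K v) u w = 0"
proof -
  define z where "z = ldiff (lact u v) (lact w v)"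
  have row: "K (u @ x) y = K (w @ x) y" if "x \<in> words" "y \<in> words" for x y
    using kdist_zero_row[OF psd _ _ that(2) 0[OF that(1)]] u that by auto
  have "lsum (K (u @ x)) z = lsum (K (w @ x)) z" if "x \<in> snd ` set v" for x
    unfolding z_def using that v set_displacement(2)[OF u v] by (intro lsum_cong row) blast+
  then have "lsum (\<lambda>x. lsum (K (u @ x)) z) v = lsum (\<lambda>x. lsum (K (w @ x)) z) v" by (rule lsum_cong)
  then have "lform K z z = 0" unfolding lform_def by (subst (2) z_def) simp
  then show ?thesis unfolding kdist_displacement[OF v u] z_def .
qed

end

text \<open>If no uniform contraction existed, the displacement kernels of a sequence of counterexamples, normalized by
  their Dirichlet forms, would converge to a kernel on the group; property (T) bounds its orbits, and an almost fixed
  convex combination for the limit contracts along the sequence.\<close>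

lemma uniform_contraction:
  fixes G (structure) and K :: "nat \<Rightarrow> nat list \<Rightarrow> nat list \<Rightarrow> real"
  assumes T: "property_T G" and e_mult: "\<And>u w. u \<in> lists {..<k} \<Longrightarrow> w \<in> lists {..<k} \<Longrightarrow> e (u @ w) = e u \<otimes> e w"
    and e_Nil: "e [] = \<one>" and e_surj: "e ` lists {..<k} = carrier G"
    and wk: "\<And>m. word_kernel k (K m)"
    and e_eq: "\<And>u w. u \<in> lists {..<k} \<Longrightarrow> w \<in> lists {..<k} \<Longrightarrow> e u = e w \<Longrightarrow>
        \<forall>\<^sub>F m in sequentially. \<forall>x\<in>lists {..<k}. kdist (K m) (u @ x) (w @ x) = 0"
  shows "\<exists>R\<ge>0. \<exists>N. \<forall>m\<ge>N. \<forall>v. lconv (lists {..<k}) v \<longrightarrow> (\<exists>ys. lconv (lists {..<k}) ys \<and>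
    dirichlet k (K m) (lconvolve ys v) \<le> 1/4 * dirichlet k (K m) v \<and>
    lform (K m) (ldiff (lconvolve ys v) v) (ldiff (lconvolve ys v) v) \<le> R * dirichlet k (K m) v)"
proof (rule ccontr)
  assume neg: "\<not> ?thesis"
  define W where "W = lists {..<k}"
  have WI: "[] \<in> W" "\<And>u w. u \<in> W \<Longrightarrow> w \<in> W \<Longrightarrow> u @ w \<in> W" "\<And>l. l < k \<Longrightarrow> [l] \<in> W" by (auto simp: W_def)
  have relT: "relative_T G (carrier G)" using T by (simp add: property_T_def)
  then have grp: "group G" by (simp add: relative_T_def)
  interpret group G by (rule grp)
  define good where "good r m v ys \<longleftrightarrow> lconv W ys \<and> dirichlet k (K m) (lconvolve ys v) \<le> 1/4 * dirichlet k (K m) v \<and>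
    lform (K m) (ldiff (lconvolve ys v) v) (ldiff (lconvolve ys v) v) \<le> real r * dirichlet k (K m) v" for r m v ys
  \<comment> \<open>The negated claim with \<open>r\<close> as both the constant and the threshold:
    a counterexample of index at least \<open>r\<close>.\<close>
  have "\<exists>m v. r \<le> m \<and> lconv W v \<and> (\<forall>ys. \<not> good r m v ys)" for r
  proof (rule ccontr)
    assume "\<not> ?thesis"
    then have "\<forall>m\<ge>r. \<forall>v. lconv W v \<longrightarrow> (\<exists>ys. good r m v ys)" by blast
    then have "0 \<le> real r \<and> (\<exists>N. \<forall>m\<ge>N. \<forall>v. lconv W v \<longrightarrow> (\<exists>ys. good r m v ys))" by auto
    then show False using neg unfolding good_def W_def by blast
  qed
  then have "\<forall>r. \<exists>p. r \<le> fst p \<and> lconv W (snd p) \<and> (\<forall>ys. \<not> good r (fst p) (snd p) ys)" by auto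
  then obtain p where p: "\<And>r. r \<le> fst (p r) \<and> lconv W (snd (p r)) \<and> (\<forall>ys. \<not> good r (fst (p r)) (snd (p r)) ys)"
    using choice[of "\<lambda>r p. r \<le> fst p \<and> lconv W (snd p) \<and> (\<forall>ys. \<not> good r (fst p) (snd p) ys)"] by blast
  define L v D where "L r = K (fst (p r))" and "v r = snd (p r)" and "D r = dirichlet k (L r) (v r)" for r
  have wkL: "word_kernel k (L r)" for r unfolding L_def by (rule wk)
  have cv: "lconv W (v r)" for r using p by (simp add: v_def)
  have sv: "snd ` set (v r) \<subseteq> lists {..<k}" for r using lconvD(1)[OF cv] by (simp add: W_def)
  have bad: "\<not> (dirichlet k (L r) (lconvolve ys (v r)) \<le> 1/4 * D r \<and>
      lform (L r) (ldiff (lconvolve ys (v r)) (v r)) (ldiff (lconvolve ys (v r)) (v r)) \<le> real r * D r)"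
    if "lconv W ys" for r ys using p[of r] that unfolding good_def L_def v_def D_def by blast
  have dir_conv: "dirichlet k (L r) (lconvolve ys (v r)) =
      (\<Sum>l<k. lform (displacement (L r) (v r)) (ldiff (lact [l] ys) ys) (ldiff (lact [l] ys) ys))" if "lconv W ys" for r ys
    unfolding dirichlet_def using lconvD(3)[OF that] by (intro sum.cong refl lform_lconvolve_translate)
  \<comment> \<open>If the Dirichlet form vanished, the unit mass at \<open>[]\<close>, which leaves
    the vector unchanged, would meet all demands. So the normalization by \<open>D r\<close> is
    legitimate.\<close>
  have Dpos: "D r > 0" for r
  proof (rule ccontr)
    assume "\<not> D r > 0"
    then have D0: "D r = 0" using word_kernel.dirichlet_nonneg[OF wkL sv, of r r] by (simp add: D_def)
    define y :: "(real \<times> nat list) list" where "y = [(1, [])]"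
    have y: "lconv W y" unfolding y_def by (rule lconv_single[OF WI(1)])
    have eq: "lsum f (lconvolve y (v r)) = lsum f (v r)" for f by (simp add: y_def)
    have "dirichlet k (L r) (lconvolve y (v r)) = D r"
      unfolding D_def dirichlet_def by (intro sum.cong refl lform_lsum_cong) (simp_all only: lsum_ldiff lsum_lmap eq)
    moreover have "lform (L r) (ldiff (lconvolve y (v r)) (v r)) (ldiff (lconvolve y (v r)) (v r)) = lform (L r) [] []"
      by (intro lform_lsum_cong) (simp_all only: lsum_ldiff lsum_Nil eq diff_self)
    ultimately show False using bad[OF y, of r] D0 by (simp add: lform_def)
  qed
  \<comment> \<open>After division by the Dirichlet form, the values are bounded by the product of
    the word lengths, uniformly in \<open>r\<close>; this is the compactness that the argument
    needs.\<close>
  define \<kappa> where "\<kappa> r u w = displacement (L r) (v r) u w / D r" for r u w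
  have \<kappa>_psd: "psd_on W (\<kappa> r)" for r
    using psd_on_mult_const[OF word_kernel.psd_displacement[OF wkL sv], of "1 / D r" r r] Dpos[of r]
    unfolding \<kappa>_def W_def by simp
  have \<kappa>_bdd: "\<bar>\<kappa> r u w\<bar> \<le> real (length u) * real (length w)" if "u \<in> W" "w \<in> W" for r u w
  proof -
    have "\<bar>displacement (L r) (v r) u w\<bar> \<le> real (length u) * real (length w) * D r"
      unfolding D_def using that by (intro word_kernel.abs_displacement_le[OF wkL sv]) (simp_all add: W_def)
    then show ?thesis using Dpos[of r] by (simp add: \<kappa>_def abs_divide pos_divide_le_eq)
  qed
  have \<kappa>_kd: "kdist (\<kappa> r) u w = kdist (displacement (L r) (v r)) u w / D r" for r u w
    by (simp add: kdist_def \<kappa>_def diff_divide_distrib add_divide_distrib)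
  have \<kappa>_form: "lform (displacement (L r) (v r)) xs ys = D r * lform (\<kappa> r) xs ys" for r xs ys
  proof -
    have "\<kappa> r = (\<lambda>u w. displacement (L r) (v r) u w / D r)" by (intro ext) (rule \<kappa>_def)
    then have "lform (\<kappa> r) xs ys = lform (displacement (L r) (v r)) xs ys / D r"
      by (simp only: lform_def lsum_divide)
    then show ?thesis using Dpos[of r] by simp
  qed
  \<comment> \<open>Extended by zero to all pairs of lists of naturals, a countable type, so that
    the diagonal subsequence lemma applies.\<close>
  define f where "f r q = (if fst q \<in> W \<and> snd q \<in> W then \<kappa> r (fst q) (snd q) else 0)" for r q
  have "\<bar>f r q\<bar> \<le> real (length (fst q)) * real (length (snd q))" for r q
    using \<kappa>_bdd[of "fst q" "snd q" r] by (simp add: f_def)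
  then obtain s g where s: "strict_mono (s :: nat \<Rightarrow> nat)" and g: "\<forall>q. (\<lambda>n. f (s n) q) \<longlonglongrightarrow> g q"
    using pointwise_convergent_subsequence[of f "\<lambda>q. real (length (fst q)) * real (length (snd q))"] by blast
  define \<kappa>' where "\<kappa>' u w = g (u, w)" for u w
  have lim: "(\<lambda>n. \<kappa> (s n) u w) \<longlonglongrightarrow> \<kappa>' u w" if "u \<in> W" "w \<in> W" for u w
    using g[THEN spec, of "(u, w)"] that by (simp add: f_def \<kappa>'_def)
  have psd': "psd_on W \<kappa>'" by (rule psd_on_tendsto[OF \<kappa>_psd lim])
  have lim_kd: "(\<lambda>n. kdist (\<kappa> (s n)) u w) \<longlonglongrightarrow> kdist \<kappa>' u w" if "u \<in> W" "w \<in> W" for u w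
    unfolding kdist_def using that by (intro tendsto_intros lim)
  have lim_form: "(\<lambda>n. lform (\<kappa> (s n)) xs xs) \<longlonglongrightarrow> lform \<kappa>' xs xs" if "snd ` set xs \<subseteq> W" for xs
    unfolding lform_def using that by (intro lsum_tendsto lim) auto
  have kd_mult: "kdist \<kappa>' (h @ u) (h @ w) = kdist \<kappa>' u w" if "h \<in> W" "u \<in> W" "w \<in> W" for h u w
  proof -
    have "kdist (\<kappa> r) (h @ u) (h @ w) = kdist (\<kappa> r) u w" for r
      unfolding \<kappa>_kd using that by (subst word_kernel.kdist_displacement_mult[OF wkL sv]) (simp_all add: W_def)
    then have "(\<lambda>n. kdist (\<kappa> (s n)) u w) \<longlonglongrightarrow> kdist \<kappa>' (h @ u) (h @ w)"
      using lim_kd[of "h @ u" "h @ w"] that WI(2) by simp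
    then show ?thesis using lim_kd[OF that(2,3)] LIMSEQ_unique by blast
  qed
  have kd_eq: "kdist \<kappa>' u w = 0" if u: "u \<in> W" "w \<in> W" "e u = e w" for u w
  proof -
    have "\<forall>\<^sub>F m in sequentially. \<forall>x\<in>W. kdist (K m) (u @ x) (w @ x) = 0"
      using e_eq[of u w] u by (simp add: W_def)
    then obtain N where N: "\<And>m x. m \<ge> N \<Longrightarrow> x \<in> W \<Longrightarrow> kdist (K m) (u @ x) (w @ x) = 0"
      by (auto simp: eventually_sequentially)
    have "kdist (\<kappa> (s n)) u w = 0" if "n \<ge> N" for n
    proof -
      have "fst (p (s n)) \<ge> N" using that p[of "s n"] seq_suble[OF s, of n] by linarith
      then have "kdist (displacement (L (s n)) (v (s n))) u w = 0"
        using u N by (intro word_kernel.kdist_displacement_zero[OF wkL sv]) (simp_all add: W_def L_def)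
      then show ?thesis by (simp add: \<kappa>_kd)
    qed
    then have "\<forall>\<^sub>F n in sequentially. kdist (\<kappa> (s n)) u w = 0" by (auto simp: eventually_sequentially)
    then have "(\<lambda>n. kdist (\<kappa> (s n)) u w) \<longlonglongrightarrow> 0" by (rule tendsto_eventually)
    then show ?thesis using lim_kd[OF u(1,2)] LIMSEQ_unique by blast
  qed
  have "\<forall>h. \<exists>w. h \<in> carrier G \<longrightarrow> w \<in> W \<and> e w = h"
  proof
    fix h
    show "\<exists>w. h \<in> carrier G \<longrightarrow> w \<in> W \<and> e w = h"
    proof (cases "h \<in> carrier G")
      case True
      then have "h \<in> e ` W" by (simp only: e_surj W_def)
      then obtain w where "h = e w" "w \<in> W" by (rule imageE)
      then show ?thesis by (intro exI[of _ w]) simp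
    qed simp
  qed
  then have "\<exists>\<omega>. \<forall>h. h \<in> carrier G \<longrightarrow> \<omega> h \<in> W \<and> e (\<omega> h) = h" by (rule choice)
  then obtain \<omega> where om: "\<forall>h. h \<in> carrier G \<longrightarrow> \<omega> h \<in> W \<and> e (\<omega> h) = h" ..
  have \<omega>: "\<omega> h \<in> W" "e (\<omega> h) = h" if h: "h \<in> carrier G" for h
    by (fact conjunct1[OF om[rule_format, OF h]] conjunct2[OF om[rule_format, OF h]])+
  \<comment> \<open>\<open>\<omega>\<close> is only a choice of words and not a homomorphism. The
    words \<open>\<omega> (c \<otimes> d)\<close> and \<open>\<omega> c @ \<omega> d\<close> are at
    distance zero for the limit kernel, so \<open>KG\<close> is nevertheless left invariant in its
    distances.\<close>
  define KG where "KG g h = \<kappa>' (\<omega> g) (\<omega> h)" for g h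
  have KGpsd: "psd_on (carrier G) KG" unfolding KG_def by (rule psd_on_comp[OF psd']) (use \<omega> in blast)
  have KGd: "kdist KG g h = kdist \<kappa>' (\<omega> g) (\<omega> h)" for g h by (simp add: kdist_def KG_def)
  have \<omega>_mult: "kdist \<kappa>' (\<omega> (c \<otimes> d)) (\<omega> c @ \<omega> d) = 0" if c: "c \<in> carrier G" and d: "d \<in> carrier G" for c d
  proof (rule kd_eq[OF \<omega>(1)[OF m_closed[OF c d]] WI(2)[OF \<omega>(1)[OF c] \<omega>(1)[OF d]]])
    show "e (\<omega> (c \<otimes> d)) = e (\<omega> c @ \<omega> d)"
      by (simp only: \<omega>(2)[OF m_closed[OF c d]] \<omega>(2)[OF c] \<omega>(2)[OF d]
        e_mult[OF \<omega>(1)[OF c, unfolded W_def] \<omega>(1)[OF d, unfolded W_def]])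
  qed
  have KGinv: "kdist KG (c \<otimes> g) (c \<otimes> h) = kdist KG g h"
    if c: "c \<in> carrier G" and g: "g \<in> carrier G" and h: "h \<in> carrier G" for c g h
  proof -
    have "kdist KG (c \<otimes> g) (c \<otimes> h) = kdist \<kappa>' (\<omega> c @ \<omega> g) (\<omega> c @ \<omega> h)"
      unfolding KGd
      by (rule kdist_rows(2)[OF psd' \<omega>(1)[OF m_closed[OF c g]] WI(2)[OF \<omega>(1)[OF c] \<omega>(1)[OF g]]
        \<omega>(1)[OF m_closed[OF c h]] WI(2)[OF \<omega>(1)[OF c] \<omega>(1)[OF h]] \<omega>_mult[OF c g] \<omega>_mult[OF c h]])
    also have "\<dots> = kdist \<kappa>' (\<omega> g) (\<omega> h)" by (rule kd_mult[OF \<omega>(1)[OF c] \<omega>(1)[OF g] \<omega>(1)[OF h]])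
    finally show ?thesis by (simp only: KGd)
  qed
  have cG: "countable (carrier G)" unfolding e_surj[symmetric] by (rule countable_image) simp
  have "\<exists>C. \<forall>h\<in>carrier G. kdist KG \<one> h \<le> C" by (rule relative_T_bounded[OF relT cG KGpsd KGinv])
  then obtain C where C0: "\<forall>h\<in>carrier G. kdist KG \<one> h \<le> C" ..
  have C: "kdist KG \<one> h \<le> C" if h: "h \<in> carrier G" for h by (rule bspec[OF C0 h])
  have "C \<ge> 0" using C[OF one_closed] by (simp add: kdist_def)
  have "\<exists>xs. \<forall>n. lconv (carrier G) (xs n) \<and>
    lform KG (ldiff (xs (Suc n)) (xs n)) (ldiff (xs (Suc n)) (xs n)) \<le> 4 * (1/4)^n \<and>
    (\<forall>h\<in>carrier G. lform KG (ldiff (lmap ((\<otimes>) h) (xs n)) (xs n)) (ldiff (lmap ((\<otimes>) h) (xs n)) (xs n)) \<le> 4 * (1/4)^n) \<and>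
    lform KG (ldiff (xs n) [(1, \<one>)]) (ldiff (xs n) [(1, \<one>)]) \<le> C"
    by (rule circumcenter[OF grp subgroup_self KGpsd KGinv C])
  then obtain xs where xs: "\<forall>n. lconv (carrier G) (xs n) \<and>
    lform KG (ldiff (xs (Suc n)) (xs n)) (ldiff (xs (Suc n)) (xs n)) \<le> 4 * (1/4)^n \<and>
    (\<forall>h\<in>carrier G. lform KG (ldiff (lmap ((\<otimes>) h) (xs n)) (xs n)) (ldiff (lmap ((\<otimes>) h) (xs n)) (xs n)) \<le> 4 * (1/4)^n) \<and>
    lform KG (ldiff (xs n) [(1, \<one>)]) (ldiff (xs n) [(1, \<one>)]) \<le> C" ..
  have "(\<lambda>n. 4 * (1/4::real)^n) \<longlonglongrightarrow> 0" by real_asymp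
  then have "\<forall>\<^sub>F n in sequentially. 4 * (1/4::real)^n < 1 / (8 * (real k + 1))" by (rule order_tendstoD(2)) simp
  \<comment> \<open>With this threshold the displacements by the \<open>k\<close> letters add up to
    less than one eighth, well below the required quarter.\<close>
  then obtain n where n: "4 * (1/4::real)^n < 1 / (8 * (real k + 1))" by (auto simp: eventually_sequentially)
  define x where "x = xs n"
  have cx: "lconv (carrier G) x" and xinv: "\<forall>h\<in>carrier G. lform KG (ldiff (lmap ((\<otimes>) h) x) x) (ldiff (lmap ((\<otimes>) h) x) x) \<le> 4 * (1/4)^n"
    and xclose: "lform KG (ldiff x [(1, \<one>)]) (ldiff x [(1, \<one>)]) \<le> C"
    using xs[THEN spec, of n] unfolding x_def by blast+
  have KG_eq: "KG = (\<lambda>g h. \<kappa>' (\<omega> g) (\<omega> h))" by (intro ext) (rule KG_def)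
  have xW: "i \<in> carrier G" if "i \<in> snd ` set x" for i using lconvD(1)[OF cx] that by blast
  define ys where "ys = lmap \<omega> x"
  have ys: "lconv W ys" unfolding ys_def by (rule lconv_lmap[OF cx]) (use \<omega> in blast)
  have y1: "lform \<kappa>' (ldiff (lact [l] ys) ys) (ldiff (lact [l] ys) ys) < 1 / (8 * (real k + 1))" if l: "l < k" for l
  proof -
    define h where "h = e [l]"
    have h: "h \<in> carrier G" unfolding h_def using e_surj WI(3)[OF l] by (auto simp: W_def)
    have le: "lform KG (ldiff (lmap ((\<otimes>) h) x) x) (ldiff (lmap ((\<otimes>) h) x) x) < 1 / (8 * (real k + 1))"
      using bspec[OF xinv h] n by linarith
    \<comment> \<open>The disjoint sum keeps translated and untranslated points apart, so that they
      can be lifted differently: \<open>F1\<close> lifts the product \<open>h \<otimes> i\<close>,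
      whereas \<open>F2\<close> puts the letter before the lift of \<open>i\<close>. Both lifts give
      the same vectors for the limit kernel.\<close>
    define z :: "(real \<times> ('a + 'a)) list" where "z = ldiff (lmap Inl x) (lmap Inr x)"
    define F1 where "F1 = case_sum (\<lambda>i. \<omega> (h \<otimes> i)) \<omega>"
    define F2 where "F2 = case_sum (\<lambda>i. l # \<omega> i) \<omega>"
    have zs: "snd ` set z = Inl ` snd ` set x \<union> Inr ` snd ` set x" by (simp add: z_def)
    have "lform KG (ldiff (lmap ((\<otimes>) h) x) x) (ldiff (lmap ((\<otimes>) h) x) x) = lform \<kappa>' (lmap F1 z) (lmap F1 z)"
      by (simp only: lform_def KG_eq z_def F1_def lsum_ldiff lsum_lmap lsum_single sum.case)
    also have "\<dots> = lform \<kappa>' (lmap F2 z) (lmap F2 z)"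
    proof (rule lform_rows[OF psd'])
      fix i assume "i \<in> snd ` set z"
      then consider j where "i = Inl j" "j \<in> carrier G" | j where "i = Inr j" "j \<in> carrier G" using zs xW by blast
      then show "F1 i \<in> W \<and> F2 i \<in> W \<and> kdist \<kappa>' (F1 i) (F2 i) = 0"
      proof cases
        case 1
        have m: "[l] @ \<omega> j \<in> W" by (rule WI(2)[OF WI(3)[OF l] \<omega>(1)[OF 1(2)]])
        have eq: "e ([l] @ \<omega> j) = h \<otimes> j"
          by (simp only: e_mult[OF WI(3)[OF l, unfolded W_def] \<omega>(1)[OF 1(2), unfolded W_def]] \<omega>(2)[OF 1(2)] h_def)
        have f: "F1 i = \<omega> (h \<otimes> j)" "F2 i = [l] @ \<omega> j" by (simp_all add: F1_def F2_def 1(1))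
        have hj: "h \<otimes> j \<in> carrier G" by (rule m_closed[OF h 1(2)])
        have "kdist \<kappa>' (\<omega> (h \<otimes> j)) ([l] @ \<omega> j) = 0"
          by (rule kd_eq[OF \<omega>(1)[OF hj] m]) (simp only: \<omega>(2)[OF hj] eq)
        then show ?thesis unfolding f using \<omega>(1)[OF hj] m by blast
      next
        case 2
        have f: "F1 i = \<omega> j" "F2 i = \<omega> j" by (simp_all add: F1_def F2_def 2(1))
        show ?thesis unfolding f using \<omega>(1)[OF 2(2)] by (simp add: kdist_def)
      qed
    qed
    also have "\<dots> = lform \<kappa>' (ldiff (lact [l] ys) ys) (ldiff (lact [l] ys) ys)"
      by (intro lform_lsum_cong) (simp_all add: z_def F2_def ys_def)
    finally show ?thesis using le by simp
  qed
  have y2: "lform \<kappa>' (ldiff ys [(1, [])]) (ldiff ys [(1, [])]) \<le> C"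
  proof -
    note le = xclose
    define z :: "(real \<times> ('a + 'a)) list" where "z = ldiff (lmap Inl x) [(1, Inr \<one>)]"
    define F1 where "F1 = case_sum \<omega> \<omega>"
    define F2 :: "'a + 'a \<Rightarrow> nat list" where "F2 = case_sum \<omega> (\<lambda>_. [])"
    have zs: "snd ` set z = Inl ` snd ` set x \<union> {Inr \<one>}" by (simp add: z_def)
    have "lform KG (ldiff x [(1, \<one>)]) (ldiff x [(1, \<one>)]) = lform \<kappa>' (lmap F1 z) (lmap F1 z)"
      by (simp only: lform_def KG_eq z_def F1_def lsum_ldiff lsum_lmap lsum_single sum.case)
    also have "\<dots> = lform \<kappa>' (lmap F2 z) (lmap F2 z)"
    proof (rule lform_rows[OF psd'])
      fix i assume "i \<in> snd ` set z"
      then have i: "i \<in> Inl ` snd ` set x \<or> i = Inr \<one>" by (simp only: zs Un_iff singleton_iff)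
      show "F1 i \<in> W \<and> F2 i \<in> W \<and> kdist \<kappa>' (F1 i) (F2 i) = 0"
      proof (cases i)
        case (Inl j)
        have "j \<in> snd ` set x" using i unfolding Inl by (simp only: inj_image_mem_iff[OF inj_Inl] sum.distinct simp_thms)
        then have j: "j \<in> carrier G" by (rule xW)
        have f: "F1 i = \<omega> j" "F2 i = \<omega> j" by (simp_all add: F1_def F2_def Inl)
        show ?thesis unfolding f using \<omega>(1)[OF j] by (simp add: kdist_def)
      next
        case (Inr j)
        have "j = \<one>" using i unfolding Inr by auto
        then have f: "F1 i = \<omega> \<one>" "F2 i = []" by (simp_all add: F1_def F2_def Inr)
        have "kdist \<kappa>' (\<omega> \<one>) [] = 0"
          by (rule kd_eq[OF \<omega>(1)[OF one_closed] WI(1)]) (simp only: \<omega>(2)[OF one_closed] e_Nil)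
        then show ?thesis unfolding f using \<omega>(1)[OF one_closed] WI(1) by blast
      qed
    qed
    also have "\<dots> = lform \<kappa>' (ldiff ys [(1, [])]) (ldiff ys [(1, [])])"
      by (intro lform_lsum_cong) (simp_all add: z_def F2_def ys_def)
    finally show ?thesis using le by simp
  qed
  have sy: "snd ` set (ldiff (lact [l] ys) ys) \<subseteq> W" if "l < k" for l
    unfolding W_def by (rule word_kernel.set_displacement(1)[OF wkL[of 0], of "[l]" "[]" ys])
      (use that lconvD(1)[OF ys] in \<open>simp_all add: W_def\<close>)
  have sy2: "snd ` set (ldiff ys [(1, [])]) \<subseteq> W" using lconvD(1)[OF ys] WI(1) by auto
  have "\<forall>\<^sub>F n in sequentially. \<forall>l\<in>{..<k}. lform (\<kappa> (s n)) (ldiff (lact [l] ys) ys) (ldiff (lact [l] ys) ys) < 1 / (8 * (real k + 1))"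
    by (intro eventually_ball_finite ballI order_tendstoD(2)[OF lim_form[OF sy] y1]) auto
  moreover have "\<forall>\<^sub>F n in sequentially. lform (\<kappa> (s n)) (ldiff ys [(1, [])]) (ldiff ys [(1, [])]) < C + 1"
    by (rule order_tendstoD(2)[OF lim_form[OF sy2]]) (use y2 in linarith)
  \<comment> \<open>The limit has the fixed bound \<open>C\<close>, while the counterexamples were
    chosen against the growing constants \<open>s n\<close>; eventually these exceed
    \<open>C + 1\<close>.\<close>
  moreover have "\<forall>\<^sub>F n in sequentially. C + 1 \<le> real (s n)"
    using filterlim_compose[OF filterlim_real_sequentially filterlim_subseq[OF s]]
    unfolding filterlim_at_top by blast
  ultimately have "\<forall>\<^sub>F n in sequentially. False"
  proof eventually_elim
    case (elim n)
    have "dirichlet k (L (s n)) (lconvolve ys (v (s n))) = D (s n) * (\<Sum>l<k. lform (\<kappa> (s n)) (ldiff (lact [l] ys) ys) (ldiff (lact [l] ys) ys))"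
      unfolding dir_conv[OF ys] \<kappa>_form by (simp only: sum_distrib_left)
    also have "(\<Sum>l<k. lform (\<kappa> (s n)) (ldiff (lact [l] ys) ys) (ldiff (lact [l] ys) ys)) \<le> (\<Sum>l<k. 1 / (8 * (real k + 1)))"
      using elim(1) by (intro sum_mono) (auto intro: less_imp_le)
    also have "(\<Sum>l<k. 1 / (8 * (real k + 1))) \<le> 1/4" by (simp add: field_simps)
    finally have 1: "dirichlet k (L (s n)) (lconvolve ys (v (s n))) \<le> 1/4 * D (s n)"
      using Dpos[of "s n"] by (simp add: mult_left_mono)
    have "lform (L (s n)) (ldiff (lconvolve ys (v (s n))) (v (s n))) (ldiff (lconvolve ys (v (s n))) (v (s n))) =
        D (s n) * lform (\<kappa> (s n)) (ldiff ys [(1, [])]) (ldiff ys [(1, [])])"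
      unfolding lform_lconvolve_ldiff[OF lconvD(3)[OF ys]] \<kappa>_form ..
    also have "\<dots> \<le> D (s n) * real (s n)" using elim(2,3) Dpos[of "s n"] by (intro mult_left_mono) auto
    finally show False using bad[OF ys, of "s n"] 1 by (simp add: mult.commute)
  qed
  then show False by simp
qed

text \<open>The contraction is iterated from the unit mass at \<open>[]\<close>. The Dirichlet form
  drops by a factor of 4 each time, so the \<open>n\<close>-th step has length at most
  \<open>sqrt (R * D0) * (1/2)^n\<close>. The lengths add up to at most
  \<open>2 * sqrt (R * D0)\<close>, whose square is the last bound.\<close>

lemma (in word_kernel) contraction_sequence:
  assumes R: "R \<ge> 0" and step: "\<And>v. lconv words v \<Longrightarrow> \<exists>ys. lconv words ys \<and>
      dirichlet k K (lconvolve ys v) \<le> 1/4 * dirichlet k K v \<and>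
      lform K (ldiff (lconvolve ys v) v) (ldiff (lconvolve ys v) v) \<le> R * dirichlet k K v"
  defines "D0 \<equiv> \<Sum>l<k. kdist K [l] []"
  shows "\<exists>xs :: nat \<Rightarrow> (real \<times> nat list) list. \<forall>n. lconv words (xs n) \<and>
    lform K (ldiff (xs (Suc n)) (xs n)) (ldiff (xs (Suc n)) (xs n)) \<le> R * D0 * (1/4)^n \<and>
    (\<forall>u\<in>words. lform K (ldiff (lact u (xs n)) (xs n)) (ldiff (lact u (xs n)) (xs n)) \<le> (real (length u))\<^sup>2 * D0 * (1/4)^n) \<and>
    lform K (ldiff (xs n) [(1, [])]) (ldiff (xs n) [(1, [])]) \<le> 4 * R * D0"
proof -
  define P where "P v ys \<longleftrightarrow> lconv words ys \<and> dirichlet k K (lconvolve ys v) \<le> 1/4 * dirichlet k K v \<and>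
      lform K (ldiff (lconvolve ys v) v) (ldiff (lconvolve ys v) v) \<le> R * dirichlet k K v" for v ys
  have "\<forall>v. \<exists>ys. lconv words v \<longrightarrow> P v ys" using step unfolding P_def by blast
  then obtain y where y: "\<forall>v. lconv words v \<longrightarrow> P v (y v)" using choice[of "\<lambda>v ys. lconv words v \<longrightarrow> P v ys"] by blast
  define xs where "xs = rec_nat [(1, [])] (\<lambda>_ v. lconvolve (y v) v)"
  have xs0: "xs 0 = [(1, [])]" and xsS: "xs (Suc n) = lconvolve (y (xs n)) (xs n)" for n by (simp_all add: xs_def)
  have cv: "lconv words (xs n)" for n
  proof (induction n)
    case 0
    show ?case unfolding xs0 by (rule lconv_single) simp
  next
    case (Suc n)
    show ?case unfolding xsS by (rule lconv_lconvolve[OF _ Suc]) (use y Suc in \<open>simp add: P_def\<close>)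
  qed
  have sx: "snd ` set (xs n) \<subseteq> words" for n by (rule lconvD(1)[OF cv])
  have Pn: "P (xs n) (y (xs n))" for n using y cv by blast
  have dir: "dirichlet k K (xs n) \<le> D0 * (1/4)^n" for n
  proof (induction n)
    case 0
    have "dirichlet k K (xs 0) = (\<Sum>l<k. lform K (ldiff [(1, [l])] [(1, [])]) (ldiff [(1, [l])] [(1, [])]))"
      unfolding dirichlet_def xs0 by (simp only: lmap_def list.map prod.case append_Nil2)
    also have "\<dots> = D0" unfolding D0_def by (intro sum.cong refl kdist_lnorm[OF psd]) auto
    finally show ?case by simp
  next
    case (Suc n)
    then show ?case using Pn[of n] unfolding xsS P_def by simp
  qed
  have D0: "D0 \<ge> 0" using dir[of 0] dirichlet_nonneg[OF sx, of 0] by simp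
  have st: "lform K (ldiff (xs (Suc n)) (xs n)) (ldiff (xs (Suc n)) (xs n)) \<le> R * D0 * (1/4)^n" for n
  proof -
    have "lform K (ldiff (xs (Suc n)) (xs n)) (ldiff (xs (Suc n)) (xs n)) \<le> R * dirichlet k K (xs n)"
      using Pn[of n] unfolding xsS P_def by blast
    also have "\<dots> \<le> R * (D0 * (1/4)^n)" by (rule mult_left_mono[OF dir R])
    finally show ?thesis by (simp add: mult.assoc)
  qed
  have tr: "lform K (ldiff (lact u (xs n)) (xs n)) (ldiff (lact u (xs n)) (xs n)) \<le> (real (length u))\<^sup>2 * D0 * (1/4)^n"
    if "u \<in> words" for u n
  proof -
    have "(real (length u))\<^sup>2 * dirichlet k K (xs n) \<le> (real (length u))\<^sup>2 * (D0 * (1/4)^n)"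
      by (rule mult_left_mono[OF dir]) simp
    then show ?thesis using lform_displacement_le[OF sx that, of n] by (simp add: mult.assoc)
  qed
  define d where "d = sqrt (R * D0)"
  have near: "lnorm K (ldiff (xs n) (xs 0)) \<le> d * (2 - 2 * (1/2)^n)" for n
  proof (induction n)
    case 0
    have "lform K (ldiff (xs 0) (xs 0)) (ldiff (xs 0) (xs 0)) = lform K [] []" by (intro lform_lsum_cong) simp_all
    then show ?case by (simp add: lnorm_def lform_def)
  next
    case (Suc n)
    have "sqrt ((1/4)^n) = (1/2::real)^n" by (simp add: real_sqrt_power real_sqrt_divide)
    then have "lnorm K (ldiff (xs (Suc n)) (xs n)) \<le> d * (1/2)^n"
      using real_sqrt_le_mono[OF st[of n]] by (simp add: lnorm_def d_def real_sqrt_mult)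
    moreover have "lnorm K (ldiff (xs (Suc n)) (xs 0)) \<le> lnorm K (ldiff (xs (Suc n)) (xs n)) + lnorm K (ldiff (xs n) (xs 0))"
      by (rule lnorm_triangle[OF psd sx sx sx])
    ultimately show ?case using Suc by (simp add: algebra_simps)
  qed
  have cl: "lform K (ldiff (xs n) [(1, [])]) (ldiff (xs n) [(1, [])]) \<le> 4 * R * D0" for n
  proof -
    have S: "snd ` set (ldiff (xs n) (xs 0)) \<subseteq> words" using sx[of n] sx[of 0] by simp
    have d: "d \<ge> 0" "d\<^sup>2 = R * D0" using R D0 by (simp_all add: d_def)
    have "d * (2 - 2 * (1/2)^n) \<le> d * 2" by (intro mult_left_mono d) simp
    then have "lnorm K (ldiff (xs n) (xs 0)) \<le> d * 2" using near[of n] by linarith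
    then have "(lnorm K (ldiff (xs n) (xs 0)))\<^sup>2 \<le> (d * 2)\<^sup>2" by (rule power_mono[OF _ lnorm_nonneg[OF psd S]])
    then have "lform K (ldiff (xs n) (xs 0)) (ldiff (xs n) (xs 0)) \<le> (d * 2)\<^sup>2" by (simp only: lnorm_sq[OF psd S])
    also have "(d * 2)\<^sup>2 = 4 * R * D0" by (simp add: power_mult_distrib d(2))
    finally show ?thesis by (simp only: xs0)
  qed
  show ?thesis using cv st tr cl by blast
qed

section \<open>Marked groups and their actions through words\<close>

definition word_eval :: "('g, 'b) monoid_scheme \<Rightarrow> 'g list \<Rightarrow> nat list \<Rightarrow> 'g" where
  "word_eval G L w = foldr (\<lambda>l x. L ! l \<otimes>\<^bsub>G\<^esub> x) w \<one>\<^bsub>G\<^esub>"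

definition word_inverse :: "nat list \<Rightarrow> nat list \<Rightarrow> nat list" where
  "word_inverse \<tau> w = rev (map (\<lambda>l. \<tau> ! l) w)"

text \<open>\<open>L\<close> lists a symmetric generating set, and \<open>\<tau> ! l\<close> is the position of the inverse of \<open>L ! l\<close>.\<close>

definition marking :: "('g, 'b) monoid_scheme \<Rightarrow> 'g list \<Rightarrow> nat list \<Rightarrow> bool" where
  "marking G L \<tau> \<longleftrightarrow> set L \<subseteq> carrier G \<and> L \<noteq> [] \<and> length \<tau> = length L \<and>
    (\<forall>l<length L. \<tau> ! l < length L \<and> L ! (\<tau> ! l) = inv\<^bsub>G\<^esub> (L ! l)) \<and>
    word_eval G L ` lists {..<length L} = carrier G"

lemma word_eval_closed:
  assumes "group G" "set L \<subseteq> carrier G" "w \<in> lists {..<length L}"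
  shows "word_eval G L w \<in> carrier G"
proof -
  interpret group G by (rule assms(1))
  have "w \<in> lists {..<length L} \<Longrightarrow> ?thesis"
  proof (induction w)
    case (Cons l w)
    then have "L ! l \<in> carrier G" using assms(2) nth_mem[of l L] by auto
    then show ?case using Cons by (simp add: word_eval_def)
  qed (simp add: word_eval_def)
  then show ?thesis using assms(3) by blast
qed

lemma word_eval_append:
  assumes "group G" "set L \<subseteq> carrier G" "u \<in> lists {..<length L}" "w \<in> lists {..<length L}"
  shows "word_eval G L (u @ w) = word_eval G L u \<otimes>\<^bsub>G\<^esub> word_eval G L w"
proof -
  interpret group G by (rule assms(1))
  have w: "word_eval G L w \<in> carrier G" by (rule word_eval_closed[OF assms(1,2,4)])
  have "u \<in> lists {..<length L} \<Longrightarrow> ?thesis"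
  proof (induction u)
    case Nil
    then show ?case using w by (simp add: word_eval_def)
  next
    case (Cons l u)
    then have l: "L ! l \<in> carrier G" and u: "u \<in> lists {..<length L}" using assms(2) nth_mem[of l L] by auto
    have "word_eval G L ((l # u) @ w) = L ! l \<otimes>\<^bsub>G\<^esub> word_eval G L (u @ w)" by (simp add: word_eval_def)
    also have "\<dots> = L ! l \<otimes>\<^bsub>G\<^esub> word_eval G L u \<otimes>\<^bsub>G\<^esub> word_eval G L w"
      using Cons.IH[OF u] l w word_eval_closed[OF assms(1,2) u] by (simp add: m_assoc)
    finally show ?case by (simp add: word_eval_def)
  qed
  then show ?thesis using assms(3) by blast
qed

lemma word_eval_Nil: "word_eval G L [] = \<one>\<^bsub>G\<^esub>"
  by (simp add: word_eval_def)

lemma word_eval_single: "group G \<Longrightarrow> set L \<subseteq> carrier G \<Longrightarrow> l < length L \<Longrightarrow> word_eval G L [l] = L ! l"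
  using nth_mem[of l L] by (simp add: word_eval_def group.is_monoid monoid.r_one subset_iff)

lemma word_inverse_words:
  assumes "marking G L \<tau>" "w \<in> lists {..<length L}"
  shows "word_inverse \<tau> w \<in> lists {..<length L}"
  using assms unfolding marking_def word_inverse_def by auto

lemma word_eval_inverse:
  assumes G: "group G" and mk: "marking G L \<tau>" and w: "w \<in> lists {..<length L}"
  shows "word_eval G L (word_inverse \<tau> w) = inv\<^bsub>G\<^esub> word_eval G L w"
proof -
  interpret group G by (rule G)
  have L: "set L \<subseteq> carrier G" using mk by (simp add: marking_def)
  have "w \<in> lists {..<length L} \<Longrightarrow> ?thesis"
  proof (induction w)
    case (Cons l w)
    then have l: "l < length L" "\<tau> ! l < length L" "L ! (\<tau> ! l) = inv\<^bsub>G\<^esub> (L ! l)" and w: "w \<in> lists {..<length L}"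
      using mk by (auto simp: marking_def)
    have lG: "L ! l \<in> carrier G" using L nth_mem[OF l(1)] by blast
    have "word_eval G L (word_inverse \<tau> (l # w)) = word_eval G L (word_inverse \<tau> w @ [\<tau> ! l])"
      by (simp add: word_inverse_def)
    also have "\<dots> = word_eval G L (word_inverse \<tau> w) \<otimes>\<^bsub>G\<^esub> word_eval G L [\<tau> ! l]"
      by (rule word_eval_append[OF G L word_inverse_words[OF mk w]]) (use l in simp)
    also have "\<dots> = inv\<^bsub>G\<^esub> word_eval G L w \<otimes>\<^bsub>G\<^esub> inv\<^bsub>G\<^esub> (L ! l)"
      using Cons.IH[OF w] l(3) by (simp add: word_eval_single[OF G L l(2)])
    also have "\<dots> = inv\<^bsub>G\<^esub> (L ! l \<otimes>\<^bsub>G\<^esub> word_eval G L w)"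
      using lG word_eval_closed[OF G L w] by (simp add: inv_mult_group)
    also have "L ! l \<otimes>\<^bsub>G\<^esub> word_eval G L w = word_eval G L (l # w)" by (simp add: word_eval_def)
    finally show ?case .
  qed (simp add: word_eval_def word_inverse_def)
  then show ?thesis using w by blast
qed

lemma property_T_marking:
  assumes T: "property_T G"
  shows "\<exists>L \<tau>. marking G L \<tau>"
proof -
  have G: "group G" using T by (simp add: property_T_def relative_T_def)
  interpret group G by (rule G)
  obtain F where F: "finite F" "F \<subseteq> carrier G" "generate G F = carrier G"
    using property_T_finitely_generated[OF T] by blast
  \<comment> \<open>Inverses make the generating set symmetric, so that inverses of words are words;
    the unit makes the list nonempty.\<close>
  define X where "X = insert \<one>\<^bsub>G\<^esub> (F \<union> (\<lambda>x. inv\<^bsub>G\<^esub> x) ` F)"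
  have "finite X" using F(1) by (simp add: X_def)
  then obtain L where LX: "set L = X" using finite_list by blast
  have L: "set L \<subseteq> carrier G" unfolding LX X_def using F(2) by auto
  have idx: "\<exists>l<length L. L ! l = x" if "x \<in> X" for x using that unfolding LX[symmetric] in_set_conv_nth by blast
  have inv_X: "inv\<^bsub>G\<^esub> x \<in> X" if x: "x \<in> X" for x
  proof -
    consider "x = \<one>\<^bsub>G\<^esub>" | "x \<in> F" | y where "y \<in> F" "x = inv\<^bsub>G\<^esub> y" using x unfolding X_def by blast
    then show ?thesis
    proof cases
      case 3
      then show ?thesis using F(2) by (auto simp: X_def)
    qed (simp_all add: X_def)
  qed
  define t where "t l = (SOME j. j < length L \<and> L ! j = inv\<^bsub>G\<^esub> (L ! l))" for l
  have t: "t l < length L \<and> L ! t l = inv\<^bsub>G\<^esub> (L ! l)" if "l < length L" for l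
    unfolding t_def by (rule someI_ex) (use idx[OF inv_X] nth_mem[OF that] in \<open>auto simp: LX\<close>)
  have gen: "c \<in> word_eval G L ` lists {..<length L}" if "c \<in> generate G F" for c
    using that
  proof induction
    case one
    have "word_eval G L [] = \<one>\<^bsub>G\<^esub>" by (rule word_eval_Nil)
    then show ?case by (intro image_eqI[of _ _ "[]"]) auto
  next
    case (incl h)
    then have "h \<in> X" by (simp add: X_def)
    then obtain l where l: "l < length L" "L ! l = h" using idx by blast
    then show ?case using word_eval_single[OF G L l(1)] by (intro image_eqI[of _ _ "[l]"]) auto
  next
    case (inv h)
    then have "inv\<^bsub>G\<^esub> h \<in> X" by (simp add: X_def)
    then obtain l where l: "l < length L" "L ! l = inv\<^bsub>G\<^esub> h" using idx by blast
    then show ?case using word_eval_single[OF G L l(1)] by (intro image_eqI[of _ _ "[l]"]) auto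
  next
    case (eng h1 h2)
    then obtain u w where uw: "u \<in> lists {..<length L}" "w \<in> lists {..<length L}" "h1 = word_eval G L u" "h2 = word_eval G L w"
      by blast
    have "u @ w \<in> lists {..<length L}" using uw(1,2) by simp
    then show ?case using word_eval_append[OF G L uw(1,2)] uw(3,4) by (intro image_eqI[of _ _ "u @ w"]) simp_all
  qed
  have "marking G L (map t [0..<length L])"
    unfolding marking_def
  proof (intro conjI)
    show "L \<noteq> []" using LX by (auto simp: X_def)
    show "word_eval G L ` lists {..<length L} = carrier G"
      using gen F(3) word_eval_closed[OF G L] by blast
    show "\<forall>l<length L. map t [0..<length L] ! l < length L \<and> L ! (map t [0..<length L] ! l) = inv\<^bsub>G\<^esub> (L ! l)"
      using t by simp
  qed (simp_all add: L)
  then show ?thesis by blast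
qed

text \<open>Property (T) comes without a countability assumption here; finite generation supplies
  it.\<close>

lemma countable_carrier_property_T:
  assumes T: "property_T G"
  shows "countable (carrier G)"
proof -
  obtain L \<tau> where "marking G L \<tau>" using property_T_marking[OF T] by blast
  then have "carrier G = word_eval G L ` lists {..<length L}" by (simp add: marking_def)
  then show ?thesis by simp
qed

definition marked_subgroup :: "'a measure \<Rightarrow> ('a \<times> 'a) set \<Rightarrow> 'a set \<times> ('a \<Rightarrow> 'a) set \<Rightarrow> ('a \<Rightarrow> 'a) set list \<Rightarrow> nat list \<Rightarrow>
    'a set \<Rightarrow> (('a \<Rightarrow> 'a) set \<Rightarrow> 'a \<Rightarrow> 'a) \<Rightarrow> bool" where
  "marked_subgroup M R p L \<tau> Z a \<longleftrightarrow> pseudo_subgroup M R (fst p) (snd p) \<and> group (class_group M (fst p) (snd p)) \<and>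
    ergodic_on M (fst p) (snd p) \<and>
    marking (class_group M (fst p) (snd p)) L \<tau> \<and> rel_action M R (fst p) (snd p) Z a"

lemma T_subgroups_marked:
  assumes R: "II1_rel M R" and p: "p \<in> T_subgroups M R"
  shows "\<exists>L \<tau> Z a. marked_subgroup M R p L \<tau> Z a"
proof -
  have p': "pseudo_subgroup M R (fst p) (snd p)" "property_T (class_group M (fst p) (snd p))" "ergodic_on M (fst p) (snd p)"
    using p by (auto simp: T_subgroups_def)
  have G: "group (class_group M (fst p) (snd p))" using p'(2) by (simp add: property_T_def relative_T_def)
  show ?thesis
    using property_T_marking[OF p'(2)] pseudo_subgroup_action[OF R p'(1) G countable_carrier_property_T[OF p'(2)]] p' G
    unfolding marked_subgroup_def by blast
qed

definition word_action :: "'a measure \<Rightarrow> 'a set \<times> ('a \<Rightarrow> 'a) set \<Rightarrow> ('a \<Rightarrow> 'a) set list \<Rightarrow> (('a \<Rightarrow> 'a) set \<Rightarrow> 'a \<Rightarrow> 'a) \<Rightarrow>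
    nat list \<Rightarrow> 'a \<Rightarrow> 'a" where
  "word_action M p L a w = a (word_eval (class_group M (fst p) (snd p)) L w)"

text \<open>Pulling the action back to words replaces groups that vary with the subgroup by one
  index set, which depends only on the number of letters; formal inversion depends only on the table
  \<open>\<tau>\<close>.\<close>

lemma word_action:
  assumes mk: "marked_subgroup M R p L \<tau> Z a"
  shows "w \<in> lists {..<length L} \<Longrightarrow> word_action M p L a w \<in> M \<rightarrow>\<^sub>M M"
    and "w \<in> lists {..<length L} \<Longrightarrow> x \<in> space M \<Longrightarrow> (x, word_action M p L a w x) \<in> R"
    and "w \<in> lists {..<length L} \<Longrightarrow> x \<in> Z \<Longrightarrow> word_action M p L a w x \<in> Z"
    and "w \<in> lists {..<length L} \<Longrightarrow> A \<in> sets M \<Longrightarrow> emeasure M (word_action M p L a w -` A \<inter> space M) = emeasure M A"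
    and "u \<in> lists {..<length L} \<Longrightarrow> w \<in> lists {..<length L} \<Longrightarrow> x \<in> space M \<Longrightarrow>
      word_action M p L a (u @ w) x = word_action M p L a u (word_action M p L a w x)"
    and "x \<in> space M \<Longrightarrow> word_action M p L a [] x = x"
    and "w \<in> lists {..<length L} \<Longrightarrow> x \<in> space M \<Longrightarrow> word_action M p L a (word_inverse \<tau> w) (word_action M p L a w x) = x"
    and "w \<in> lists {..<length L} \<Longrightarrow> x \<in> space M \<Longrightarrow> word_action M p L a w (word_action M p L a (word_inverse \<tau> w) x) = x"
    and "w \<in> lists {..<length L} \<Longrightarrow> f \<in> snd p \<Longrightarrow> ae_class M (fst p) f = word_eval (class_group M (fst p) (snd p)) L w \<Longrightarrow>
      AE x in M. x \<in> fst p \<longrightarrow> f x = word_action M p L a w x"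
proof -
  define G where "G = class_group M (fst p) (snd p)"
  have G: "group G" and mkg: "marking G L \<tau>" and act: "rel_action M R (fst p) (snd p) Z a"
    using mk by (auto simp: marked_subgroup_def G_def)
  interpret group G by (rule G)
  have L: "set L \<subseteq> carrier G" using mkg by (simp add: marking_def)
  have cl: "word_eval G L w \<in> carrier G" if "w \<in> lists {..<length L}" for w by (rule word_eval_closed[OF G L that])
  have ac: "a c \<in> M \<rightarrow>\<^sub>M M" "a c \<in> c" "\<And>x. x \<in> space M \<Longrightarrow> (x, a c x) \<in> R" "\<And>x. x \<in> Z \<Longrightarrow> a c x \<in> Z"
    "\<And>A. A \<in> sets M \<Longrightarrow> emeasure M (a c -` A \<inter> space M) = emeasure M A" if "c \<in> carrier G" for c
    using act that unfolding rel_action_def G_def by blast+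
  have am: "a (c \<otimes>\<^bsub>G\<^esub> d) x = a c (a d x)" if "c \<in> carrier G" "d \<in> carrier G" "x \<in> space M" for c d x
    using act that unfolding rel_action_def G_def by blast
  have a1: "a \<one>\<^bsub>G\<^esub> x = x" if "x \<in> space M" for x using act that unfolding rel_action_def G_def by blast
  note wa = word_action_def[of M p L a, folded G_def]
  show "w \<in> lists {..<length L} \<Longrightarrow> word_action M p L a w \<in> M \<rightarrow>\<^sub>M M" unfolding wa by (rule ac(1)[OF cl])
  show "w \<in> lists {..<length L} \<Longrightarrow> x \<in> space M \<Longrightarrow> (x, word_action M p L a w x) \<in> R" unfolding wa by (rule ac(3)[OF cl])
  show "w \<in> lists {..<length L} \<Longrightarrow> x \<in> Z \<Longrightarrow> word_action M p L a w x \<in> Z" unfolding wa by (rule ac(4)[OF cl])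
  show "w \<in> lists {..<length L} \<Longrightarrow> A \<in> sets M \<Longrightarrow> emeasure M (word_action M p L a w -` A \<inter> space M) = emeasure M A"
    unfolding wa by (rule ac(5)[OF cl])
  show "word_action M p L a (u @ w) x = word_action M p L a u (word_action M p L a w x)"
    if "u \<in> lists {..<length L}" "w \<in> lists {..<length L}" "x \<in> space M"
    unfolding wa word_eval_append[OF G L that(1,2)] by (rule am[OF cl[OF that(1)] cl[OF that(2)] that(3)])
  show "x \<in> space M \<Longrightarrow> word_action M p L a [] x = x" unfolding wa word_eval_Nil by (rule a1)
  show "word_action M p L a (word_inverse \<tau> w) (word_action M p L a w x) = x"
    if "w \<in> lists {..<length L}" "x \<in> space M"
    unfolding wa word_eval_inverse[OF G mkg that(1)]
    using am[of "inv\<^bsub>G\<^esub> word_eval G L w" "word_eval G L w" x] cl[OF that(1)] a1 that(2) by simp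
  show "word_action M p L a w (word_action M p L a (word_inverse \<tau> w) x) = x"
    if "w \<in> lists {..<length L}" "x \<in> space M"
    unfolding wa word_eval_inverse[OF G mkg that(1)]
    using am[of "word_eval G L w" "inv\<^bsub>G\<^esub> word_eval G L w" x] cl[OF that(1)] a1 that(2) by simp
  show "AE x in M. x \<in> fst p \<longrightarrow> f x = word_action M p L a w x"
    if "w \<in> lists {..<length L}" "f \<in> snd p" "ae_class M (fst p) f = word_eval (class_group M (fst p) (snd p)) L w"
  proof (rule ergodic_measure_relation[of "word_eval G L w" M "fst p" "snd p"])
    show "word_eval G L w \<in> carrier (class_group M (fst p) (snd p))" using cl[OF that(1)] by (simp add: G_def)
    show "f \<in> word_eval G L w" using that(3) ae_class_self[of f M "fst p"] by (simp add: G_def)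
    show "word_action M p L a w \<in> word_eval G L w" unfolding wa by (rule ac(2)[OF cl[OF that(1)]])
  qed
qed

lemma marked_subgroup_words:
  assumes mk: "marked_subgroup M R p L \<tau> Z a"
  shows "f \<in> snd p \<Longrightarrow> \<exists>w\<in>lists {..<length L}. ae_class M (fst p) f = word_eval (class_group M (fst p) (snd p)) L w"
    and "w \<in> lists {..<length L} \<Longrightarrow> \<exists>f\<in>snd p. ae_class M (fst p) f = word_eval (class_group M (fst p) (snd p)) L w"
proof -
  have e: "word_eval (class_group M (fst p) (snd p)) L ` lists {..<length L} = ae_class M (fst p) ` snd p"
    using mk by (simp add: marked_subgroup_def marking_def class_group_def)
  show "f \<in> snd p \<Longrightarrow> \<exists>w\<in>lists {..<length L}. ae_class M (fst p) f = word_eval (class_group M (fst p) (snd p)) L w"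
    using e by blast
  show "w \<in> lists {..<length L} \<Longrightarrow> \<exists>f\<in>snd p. ae_class M (fst p) f = word_eval (class_group M (fst p) (snd p)) L w"
    using e by (metis image_iff)
qed

lemma marked_subgroup_support:
  assumes "marked_subgroup M R p L \<tau> Z a"
  shows "fst p \<in> sets M" "Z \<in> sets M" "Z \<subseteq> fst p" "emeasure M (fst p - Z) = 0"
    "AE x in M. x \<in> fst p \<longrightarrow> x \<in> Z"
proof -
  show *: "fst p \<in> sets M" "Z \<in> sets M" "Z \<subseteq> fst p" "emeasure M (fst p - Z) = 0"
    using assms by (auto simp: marked_subgroup_def rel_action_def pseudo_subgroup_def)
  have "AE x in M. x \<notin> fst p - Z" using * by (intro AE_not_in) auto
  then show "AE x in M. x \<in> fst p \<longrightarrow> x \<in> Z" by eventually_elim blast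
qed

lemma word_action_ergodic:
  assumes mk: "marked_subgroup M R p L \<tau> Z a" and A: "A \<in> sets M" "A \<subseteq> Z"
    and inv: "\<And>w. w \<in> lists {..<length L} \<Longrightarrow> AE x in M. x \<in> Z \<longrightarrow> (word_action M p L a w x \<in> A \<longleftrightarrow> x \<in> A)"
  shows "emeasure M A = 0 \<or> emeasure M (Z - A) = 0"
proof -
  note Z = marked_subgroup_support[OF mk]
  have "AE x in M. x \<in> fst p \<longrightarrow> (f x \<in> A \<longleftrightarrow> x \<in> A)" if f: "f \<in> snd p" for f
  proof -
    obtain w where w: "w \<in> lists {..<length L}" "ae_class M (fst p) f = word_eval (class_group M (fst p) (snd p)) L w"
      using marked_subgroup_words(1)[OF mk f] by blast
    show ?thesis using word_action(9)[OF mk w(1) f w(2)] inv[OF w(1)] Z(5) by eventually_elim simp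
  qed
  moreover have "ergodic_on M (fst p) (snd p)" using mk by (simp add: marked_subgroup_def)
  ultimately have "emeasure M A = 0 \<or> emeasure M (fst p - A) = 0"
    using A Z(3) unfolding ergodic_on_def by blast
  moreover have "emeasure M (Z - A) \<le> emeasure M (fst p - A)"
    using Z A by (intro emeasure_mono) auto
  ultimately show ?thesis by auto
qed

text \<open>With the same number of letters and the same table \<open>\<tau>\<close>, one formal
  inverse of words serves both actions, although the two groups may satisfy different
  relations.\<close>

lemma paired_word_actions:
  assumes prob: "prob_space M" and Q: "separating M Q" and p: "marked_subgroup M R p L \<tau> Z a"
    and q: "marked_subgroup M R q L' \<tau> Z' a'" and len: "length L' = length L"
  shows "paired_actions M Q (lists {..<length L}) (@) [] (word_inverse \<tau>) (word_action M p L a) (word_action M q L' a') Z Z'"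
proof -
  interpret prob_space M by (rule prob)
  have mkp: "marking (class_group M (fst p) (snd p)) L \<tau>" using p by (simp add: marked_subgroup_def)
  note A = word_action[OF p] and B = word_action[OF q, unfolded len]
  note Z = marked_subgroup_support(2)[OF p] marked_subgroup_support(2)[OF q]
  have c: "countable (lists {..<length L})" by simp
  have n: "[] \<in> lists {..<length L}" by simp
  have ap: "u \<in> lists {..<length L} \<Longrightarrow> w \<in> lists {..<length L} \<Longrightarrow> u @ w \<in> lists {..<length L}" for u w by simp
  have fin: "emeasure M X < \<infinity>" for X by (simp add: less_top[symmetric])
  show ?thesis
    by (rule paired_actions.intro)
      (fact Q c n ap word_inverse_words[OF mkp] A(1) B(1) A(5) B(5) A(6) B(6) A(7) A(8) B(7) B(8) A(4) B(4)
        Z fin A(3) B(3))+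
qed

text \<open>On a null support all functions agree almost everywhere, so every class is the set of
  all functions and both sides of the conjugacy equation collapse to the same single class.\<close>

lemma pseudo_conjugate_null:
  assumes p: "marked_subgroup M R p L \<tau> Z a" and q: "marked_subgroup M R q L' \<tau>' Z' a'"
    and 0: "emeasure M Z = 0" "emeasure M Z' = 0"
  shows "pseudo_conjugate M R p q"
proof -
  have null: "emeasure M (fst p) = 0" "AE x in M. x \<notin> fst p" if "marked_subgroup M R p L \<tau> Z a" "emeasure M Z = 0" for p L \<tau> Z a
  proof -
    note Z = marked_subgroup_support[OF that(1)]
    have "emeasure M (fst p) \<le> emeasure M Z + emeasure M (fst p - Z)"
      using Z emeasure_subadditive[of Z M "fst p - Z"] by (simp add: Un_absorb1)
    then show "emeasure M (fst p) = 0" using Z(4) that(2) by simp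
    then show "AE x in M. x \<notin> fst p" using Z(1) by (intro AE_not_in) auto
  qed
  note np = null[OF p 0(1)] and nq = null[OF q 0(2)]
  have cls: "ae_class M (fst p) f = UNIV" for f
  proof -
    have "AE x in M. x \<in> fst p \<longrightarrow> g x = f x" for g using np(2) by eventually_elim simp
    then show ?thesis by (simp add: ae_class_def)
  qed
  have "snd p \<noteq> {}" "snd q \<noteq> {}" using p q by (auto simp: marked_subgroup_def pseudo_subgroup_def)
  then have "{ae_class M (fst p) (id \<circ> f) | f. f \<in> snd p} = {ae_class M (fst p) (g \<circ> id) | g. g \<in> snd q}"
    unfolding cls by blast
  moreover have "in_pseudogroup M R (fst p) (fst q) id"
    unfolding in_pseudogroup_def
  proof (intro conjI)
    show "\<exists>D0 E0. D0 \<in> sets M \<and> E0 \<in> sets M \<and> D0 \<subseteq> fst p \<and> E0 \<subseteq> fst q \<and> emeasure M (fst p - D0) = 0 \<and>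
        emeasure M (fst q - E0) = 0 \<and> bij_betw id D0 E0 \<and> id \<in> restrict_space M D0 \<rightarrow>\<^sub>M M \<and>
        (\<forall>A\<in>sets M. A \<subseteq> D0 \<longrightarrow> id ` A \<in> sets M \<and> (emeasure M (id ` A) = 0) = (emeasure M A = 0))"
      using np(1) nq(1) by (intro exI[of _ "{}"]) (auto simp: measurable_def space_restrict_space)
    show "AE x in M. x \<in> fst p \<longrightarrow> (x, id x) \<in> R" using np(2) by eventually_elim simp
  qed (use marked_subgroup_support(1)[OF p] marked_subgroup_support(1)[OF q] in simp_all)
  ultimately show ?thesis unfolding pseudo_conjugate_def by blast
qed

text \<open>Every class of either group is named by a word, and \<open>eqv\<close> says that
  \<open>\<phi>\<close> intertwines the two actions of the same word; hence the two sets of classes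
  match. On each piece \<open>D' w\<close> the map is a composition of two maps with graph in
  \<open>R\<close>, so it belongs to the pseudogroup.\<close>

lemma pseudo_conjugateI:
  assumes R: "II1_rel M R" and p: "marked_subgroup M R p L \<tau> Z a" and q: "marked_subgroup M R q L' \<tau> Z' a'"
    and len: "length L' = length L"
    and D: "D \<in> sets M" "D \<subseteq> Z" "emeasure M (Z - D) = 0" "D = (\<Union>w\<in>lists {..<length L}. D' w)"
      "\<And>w. w \<in> lists {..<length L} \<Longrightarrow> D' w \<in> sets M"
    and \<phi>: "\<And>w x. w \<in> lists {..<length L} \<Longrightarrow> x \<in> D' w \<Longrightarrow>
        \<phi> x = word_action M q L' a' w (word_action M p L a (word_inverse \<tau> w) x)"
    and inj: "inj_on \<phi> D" and im: "\<phi> ` D \<subseteq> Z'" "emeasure M (Z' - \<phi> ` D) = 0"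
    and mp: "\<And>A. A \<in> sets M \<Longrightarrow> A \<subseteq> D \<Longrightarrow> \<phi> ` A \<in> sets M \<and> emeasure M (\<phi> ` A) = emeasure M A"
    and eqv: "\<And>w. w \<in> lists {..<length L} \<Longrightarrow>
        AE x in M. x \<in> Z \<longrightarrow> \<phi> (word_action M p L a w x) = word_action M q L' a' w (\<phi> x)"
  shows "pseudo_conjugate M R p q"
proof -
  note A = word_action[OF p] and B = word_action[OF q, unfolded len]
  note Z = marked_subgroup_support[OF p] and Z' = marked_subgroup_support[OF q]
  have mkp: "marking (class_group M (fst p) (snd p)) L \<tau>" using p by (simp add: marked_subgroup_def)
  note iv = word_inverse_words[OF mkp]
  have Dsp: "x \<in> space M" if "x \<in> D" for x using that sets.sets_into_space[OF D(1)] by blast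
  have trR: "trans R" using R by (auto simp: II1_rel_def equiv_def)
  have \<phi>R: "(x, \<phi> x) \<in> R" if xD: "x \<in> D" for x
  proof -
    obtain w where w: "w \<in> lists {..<length L}" "x \<in> D' w" using xD unfolding D(4) by (rule UN_E)
    define y where "y = word_action M p L a (word_inverse \<tau> w) x"
    have "(x, y) \<in> R" unfolding y_def by (rule A(2)[OF iv[OF w(1)] Dsp[OF xD]])
    moreover have "y \<in> space M" unfolding y_def by (rule measurable_space[OF A(1)[OF iv[OF w(1)]] Dsp[OF xD]])
    then have "(y, \<phi> x) \<in> R" unfolding \<phi>[OF w] y_def[symmetric] by (rule B(2)[OF w(1)])
    ultimately show ?thesis by (rule transD[OF trR])
  qed
  have vim: "{x \<in> D. \<phi> x \<in> E} \<in> sets M" if E: "E \<in> sets M" for E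
  proof -
    define V where "V w = (\<lambda>x. word_action M q L' a' w (word_action M p L a (word_inverse \<tau> w) x)) -` E \<inter> space M" for w
    have VM: "D' w \<inter> V w \<in> sets M" if "w \<in> lists {..<length L}" for w
      unfolding V_def using measurable_sets[OF measurable_compose[OF A(1)[OF iv[OF that]] B(1)[OF that]] E] D(5)[OF that] by blast
    have "{x \<in> D. \<phi> x \<in> E} = (\<Union>w\<in>lists {..<length L}. D' w \<inter> V w)"
    proof (intro Set.set_eqI iffI)
      fix x assume x: "x \<in> {x \<in> D. \<phi> x \<in> E}"
      then obtain w where w: "w \<in> lists {..<length L}" "x \<in> D' w" using D(4) by blast
      have "x \<in> V w" using x \<phi>[OF w] Dsp by (simp add: V_def)
      then show "x \<in> (\<Union>w\<in>lists {..<length L}. D' w \<inter> V w)" using w by blast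
    next
      fix x assume "x \<in> (\<Union>w\<in>lists {..<length L}. D' w \<inter> V w)"
      then obtain w where w: "w \<in> lists {..<length L}" "x \<in> D' w" "x \<in> V w" by blast
      have "\<phi> x \<in> E" using w(3) \<phi>[OF w(1,2)] by (simp add: V_def)
      then show "x \<in> {x \<in> D. \<phi> x \<in> E}" using w(1,2) D(4) by blast
    qed
    also have "\<dots> \<in> sets M" by (rule sets.countable_UN') (use VM in auto)
    finally show ?thesis .
  qed
  have \<phi>M: "\<phi> \<in> restrict_space M D \<rightarrow>\<^sub>M M"
  proof (rule measurableI)
    fix x assume "x \<in> space (restrict_space M D)"
    then have "\<phi> x \<in> Z'" using im(1) by (auto simp: space_restrict_space)
    then show "\<phi> x \<in> space M" using sets.sets_into_space[OF Z'(2)] by blast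
  next
    fix E assume E: "E \<in> sets M"
    have "\<phi> -` E \<inter> space (restrict_space M D) = {x \<in> D. \<phi> x \<in> E}" using Dsp by (auto simp: space_restrict_space)
    then show "\<phi> -` E \<inter> space (restrict_space M D) \<in> sets (restrict_space M D)"
      using vim[OF E] D(1) by (auto simp: sets_restrict_space_iff)
  qed
  have AE_D: "AE x in M. x \<in> fst p \<longrightarrow> x \<in> D"
  proof -
    have "AE x in M. x \<notin> Z - D" using D(1,3) Z(2) by (intro AE_not_in) auto
    then show ?thesis using Z(5) by eventually_elim blast
  qed
  \<comment> \<open>\<open>\<phi>\<close> preserves measure, so null sets pull back, and statements
    valid almost everywhere on the support of \<open>q\<close> may be read at
    \<open>\<phi> x\<close>.\<close>
  have AE_\<phi>: "AE x in M. x \<in> fst p \<longrightarrow> P (\<phi> x)" if AE_P: "AE y in M. y \<in> fst q \<longrightarrow> P y" for P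
  proof -
    obtain N where N: "{y \<in> space M. \<not> (y \<in> fst q \<longrightarrow> P y)} \<subseteq> N" "emeasure M N = 0" "N \<in> sets M"
      using AE_P by (rule AE_E)
    define E where "E = {x \<in> D. \<phi> x \<in> N}"
    have E: "E \<in> sets M" "E \<subseteq> D" unfolding E_def using vim[OF N(3)] by auto
    have "emeasure M E = emeasure M (\<phi> ` E)" using mp[OF E] by simp
    also have "\<dots> \<le> emeasure M N" by (rule emeasure_mono[OF _ N(3)]) (auto simp: E_def)
    finally have "emeasure M E = 0" using N(2) by simp
    then have "AE x in M. x \<notin> E" using E(1) by (intro AE_not_in) auto
    then show ?thesis using AE_D
    proof eventually_elim
      case (elim x)
      show ?case
      proof
        assume "x \<in> fst p"
        then have x: "x \<in> D" "\<phi> x \<notin> N" using elim by (auto simp: E_def)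
        then have "\<phi> x \<in> Z'" using im(1) by blast
        then have "\<phi> x \<in> fst q" "\<phi> x \<in> space M" using Z'(3) sets.sets_into_space[OF Z'(2)] by blast+
        then show "P (\<phi> x)" using x(2) N(1) by blast
      qed
    qed
  qed
  have "in_pseudogroup M R (fst p) (fst q) \<phi>"
    unfolding in_pseudogroup_def
  proof (intro conjI; (rule exI[of _ D], rule exI[of _ "\<phi> ` D"], intro conjI)?)
    show "fst p \<in> sets M" "fst q \<in> sets M" "D \<in> sets M" by (fact Z(1) Z'(1) D(1))+
    show M: "\<phi> ` D \<in> sets M" using mp[OF D(1)] by blast
    show "D \<subseteq> fst p" "\<phi> ` D \<subseteq> fst q" using D(2) Z(3) im(1) Z'(3) by blast+
    show "bij_betw \<phi> D (\<phi> ` D)" using inj by (simp add: bij_betw_def)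
    show "\<phi> \<in> restrict_space M D \<rightarrow>\<^sub>M M" by (rule \<phi>M)
    show "\<forall>A\<in>sets M. A \<subseteq> D \<longrightarrow> \<phi> ` A \<in> sets M \<and> (emeasure M (\<phi> ` A) = 0) = (emeasure M A = 0)"
      using mp by simp
    show "AE x in M. x \<in> fst p \<longrightarrow> (x, \<phi> x) \<in> R" using AE_D by eventually_elim (use \<phi>R in blast)
    have "emeasure M (fst p - D) \<le> emeasure M (fst p - Z) + emeasure M (Z - D)"
      using Z D(1) by (intro order_trans[OF emeasure_mono emeasure_subadditive]) auto
    then show "emeasure M (fst p - D) = 0" using Z(4) D(3) by simp
    have "emeasure M (fst q - \<phi> ` D) \<le> emeasure M (fst q - Z') + emeasure M (Z' - \<phi> ` D)"
      using Z' M by (intro order_trans[OF emeasure_mono emeasure_subadditive]) auto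
    then show "emeasure M (fst q - \<phi> ` D) = 0" using Z'(4) im(2) by simp
  qed
  moreover have key: "ae_class M (fst p) (\<phi> \<circ> f) = ae_class M (fst p) (g \<circ> \<phi>)"
    if w: "w \<in> lists {..<length L}" and f: "f \<in> snd p" "ae_class M (fst p) f = word_eval (class_group M (fst p) (snd p)) L w"
      and g: "g \<in> snd q" "ae_class M (fst q) g = word_eval (class_group M (fst q) (snd q)) L' w" for w f g
  proof -
    have 1: "AE x in M. x \<in> fst p \<longrightarrow> f x = word_action M p L a w x" by (rule A(9)[OF w f])
    have 2: "AE x in M. x \<in> fst p \<longrightarrow> g (\<phi> x) = word_action M q L' a' w (\<phi> x)" by (rule AE_\<phi>[OF B(9)[OF w g]])
    have 3: "AE x in M. x \<in> fst p \<longrightarrow> (\<phi> \<circ> f) x = (g \<circ> \<phi>) x"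
      using 1 2 eqv[OF w] Z(5) by eventually_elim simp
    have "(AE x in M. x \<in> fst p \<longrightarrow> h x = (\<phi> \<circ> f) x) \<longleftrightarrow> (AE x in M. x \<in> fst p \<longrightarrow> h x = (g \<circ> \<phi>) x)" for h
    proof
      assume "AE x in M. x \<in> fst p \<longrightarrow> h x = (\<phi> \<circ> f) x"
      then show "AE x in M. x \<in> fst p \<longrightarrow> h x = (g \<circ> \<phi>) x" using 3 by eventually_elim simp
    next
      assume "AE x in M. x \<in> fst p \<longrightarrow> h x = (g \<circ> \<phi>) x"
      then show "AE x in M. x \<in> fst p \<longrightarrow> h x = (\<phi> \<circ> f) x" using 3 by eventually_elim simp
    qed
    then show ?thesis by (simp only: ae_class_def)
  qed
  have "{ae_class M (fst p) (\<phi> \<circ> f) | f. f \<in> snd p} = {ae_class M (fst p) (g \<circ> \<phi>) | g. g \<in> snd q}"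
  proof (intro Set.set_eqI iffI)
    fix c assume "c \<in> {ae_class M (fst p) (\<phi> \<circ> f) | f. f \<in> snd p}"
    then obtain f where f: "f \<in> snd p" "c = ae_class M (fst p) (\<phi> \<circ> f)" by blast
    obtain w where w: "w \<in> lists {..<length L}" "ae_class M (fst p) f = word_eval (class_group M (fst p) (snd p)) L w"
      using marked_subgroup_words(1)[OF p f(1)] by blast
    obtain g where g: "g \<in> snd q" "ae_class M (fst q) g = word_eval (class_group M (fst q) (snd q)) L' w"
      using marked_subgroup_words(2)[OF q, unfolded len, OF w(1)] by blast
    show "c \<in> {ae_class M (fst p) (g \<circ> \<phi>) | g. g \<in> snd q}"
      unfolding f(2) key[OF w(1) f(1) w(2) g] using g(1) by blast
  next
    fix c assume "c \<in> {ae_class M (fst p) (g \<circ> \<phi>) | g. g \<in> snd q}"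
    then obtain g where g: "g \<in> snd q" "c = ae_class M (fst p) (g \<circ> \<phi>)" by blast
    obtain w where w: "w \<in> lists {..<length L}" "ae_class M (fst q) g = word_eval (class_group M (fst q) (snd q)) L' w"
      using marked_subgroup_words(1)[OF q g(1), unfolded len] by blast
    obtain f where f: "f \<in> snd p" "ae_class M (fst p) f = word_eval (class_group M (fst p) (snd p)) L w"
      using marked_subgroup_words(2)[OF p w(1)] by blast
    show "c \<in> {ae_class M (fst p) (\<phi> \<circ> f) | f. f \<in> snd p}"
      unfolding g(2) key[OF w(1) f g(1) w(2), symmetric] using f(1) by blast
  qed
  ultimately show ?thesis unfolding pseudo_conjugate_def by blast
qed

section \<open>Countability modulo conjugacy\<close>

context paired_actions
begin

lemma kdist_kern_zero:
  assumes "a (iv g) = a (iv h)" "b g = b h"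
  shows "kdist kern g h = 0"
proof -
  have "ind x g h = ind x g g" "ind x h h = ind x g g" for x using assms by (simp_all add: ind_def dm_def v_def)
  then show ?thesis by (simp add: kdist_def kern_def)
qed

end

text \<open>Otherwise some \<open>p\<close> has, for each level \<open>m\<close>, a nonconjugate
  partner \<open>q m\<close> with the same code. The contraction constant obtained from property (T)
  of the group of \<open>p\<close> does not depend on \<open>m\<close>, while the letters move the
  diagonal by less and less. So for large \<open>m\<close> the equivariant map exists and conjugates
  the two subgroups.\<close>

lemma T_subgroups_countable_mod_conjugacy:
  assumes std: "standard_prob_space M" and R: "II1_rel M R"
  shows "countable_mod_conjugacy M R (T_subgroups M R)"
proof -
  interpret prob_space M using std by (simp add: standard_prob_space_def)
  define T where "T = T_subgroups M R"
  have "\<exists>d. marked_subgroup M R p (fst d) (fst (snd d)) (fst (snd (snd d))) (snd (snd (snd d)))" if "p \<in> T" for p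
    using T_subgroups_marked[OF R, of p] that unfolding T_def by simp
  then have "\<forall>p. \<exists>d. p \<in> T \<longrightarrow> marked_subgroup M R p (fst d) (fst (snd d)) (fst (snd (snd d))) (snd (snd (snd d)))" by blast
  then have "\<exists>d. \<forall>p. p \<in> T \<longrightarrow> marked_subgroup M R p (fst (d p)) (fst (snd (d p))) (fst (snd (snd (d p)))) (snd (snd (snd (d p))))"
    by (rule choice)
  then obtain d where d: "\<forall>p. p \<in> T \<longrightarrow> marked_subgroup M R p (fst (d p)) (fst (snd (d p))) (fst (snd (snd (d p)))) (snd (snd (snd (d p))))" ..
  define L \<tau> Z a where "L p = fst (d p)" and "\<tau> p = fst (snd (d p))" and "Z p = fst (snd (snd (d p)))" and "a p = snd (snd (snd (d p)))" for p
  have mk: "marked_subgroup M R p (L p) (\<tau> p) (Z p) (a p)" if "p \<in> T" for p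
    unfolding L_def \<tau>_def Z_def a_def by (rule d[rule_format, OF that])
  define gp where "gp p = class_group M (fst p) (snd p)" for p :: "'a set \<times> ('a \<Rightarrow> 'a) set"
  have gp: "group (gp p)" "marking (gp p) (L p) (\<tau> p)" "rel_action M R (fst p) (snd p) (Z p) (a p)" "set (L p) \<subseteq> carrier (gp p)" if "p \<in> T" for p
    using mk[OF that] by (auto simp: marked_subgroup_def gp_def marking_def)
  obtain Q where Q: "separating M Q" using standard_separating[OF std] by blast
  obtain A0 where A0: "approximating M A0" using standard_approximating[OF std] by blast
  have Rs: "R \<in> sets (M \<Otimes>\<^sub>M M)" and Rc: "\<And>x. x \<in> space M \<Longrightarrow> countable (R `` {x})"
    using R unfolding II1_rel_def by blast+
  have "\<exists>f :: nat \<Rightarrow> 'a \<Rightarrow> 'a. (\<forall>n. f n \<in> M \<rightarrow>\<^sub>M M) \<and> (AE x in M. \<forall>y. (x, y) \<in> R \<longrightarrow> (\<exists>n. y = f n x))"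
    by (rule countable_sections_covered[OF std Rs Rc])
  then obtain f :: "nat \<Rightarrow> 'a \<Rightarrow> 'a" where f0: "(\<forall>n. f n \<in> M \<rightarrow>\<^sub>M M) \<and> (AE x in M. \<forall>y. (x, y) \<in> R \<longrightarrow> (\<exists>n. y = f n x))"
    by (elim exE)
  have f: "\<And>n. f n \<in> M \<rightarrow>\<^sub>M M" "AE x in M. \<forall>y. (x, y) \<in> R \<longrightarrow> (\<exists>n. y = f n x)"
    using f0 by blast+
  have cov: "covered_map M f (a p c, Z p)" if p: "p \<in> T" and c: "c \<in> carrier (gp p)" for p c
  proof -
    have 1: "a p c \<in> M \<rightarrow>\<^sub>M M" "Z p \<in> sets M" "\<And>x. x \<in> space M \<Longrightarrow> (x, a p c x) \<in> R"
      using gp(3)[OF p] c unfolding rel_action_def gp_def by blast+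
    have "AE x in M. x \<in> Z p \<longrightarrow> (\<exists>k. a p c x = f k x)"
      using f(2) AE_space by eventually_elim (use 1(3) in blast)
    moreover have "emeasure M (Z p) < \<infinity>" by (simp add: less_top[symmetric])
    ultimately show ?thesis unfolding covered_map_def using 1(1,2) by simp
  qed
  have "\<exists>\<kappa> :: ('a \<Rightarrow> 'a) \<times> 'a set \<Rightarrow> nat. \<forall>p r. covered_map M f p \<longrightarrow> covered_map M f r \<longrightarrow> \<kappa> p = \<kappa> r \<longrightarrow>
      emeasure M (sym_diff (snd p) (snd r)) < ennreal (1 / (real m + 1)) \<and>
      emeasure M {x \<in> snd p \<inter> snd r. fst p x \<noteq> fst r x} < ennreal (1 / (real m + 1))" for m
    by (rule covered_maps_code[OF Q A0 f(1)]) simp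
  then have "\<forall>m. \<exists>\<kappa> :: ('a \<Rightarrow> 'a) \<times> 'a set \<Rightarrow> nat. \<forall>p r. covered_map M f p \<longrightarrow> covered_map M f r \<longrightarrow> \<kappa> p = \<kappa> r \<longrightarrow>
      emeasure M (sym_diff (snd p) (snd r)) < ennreal (1 / (real m + 1)) \<and>
      emeasure M {x \<in> snd p \<inter> snd r. fst p x \<noteq> fst r x} < ennreal (1 / (real m + 1))" by blast
  from choice[OF this] obtain \<kappa> :: "nat \<Rightarrow> ('a \<Rightarrow> 'a) \<times> 'a set \<Rightarrow> nat" where
    \<kappa>0: "\<forall>m. \<forall>p r. covered_map M f p \<longrightarrow> covered_map M f r \<longrightarrow> \<kappa> m p = \<kappa> m r \<longrightarrow>
      emeasure M (sym_diff (snd p) (snd r)) < ennreal (1 / (real m + 1)) \<and>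
      emeasure M {x \<in> snd p \<inter> snd r. fst p x \<noteq> fst r x} < ennreal (1 / (real m + 1))" by (elim exE)
  have \<kappa>: "emeasure M (sym_diff (snd p) (snd r)) < ennreal (1 / (real m + 1))"
    "emeasure M {x \<in> snd p \<inter> snd r. fst p x \<noteq> fst r x} < ennreal (1 / (real m + 1))"
    if "covered_map M f p" "covered_map M f r" "\<kappa> m p = \<kappa> m r" for m p r
    using \<kappa>0 that by blast+
  \<comment> \<open>Whether the \<open>i\<close>-th pair of words, in a fixed enumeration of pairs,
    is a relation of the group of \<open>p\<close>.\<close>
  define same where "same p i \<longleftrightarrow> word_eval (gp p) (L p) (fst (from_nat i :: nat list \<times> nat list)) =
      word_eval (gp p) (L p) (snd (from_nat i :: nat list \<times> nat list))" for p i
  \<comment> \<open>Number of letters, inverse table and nullity of the support are matched exactly,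
    the maps of the letters and their support up to \<open>1 / (m + 1)\<close>, and the relations
    among the first \<open>m\<close> candidates.\<close>
  define code where "code m p = ((length (L p), \<tau> p), emeasure M (Z p) = 0,
    map (\<lambda>l. \<kappa> m (a p (L p ! l), Z p)) [0..<length (L p)], map (same p) [0..<m])" for m p
  have "\<exists>m. \<forall>q\<in>T. code m q = code m p \<longrightarrow> pseudo_conjugate M R p q" if p: "p \<in> T" for p
  proof (rule ccontr)
    assume "\<not> ?thesis"
    then have "\<forall>m. \<exists>q. q \<in> T \<and> code m q = code m p \<and> \<not> pseudo_conjugate M R p q"
      by (simp only: not_ex not_all Ball_def not_imp simp_thms)
    then have "\<exists>q. \<forall>m. q m \<in> T \<and> code m (q m) = code m p \<and> \<not> pseudo_conjugate M R p (q m)" by (rule choice)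
    then obtain q where q0: "\<forall>m. q m \<in> T \<and> code m (q m) = code m p \<and> \<not> pseudo_conjugate M R p (q m)" ..
    have q: "q m \<in> T" "code m (q m) = code m p" "\<not> pseudo_conjugate M R p (q m)" for m
      using q0[THEN spec, of m] by blast+
    define k where "k = length (L p)"
    define W where "W = lists {..<k}"
    have c: "(length (L (q m)) = length (L p) \<and> \<tau> (q m) = \<tau> p) \<and> (emeasure M (Z (q m)) = 0) = (emeasure M (Z p) = 0) \<and>
      map (\<lambda>l. \<kappa> m (a (q m) (L (q m) ! l), Z (q m))) [0..<length (L (q m))] = map (\<lambda>l. \<kappa> m (a p (L p ! l), Z p)) [0..<length (L p)] \<and>
      map (same (q m)) [0..<m] = map (same p) [0..<m]" for m
      using q(2)[of m] unfolding code_def prod.inject .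
    have len: "length (L (q m)) = k" "\<tau> (q m) = \<tau> p" and nul: "emeasure M (Z (q m)) = 0 \<longleftrightarrow> emeasure M (Z p) = 0"
      and rel: "map (same (q m)) [0..<m] = map (same p) [0..<m]" for m
      using c[of m] unfolding k_def by blast+
    have letter: "map (\<lambda>l. \<kappa> m (a (q m) (L (q m) ! l), Z (q m))) [0..<k] = map (\<lambda>l. \<kappa> m (a p (L p ! l), Z p)) [0..<k]" for m
      using conjunct1[OF conjunct2[OF conjunct2[OF c[of m]]]] by (simp only: len(1) k_def[symmetric])
    have mkq: "marked_subgroup M R (q m) (L (q m)) (\<tau> p) (Z (q m)) (a (q m))" for m
      using mk[OF q(1), of m] by (simp only: len(2))
    have Zpos: "emeasure M (Z p) \<noteq> 0"
    proof
      assume "emeasure M (Z p) = 0"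
      then have "pseudo_conjugate M R p (q 0)" using nul by (intro pseudo_conjugate_null[OF mk[OF p] mkq]) auto
      then show False using q(3) by blast
    qed
    have kpos: "k > 0" using gp(2)[OF p] by (simp add: marking_def k_def)
    have near: "emeasure M (sym_diff (Z p) (Z (q m))) < ennreal (1 / (real m + 1))"
      "emeasure M {x \<in> Z p \<inter> Z (q m). a p (L p ! l) x \<noteq> a (q m) (L (q m) ! l) x} < ennreal (1 / (real m + 1))"
      if l: "l < k" for l m
    proof -
      have eq: "\<kappa> m (a p (L p ! l), Z p) = \<kappa> m (a (q m) (L (q m) ! l), Z (q m))"
        using arg_cong[OF letter[of m], of "\<lambda>xs. xs ! l"] l by simp
      have c: "L p ! l \<in> carrier (gp p)" "L (q m) ! l \<in> carrier (gp (q m))"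
        using gp(4)[OF p] gp(4)[OF q(1)[of m]] nth_mem[of l "L p"] nth_mem[of l "L (q m)"] l len(1)[of m] by (auto simp: k_def)
      show "emeasure M (sym_diff (Z p) (Z (q m))) < ennreal (1 / (real m + 1))"
        "emeasure M {x \<in> Z p \<inter> Z (q m). a p (L p ! l) x \<noteq> a (q m) (L (q m) ! l) x} < ennreal (1 / (real m + 1))"
        using \<kappa>[OF cov[OF p c(1)] cov[OF q(1) c(2)] eq] by simp_all
    qed
    define A where "A = word_action M p (L p) (a p)"
    define B where "B m = word_action M (q m) (L (q m)) (a (q m))" for m
    have PA: "paired_actions M Q W (@) [] (word_inverse (\<tau> p)) A (B m) (Z p) (Z (q m))" for m
      unfolding W_def k_def A_def B_def
      by (rule paired_word_actions[OF prob_space_axioms Q mk[OF p] mkq]) (simp add: len(1) k_def)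
    define K where "K m = paired_actions.kern M (word_inverse (\<tau> p)) A (B m) (Z p) (Z (q m))" for m
    have wk: "word_kernel k (K m)" for m
    proof (rule word_kernel.intro)
      show "psd_on (lists {..<k}) (K m)" unfolding K_def using paired_actions.kern_psd[OF PA] by (simp add: W_def)
      show "K m (g @ u) (g @ w) = K m u w" if "g \<in> lists {..<k}" "u \<in> lists {..<k}" "w \<in> lists {..<k}" for g u w
        unfolding K_def by (rule paired_actions.kern_mult[OF PA]) (use that in \<open>simp_all add: W_def\<close>)
    qed
    define e where "e = word_eval (gp p) (L p)"
    have iv: "word_inverse (\<tau> p) w \<in> W" if "w \<in> W" for w
      using word_inverse_words[OF gp(2)[OF p]] that by (simp add: W_def k_def)
    have e_mult: "e (u @ w) = e u \<otimes>\<^bsub>gp p\<^esub> e w" if "u \<in> lists {..<k}" "w \<in> lists {..<k}" for u w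
      unfolding e_def using that by (intro word_eval_append[OF gp(1,4)[OF p]]) (simp_all add: k_def)
    have e_iv: "e (word_inverse (\<tau> p) w) = inv\<^bsub>gp p\<^esub> e w" if "w \<in> lists {..<k}" for w
      unfolding e_def using that by (intro word_eval_inverse[OF gp(1,2)[OF p]]) (simp_all add: k_def)
    have A_e: "A w = a p (e w)" for w by (simp add: A_def word_action_def e_def gp_def)
    have e_eq: "\<forall>\<^sub>F m in sequentially. \<forall>x\<in>lists {..<k}. kdist (K m) (u @ x) (w @ x) = 0"
      if u: "u \<in> lists {..<k}" and w: "w \<in> lists {..<k}" and eq: "e u = e w" for u w
    proof -
      \<comment> \<open>The relation between \<open>u\<close> and \<open>w\<close> has number
        \<open>i\<close> and is recorded by all codes of level above \<open>i\<close>. It then holds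
        in the group of \<open>q m\<close> too, so both words act identically on both sides.\<close>
      define i where "i = to_nat (u, w)"
      have "kdist (K m) (u @ x) (w @ x) = 0" if m: "m > i" and x: "x \<in> lists {..<k}" for m x
      proof -
        have "same (q m) i = same p i" using arg_cong[OF rel[of m], of "\<lambda>xs. xs ! i"] m by simp
        moreover have "same p i" using eq by (simp add: same_def i_def e_def)
        ultimately have eqq: "word_eval (gp (q m)) (L (q m)) u = word_eval (gp (q m)) (L (q m)) w" by (simp add: same_def i_def)
        have ap: "word_eval (gp (q m)) (L (q m)) (y @ x) = word_eval (gp (q m)) (L (q m)) y \<otimes>\<^bsub>gp (q m)\<^esub> word_eval (gp (q m)) (L (q m)) x"
          if "y \<in> lists {..<k}" for y
          by (rule word_eval_append[OF gp(1,4)[OF q(1)]]) (use that x in \<open>simp_all add: len(1)\<close>)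
        have 1: "B m (u @ x) = B m (w @ x)"
          unfolding B_def word_action_def gp_def[symmetric] ap[OF u] ap[OF w] eqq ..
        have "e (u @ x) = e (w @ x)" unfolding e_mult[OF u x] e_mult[OF w x] eq ..
        then have 2: "A (word_inverse (\<tau> p) (u @ x)) = A (word_inverse (\<tau> p) (w @ x))"
          unfolding A_e using e_iv[of "u @ x"] e_iv[of "w @ x"] u w x by simp
        show ?thesis unfolding K_def by (rule paired_actions.kdist_kern_zero[OF PA 2 1])
      qed
      then show ?thesis unfolding eventually_sequentially by (intro exI[of _ "Suc i"]) (simp add: Suc_le_eq)
    qed
    have T': "property_T (gp p)" using p by (auto simp: T_def T_subgroups_def gp_def)
    have e_surj: "e ` lists {..<k} = carrier (gp p)" using gp(2)[OF p] by (simp add: marking_def e_def k_def)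
    have e_Nil: "e [] = \<one>\<^bsub>gp p\<^esub>" by (simp add: e_def word_eval_Nil)
    have "\<exists>R\<ge>0. \<exists>N. \<forall>m\<ge>N. \<forall>v. lconv (lists {..<k}) v \<longrightarrow> (\<exists>ys. lconv (lists {..<k}) ys \<and>
      dirichlet k (K m) (lconvolve ys v) \<le> 1/4 * dirichlet k (K m) v \<and>
      lform (K m) (ldiff (lconvolve ys v) v) (ldiff (lconvolve ys v) v) \<le> R * dirichlet k (K m) v)"
      by (rule uniform_contraction[where K = K and e = e, OF T']) (fact e_mult e_Nil e_surj wk e_eq)+
    then obtain C N where C: "C \<ge> 0" and N: "\<forall>m\<ge>N. \<forall>v. lconv (lists {..<k}) v \<longrightarrow> (\<exists>ys. lconv (lists {..<k}) ys \<and>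
      dirichlet k (K m) (lconvolve ys v) \<le> 1/4 * dirichlet k (K m) v \<and>
      lform (K m) (ldiff (lconvolve ys v) v) (ldiff (lconvolve ys v) v) \<le> C * dirichlet k (K m) v)"
      by (elim exE conjE) (rule that)
    have small: "(\<Sum>l<k. kdist (K m) [l] []) \<le> real k * (2 / (real m + 1))" for m
    proof -
      have "kdist (K m) [l] [] \<le> 2 / (real m + 1)" if l: "l < k" for l
      proof -
        \<comment> \<open>The estimate for \<open>[l]\<close> compares the actions of the formal
          inverse, which is the single letter \<open>j\<close>; the codes control that letter as
          well.\<close>
        define j where "j = \<tau> p ! l"
        have j: "j < k" using gp(2)[OF p] l by (simp add: marking_def j_def k_def)
        have "kdist (K m) [l] [] = kdist (K m) [] [l]"
          by (rule kdist_sym[OF word_kernel.psd[OF wk]]) (use l in auto)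
        also have "\<dots> \<le> 2 * measure M {x \<in> Z p \<inter> Z (q m). A (word_inverse (\<tau> p) [l]) x \<noteq> B m (word_inverse (\<tau> p) [l]) x}"
          unfolding K_def by (rule paired_actions.kdist_kern_le[OF PA]) (use l in \<open>simp add: W_def\<close>)
        also have "word_inverse (\<tau> p) [l] = [j]" by (simp add: word_inverse_def j_def)
        also have "A [j] = a p (L p ! j)"
          unfolding A_e e_def using word_eval_single[OF gp(1,4)[OF p], of j] j by (simp add: k_def)
        also have "B m [j] = a (q m) (L (q m) ! j)"
          unfolding B_def word_action_def gp_def[symmetric] using word_eval_single[OF gp(1,4)[OF q(1)[of m]], of j] j by (simp add: len(1))
        also have "measure M {x \<in> Z p \<inter> Z (q m). a p (L p ! j) x \<noteq> a (q m) (L (q m) ! j) x} \<le> 1 / (real m + 1)"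
          using near(2)[OF j, of m] by (simp add: emeasure_eq_measure ennreal_less_iff)
        finally show ?thesis by simp
      qed
      then have "(\<Sum>l<k. kdist (K m) [l] []) \<le> (\<Sum>l<k. 2 / (real m + 1))" by (intro sum_mono) simp
      then show ?thesis by simp
    qed
    have meet: "measure M (Z p) - 1 / (real m + 1) \<le> measure M (Z p \<inter> Z (q m))" for m
    proof -
      have S: "Z p \<in> sets M" "Z (q m) \<in> sets M"
        using marked_subgroup_support(2)[OF mk[OF p]] marked_subgroup_support(2)[OF mkq] by blast+
      have "measure M (Z p) = measure M (Z p \<inter> Z (q m)) + measure M (Z p - Z (q m))"
        using S finite_measure_Diff'[of "Z p" "Z (q m)"] by simp
      moreover have "measure M (Z p - Z (q m)) \<le> measure M (sym_diff (Z p) (Z (q m)))"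
        using S by (intro finite_measure_mono) auto
      moreover have "measure M (sym_diff (Z p) (Z (q m))) \<le> 1 / (real m + 1)"
        using near(1)[OF kpos, of m] by (simp add: emeasure_eq_measure ennreal_less_iff)
      ultimately show ?thesis by linarith
    qed
    have "measure M (Z p) > 0" using Zpos by (simp add: emeasure_eq_measure zero_less_measure_iff)
    moreover have "(\<lambda>m. 4 * (4 * C * (real k * (2 / (real m + 1)))) + 1 / (real m + 1)) \<longlonglongrightarrow> 0" by real_asymp
    ultimately have "\<forall>\<^sub>F m in sequentially. 4 * (4 * C * (real k * (2 / (real m + 1)))) + 1 / (real m + 1) < measure M (Z p)"
      by (intro order_tendstoD(2))
    then have "\<forall>\<^sub>F m in sequentially. m \<ge> N \<and> 4 * (4 * C * (real k * (2 / (real m + 1)))) + 1 / (real m + 1) < measure M (Z p)"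
      using eventually_ge_at_top[of N] by eventually_elim simp
    then obtain m where m: "m \<ge> N" "4 * (4 * C * (real k * (2 / (real m + 1)))) + 1 / (real m + 1) < measure M (Z p)"
      using eventually_happens'[OF sequentially_bot] by blast
    \<comment> \<open>The limit stays within \<open>4 * C * D0\<close> of the diagonal, and
      \<open>D0\<close> is at most \<open>2 * k / (m + 1)\<close>. Four times this bound must be
      less than the measure of the overlap, which is at least that of \<open>Z p\<close> minus
      \<open>1 / (m + 1)\<close>.\<close>
    define D0 where "D0 = (\<Sum>l<k. kdist (K m) [l] [])"
    have "4 * C * D0 \<le> 4 * C * (real k * (2 / (real m + 1)))"
      unfolding D0_def by (rule mult_left_mono[OF small]) (use C in simp)
    then have \<epsilon>: "4 * (4 * C * D0) < measure M (Z p \<inter> Z (q m))" using m(2) meet[of m] by linarith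
    have st: "\<exists>ys. lconv (lists {..<k}) ys \<and> dirichlet k (K m) (lconvolve ys v) \<le> 1/4 * dirichlet k (K m) v \<and>
      lform (K m) (ldiff (lconvolve ys v) v) (ldiff (lconvolve ys v) v) \<le> C * dirichlet k (K m) v"
      if "lconv (lists {..<k}) v" for v
      by (rule N[rule_format, OF m(1) that])
    have "\<exists>xs :: nat \<Rightarrow> (real \<times> nat list) list. \<forall>n. lconv W (xs n) \<and>
      lform (K m) (ldiff (xs (Suc n)) (xs n)) (ldiff (xs (Suc n)) (xs n)) \<le> C * D0 * (1/4)^n \<and>
      (\<forall>u\<in>W. lform (K m) (ldiff (lact u (xs n)) (xs n)) (ldiff (lact u (xs n)) (xs n)) \<le> (real (length u))\<^sup>2 * D0 * (1/4)^n) \<and>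
      lform (K m) (ldiff (xs n) [(1, [])]) (ldiff (xs n) [(1, [])]) \<le> 4 * C * D0"
      unfolding D0_def W_def by (rule word_kernel.contraction_sequence[OF wk C]) (rule st)
    then obtain xs :: "nat \<Rightarrow> (real \<times> nat list) list" where xs: "\<forall>n. lconv W (xs n) \<and>
      lform (K m) (ldiff (xs (Suc n)) (xs n)) (ldiff (xs (Suc n)) (xs n)) \<le> C * D0 * (1/4)^n \<and>
      (\<forall>u\<in>W. lform (K m) (ldiff (lact u (xs n)) (xs n)) (ldiff (lact u (xs n)) (xs n)) \<le> (real (length u))\<^sup>2 * D0 * (1/4)^n) \<and>
      lform (K m) (ldiff (xs n) [(1, [])]) (ldiff (xs n) [(1, [])]) \<le> 4 * C * D0" ..
    have x1: "lconv W (xs n)" "lform (K m) (ldiff (xs (Suc n)) (xs n)) (ldiff (xs (Suc n)) (xs n)) \<le> C * D0 * (1/4)^n"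
      "lform (K m) (ldiff (xs n) [(1, [])]) (ldiff (xs n) [(1, [])]) \<le> 4 * C * D0" for n
      using xs[THEN spec, of n] by blast+
    have x2: "\<exists>C. \<forall>n. lform (K m) (ldiff (lact u (xs n)) (xs n)) (ldiff (lact u (xs n)) (xs n)) \<le> C * (1/4)^n" if u: "u \<in> W" for u
    proof (intro exI allI)
      fix n
      show "lform (K m) (ldiff (lact u (xs n)) (xs n)) (ldiff (lact u (xs n)) (xs n)) \<le> (real (length u))\<^sup>2 * D0 * (1/4)^n"
        using xs[THEN spec, of n] u by blast
    qed
    have lq: "lists {..<length (L (q m))} = W" "lists {..<length (L p)} = W" by (simp_all add: len(1) W_def k_def)
    have e1: "emeasure M E = 0 \<or> emeasure M (Z p - E) = 0"
      if "E \<in> sets M" "E \<subseteq> Z p" "\<And>g. g \<in> W \<Longrightarrow> AE x in M. x \<in> Z p \<longrightarrow> (A g x \<in> E \<longleftrightarrow> x \<in> E)" for E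
      using that(3) by (intro word_action_ergodic[OF mk[OF p] that(1,2)]) (simp add: lq A_def)
    have e2: "emeasure M E = 0 \<or> emeasure M (Z (q m) - E) = 0"
      if "E \<in> sets M" "E \<subseteq> Z (q m)" "\<And>g. g \<in> W \<Longrightarrow> AE x in M. x \<in> Z (q m) \<longrightarrow> (B m g x \<in> E \<longleftrightarrow> x \<in> E)" for E
      using that(3) by (intro word_action_ergodic[OF mkq that(1,2)]) (simp add: lq B_def)
    have "\<exists>D D' \<phi>. D \<in> sets M \<and> D \<subseteq> Z p \<and> emeasure M (Z p - D) = 0 \<and>
      D = (\<Union>g\<in>W. D' g) \<and> (\<forall>g\<in>W. D' g \<in> sets M) \<and>
      (\<forall>g\<in>W. \<forall>x\<in>D' g. \<phi> x = paired_actions.v (word_inverse (\<tau> p)) A (B m) g x) \<and>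
      inj_on \<phi> D \<and> \<phi> ` D \<subseteq> Z (q m) \<and> emeasure M (Z (q m) - \<phi> ` D) = 0 \<and>
      (\<forall>A\<in>sets M. A \<subseteq> D \<longrightarrow> \<phi> ` A \<in> sets M \<and> emeasure M (\<phi> ` A) = emeasure M A) \<and>
      (\<forall>g\<in>W. AE x in M. x \<in> Z p \<longrightarrow> \<phi> (A g x) = B m g (\<phi> x)) \<and> emeasure M (Z p) = emeasure M (Z (q m))"
      by (rule paired_actions.equivariant_map[OF PA[of m], folded K_def, where xs = xs and C = "C * D0" and \<epsilon> = "4 * C * D0"])
        (fact x1(1) x1(2) x2 x1(3) \<epsilon> e1 e2)+
    then obtain D D' \<phi> where D: "D \<in> sets M" "D \<subseteq> Z p" "emeasure M (Z p - D) = 0"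
      "D = (\<Union>g\<in>W. D' g)" "\<forall>g\<in>W. D' g \<in> sets M"
      "\<forall>g\<in>W. \<forall>x\<in>D' g. \<phi> x = paired_actions.v (word_inverse (\<tau> p)) A (B m) g x"
      "inj_on \<phi> D" "\<phi> ` D \<subseteq> Z (q m)" "emeasure M (Z (q m) - \<phi> ` D) = 0"
      "\<forall>A\<in>sets M. A \<subseteq> D \<longrightarrow> \<phi> ` A \<in> sets M \<and> emeasure M (\<phi> ` A) = emeasure M A"
      "\<forall>g\<in>W. AE x in M. x \<in> Z p \<longrightarrow> \<phi> (A g x) = B m g (\<phi> x)"
      by (elim exE conjE) (rule that)
    have "pseudo_conjugate M R p (q m)"
    proof (rule pseudo_conjugateI[OF R mk[OF p] mkq _ D(1,2,3), unfolded lq, OF _ D(4) _ _ D(7,8,9)])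
      show "length (L (q m)) = length (L p)" by (simp add: len(1) k_def)
      show "\<And>w. w \<in> W \<Longrightarrow> D' w \<in> sets M" using D(5) by blast
      show "\<phi> x = word_action M (q m) (L (q m)) (a (q m)) w (word_action M p (L p) (a p) (word_inverse (\<tau> p) w) x)"
        if "w \<in> W" "x \<in> D' w" for w x
      proof -
        have "\<phi> x = B m w (A (word_inverse (\<tau> p) w) x)"
          using bspec[OF bspec[OF D(6) that(1)] that(2)] unfolding paired_actions.v_def[OF PA] .
        then show ?thesis unfolding A_def B_def .
      qed
      show "\<phi> ` E \<in> sets M \<and> emeasure M (\<phi> ` E) = emeasure M E" if "E \<in> sets M" "E \<subseteq> D" for E
        using D(10) that by blast
      show "AE x in M. x \<in> Z p \<longrightarrow> \<phi> (word_action M p (L p) (a p) w x) = word_action M (q m) (L (q m)) (a (q m)) w (\<phi> x)"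
        if "w \<in> W" for w using D(11) that unfolding A_def B_def by blast
    qed
    then show False using q(3) by blast
  qed
  from countable_representatives_by_codes[OF this]
  show ?thesis unfolding countable_mod_conjugacy_def T_def[symmetric] .
qed

theorem theorem6p1:
  fixes M :: "'a measure" and R :: "('a \<times> 'a) set"
  assumes "standard_prob_space M" and "II1_rel M R"
  shows "(\<forall>S. pseudo_subgroup M R (space M) S \<and> property_T (class_group M (space M) S) \<and>
            ergodic_on M (space M) S \<longrightarrow> countable (fundamental_group M R))
       \<and> (\<forall>S H. pseudo_subgroup M R (space M) S \<and> countable (carrier (class_group M (space M) S)) \<and>
            relative_T (class_group M (space M) S) H \<and> ergodic_on M (space M) (\<Union>H)
            \<longrightarrow> countable (fundamental_group M R))
       \<and> countable_mod_conjugacy M R (T_subgroups M R)"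
proof (intro conjI allI impI)
  fix S H
  assume "pseudo_subgroup M R (space M) S \<and> countable (carrier (class_group M (space M) S)) \<and>
    relative_T (class_group M (space M) S) H \<and> ergodic_on M (space M) (\<Union>H)"
  then show "countable (fundamental_group M R)" using countable_fundamental_group[OF assms] by blast
next
  fix S
  assume S: "pseudo_subgroup M R (space M) S \<and> property_T (class_group M (space M) S) \<and> ergodic_on M (space M) S"
  \<comment> \<open>Each representative lies in its own class. Passing to all members of the classes
    only adds conditions on an invariant set, so ergodicity carries over and the first claim becomes
    the case \<open>H = carrier\<close> of the second.\<close>
  have "S \<subseteq> \<Union>(carrier (class_group M (space M) S))"
    using ae_class_self by (fastforce simp: class_group_def)
  then have "ergodic_on M (space M) (\<Union>(carrier (class_group M (space M) S)))"
    using S unfolding ergodic_on_def by (meson subsetD)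
  then show "countable (fundamental_group M R)"
    using countable_fundamental_group[OF assms, of S "carrier (class_group M (space M) S)"] S countable_carrier_property_T
    unfolding property_T_def by blast
qed (rule T_subgroups_countable_mod_conjugacy[OF assms])

end
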